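(* There exist dendritic cubic polynomials $f:\mathbb{C}\to\mathbb{C}$ having a branching point $\xi$ in their Julia set $\mathcal{J}_f$ such that $\xi$ is neither preperiodic nor precritical for $f$.
   Context: For a polynomial $f:\mathbb{C}\to\mathbb{C}$ of degree at least $2$, the filled-in Julia set $\mathcal{K}_f$ is the set of points with bounded forward orbit and the Julia set $\mathcal{J}_f$ is its topological boundary. The polynomial $f$ is dendritic if $\mathcal{J}_f$ is a dendrite, i.e., $\mathcal{J}_f$ is connected and locally connected and contains no simple closed curve. When $\mathcal{J}_f$ is locally connected, a point $\xi\in\mathcal{J}_f$ is a branching point if $\mathcal{J}_f\setminus\{\xi\}$ has at least three connected components. A point $z\in\mathbb{C}$ is preperiodic if its forward orbit is finite, i.e. $f^{\circ(r+s)}(z)=f^{\circ r}(z)$ for some integers $r\ge 0$, $s\ge 1$ (periodic points are included). A point $z$ is precritical if $f^{\circ n}(z)=\omega$ for some critical point $\omega$ of $f$ (a zero of $f'$) and some integer $n\ge 0$. *)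

theory Defs
  imports "HOL-Analysis.Analysis" "HOL-Computational_Algebra.Polynomial"
begin

definition filled_julia :: "complex poly \<Rightarrow> complex set" where
  "filled_julia f = {z. bounded (range (\<lambda>n. (poly f ^^ n) z))}"

definition julia :: "complex poly \<Rightarrow> complex set" where
  "julia f = frontier (filled_julia f)"

(* Compactness and nonemptiness are not required here: they hold automatically for Julia sets
   of polynomials of degree at least 2, the only sets to which this is applied. *)
definition dendrite :: "complex set \<Rightarrow> bool" where
  "dendrite S \<longleftrightarrow> connected S \<and> locally connected S \<and>
     \<not> (\<exists>g. simple_path g \<and> pathfinish g = pathstart g \<and> path_image g \<subseteq> S)"

definition dendritic :: "complex poly \<Rightarrow> bool" where
  "dendritic f \<longleftrightarrow> 2 \<le> degree f \<and> dendrite (julia f)"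

(* The cardinality is that of a subset of the components because card is 0 on infinite sets,
   whereas infinitely many components also count as at least three. *)
definition branching_point :: "complex poly \<Rightarrow> complex \<Rightarrow> bool" where
  "branching_point f \<xi> \<longleftrightarrow> \<xi> \<in> julia f \<and>
     (\<exists>C \<subseteq> components (julia f - {\<xi>}). card C = 3)"

definition preperiodic :: "complex poly \<Rightarrow> complex \<Rightarrow> bool" where
  "preperiodic f z \<longleftrightarrow> (\<exists>r s. s \<ge> 1 \<and> (poly f ^^ (r + s)) z = (poly f ^^ r) z)"

definition precritical :: "complex poly \<Rightarrow> complex \<Rightarrow> bool" where
  "precritical f z \<longleftrightarrow> (\<exists>n \<omega>. poly (pderiv f) \<omega> = 0 \<and> (poly f ^^ n) z = \<omega>)"

end

theory Submission
 imports Defs "HOL-Complex_Analysis.Complex_Analysis" "HOL-Real_Asymp.Real_Asymp"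
  "HOL-Computational_Algebra.Fundamental_Theorem_Algebra"
begin

text \<open>
 Let F be the cubic polynomial with critical points c and d that fixes 0. When both critical points are eventually mapped to the
 repelling point 0, backward contraction shows that the filled Julia set has empty interior and that all external rays land,
 in such a way that landing points depend continuously on the angle and on the parameter in the connectedness locus.
 Start from the odd map with c = i y0, d = - c, F(F(c)) = 0, whose critical points have two pairs of angles each.
 Suppose that a branch point is mapped by an iterate of F to c, and choose a point y close to 0 that is mapped to d by j
 iterates and a point u of the limb behind y. Perturb the parameter, keeping the relation for d, so that the orbit of c passes
 through u instead of 0. The preimages of y near c are then separated by the angles of c, and three of the six angles land
 together; hence a nearby branch point is mapped to d, after more iterates. Now c and d exchange their roles.
 The perturbed parameter exists, since otherwise summing 1 / (A - u) over the solutions d of the relation, where A is the iterate of c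
 that vanishes at the old parameter, would give holomorphic functions of c that violate the maximum principle when u tends to 0.
 In the limit of quickly decreasing perturbations, three angles land at a point whose orbit never meets a critical point
 and never repeats; the Julia set is the image of the circle of angles and has empty interior, hence it is a dendrite.
\<close>

section \<open>Cubic polynomials with a fixed point at 0\<close>

text \<open>At every finite stage the branch point is precritical and preperiodic, so the properties
  wanted in the limit are split into two kinds. That the first k iterates of the branch point avoid
  the critical points and are pairwise distinct is an open condition; that three given angles land
  together is a closed one. A stage destroys the collision at time k and creates a later one with
  the other critical point, whose relation was kept for this purpose. The closed condition passes to
  the limit only if landing points depend continuously on parameter and angle together. This is
  known at Misiurewicz parameters, so every stage has to end at one, and the radius of the next
  perturbation depends on it. The start is odd and preserves the imaginary axis, so that its
  coincidences of rays can be read off from an interval map. Since 0 is fixed, both critical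
  relations are polynomial equations in c and d. Angles are in radians; 0 and pi are the two angles
  fixed by tripling modulo 2 pi, and they serve as base angles for the two critical points.\<close>

text \<open>The cubic polynomial with critical points c and d that fixes 0.\<close>

definition cub :: "complex => complex => complex => complex" where
 "cub c d z = z^3 - 3/2 * (c + d) * z^2 + 3 * c * d * z"

text \<open>The difference quotient (F(z) - F(w)) / (z - w) of F = \<open>cub c d\<close>, as a
  polynomial. On the diagonal it is the derivative, so that being nonzero near a point means local
  injectivity and absence of critical points at once, and it is an open condition in the parameters
  as well.\<close>

definition cubq :: "complex => complex => complex => complex => complex" where
 "cubq c d z w = z^2 + z*w + w^2 - 3/2 * (c + d) * (z + w) + 3 * c * d"

lemma cub_commute: "cub c d = cub d c"
 by (auto simp: cub_def fun_eq_iff algebra_simps)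

lemma cub_0 [simp]: "cub c d 0 = 0"
 by (simp add: cub_def)

lemma cub_diff: "cub c d z - cub c d w = (z - w) * cubq c d z w"
 by (simp add: cub_def cubq_def power2_eq_square power3_eq_cube field_simps)

lemma cubq_same: "cubq c d z z = 3 * (z - c) * (z - d)"
 by (simp add: cubq_def power2_eq_square algebra_simps)

text \<open>The fibre of a critical value: the critical point is a double root and
  \<open>(3 * d - c) / 2\<close> is the co-critical point.\<close>

lemma cub_diff_crit: "cub c d z - cub c d c = (z - c)^2 * (z - (3 * d - c) / 2)"
 by (simp add: cub_def power2_eq_square power3_eq_cube field_simps)

lemma has_field_derivative_cub:
 "(cub c d has_field_derivative 3 * (z - c) * (z - d)) (at z within S)"
proof -
 have "((%z. z^3 - 3/2 * (c + d) * z^2 + 3 * c * d * z) has_field_derivative 3 * (z - c) * (z - d)) (at z within S)"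
  by (auto intro!: derivative_eq_intros simp: power2_eq_square algebra_simps)
 thus ?thesis
  unfolding cub_def[abs_def] by simp
qed

lemma deriv_cub: "deriv (cub c d) z = 3 * (z - c) * (z - d)"
 using has_field_derivative_cub by (rule DERIV_imp_deriv)

lemma holomorphic_cub [holomorphic_intros]:
 assumes "f holomorphic_on S" shows "(%z. cub c d (f z)) holomorphic_on S"
 unfolding cub_def by (intro holomorphic_intros assms) auto

lemma continuous_on_cub [continuous_intros]:
 assumes "continuous_on S c" "continuous_on S d" "continuous_on S f"
 shows "continuous_on S (%z. cub (c z) (d z) (f z))"
 unfolding cub_def by (intro continuous_intros assms) auto

lemma tendsto_cub [tendsto_intros]:
 assumes "(c \<longlongrightarrow> c0) F" "(d \<longlongrightarrow> d0) F" "(f \<longlongrightarrow> z0) F"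
 shows "((%x. cub (c x) (d x) (f x)) \<longlongrightarrow> cub c0 d0 z0) F"
 unfolding cub_def by (intro tendsto_intros assms)

lemma tendsto_cubq [tendsto_intros]:
 assumes "(c \<longlongrightarrow> c0) F" "(d \<longlongrightarrow> d0) F" "(f \<longlongrightarrow> z0) F" "(g \<longlongrightarrow> w0) F"
 shows "((%x. cubq (c x) (d x) (f x) (g x)) \<longlongrightarrow> cubq c0 d0 z0 w0) F"
 unfolding cubq_def by (intro tendsto_intros assms)

lemma tendsto_cub_funpow [tendsto_intros]:
 assumes "(c \<longlongrightarrow> c0) F" "(d \<longlongrightarrow> d0) F" "(f \<longlongrightarrow> z0) F"
 shows "((%x. (cub (c x) (d x) ^^ n) (f x)) \<longlongrightarrow> (cub c0 d0 ^^ n) z0) F"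
 by (induction n) (auto intro!: tendsto_intros assms)

lemma continuous_on_cub_funpow [continuous_intros]:
 assumes "continuous_on S c" "continuous_on S d" "continuous_on S f"
 shows "continuous_on S (%z. (cub (c z) (d z) ^^ n) (f z))"
 by (induction n) (auto intro!: continuous_intros assms)

lemma holomorphic_cub_funpow [holomorphic_intros]:
 assumes "f holomorphic_on S" shows "(%z. (cub c d ^^ n) (f z)) holomorphic_on S"
 by (induction n) (auto intro!: holomorphic_intros assms)

lemma funpow_cub_0 [simp]: "(cub c d ^^ n) 0 = 0"
 by (induction n) auto

section \<open>Fibres of the cubic and its covering property\<close>

lemma cub_roots:
 obtains r1 r2 r3 where "!!z. cub c d z - y = (z - r1) * (z - r2) * (z - r3)"
proof -
 let ?p = "[:- y, 3 * c * d, - (3/2) * (c + d), 1:] :: complex poly"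
 have "~ constant (poly ?p)"
  by (subst constant_degree) auto
 then obtain r1 where r1: "poly ?p r1 = 0"
  using fundamental_theorem_of_algebra by blast
 have y: "y = cub c d r1"
  using r1 by (simp add: cub_def power2_eq_square power3_eq_cube algebra_simps)
 define b e where "b = r1 - 3/2 * (c + d)" and "e = r1^2 - 3/2 * (c+d) * r1 + 3 * c * d"
 define s where "s = csqrt (b^2 - 4 * e)"
 have s: "s * s = b^2 - 4 * e"
  unfolding s_def by (metis power2_csqrt power2_eq_square)
 have "cub c d z - y = (z - r1) * (z - (- b + s)/2) * (z - (- b - s)/2)" for z
 proof -
  have "(z - (- b + s)/2) * (z - (- b - s)/2) = z^2 + b * z + (b^2 - s * s) / 4"
   by (simp add: power2_eq_square field_simps)
  also have "... = z^2 + b * z + e"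
   using s by simp
  also have "... = cubq c d z r1"
   by (simp add: b_def e_def cubq_def power2_eq_square field_simps)
  finally show ?thesis
   unfolding y cub_diff by (simp add: mult.assoc)
 qed
 thus ?thesis
  using that by blast
qed

text \<open>If a product of three factors has modulus below \<open>r^3\<close>, one factor is below
  \<open>r\<close>. The bound is independent of \<open>c\<close> and \<open>d\<close>, so preimages
  can be found uniformly in the parameters.\<close>

lemma cub_root_near:
 assumes "norm (cub c d z - y) < r^3" "r > 0"
 obtains w where "cub c d w = y" "norm (z - w) < r"
proof -
 obtain r1 r2 r3 where r: "!!z. cub c d z - y = (z - r1) * (z - r2) * (z - r3)"
  using cub_roots by blast
 have "norm (z - r1) < r \<or> norm (z - r2) < r \<or> norm (z - r3) < r"
 proof (rule ccontr)
  assume "~ ?thesis"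
  hence "r <= norm (z - r1)" "r <= norm (z - r2)" "r <= norm (z - r3)"
   by auto
  hence "r * r * r <= norm (z - r1) * norm (z - r2) * norm (z - r3)"
   using assms(2) by (intro mult_mono) auto
  also have "... = norm (cub c d z - y)"
   by (simp add: r norm_mult)
  finally show False
   using assms(1) by (simp add: power3_eq_cube)
 qed
 moreover have "cub c d r1 - y = 0" "cub c d r2 - y = 0" "cub c d r3 - y = 0"
  by (simp_all only: r) simp_all
 hence "cub c d r1 = y" "cub c d r2 = y" "cub c d r3 = y"
  by simp_all
 ultimately show ?thesis
  using that by blast
qed

lemma finite_cub_vimage: "finite {z. cub c d z = y}"
proof -
 obtain r1 r2 r3 where r: "!!z. cub c d z - y = (z - r1) * (z - r2) * (z - r3)"
  using cub_roots by blast
 have "{z. cub c d z = y} \<subseteq> {r1, r2, r3}"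
 proof
  fix z assume "z \<in> {z. cub c d z = y}"
  hence "(z - r1) * (z - r2) * (z - r3) = 0" using r[of z] by simp
  thus "z \<in> {r1, r2, r3}" by simp
 qed
 thus ?thesis
  using finite_subset by blast
qed

lemma finite_funpow_cub_vimage: "finite {z. (cub c d ^^ n) z = y}"
proof (induction n arbitrary: y)
 case (Suc n)
 have "{z. (cub c d ^^ Suc n) z = y} = (\<Union>w\<in>{w. cub c d w = y}. {z. (cub c d ^^ n) z = w})"
  by auto
 thus ?case
  using Suc finite_cub_vimage by auto
qed auto

text \<open>The sheets over a small disc about \<open>x\<close> are the parts of its preimage near
  the roots. As the radius of the disc is at most \<open>E^3\<close>, every preimage is within
  \<open>E\<close> of a root, and \<open>cubq\<close> nonzero near the root makes each sheet
  injective.\<close>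

lemma covering_space_cub:
 "covering_space (- cub c d -` {cub c d c, cub c d d}) (cub c d) (- {cub c d c, cub c d d})"
  (is "covering_space ?C ?p ?S")
proof
 show "continuous_on ?C ?p"
  by (intro continuous_intros)
 show "?p ` ?C = ?S"
 proof (intro equalityI subsetI)
  fix y assume y: "y \<in> ?S"
  obtain r1 r2 r3 where r: "!!z. cub c d z - y = (z - r1) * (z - r2) * (z - r3)"
   using cub_roots by blast
  have "cub c d r1 - y = 0"
   by (simp only: r) simp
  hence "cub c d r1 = y" by simp
  with y show "y \<in> ?p ` ?C"
   by blast
 qed auto
 fix x assume x: "x \<in> ?S"
 obtain r1 r2 r3 where r: "!!z. cub c d z - x = (z - r1) * (z - r2) * (z - r3)"
  using cub_roots by blast
 have "cub c d r1 - x = 0" "cub c d r2 - x = 0" "cub c d r3 - x = 0"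
  by (simp_all only: r) simp_all
 hence rx: "cub c d r1 = x" "cub c d r2 = x" "cub c d r3 = x"
  by simp_all
 let ?R = "{r1, r2, r3}"
 have q: "cubq c d w w ~= 0" if "w \<in> ?R" for w
  using that x rx by (auto simp: cubq_same)
 have "\<exists>e>0. \<forall>z\<in>ball w e. \<forall>z'\<in>ball w e. cubq c d z z' ~= 0" if "w \<in> ?R" for w
 proof -
  have "((%z. cubq c d (fst z) (snd z)) \<longlongrightarrow> cubq c d (fst (w, w)) (snd (w, w))) (nhds (w, w))"
   by (intro tendsto_intros filterlim_ident)
  hence "((%z. cubq c d (fst z) (snd z)) \<longlongrightarrow> cubq c d w w) (nhds (w, w))"
   by simp
  hence "eventually (%z. cubq c d (fst z) (snd z) ~= 0) (nhds (w, w))"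
   using q[OF that] tendsto_imp_eventually_ne by blast
  then obtain e where e: "e > 0" "!!z. dist z (w, w) < e ==> cubq c d (fst z) (snd z) ~= 0"
   unfolding eventually_nhds_metric by blast
  have "cubq c d z z' ~= 0" if "z \<in> ball w (e/2)" "z' \<in> ball w (e/2)" for z z'
  proof -
   have "dist (z, z') (w, w) <= dist z w + dist z' w"
    unfolding dist_prod_def by (auto intro: sqrt_sum_squares_le_sum)
   also have "... < e" using that by (auto simp: dist_commute)
   finally show ?thesis using e(2)[of "(z, z')"] by simp
  qed
  thus ?thesis using e(1) by (intro exI[of _ "e/2"]) auto
 qed
 then obtain e where e: "!!w. w \<in> ?R ==> e w > 0"
   "!!w z z'. w \<in> ?R ==> z \<in> ball w (e w) ==> z' \<in> ball w (e w) ==> cubq c d z z' ~= 0"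
  by metis
 \<comment> \<open>Half the distances between distinct roots, so that the balls of radius
   \<open>E\<close> are disjoint; the element 1 keeps the set nonempty.\<close>
 define D where "D = insert 1 ((%(u, v). dist u v / 2) ` {(u, v) \<in> ?R \<times> ?R. u ~= v})"
 have D: "finite D" "\<forall>t\<in>D. t > 0" "D ~= {}"
  unfolding D_def by (auto intro: finite_subset[of _ "?R \<times> ?R"])
 define E where "E = Min (D \<union> e ` ?R \<union> {dist x (cub c d c), dist x (cub c d d)})"
 have E: "E > 0"
  unfolding E_def using D e(1) x by (subst Min_gr_iff) auto
 have E_le: "E <= t" if "t \<in> D \<union> e ` ?R" for t
  unfolding E_def using that D by (intro Min_le) auto
 define F where "F = min (E^3) E"
 have F: "F > 0" "F <= E^3" "F <= E"
  unfolding F_def using E by auto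
 define T where "T = ball x F"
 define sh where "sh w = ball w E \<inter> cub c d -` T" for w
 have F_le: "F <= dist x (cub c d c)" "F <= dist x (cub c d d)"
 proof -
  have "E <= dist x (cub c d c)" "E <= dist x (cub c d d)"
   unfolding E_def using D by (intro Min_le; auto)+
  thus "F <= dist x (cub c d c)" "F <= dist x (cub c d d)"
   using F by auto
 qed
 have TS: "T \<subseteq> ?S"
  using F_le unfolding T_def by auto
 have inj: "inj_on (cub c d) (sh w)" if "w \<in> ?R" for w
 proof (rule inj_onI)
  fix z z' assume z: "z \<in> sh w" "z' \<in> sh w" "cub c d z = cub c d z'"
  have "E <= e w" using E_le that by auto
  hence "z \<in> ball w (e w)" "z' \<in> ball w (e w)"
   using z by (auto simp: sh_def)
  hence "cubq c d z z' ~= 0" using e(2) that by blast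
  thus "z = z'"
   using cub_diff[of c d z z'] z(3) by auto
 qed
 have op: "open (sh w)" for w
  unfolding sh_def T_def by (intro open_Int open_ball open_vimage continuous_intros)
 have surj: "cub c d ` sh w = T" if "w \<in> ?R" for w
 proof safe
  fix y assume y: "y \<in> T"
  have "norm (cub c d w - y) < E^3"
   using rx that y F by (auto simp: T_def dist_norm)
  then obtain z where "cub c d z = y" "norm (w - z) < E"
   using E cub_root_near by metis
  with y show "y \<in> cub c d ` sh w"
   by (auto simp: sh_def dist_norm)
 qed (auto simp: sh_def)
 show "\<exists>T. x \<in> T & openin (top_of_set ?S) T &
     (\<exists>v. \<Union>v = ?C \<inter> ?p -` T & (\<forall>u \<in> v. openin (top_of_set ?C) u) &
       pairwise disjnt v & (\<forall>u \<in> v. \<exists>q. homeomorphism u T ?p q))"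
 proof (intro exI[of _ T] conjI exI[of _ "sh ` ?R"] ballI)
  show "x \<in> T" using F by (simp add: T_def)
  show "openin (top_of_set ?S) T"
   using TS by (intro open_subset) (auto simp: T_def)
  show un: "\<Union> (sh ` ?R) = ?C \<inter> ?p -` T"
  proof safe
   fix z assume z: "cub c d z \<in> T"
   hence "norm (cub c d z - x) < E^3"
    using F by (auto simp: T_def dist_norm norm_minus_commute)
   then obtain w where w: "cub c d w = x" "norm (z - w) < E"
    using E cub_root_near by metis
   hence "(w - r1) * (w - r2) * (w - r3) = 0" using r[of w] by simp
   hence "w \<in> ?R" by simp
   with w z show "z \<in> \<Union> (sh ` ?R)"
    by (auto simp: sh_def dist_norm norm_minus_commute)
  qed (use TS in \<open>auto simp: sh_def\<close>)
  fix u assume u: "u \<in> sh ` ?R"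
  hence "u \<subseteq> ?C" using un by blast
  thus "openin (top_of_set ?C) u"
   using u op by (auto intro: open_subset)
  obtain w where w: "w \<in> ?R" "u = sh w" using u by blast
  have "continuous_on u ?p" by (intro continuous_intros)
  then obtain g where "homeomorphism u (?p ` u) ?p g"
   using invariance_of_domain_homeomorphism[of u ?p] op inj w by blast
  thus "\<exists>q. homeomorphism u T ?p q"
   using surj w by auto
 next
  show "pairwise disjnt (sh ` ?R)"
  proof (rule pairwiseI)
   fix u v assume uv: "u \<in> sh ` ?R" "v \<in> sh ` ?R" "u ~= v"
   then obtain a b where ab: "a \<in> ?R" "b \<in> ?R" "u = sh a" "v = sh b" "a ~= b"
    by blast
   hence "dist a b / 2 \<in> D"
    unfolding D_def by force
   hence "E <= dist a b / 2" using E_le by blast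
   hence "ball a E \<inter> ball b E = {}"
    by (intro disjoint_ballI) auto
   thus "disjnt u v"
    using ab by (auto simp: disjnt_def sh_def)
  qed
 qed
qed

text \<open>Division by \<open>cubq\<close> turns the known change of the equation at the fixed
  point \<open>Z t0\<close> into the change of \<open>Z\<close>. Continuity of \<open>Z\<close>
  makes the divisor converge to the derivative at \<open>Z t0\<close>, which is nonzero.\<close>

lemma cub_implicit_differentiable:
 assumes c: "c field_differentiable (at t0)" and d: "d field_differentiable (at t0)"
  and y: "y field_differentiable (at t0)" and Z: "isCont Z t0"
  and ev: "eventually (%t. cub (c t) (d t) (Z t) = y t) (nhds t0)"
  and nz: "Z t0 ~= c t0" "Z t0 ~= d t0"
 shows "Z field_differentiable (at t0)"
proof -
 define N where "N t = y t - cub (c t) (d t) (Z t0)" for t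
 define Q where "Q t = cubq (c t) (d t) (Z t) (Z t0)" for t
 have "(%t. cub (c t) (d t) (Z t0)) field_differentiable (at t0)"
  unfolding cub_def using c d
  by (intro field_differentiable_diff field_differentiable_add field_differentiable_mult field_differentiable_const)
 hence "N field_differentiable (at t0)"
  unfolding N_def[abs_def] by (intro field_differentiable_diff y)
 then obtain N' where N': "(N has_field_derivative N') (at t0)"
  unfolding field_differentiable_def by blast
 have N0: "N t0 = 0"
  using eventually_nhds_x_imp_x[OF ev] by (simp add: N_def)
 have ct: "isCont c t0" "isCont d t0"
  using c d field_differentiable_imp_continuous_at by blast+
 have Qt: "(Q \<longlongrightarrow> cubq (c t0) (d t0) (Z t0) (Z t0)) (at t0)"
  unfolding Q_def[abs_def] using ct Z by (intro tendsto_intros) (auto simp: isCont_def)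
 have Q0: "cubq (c t0) (d t0) (Z t0) (Z t0) ~= 0"
  using nz by (simp add: cubq_same)
 have "((%t. (N t - N t0) / (t - t0) / Q t) \<longlongrightarrow> N' / cubq (c t0) (d t0) (Z t0) (Z t0)) (at t0)"
  using N' Qt Q0 by (intro tendsto_divide) (auto simp: has_field_derivative_iff)
 moreover have "eventually (%t. (N t - N t0) / (t - t0) / Q t = (Z t - Z t0) / (t - t0)) (at t0)"
 proof -
  have "eventually (%t. cub (c t) (d t) (Z t) = y t) (at t0)"
   using ev by (simp add: eventually_nhds_conv_at)
  moreover have "eventually (%t. Q t ~= 0) (at t0)"
   using Qt Q0 tendsto_imp_eventually_ne by blast
  ultimately show ?thesis
  proof eventually_elim
   case (elim t)
   have "N t = (Z t - Z t0) * Q t"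
    using cub_diff[of "c t" "d t" "Z t" "Z t0"] elim by (simp add: N_def Q_def)
   thus ?case
    using elim N0 by simp
  qed
 qed
 ultimately have "((%t. (Z t - Z t0) / (t - t0)) \<longlongrightarrow> N' / cubq (c t0) (d t0) (Z t0) (Z t0)) (at t0)"
  by (rule Lim_transform_eventually)
 thus ?thesis
  unfolding field_differentiable_def has_field_derivative_iff by blast
qed

text \<open>A convex set is simply connected, so a map missing the critical values lifts through the
  covering; the lift avoids the critical points and is therefore holomorphic.\<close>

lemma cub_lift:
 assumes S: "open S" "convex S" "z0 \<in> S" and g: "g holomorphic_on S"
  and nc: "!!z. z \<in> S ==> g z ~= cub c d c & g z ~= cub c d d" and w0: "cub c d w0 = g z0"
 obtains G where "G holomorphic_on S" "G z0 = w0" "!!z. z \<in> S ==> cub c d (G z) = g z"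
proof -
 have "w0 \<in> - cub c d -` {cub c d c, cub c d d}"
  using w0 nc S(3) by auto
 moreover have "g \<in> S \<rightarrow> - {cub c d c, cub c d d}"
  using nc by auto
 ultimately obtain G where G: "continuous_on S G" "G z0 = w0" "!!z. z \<in> S ==> cub c d (G z) = g z"
  using covering_space_lift_strong[OF covering_space_cub _ S(3) convex_imp_simply_connected[OF S(2)]
   convex_imp_locally_path_connected[OF S(2)] holomorphic_on_imp_continuous_on[OF g]] w0 by metis
 have "G holomorphic_on S"
  unfolding holomorphic_on_open[OF S(1)]
 proof
  fix z assume z: "z \<in> S"
  have "G field_differentiable (at z)"
  proof (rule cub_implicit_differentiable[of "%_. c" _ "%_. d" g])
   show "g field_differentiable (at z)"
    using g z S(1) holomorphic_on_imp_differentiable_at by blast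
   show "isCont G z" using G(1) S(1) z continuous_on_eq_continuous_at by blast
   show "\<forall>\<^sub>F t in nhds z. cub c d (G t) = g t"
    using eventually_nhds_in_open[OF S(1) z] by eventually_elim (simp add: G)
   show "G z ~= c" "G z ~= d" using nc[OF z] G(3)[OF z] by auto
  qed auto
  thus "\<exists>f'. (G has_field_derivative f') (at z)"
   by (simp add: field_differentiable_def)
 qed
 with G show ?thesis using that by blast
qed

lemma cub_lift_unique:
 assumes "connected S" "continuous_on S G" "continuous_on S G'"
  and "!!z. z \<in> S ==> cub c d (G z) = cub c d (G' z)"
  and nc: "!!z. z \<in> S ==> cub c d (G z) ~= cub c d c & cub c d (G z) ~= cub c d d"
  and "z0 \<in> S" "G z0 = G' z0" "z \<in> S"
 shows "G z = G' z"
proof (rule covering_space_lift_unique[OF covering_space_cub, where f = "%z. cub c d (G z)" and T = S and a = z0])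
 show "G \<in> S \<rightarrow> - cub c d -` {cub c d c, cub c d d}" "G' \<in> S \<rightarrow> - cub c d -` {cub c d c, cub c d d}"
  using nc assms(4) by fastforce+
qed (use assms in \<open>auto intro!: continuous_intros\<close>)

section \<open>Escape radius, filled Julia set and connectedness locus\<close>

definition par :: "complex => complex => bool" where
 "par c d \<longleftrightarrow> norm c <= 2 & norm d <= 2"

text \<open>The filled Julia set: 10 is an escape radius as soon as both critical points have modulus at most 2.\<close>

definition fk :: "complex => complex => complex set" where
 "fk c d = {z. \<forall>n. norm ((cub c d ^^ n) z) <= 10}"

text \<open>The connectedness locus.\<close>

definition con :: "complex => complex => bool" where
 "con c d \<longleftrightarrow> par c d & c \<in> fk c d & d \<in> fk c d"

lemma par_commute: "par c d \<longleftrightarrow> par d c"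
 by (auto simp: par_def)

lemma fk_commute: "fk c d = fk d c"
 by (simp add: fk_def cub_commute)

lemma con_commute: "con c d \<longleftrightarrow> con d c"
 by (auto simp: con_def par_commute fk_commute)

lemma norm_cub_low:
 assumes "par c d"
 shows "norm (cub c d z) >= (norm z)^3 - 6 * (norm z)^2 - 12 * norm z"
proof -
 have "norm (3/2 * (c + d) * z^2) <= 6 * (norm z)^2"
 proof -
  have "norm (c + d) <= 4" using assms norm_triangle_ineq[of c d] by (auto simp: par_def)
  hence "3/2 * norm (c + d) * (norm z)^2 <= 6 * (norm z)^2" by (intro mult_right_mono) auto
  moreover have "norm (3/2 * (c + d) * z^2) = norm (3/2 :: complex) * norm (c + d) * (norm z)^2"
   by (simp only: norm_mult norm_power)
  ultimately show ?thesis by (simp add: norm_divide)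
 qed
 moreover have "norm (3 * c * d * z) <= 12 * norm z"
 proof -
  have "norm c * norm d <= 2 * 2" using assms by (intro mult_mono) (auto simp: par_def)
  hence "3 * (norm c * norm d) * norm z <= 12 * norm z" by (intro mult_right_mono) auto
  thus ?thesis by (simp add: norm_mult mult_ac)
 qed
 moreover have "norm (cub c d z) >= norm (z^3) - norm (3/2 * (c + d) * z^2) - norm (3 * c * d * z)"
  unfolding cub_def by (smt (verit) norm_diff_ineq norm_triangle_ineq2)
 ultimately show ?thesis by (simp add: norm_power)
qed

text \<open>Both bounds come from x^2 - 6 x - 12 being at least x^2 / 4 and at least 2 when x >= 10.
  The linear one gives escape; the cubic one compares |z| / 2 with exact third powers and leads to
  the bound on \<open>Psi\<close>.\<close>

lemma cub_escape:
 assumes "par c d" "norm z >= 10"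
 shows "norm (cub c d z) / 2 >= (norm z / 2)^3" "norm (cub c d z) >= 2 * norm z"
proof -
 define x where "x = norm z"
 have x: "x >= 10" using assms by (simp add: x_def)
 have l: "norm (cub c d z) >= x * (x^2 - 6 * x - 12)"
  using norm_cub_low[OF assms(1), of z] by (simp add: x_def power2_eq_square power3_eq_cube algebra_simps)
 have xx: "x * x >= 10 * x" using x by (intro mult_right_mono) auto
 hence "x^2 - 6 * x - 12 >= x^2 / 4" "x^2 - 6 * x - 12 >= 2"
  using x unfolding power2_eq_square by linarith+
 hence "x * (x^2 - 6 * x - 12) >= x * (x^2/4)" "x * (x^2 - 6 * x - 12) >= x * 2"
  using x by (intro mult_left_mono; simp)+
 thus "norm (cub c d z) / 2 >= (norm z / 2)^3" "norm (cub c d z) >= 2 * norm z"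
  using l unfolding x_def[symmetric] by (auto simp: power2_eq_square power3_eq_cube)
qed

lemma cub_escape_iter:
 assumes "par c d" "norm z >= 10"
 shows "norm ((cub c d ^^ n) z) / 2 >= (norm z / 2)^(3^n) & norm ((cub c d ^^ n) z) >= 2^n * norm z"
proof (induction n)
 case (Suc n)
 let ?w = "(cub c d ^^ n) z"
 have "1 * norm z <= 2^n * norm z" by (intro mult_right_mono) auto
 hence w: "norm ?w >= 10" using Suc assms by linarith
 have "(norm z / 2)^(3^Suc n) = ((norm z / 2)^(3^n))^3"
  by (simp add: power_mult[symmetric] mult.commute)
 also have "... <= (norm ?w / 2)^3" using Suc by (intro power_mono) auto
 also have "... <= norm (cub c d ?w) / 2" using cub_escape[OF assms(1) w] by simp
 finally show ?case using cub_escape[OF assms(1) w] Suc by simp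
qed auto

lemma fk_bounded: "z \<in> fk c d ==> norm z <= 10"
 unfolding fk_def by (auto dest: spec[of _ 0])

lemma fk_funpow: "z \<in> fk c d ==> (cub c d ^^ n) z \<in> fk c d"
 unfolding fk_def by (auto simp flip: funpow_add[THEN fun_cong, simplified o_def])

lemma fk_cub: "z \<in> fk c d ==> cub c d z \<in> fk c d"
 using fk_funpow[of z c d 1] by simp

lemma fk_escape:
 assumes "par c d" "z \<notin> fk c d"
 obtains N where "!!n. norm ((cub c d ^^ (n + N)) z) >= 2^n * 10"
proof -
 obtain N where N: "norm ((cub c d ^^ N) z) > 10"
  using assms(2) by (auto simp: fk_def not_le)
 have "norm ((cub c d ^^ (n + N)) z) >= 2^n * 10" for n
 proof -
  have "2^n * 10 <= 2^n * norm ((cub c d ^^ N) z)"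
   using N by (intro mult_left_mono) auto
  also have "... <= norm ((cub c d ^^ n) ((cub c d ^^ N) z))"
   using cub_escape_iter[OF assms(1), of "(cub c d ^^ N) z"] N by auto
  finally show ?thesis by (simp add: funpow_add)
 qed
 thus ?thesis using that by blast
qed

lemma fk_unbounded:
 assumes "par c d" "z \<notin> fk c d"
 shows "filterlim (%n. norm ((cub c d ^^ n) z)) at_top sequentially"
proof -
 obtain N where N: "!!n. norm ((cub c d ^^ (n + N)) z) >= 2^n * 10"
  using fk_escape[OF assms] by blast
 have "filterlim (%n. 2^n * (10::real)) at_top sequentially"
  by real_asymp
 hence "filterlim (%n. norm ((cub c d ^^ (n + N)) z)) at_top sequentially"
  by (rule filterlim_at_top_mono) (use N in auto)
 thus ?thesis
  unfolding filterlim_at_top eventually_sequentially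
  by (metis add.commute le_add_diff_inverse add_le_imp_le_diff add_leD2)
qed

text \<open>An orbit leaving the disc of radius 10 tends to infinity, so a bound along any times
  tending to infinity is enough. Normal families provide such bounds along subsequences
  only.\<close>

lemma fk_bounded_subseqI:
 assumes "par c d" "filterlim n at_top sequentially" "!!k::nat. k >= k0 ==> norm ((cub c d ^^ n k) z) <= B"
 shows "z \<in> fk c d"
proof (rule ccontr)
 assume "z \<notin> fk c d"
 hence "filterlim (%k. norm ((cub c d ^^ n k) z)) at_top sequentially"
  using filterlim_compose[OF fk_unbounded[OF assms(1)] assms(2)] by simp
 hence "eventually (%k. norm ((cub c d ^^ n k) z) > B) sequentially"
  by (simp add: filterlim_at_top_dense)
 then obtain k1 where "!!k. k >= k1 ==> norm ((cub c d ^^ n k) z) > B"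
  by (auto simp: eventually_sequentially)
 from this[of "max k0 k1"] assms(3)[of "max k0 k1"] show False by simp
qed

lemma fk_cubD:
 assumes "par c d" "cub c d z \<in> fk c d" shows "z \<in> fk c d"
proof (rule fk_bounded_subseqI[OF assms(1), of Suc 0 z 10])
 show "filterlim Suc at_top sequentially" by (rule filterlim_Suc)
 show "norm ((cub c d ^^ Suc k) z) <= 10" for k
  using assms(2) unfolding fk_def by (simp add: funpow_swap1)
qed

lemma fk_cub_iff: "par c d ==> cub c d z \<in> fk c d \<longleftrightarrow> z \<in> fk c d"
 using fk_cub fk_cubD by blast

lemma fk_funpow_iff: "par c d ==> (cub c d ^^ n) z \<in> fk c d \<longleftrightarrow> z \<in> fk c d"
 by (induction n) (auto simp: fk_cub_iff)

lemma zero_in_fk [simp]: "0 \<in> fk c d"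
 by (simp add: fk_def)

lemma closed_fk: "closed (fk c d)"
proof -
 have "fk c d = (\<Inter>n. {z. norm ((cub c d ^^ n) z) <= 10})"
  by (auto simp: fk_def)
 also have "closed ..."
  by (intro closed_INT ballI closed_Collect_le continuous_intros)
 finally show ?thesis .
qed

lemma compact_fk: "compact (fk c d)"
 unfolding compact_eq_bounded_closed bounded_iff using closed_fk fk_bounded by blast

text \<open>Upper semicontinuity of the filled Julia set: the condition on each single iterate is
  closed in the parameters and the point together.\<close>

lemma fk_closed_graph:
 assumes "(c \<longlongrightarrow> c0) sequentially" "(d \<longlongrightarrow> d0) sequentially" "(z \<longlongrightarrow> z0) sequentially"
  and "!!n. z n \<in> fk (c n) (d n)"
 shows "z0 \<in> fk c0 d0"
 unfolding fk_def
proof safe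
 fix n
 have "(%k. norm ((cub (c k) (d k) ^^ n) (z k))) \<longlonglongrightarrow> norm ((cub c0 d0 ^^ n) z0)"
  by (intro tendsto_intros assms)
 thus "norm ((cub c0 d0 ^^ n) z0) <= 10"
  by (rule LIMSEQ_le_const2) (use assms(4) in \<open>auto simp: fk_def\<close>)
qed

lemma con_limit:
 assumes "(c \<longlongrightarrow> c0) sequentially" "(d \<longlongrightarrow> d0) sequentially" "!!n. con (c n) (d n)"
 shows "con c0 d0"
proof -
 have "norm c0 <= 2" "norm d0 <= 2"
  using assms by (auto intro!: LIMSEQ_le_const2[OF tendsto_norm] simp: con_def par_def)
 moreover have "c0 \<in> fk c0 d0" "d0 \<in> fk c0 d0"
  using fk_closed_graph[OF assms(1,2,1)] fk_closed_graph[OF assms(1,2,2)] assms(3) by (auto simp: con_def)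
 ultimately show ?thesis by (simp add: con_def par_def)
qed

section \<open>The Boettcher parametrisation of the basin\<close>

text \<open>The variable \<open>ze\<close> is a logarithm of the Boettcher coordinate: its real part
  is the potential, its imaginary part the external angle, and the cubic acts as multiplication by
  3.\<close>

definition hp :: "real => complex set" where
 "hp s = {ze. s < Re ze}"

lemma open_hp [simp]: "open (hp s)" and convex_hp [simp]: "convex (hp s)"
 unfolding hp_def by (auto simp: open_halfspace_Re_gt convex_halfspace_Re_gt)

lemma connected_hp [simp]: "connected (hp s)"
 by (simp add: convex_connected)

lemma hp_mult3: "ze \<in> hp s ==> 0 <= s ==> 3 * ze \<in> hp s"
 by (simp add: hp_def)

lemma hp_mult_pow3: "ze \<in> hp s ==> 0 <= s ==> 3 ^ k * ze \<in> hp s"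
 by (induction k) (auto simp: mult.assoc hp_mult3)

lemma hp_period: "ze \<in> hp s ==> ze + 2 * pi * \<i> \<in> hp s"
 by (simp add: hp_def)

text \<open>The relative error of the leading term: F(exp t) = exp(3 t) * (1 +
  \<open>cW c d t\<close>). Its logarithm \<open>cU\<close> is the additive error in logarithmic
  coordinates.\<close>

definition cW :: "complex => complex => complex => complex" where
 "cW c d t = 3 * c * d * (exp (-t))^2 - 3/2 * (c + d) * exp (-t)"

definition cU :: "complex => complex => complex => complex" where
 "cU c d t = Ln (1 + cW c d t)"

lemma exp_minus_9: "exp (-9 :: real) <= 1/1000"
proof -
 have "(5/4) ^ 36 <= exp (1/4 :: real) ^ 36"
  using exp_ge_add_one_self[of "1/4::real"] by (intro power_mono) auto
 also have "... = exp 9"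
  by (simp add: exp_of_nat_mult[symmetric])
 finally have "exp 9 >= (1000 :: real)"
  by (simp add: power_divide field_simps)
 thus ?thesis
  by (simp add: exp_minus field_simps)
qed

lemma norm_exp_minus:
 assumes "Re t >= 9" shows "norm (exp (- t)) <= 1/1000"
proof -
 have "exp (- Re t) <= exp (-9)" using assms by simp
 moreover have "norm (exp (- t)) = exp (- Re t)" by (simp add: norm_exp_eq_Re)
 ultimately show ?thesis using exp_minus_9 by linarith
qed

lemma holomorphic_on_mult3:
 assumes "f holomorphic_on B" "!!z. z \<in> A ==> 3 * z \<in> B"
 shows "(%z. f (3 * z)) holomorphic_on A"
proof -
 have "(f \<circ> (%z. 3 * z)) holomorphic_on A"
  using assms by (intro holomorphic_on_compose_gen[of _ A f B]) (auto intro!: holomorphic_intros)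
 thus ?thesis by (simp add: o_def)
qed

lemma holomorphic_on_shift:
 assumes "f holomorphic_on B" "!!z. z \<in> A ==> z + a \<in> B"
 shows "(%z. f (z + a)) holomorphic_on A"
proof -
 have "(f \<circ> (%z. z + a)) holomorphic_on A"
  using assms by (intro holomorphic_on_compose_gen[of _ A f B]) (auto intro!: holomorphic_intros)
 thus ?thesis by (simp add: o_def)
qed

text \<open>The coefficient \<open>k\<close> is 3 for \<open>cW\<close> and 6 for its derivative up
  to sign, so one estimate serves both.\<close>

lemma norm_quad_bound:
 assumes "par c d" "norm x <= 1/1000" "0 <= k" "k <= 6"
 shows "norm (of_real k * c * d * x^2 - 3/2 * (c + d) * x) <= 1/100"
proof -
 have "norm (c + d) <= 4" using assms norm_triangle_ineq[of c d] by (auto simp: par_def)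
 hence f1: "norm (3/2 :: complex) * norm (c + d) * norm x <= 3/2 * 4 * (1/1000)"
  using assms by (intro mult_mono) (auto simp: norm_divide)
 have "norm c * norm d <= 2 * 2" using assms by (intro mult_mono) (auto simp: par_def)
 hence f2: "k * (norm c * norm d) * (norm x)^2 <= 6 * 4 * (1/1000)^2"
  using assms by (intro mult_mono power_mono) auto
 have f3: "norm (of_real k * c * d * x^2 - 3/2 * (c + d) * x)
   <= norm (of_real k * c * d * x^2) + norm (3/2 * (c + d) * x)"
  by (rule norm_triangle_ineq4)
 have f4: "norm (of_real k * c * d * x^2) = k * (norm c * norm d) * (norm x)^2"
  using assms by (simp add: norm_mult norm_power)
 have f5: "norm (3/2 * (c + d) * x) = norm (3/2 :: complex) * norm (c + d) * norm x"
  by (simp only: norm_mult)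
 have "norm (of_real k * c * d * x^2 - 3/2 * (c + d) * x) <= 6 * 4 * (1/1000)^2 + 3/2 * 4 * (1/1000)"
  using f1 f2 f3 f4 f5 by linarith
 also have "... <= 1/100" by (simp add: power2_eq_square)
 finally show ?thesis .
qed

lemma cW_bound: "par c d ==> Re t >= 9 ==> norm (cW c d t) <= 1/100"
 using norm_quad_bound[of c d "exp (-t)" 3] norm_exp_minus[of t] by (simp add: cW_def)

lemma cW_nonpos:
 assumes "par c d" "Re t >= 9" shows "1 + cW c d t \<notin> \<real>\<^sub>\<le>\<^sub>0" "1 + cW c d t ~= 0"
proof -
 have "\<bar>Re (cW c d t)\<bar> <= 1/100"
  using cW_bound[OF assms] abs_Re_le_cmod order_trans by blast
 hence "Re (1 + cW c d t) > 0" by simp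
 thus "1 + cW c d t \<notin> \<real>\<^sub>\<le>\<^sub>0"
  by (auto simp: complex_nonpos_Reals_iff)
 thus "1 + cW c d t ~= 0" by force
qed

lemma cU_deriv:
 assumes "par c d" "Re t >= 9"
 shows "\<exists>U'. (cU c d has_field_derivative U') (at t within S) & norm U' <= 1/50"
proof -
 let ?W' = "- (of_real 6 * c * d * (exp (-t))^2 - 3/2 * (c + d) * exp (-t))"
 have W: "(cW c d has_field_derivative ?W') (at t within S)"
  unfolding cW_def[abs_def] by (auto intro!: derivative_eq_intros simp: power2_eq_square field_simps)
 have "((%t. Ln (1 + cW c d t)) has_field_derivative ?W' / (1 + cW c d t)) (at t within S)"
 proof -
  have "((%t. 1 + cW c d t) has_field_derivative ?W') (at t within S)"
   using DERIV_add[OF DERIV_const W, of 1] by simp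
  from DERIV_chain2[OF has_field_derivative_Ln[OF cW_nonpos(1)[OF assms]] this]
  show ?thesis by (simp only: divide_inverse_commute)
 qed
 moreover have "norm (?W' / (1 + cW c d t)) <= (1/100) / (99/100)"
 proof -
  have "norm (1 + cW c d t) >= 1 - 1/100"
   using cW_bound[OF assms] norm_diff_ineq[of 1 "cW c d t"] by simp
  moreover have "norm ?W' <= 1/100"
   unfolding norm_minus_cancel by (rule norm_quad_bound[OF assms(1) norm_exp_minus[OF assms(2)]]) simp_all
  ultimately show ?thesis
   unfolding norm_divide by (intro frac_le) auto
 qed
 ultimately show ?thesis
  unfolding cU_def[abs_def] by (intro exI[of _ "?W' / (1 + cW c d t)"]) simp
qed

lemma cU_lipschitz:
 assumes "par c d" "Re t >= 9" "Re t' >= 9"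
 shows "norm (cU c d t - cU c d t') <= 1/50 * norm (t - t')"
proof -
 let ?A = "{t. Re t >= 9}"
 have "\<forall>t\<in>?A. \<exists>U'. (cU c d has_field_derivative U') (at t within ?A) & norm U' <= 1/50"
  using cU_deriv[OF assms(1)] by simp
 from bchoice[OF this] obtain U' where
  U': "\<forall>t\<in>?A. (cU c d has_field_derivative U' t) (at t within ?A) & norm (U' t) <= 1/50" ..
 show ?thesis
  by (rule field_differentiable_bound[of ?A _ U']) (use assms U' in \<open>auto simp: convex_halfspace_Re_ge\<close>)
qed

lemma cU_bound:
 assumes "par c d" "Re t >= 9" shows "norm (cU c d t) <= 1/50"
 using norm_Ln_le[of "cW c d t"] cW_bound[OF assms] by (simp add: cU_def)

lemma cU_holomorphic:
 assumes "par c d" "f holomorphic_on S" "!!z. z \<in> S ==> Re (f z) >= 9" shows "(%z. cU c d (f z)) holomorphic_on S"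
proof -
 have "cU c d holomorphic_on {t. 9 <= Re t}"
  unfolding holomorphic_on_def field_differentiable_def using cU_deriv[OF assms(1)] by blast
 hence "(cU c d \<circ> f) holomorphic_on S"
  using assms by (intro holomorphic_on_compose_gen[of f S]) auto
 thus ?thesis by (simp add: o_def)
qed

lemma cub_exp:
 assumes "par c d" "Re t >= 9" shows "cub c d (exp t) = exp (3 * t + cU c d t)"
proof -
 have "cub c d (exp t) = exp t ^ 3 * (1 + cW c d t)"
  by (simp add: cub_def cW_def exp_minus power2_eq_square power3_eq_cube field_simps)
 also have "exp t ^ 3 = exp (3 * t)"
  using exp_of_nat_mult[of 3 t] by simp
 also have "1 + cW c d t = exp (cU c d t)"
  unfolding cU_def using cW_nonpos(2)[OF assms] by simp
 finally show ?thesis by (simp add: exp_add)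
qed

text \<open>Picard iteration for h(3 ze) = 3 h(ze) + U(ze + h(ze)) with U = \<open>cU c d\<close>. A
  solution makes exp(ze + h(ze)) a conjugacy from multiplication by 3 to the cubic.\<close>

primrec hs :: "complex => complex => nat => complex => complex" where
 "hs c d 0 = (%_. 0)"
| "hs c d (Suc n) = (%ze. (hs c d n (3 * ze) - cU c d (ze + hs c d n ze)) / 3)"

lemma Re_add_ge9:
 assumes "ze \<in> hp 10" "norm h <= 1/50" shows "Re (ze + h) >= 9"
 using assms abs_Re_le_cmod[of h] by (simp add: hp_def)

lemma hs_bound:
 assumes "par c d" "ze \<in> hp 10" shows "norm (hs c d n ze) <= 1/50"
 using assms(2)
proof (induction n arbitrary: ze)
 case (Suc n)
 have "norm (hs c d n (3 * ze)) <= 1/50" using Suc by (simp add: hp_mult3)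
 moreover have "norm (cU c d (ze + hs c d n ze)) <= 1/50"
  using Suc by (intro cU_bound assms Re_add_ge9) auto
 ultimately have "norm (hs c d n (3 * ze) - cU c d (ze + hs c d n ze)) <= 1/50 + 1/50"
  by (intro order_trans[OF norm_triangle_ineq4]) auto
 thus ?case by (simp add: norm_divide)
qed auto

text \<open>The function \<open>cU\<close> has Lipschitz constant 1/50, so the iteration contracts
  by (1 + 1/50) / 3, which is below 1/2.\<close>

lemma hs_diff:
 assumes "par c d" "ze \<in> hp 10" shows "norm (hs c d (Suc n) ze - hs c d n ze) <= (1/2)^n"
 using assms(2)
proof (induction n arbitrary: ze)
 case 0
 show ?case using hs_bound[OF assms(1) 0, of "Suc 0"] by simp
next
 case (Suc n)
 let ?h = "hs c d"
 have 1: "norm (?h (Suc n) (3 * ze) - ?h n (3 * ze)) <= (1/2)^n"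
  using Suc by (simp add: hp_mult3 del: hs.simps)
 have "norm (cU c d (ze + ?h (Suc n) ze) - cU c d (ze + ?h n ze))
   <= 1/50 * norm ((ze + ?h (Suc n) ze) - (ze + ?h n ze))"
  using Suc.prems by (intro cU_lipschitz assms Re_add_ge9 hs_bound)
 also have "... = 1/50 * norm (?h (Suc n) ze - ?h n ze)"
  by simp
 also have "... <= 1/50 * (1/2)^n" by (intro mult_left_mono Suc) auto
 finally have 2: "norm (cU c d (ze + ?h (Suc n) ze) - cU c d (ze + ?h n ze)) <= 1/50 * (1/2)^n" .
 have "?h (Suc (Suc n)) ze - ?h (Suc n) ze =
  ((?h (Suc n) (3 * ze) - ?h n (3 * ze)) - (cU c d (ze + ?h (Suc n) ze) - cU c d (ze + ?h n ze))) / 3"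
  by (subst (1 2) hs.simps(2)) (simp add: diff_divide_distrib del: hs.simps)
 also have "norm ... <= ((1/2)^n + 1/50 * (1/2)^n) / 3"
  unfolding norm_divide using 1 2
  by (intro divide_mono order_trans[OF norm_triangle_ineq4]) (auto simp del: hs.simps)
 also have "... <= (1/2)^Suc n" by simp
 finally show ?case .
qed

lemma hs_holomorphic:
 assumes "par c d" shows "hs c d n holomorphic_on hp 10"
proof (induction n)
 case (Suc n)
 have "(%ze. hs c d n (3 * ze)) holomorphic_on hp 10"
  by (rule holomorphic_on_mult3[OF Suc]) (simp add: hp_mult3)
 moreover have "(%ze. cU c d (ze + hs c d n ze)) holomorphic_on hp 10"
  by (intro cU_holomorphic assms holomorphic_intros Suc Re_add_ge9 hs_bound)
 ultimately show ?case
  unfolding hs.simps by (intro holomorphic_intros) auto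
qed auto

lemma cW_period: "cW c d (t + 2 * pi * \<i>) = cW c d t"
proof -
 have "exp (- (t + 2 * pi * \<i>)) = exp (- t)"
  by (simp add: exp_diff)
 thus ?thesis by (simp only: cW_def)
qed

lemma hs_period: "hs c d n (ze + 2 * pi * \<i>) = hs c d n ze"
proof (induction n arbitrary: ze)
 case (Suc n)
 have "hs c d n (3 * (ze + 2 * pi * \<i>)) = hs c d n (3 * ze + 2 * pi * \<i> + 2 * pi * \<i> + 2 * pi * \<i>)"
  by (simp add: algebra_simps)
 also have "... = hs c d n (3 * ze)" by (simp only: Suc)
 finally have "hs c d n (3 * (ze + 2 * pi * \<i>)) = hs c d n (3 * ze)" .
 moreover have "cU c d (ze + 2 * pi * \<i> + hs c d n (ze + 2 * pi * \<i>)) = cU c d (ze + hs c d n ze)"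
  using cW_period[of c d "ze + hs c d n ze"] unfolding cU_def Suc by (simp add: add_ac)
 ultimately show ?case by simp
qed auto

lemma near_infinity:
 assumes "par c d"
 obtains h where "h holomorphic_on hp 10" "!!ze. ze \<in> hp 10 ==> norm (h ze) <= 1/50"
  "!!ze. ze \<in> hp 10 ==> 3 * h ze + cU c d (ze + h ze) = h (3 * ze)"
  "!!ze. ze \<in> hp 10 ==> h (ze + 2 * pi * \<i>) = h ze"
proof -
 define h where "h ze = (\<Sum>i. hs c d (Suc i) ze - hs c d i ze)" for ze
 have "uniform_limit (hp 10) (%n x. \<Sum>i<n. hs c d (Suc i) x - hs c d i x) h sequentially"
  unfolding h_def by (rule Weierstrass_m_test[where M = "%n. (1/2)^n"]) (use hs_diff[OF assms] in auto)
 moreover have "(\<Sum>i<n. hs c d (Suc i) x - hs c d i x) = hs c d n x" for n x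
  using sum_lessThan_telescope[of "%i. hs c d i x" n] by simp
 ultimately have "uniform_limit (hp 10) (%n x. hs c d n x) h sequentially"
  by (simp only:)
 hence ul: "uniform_limit (hp 10) (hs c d) h sequentially" .
 have lim: "(%n. hs c d n ze) \<longlonglongrightarrow> h ze" if "ze \<in> hp 10" for ze
  using tendsto_uniform_limitI[OF ul that] .
 show ?thesis
 proof
  show "h holomorphic_on hp 10"
  proof (rule holomorphic_uniform_sequence[OF open_hp])
   fix x assume "x \<in> hp 10"
   then obtain e where "e > 0" "cball x e \<subseteq> hp 10"
    using open_contains_cball open_hp by blast
   thus "\<exists>e>0. cball x e \<subseteq> hp 10 & uniform_limit (cball x e) (hs c d) h sequentially"
    using uniform_limit_on_subset[OF ul] by blast
  qed (use hs_holomorphic[OF assms] in blast)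
  show bd: "norm (h ze) <= 1/50" if "ze \<in> hp 10" for ze
   by (rule LIMSEQ_le_const2[OF tendsto_norm[OF lim[OF that]]]) (use hs_bound[OF assms that] in blast)
  show "h (ze + 2 * pi * \<i>) = h ze" if "ze \<in> hp 10" for ze
   using LIMSEQ_unique[OF lim[OF hp_period[OF that], unfolded hs_period] lim[OF that]] .
  fix ze assume ze: "ze \<in> hp 10"
  have "isCont (cU c d) (ze + h ze)"
   using cU_deriv[OF assms Re_add_ge9[OF ze bd[OF ze]]] DERIV_isCont by blast
  hence "(%n. (hs c d n (3 * ze) - cU c d (ze + hs c d n ze)) / 3) \<longlonglongrightarrow> (h (3 * ze) - cU c d (ze + h ze)) / 3"
   by (intro tendsto_intros lim ze hp_mult3 isCont_tendsto_compose[of _ "cU c d"]) auto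
  hence "(%n. hs c d (Suc n) ze) \<longlonglongrightarrow> (h (3 * ze) - cU c d (ze + h ze)) / 3"
   by simp
  hence "h ze = (h (3 * ze) - cU c d (ze + h ze)) / 3"
   using LIMSEQ_Suc[OF lim[OF ze]] LIMSEQ_unique by blast
  thus "3 * h ze + cU c d (ze + h ze) = h (3 * ze)"
   by (simp add: field_simps)
 qed
qed

text \<open>An inverse Boettcher map on a half-plane, in logarithmic form. The rough comparison with
  \<open>exp\<close> is preserved by limits and still fixes the normalisation, so that uniqueness
  can be applied to limit functions.\<close>

definition isPsi :: "complex => complex => real => (complex => complex) => bool" where
 "isPsi c d s \<Psi> \<longleftrightarrow> \<Psi> holomorphic_on hp s &
  (\<forall>ze\<in>hp s. cub c d (\<Psi> ze) = \<Psi> (3 * ze)) & (\<forall>ze\<in>hp s. \<Psi> (ze + 2 * pi * \<i>) = \<Psi> ze) &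
  (\<forall>ze\<in>hp (max s 10). norm (\<Psi> ze - exp ze) <= 1/10 * norm (exp ze))"

text \<open>For the second assertion, P t = z follows from the fixed point equation t = Ln z - h t;
  the right-hand side maps a small disc about Ln z to itself, and Brouwer applies.\<close>

lemma isPsi_near_infinity:
 assumes "par c d" obtains \<Psi> where "isPsi c d 10 \<Psi>"
  "!!z. norm z > exp 11 ==> \<exists>ze\<in>hp 10. \<Psi> ze = z"
proof -
 obtain h where h: "h holomorphic_on hp 10" "!!ze. ze \<in> hp 10 ==> norm (h ze) <= 1/50"
  "!!ze. ze \<in> hp 10 ==> 3 * h ze + cU c d (ze + h ze) = h (3 * ze)"
  "!!ze. ze \<in> hp 10 ==> h (ze + 2 * pi * \<i>) = h ze"
  using near_infinity[OF assms] by metis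
 define P where "P ze = exp (ze + h ze)" for ze
 have "isPsi c d 10 P"
  unfolding isPsi_def
 proof (intro conjI ballI)
  show "P holomorphic_on hp 10" unfolding P_def by (intro holomorphic_intros h)
  fix ze assume ze: "ze \<in> hp 10"
  have "cub c d (P ze) = exp (3 * (ze + h ze) + cU c d (ze + h ze))"
   unfolding P_def by (intro cub_exp assms Re_add_ge9 ze h)
  also have "3 * (ze + h ze) + cU c d (ze + h ze) = 3 * ze + h (3 * ze)"
   using h(3)[OF ze] by (simp add: algebra_simps)
  finally show "cub c d (P ze) = P (3 * ze)" by (simp add: P_def)
  show "P (ze + 2 * pi * \<i>) = P ze"
   using h(4)[OF ze] by (simp add: P_def exp_add)
 next
  fix ze assume "ze \<in> hp (max 10 10)"
  hence ze: "ze \<in> hp 10" by simp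
  have "norm (exp (h ze) - exp 0) <= exp (1/50) * norm (h ze - 0)"
  proof (rule field_differentiable_bound[of "cball 0 (1/50)" exp exp])
   fix z :: complex assume "z \<in> cball 0 (1/50)"
   hence "Re z <= 1/50" using complex_Re_le_cmod[of z] by simp
   thus "norm (exp z) <= exp (1/50)" by simp
  qed (use h(2)[OF ze] in \<open>auto intro!: derivative_eq_intros\<close>)
  also have "exp (1/50 :: real) <= exp 1" by simp
  also have "exp 1 <= (3::real)" by (rule exp_le)
  finally have "norm (exp (h ze) - 1) <= 3 * norm (h ze)" by (simp add: mult_right_mono)
  also have "... <= 1/10" using h(2)[OF ze] by simp
  finally have "norm (exp ze) * norm (exp (h ze) - 1) <= norm (exp ze) * (1/10)"
   by (intro mult_left_mono) auto
  thus "norm (P ze - exp ze) <= 1/10 * norm (exp ze)"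
   unfolding norm_mult[symmetric] by (simp add: P_def exp_add algebra_simps)
 qed
 moreover have "\<exists>ze\<in>hp 10. P ze = z" if z: "norm z > exp 11" for z
 proof -
  have z0: "z ~= 0" using z by auto
  have lz: "Re (Ln z) > 11"
   using z z0 by (metis Re_Ln exp_gt_zero ln_exp ln_less_cancel_iff zero_less_norm_iff)
  have sub: "cball (Ln z) (1/50) \<subseteq> hp 10"
  proof
   fix t assume "t \<in> cball (Ln z) (1/50)"
   hence "\<bar>Re (Ln z - t)\<bar> <= 1/50"
    using abs_Re_le_cmod order_trans unfolding mem_cball dist_norm by blast
   hence "Re t > 10" using lz unfolding minus_complex.sel by linarith
   thus "t \<in> hp 10" by (simp add: hp_def)
  qed
  obtain t where t: "t \<in> cball (Ln z) (1/50)" "Ln z - h t = t"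
  proof (rule brouwer[of "cball (Ln z) (1/50)" "%t. Ln z - h t"])
   show "continuous_on (cball (Ln z) (1/50)) (%t. Ln z - h t)"
    using holomorphic_on_imp_continuous_on[OF h(1)] sub
    by (intro continuous_intros) (auto intro: continuous_on_subset)
   show "(%t. Ln z - h t) \<in> cball (Ln z) (1/50) \<rightarrow> cball (Ln z) (1/50)"
    using h(2) sub by (auto simp: dist_norm)
  qed auto
  hence "t + h t = Ln z" by (metis add.commute diff_add_cancel)
  hence "P t = z" using z0 by (simp add: P_def)
  with t sub show ?thesis by blast
 qed
 ultimately show ?thesis using that by blast
qed

lemma norm_exp_ge_1000:
 assumes "ze \<in> hp 10" shows "norm (exp ze) >= 1000"
proof -
 have "norm (exp (- ze)) <= 1/1000" using assms by (intro norm_exp_minus) (auto simp: hp_def)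
 moreover have "norm (exp (- ze)) = exp (- Re ze)" by (simp add: norm_exp_eq_Re)
 ultimately have "inverse (exp (Re ze)) <= 1/1000" by (simp only: exp_minus)
 hence "exp (Re ze) >= 1000" by (simp add: inverse_eq_divide field_simps)
 thus ?thesis by simp
qed

text \<open>In units of \<open>e\<close> both points are within 1/10 of 1. There A^2 + A B + B^2 is
  within 63/100 of 3, and the lower order terms of \<open>cubq\<close> contribute at most
  1/10.\<close>

lemma isPsi_expand:
 assumes "par c d" "norm (z - e) <= 1/10 * norm e" "norm (w - e) <= 1/10 * norm e" "norm e >= 1000"
 shows "norm (cub c d z - cub c d w) >= 2 * norm (z - w) * (norm e)^2"
proof -
 define A B where "A = z / e" and "B = w / e"
 have e: "e ~= 0" using assms by auto
 have zw: "z = e * A" "w = e * B" using e by (auto simp: A_def B_def)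
 have A1: "norm (A - 1) <= 1/10" "norm (B - 1) <= 1/10"
 proof -
  have "A - 1 = (z - e) / e" "B - 1 = (w - e) / e" using e by (auto simp: A_def B_def field_simps)
  hence "norm (A - 1) = norm (z - e) / norm e" "norm (B - 1) = norm (w - e) / norm e"
   by (simp_all only: norm_divide)
  thus "norm (A - 1) <= 1/10" "norm (B - 1) <= 1/10"
   using assms e by (simp_all only: divide_le_eq zero_less_norm_iff) simp_all
 qed
 define a b where "a = A - 1" and "b = B - 1"
 have ab: "norm a <= 1/10" "norm b <= 1/10" "A = 1 + a" "B = 1 + b" using A1 by (auto simp: a_def b_def)
 define R where "R = - 3/2 * (c + d) * (A + B) / e + 3 * c * d / e^2"
 have q: "cubq c d z w = e^2 * (A^2 + A * B + B^2 + R)"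
  using e by (simp add: cubq_def zw R_def power2_eq_square field_simps)
 have "norm (A^2 + A * B + B^2) >= 3 - norm (3 * a + 3 * b + a^2 + a * b + b^2)"
 proof -
  have "A^2 + A * B + B^2 = 3 + (3 * a + 3 * b + a^2 + a * b + b^2)"
   by (simp add: ab power2_eq_square algebra_simps)
  thus ?thesis using norm_diff_ineq[of 3 "3 * a + 3 * b + a^2 + a * b + b^2"] by simp
 qed
 moreover have "norm (3 * a + 3 * b + a^2 + a * b + b^2) <= 3 * (1/10) + 3 * (1/10) + 1/100 + 1/100 + 1/100"
 proof -
  have "norm a * norm a <= (1/10) * (1/10)" "norm a * norm b <= (1/10) * (1/10)" "norm b * norm b <= (1/10) * (1/10)"
   using ab by (intro mult_mono; simp)+
  hence "norm (3 * a) <= 3 * (1/10)" "norm (3 * b) <= 3 * (1/10)" "norm (a^2) <= 1/100"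
   "norm (a * b) <= 1/100" "norm (b^2) <= 1/100"
   using ab by (auto simp: norm_mult power2_eq_square)
  thus ?thesis by (intro norm_triangle_le add_mono)
 qed
 moreover have "norm R <= 1/10"
 proof -
  have "norm (A + B) <= 3"
   using ab norm_triangle_ineq[of a b] norm_triangle_ineq[of 2 "a + b"] by (simp add: add_ac)
  moreover have "norm (c + d) <= 4" using assms norm_triangle_ineq[of c d] by (auto simp: par_def)
  ultimately have g1: "norm (- 3/2 :: complex) * norm (c + d) * norm (A + B) / norm e <= 3/2 * 4 * 3 / 1000"
   using assms by (intro frac_le mult_mono) (auto simp: norm_divide)
  have g2: "norm (3 :: complex) * norm c * norm d / (norm e)^2 <= 3 * 2 * 2 / 1000^2"
   using assms by (intro frac_le mult_mono power_mono) (auto simp: par_def)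
  have g3: "norm R <= norm (- 3/2 * (c + d) * (A + B) / e) + norm (3 * c * d / e^2)"
   unfolding R_def by (rule norm_triangle_ineq)
  have g4: "norm (- 3/2 * (c + d) * (A + B) / e) = norm (- 3/2 :: complex) * norm (c + d) * norm (A + B) / norm e"
   by (simp only: norm_mult norm_divide)
  have g5: "norm (3 * c * d / e^2) = norm (3 :: complex) * norm c * norm d / (norm e)^2"
   by (simp only: norm_mult norm_divide norm_power)
  have "norm R <= 3/2 * 4 * 3 / 1000 + 3 * 2 * 2 / 1000^2"
   using g1 g2 g3 g4 g5 by linarith
  thus ?thesis by (simp add: power2_eq_square)
 qed
 ultimately have "norm (A^2 + A * B + B^2 + R) >= 2"
  using norm_diff_ineq[of "A^2 + A * B + B^2" R] by simp
 hence "norm (z - w) * (norm e)^2 * 2 <= norm (z - w) * (norm e)^2 * norm (A^2 + A * B + B^2 + R)"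
  by (intro mult_left_mono) auto
 also have "... = norm (cub c d z - cub c d w)"
  by (simp add: cub_diff q norm_mult norm_power)
 finally show ?thesis by (simp add: mult_ac)
qed

text \<open>The difference relative to \<open>exp ze\<close> is at most half of the relative
  difference at \<open>3 * ze\<close>: the cubic expands by \<open>2 * (norm (exp ze))^2\<close>,
  and the modulus of \<open>exp (3 * ze)\<close> exceeds that of \<open>exp ze\<close> by the same
  square. Hence both maps agree far to the right, and analytic continuation does the rest.\<close>

lemma isPsi_unique:
 assumes "par c d" "isPsi c d s P" "isPsi c d s' P'" "ze \<in> hp s" "ze \<in> hp s'"
 shows "P ze = P' ze"
proof -
 define m where "m = max 10 (max s s')"
 have m: "hp m \<subseteq> hp s" "hp m \<subseteq> hp s'" "hp m \<subseteq> hp 10" "hp m \<subseteq> hp (max s 10)" "hp m \<subseteq> hp (max s' 10)" "m >= 0"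
  by (auto simp: m_def hp_def)
 have *: "norm (P ze - P' ze) <= 1/5 * (1/2)^k * norm (exp ze)" if "ze \<in> hp m" for k ze
  using that
 proof (induction k arbitrary: ze)
  case 0
  have "norm (P ze - exp ze) <= 1/10 * norm (exp ze)" "norm (P' ze - exp ze) <= 1/10 * norm (exp ze)"
   using assms(2,3) m 0 unfolding isPsi_def by blast+
  thus ?case using norm_triangle_ineq4[of "P ze - exp ze" "P' ze - exp ze"] by simp
 next
  case (Suc k)
  have P: "norm (P ze - exp ze) <= 1/10 * norm (exp ze)" "norm (P' ze - exp ze) <= 1/10 * norm (exp ze)"
   using assms(2,3) m Suc unfolding isPsi_def by blast+
  have "2 * norm (P ze - P' ze) * (norm (exp ze))^2 <= norm (cub c d (P ze) - cub c d (P' ze))"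
   using isPsi_expand[OF assms(1) P norm_exp_ge_1000] Suc.prems m by blast
  also have "... = norm (P (3 * ze) - P' (3 * ze))"
   using assms(2,3) m Suc.prems unfolding isPsi_def by (metis subsetD)
  also have "... <= 1/5 * (1/2)^k * norm (exp (3 * ze))"
   by (rule Suc.IH[OF hp_mult3[OF Suc.prems m(6)]])
  also have "norm (exp (3 * ze)) = norm (exp ze) * (norm (exp ze))^2"
   by (simp add: power2_eq_square flip: exp_add)
  finally have "(2 * norm (P ze - P' ze)) * (norm (exp ze))^2 <= (1/5 * (1/2)^k * norm (exp ze)) * (norm (exp ze))^2"
   by (simp only: mult.assoc)
  hence "2 * norm (P ze - P' ze) <= 1/5 * (1/2)^k * norm (exp ze)"
   by (rule mult_right_le_imp_le) auto
  thus ?case by simp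
 qed
 have eq: "P ze = P' ze" if "ze \<in> hp m" for ze
 proof -
  have "(%k. 1/5 * (1/2)^k * norm (exp ze)) \<longlonglongrightarrow> 1/5 * 0 * norm (exp ze)"
   by (intro tendsto_intros LIMSEQ_power_zero) auto
  hence "norm (P ze - P' ze) <= 1/5 * 0 * norm (exp ze)"
   by (rule LIMSEQ_le_const) (use *[OF that] in blast)
  thus ?thesis by simp
 qed
 have "of_real (m + 1) \<in> hp m" by (simp add: hp_def)
 hence ne: "hp m ~= {}" by blast
 show ?thesis
 proof (rule analytic_continuation_open[of "hp m" "hp (max s s')" P P'])
  have "hp (max s s') \<subseteq> hp s" "hp (max s s') \<subseteq> hp s'" by (auto simp: hp_def)
  thus "P holomorphic_on hp (max s s')" "P' holomorphic_on hp (max s s')"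
   using assms(2,3) holomorphic_on_subset unfolding isPsi_def by blast+
  show "ze \<in> hp (max s s')" using assms by (simp add: hp_def)
  show "hp m \<subseteq> hp (max s s')" by (auto simp: m_def hp_def)
 qed (use eq ne in auto)
qed

lemma isPsi_iter:
 assumes "isPsi c d s P" "0 <= s" "ze \<in> hp s"
 shows "(cub c d ^^ k) (P ze) = P (3^k * ze)"
proof (induction k)
 case (Suc k)
 have "(cub c d ^^ Suc k) (P ze) = P (3 * (3^k * ze))"
  using Suc assms hp_mult_pow3[OF assms(3,2)] by (simp add: isPsi_def)
 thus ?case by (simp only: power_Suc mult.assoc)
qed auto

lemma Re_3k_large:
 assumes "Re ze > 0" obtains k where "3^k * ze \<in> hp r"
proof -
 obtain k where "r / Re ze < 3^k"
  using real_arch_pow[of 3 "r / Re ze"] by auto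
 hence "3^k * Re ze > r"
  using assms by (simp add: divide_less_eq)
 moreover have "(3 :: complex)^k = of_real (3^k)" by simp
 hence "Re (3^k * ze) = 3^k * Re ze" by (simp only: times_complex.sel Re_complex_of_real Im_complex_of_real)
 ultimately have "Re (3^k * ze) > r" by simp
 thus ?thesis using that by (simp add: hp_def)
qed

lemma isPsi_notin_fk:
 assumes "par c d" "isPsi c d s P" "0 <= s" "ze \<in> hp s"
 shows "P ze \<notin> fk c d"
proof
 assume "P ze \<in> fk c d"
 obtain k where k: "3^k * ze \<in> hp (max s 10)"
  using Re_3k_large[of ze "max s 10"] assms by (auto simp: hp_def)
 have "norm (P (3^k * ze) - exp (3^k * ze)) <= 1/10 * norm (exp (3^k * ze))"
  using assms(2) k unfolding isPsi_def by blast
 moreover have "norm (exp (3^k * ze)) >= 1000"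
 proof (rule norm_exp_ge_1000)
  have "hp (max s 10) \<subseteq> hp 10" by (auto simp: hp_def)
  thus "3^k * ze \<in> hp 10" using k by blast
 qed
 ultimately have "norm (P (3^k * ze)) > 10"
  using norm_triangle_ineq2[of "exp (3^k * ze)" "P (3^k * ze)"] by (simp add: norm_minus_commute)
 moreover have "P (3^k * ze) \<in> fk c d"
  using isPsi_iter[OF assms(2,3,4), of k] fk_funpow[OF \<open>P ze \<in> fk c d\<close>, of k] by simp
 ultimately show False using fk_bounded by fastforce
qed

text \<open>The extension is a lift of the map P(3 ze) through the cubic. The critical values belong
  to the filled Julia set, which P misses; this is where connectedness enters.\<close>

lemma isPsi_extend:
 assumes "con c d" "isPsi c d s P" "0 < s" "s <= 10"
 obtains P' where "isPsi c d (s/3) P'"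
proof -
 have par: "par c d" using assms by (simp add: con_def)
 define m where "m = max s 10"
 define ze0 :: complex where "ze0 = of_real (m + 1)"
 have ze0: "ze0 \<in> hp m" "ze0 \<in> hp s" "ze0 \<in> hp (s/3)" using assms by (auto simp: hp_def ze0_def m_def)
 have h3: "3 * ze \<in> hp s" if "ze \<in> hp (s/3)" for ze using that by (simp add: hp_def)
 have Phol: "P holomorphic_on hp s" using assms by (simp add: isPsi_def)
 have gh: "(%ze. P (3 * ze)) holomorphic_on hp (s/3)"
  by (rule holomorphic_on_mult3[OF Phol h3])
 have nc: "P (3 * ze) ~= cub c d c & P (3 * ze) ~= cub c d d" if "ze \<in> hp (s/3)" for ze
  using isPsi_notin_fk[OF par assms(2) _ h3[OF that]] assms fk_cub by (auto simp: con_def)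
 obtain G where G: "G holomorphic_on hp (s/3)" "G ze0 = P ze0" "!!z. z \<in> hp (s/3) ==> cub c d (G z) = P (3 * z)"
  using cub_lift[of "hp (s/3)" ze0 "%ze. P (3 * ze)" c d "P ze0"] gh nc ze0 assms by (auto simp: isPsi_def)
 have GP: "G ze = P ze" if "ze \<in> hp s" for ze
 proof (rule cub_lift_unique[of "hp s" G P c d ze0])
  have sub: "hp s \<subseteq> hp (s/3)" using assms by (auto simp: hp_def)
  show "continuous_on (hp s) G" "continuous_on (hp s) P"
   using G(1) Phol holomorphic_on_imp_continuous_on continuous_on_subset sub by blast+
  show "cub c d (G z) = cub c d (P z)" if "z \<in> hp s" for z
   using that sub G(3) assms(2) by (auto simp: isPsi_def)
  show "cub c d (G z) ~= cub c d c & cub c d (G z) ~= cub c d d" if "z \<in> hp s" for z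
   using that sub G(3) nc by (metis subsetD)
 qed (use ze0 G that in auto)
 have "G (ze + 2 * pi * \<i>) = G ze" if "ze \<in> hp (s/3)" for ze
 proof (rule analytic_continuation_open[of "hp s" "hp (s/3)" "%ze. G (ze + 2 * pi * \<i>)" G])
  show "(%ze. G (ze + 2 * pi * \<i>)) holomorphic_on hp (s/3)"
   by (rule holomorphic_on_shift[OF G(1) hp_period])
  show "G (z + 2 * pi * \<i>) = G z" if "z \<in> hp s" for z
   using GP[OF that] GP[OF hp_period[OF that]] assms(2) that by (auto simp: isPsi_def)
  show "hp s \<subseteq> hp (s/3)" using assms by (auto simp: hp_def)
  show "hp s ~= {}" using ze0 by blast
 qed (use G that in auto)
 hence "isPsi c d (s/3) G"
  unfolding isPsi_def
 proof (intro conjI ballI)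
  fix ze assume ze: "ze \<in> hp (s/3)"
  show "cub c d (G ze) = G (3 * ze)" using G(3)[OF ze] GP[OF h3[OF ze]] by simp
 next
  fix ze assume ze: "ze \<in> hp (max (s/3) 10)"
  show "norm (G ze - exp ze) <= 1/10 * norm (exp ze)"
   using GP[of ze] assms ze by (simp add: isPsi_def hp_def)
 qed (use G in auto)
 thus ?thesis using that by blast
qed

lemma isPsi_exists:
 assumes "con c d" obtains P where "isPsi c d 0 P"
proof -
 have par: "par c d" using assms by (simp add: con_def)
 have "\<exists>P. isPsi c d (10/3^n) P" for n
 proof (induction n)
  case 0
  have "\<exists>P. isPsi c d 10 P" by (rule isPsi_near_infinity[OF par]) blast
  thus ?case by simp
 next
  case (Suc n)
  then obtain P where P: "isPsi c d (10/3^n) P" by blast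
  have "(10::real)/3^n <= 10" by (simp add: divide_le_eq)
  then obtain P' where "isPsi c d (10/3^n/3) P'"
   using isPsi_extend[OF assms P] by auto
  thus ?case by (auto simp: mult.commute)
 qed
 then obtain Q where Q: "!!n. isPsi c d (10/3^n) (Q n)" by metis
 \<comment> \<open>The choice of n is immaterial, because by uniqueness all \<open>Q n\<close> agree
   where they are defined.\<close>
 define P where "P ze = Q (SOME n. ze \<in> hp (10/3^n)) ze" for ze
 have PQ: "P ze = Q n ze" if "ze \<in> hp (10/3^n)" for n ze
  unfolding P_def using isPsi_unique[OF par Q Q someI[of "%n. ze \<in> hp (10/3^n)", OF that] that] .
 have ex: "\<exists>n. ze \<in> hp (10/3^n)" if "ze \<in> hp 0" for ze
 proof -
  obtain n where "10 / Re ze < 3^n" using real_arch_pow[of 3 "10 / Re ze"] by auto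
  hence "10 / 3^n < Re ze" using that by (simp add: hp_def field_simps)
  thus ?thesis by (auto simp: hp_def)
 qed
 have sub: "hp (10/3^n) \<subseteq> hp 0" for n
  by (auto simp: hp_def intro: less_trans[of 0 "10/3^n"])
 have un: "hp 0 = (\<Union>n. hp (10/3^n))" using ex sub by blast
 have "isPsi c d 0 P"
  unfolding isPsi_def
 proof (intro conjI ballI)
  show "P holomorphic_on hp 0"
   unfolding un
  proof (rule holomorphic_on_UN_open)
   fix n
   have "Q n holomorphic_on hp (10/3^n)" using Q[of n] by (simp add: isPsi_def)
   thus "P holomorphic_on hp (10/3^n)"
    by (rule holomorphic_transform) (simp add: PQ)
  qed auto
  fix ze assume "ze \<in> hp 0"
  then obtain n where n: "ze \<in> hp (10/3^n)" using ex by blast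
  show "cub c d (P ze) = P (3 * ze)"
   using Q[of n] n PQ[OF n] PQ[OF hp_mult3[OF n]] by (simp add: isPsi_def)
  show "P (ze + 2 * pi * \<i>) = P ze"
   using Q[of n] n PQ[OF n] PQ[OF hp_period[OF n]] by (simp add: isPsi_def)
 next
  fix ze assume ze: "ze \<in> hp (max 0 10)"
  hence "ze \<in> hp (10/3^0)" by simp
  from PQ[OF this] show "norm (P ze - exp ze) <= 1/10 * norm (exp ze)"
   using Q[of 0] ze by (simp add: isPsi_def)
 qed
 thus ?thesis using that by blast
qed

definition Psi :: "complex => complex => complex => complex" where
 "Psi c d = (SOME P. isPsi c d 0 P)"

lemma isPsi_Psi: "con c d ==> isPsi c d 0 (Psi c d)"
 unfolding Psi_def using isPsi_exists someI_ex[of "isPsi c d 0"] by blast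

lemma con_par: "con c d ==> par c d"
 by (simp add: con_def)

lemma Psi_eqI: "con c d ==> isPsi c d s P ==> ze \<in> hp s ==> ze \<in> hp 0 ==> P ze = Psi c d ze"
 using isPsi_unique[OF con_par _ isPsi_Psi] by blast

lemma Psi_commute: "Psi c d = Psi d c"
 unfolding Psi_def isPsi_def by (simp add: cub_commute)

lemma Psi_holomorphic: "con c d ==> Psi c d holomorphic_on hp 0"
 and Psi_cub: "con c d ==> ze \<in> hp 0 ==> cub c d (Psi c d ze) = Psi c d (3 * ze)"
 and Psi_period: "con c d ==> ze \<in> hp 0 ==> Psi c d (ze + 2 * pi * \<i>) = Psi c d ze"
 and Psi_near: "con c d ==> ze \<in> hp 10 ==> norm (Psi c d ze - exp ze) <= 1/10 * norm (exp ze)"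
 using isPsi_Psi[of c d] unfolding isPsi_def by auto

lemma Psi_continuous: "con c d ==> continuous_on (hp 0) (Psi c d)"
 using Psi_holomorphic holomorphic_on_imp_continuous_on by blast

lemma Psi_iter: "con c d ==> ze \<in> hp 0 ==> (cub c d ^^ k) (Psi c d ze) = Psi c d (3^k * ze)"
 using isPsi_iter[OF isPsi_Psi] by simp

lemma Psi_notin_fk: "con c d ==> ze \<in> hp 0 ==> Psi c d ze \<notin> fk c d"
 using isPsi_notin_fk[OF con_par isPsi_Psi] by simp

lemma Psi_period_nat: "con c d ==> ze \<in> hp 0 ==> Psi c d (ze + 2 * pi * \<i> * of_nat n) = Psi c d ze"
proof (induction n)
 case (Suc n)
 have "ze + 2 * pi * \<i> * of_nat n \<in> hp 0" using Suc by (simp add: hp_def)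
 from Psi_period[OF Suc.prems(1) this] show ?case using Suc by (simp add: algebra_simps)
qed auto

lemma Psi_period_int:
 assumes "con c d" "ze \<in> hp 0" shows "Psi c d (ze + 2 * pi * \<i> * of_int n) = Psi c d ze"
proof (cases "n >= 0")
 case True
 thus ?thesis using Psi_period_nat[OF assms, of "nat n"] by simp
next
 case False
 have "ze + 2 * pi * \<i> * of_int n \<in> hp 0" using assms by (simp add: hp_def)
 from Psi_period_nat[OF assms(1) this, of "nat (- n)"] show ?thesis using False by (simp add: algebra_simps)
qed

section \<open>Injectivity and surjectivity of \<open>Psi\<close>\<close>

lemma cube_expand:
 fixes w :: complex assumes "norm (w - 1) <= 1/4" shows "norm (w^3 - 1) >= 2 * norm (w - 1)"
proof -
 define a where "a = w - 1"
 have w: "w = 1 + a" by (simp add: a_def)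
 have a: "norm a <= 1/4" using assms by (simp add: a_def)
 have "norm a * norm a <= 1/4 * (1/4)" using a by (intro mult_mono) auto
 hence "norm (3 * a + a^2) <= 3 * (1/4) + 1/16"
  using a by (intro norm_triangle_le add_mono) (auto simp: norm_mult norm_power power2_eq_square)
 moreover have "norm (3 + (3 * a + a^2)) >= norm (3::complex) - norm (3 * a + a^2)"
  by (rule norm_diff_ineq)
 ultimately have "norm (3 + (3 * a + a^2)) >= 2" by simp
 hence "norm a * norm (3 + (3 * a + a^2)) >= norm a * 2" by (intro mult_left_mono) auto
 moreover have "w^3 - 1 = a * (3 + (3 * a + a^2))"
  by (simp add: w power2_eq_square power3_eq_cube algebra_simps)
 ultimately show ?thesis by (simp add: norm_mult a_def)
qed

text \<open>Let w = exp(ze - ze'). Comparison with \<open>exp\<close> keeps the powers of w with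
  exponents 3^j within 1/4 of 1 for all j, whereas cubing at least doubles the distance to 1; hence
  w = 1.\<close>

lemma Psi_inj_near:
 assumes "con c d" "ze \<in> hp 10" "ze' \<in> hp 10" "Psi c d ze = Psi c d ze'"
 shows "exp (ze - ze') = 1"
proof -
 let ?w = "exp (ze - ze')"
 have 1: "norm (?w^(3^j) - 1) <= 1/4" for j
 proof -
  define e e' A where "e = exp (3^j * ze)" and "e' = exp (3^j * ze')" and "A = Psi c d (3^j * ze)"
  have h: "3^j * ze \<in> hp 10" "3^j * ze' \<in> hp 10" using assms hp_mult_pow3 by auto
  have h0: "ze \<in> hp 0" "ze' \<in> hp 0" using assms by (auto simp: hp_def)
  have A': "A = Psi c d (3^j * ze')"
   using Psi_iter[OF assms(1) h0(1)] Psi_iter[OF assms(1) h0(2)] assms(4) by (simp add: A_def)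
  have b: "norm (A - e) <= 1/10 * norm e" "norm (A - e') <= 1/10 * norm e'"
   using Psi_near[OF assms(1) h(1)] Psi_near[OF assms(1) h(2)] by (simp_all only: A_def e_def e'_def A'[unfolded A_def])
  have "norm e <= 11/9 * norm e'"
   using b norm_triangle_ineq2[of A e'] norm_triangle_ineq2[of e A] by (simp add: norm_minus_commute)
  moreover have "norm (e - e') <= norm (A - e) + norm (A - e')"
   using norm_triangle_ineq4[of "A - e'" "A - e"] by (simp add: add.commute)
  ultimately have "norm (e - e') <= 1/4 * norm e'"
   using b norm_ge_zero[of e'] by linarith
  moreover have e': "e' ~= 0" by (simp add: e'_def)
  moreover have "?w^(3^j) = e / e'"
   by (simp add: e_def e'_def exp_diff[symmetric] exp_of_nat_mult[symmetric] right_diff_distrib)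
  moreover have "e / e' - 1 = (e - e') / e'" using e' by (simp add: field_simps)
  ultimately show ?thesis by (simp add: norm_divide divide_le_eq)
 qed
 have 2: "2^j * norm (?w - 1) <= norm (?w^(3^j) - 1)" for j
 proof (induction j)
  case (Suc j)
  have "2 * norm (?w^(3^j) - 1) <= norm ((?w^(3^j))^3 - 1)"
   using cube_expand[OF 1] .
  also have "(?w^(3^j))^3 = ?w^(3^Suc j)" by (simp add: power_mult[symmetric] mult.commute)
  finally show ?case using Suc by simp
 qed auto
 have "?w = 1"
 proof (rule ccontr)
  assume "?w ~= 1"
  hence "norm (?w - 1) > 0" by simp
  then obtain j where "1 / norm (?w - 1) < 2^j" using real_arch_pow[of 2] by auto
  hence "1 < 2^j * norm (?w - 1)" using \<open>norm (?w - 1) > 0\<close> by (simp add: divide_less_eq)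
  thus False using 1[of j] 2[of j] by linarith
 qed
 thus ?thesis .
qed

lemma exp_eq_1_int:
 fixes z :: complex
 assumes "exp (x - y) = (1::complex)" obtains n :: int where "x = y + 2 * pi * \<i> * of_int n"
proof -
 from assms obtain n where n: "Re (x - y) = 0" "Im (x - y) = of_int (2 * n) * pi"
  unfolding exp_eq_1 by blast
 hence "x = y + 2 * pi * \<i> * of_int n" by (simp add: complex_eq_iff algebra_simps)
 thus ?thesis using that by blast
qed

text \<open>Tripling leads to the region near infinity, and the induction comes back: after one step
  back the two points differ by a multiple of a third of the period. Then \<open>Psi\<close> and its
  translate are lifts of the same map that agree at one point, hence also at the point 11, where
  injectivity is already known.\<close>

lemma Psi_inj:
 assumes con: "con c d" and "ze \<in> hp 0" "ze' \<in> hp 0" "Psi c d ze = Psi c d ze'"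
 obtains n :: int where "ze = ze' + 2 * pi * \<i> * of_int n"
proof -
 have "\<exists>n::int. ze = ze' + 2 * pi * \<i> * of_int n" if "3^k * ze \<in> hp 10" "3^k * ze' \<in> hp 10" for k
  using that assms(2-4)
 proof (induction k arbitrary: ze ze')
  case 0
  hence "exp (ze - ze') = 1" using Psi_inj_near[OF con] by simp
  thus ?case using exp_eq_1_int by blast
 next
  case (Suc k)
  have "Psi c d (3 * ze) = Psi c d (3 * ze')"
   using Psi_cub[OF con] Suc.prems by metis
  moreover have "3^k * (3 * ze) \<in> hp 10" "3^k * (3 * ze') \<in> hp 10"
   using Suc.prems by (simp_all add: mult_ac)
  ultimately obtain n :: int where n: "3 * ze = 3 * ze' + 2 * pi * \<i> * of_int n"
   using Suc.IH[of "3 * ze" "3 * ze'"] Suc.prems hp_mult3 by blast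
  define a where "a = - (2 * pi * \<i> * of_int n / 3)"
  have ze: "ze' = ze + a" using n by (simp add: a_def field_simps)
  have ha: "z + a \<in> hp s" if "z \<in> hp s" for z s using that by (simp add: hp_def a_def)
  have 3: "cub c d (Psi c d (z + a)) = Psi c d (3 * z)" if "z \<in> hp 0" for z
  proof -
   have "3 * (z + a) = 3 * z + 2 * pi * \<i> * of_int (- n)" by (simp add: a_def algebra_simps)
   thus ?thesis
    using Psi_cub[OF con ha[OF that]] Psi_period_int[OF con hp_mult3[OF that], of "- n"] by (simp only: order.refl)
  qed
  have "Psi c d 11 = Psi c d (11 + a)"
  proof (rule cub_lift_unique[of "hp 0" _ "%z. Psi c d (z + a)" c d ze])
   show "continuous_on (hp 0) (%z. Psi c d (z + a))"
    using holomorphic_on_shift[OF Psi_holomorphic[OF con] ha] holomorphic_on_imp_continuous_on by blast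
   show "cub c d (Psi c d z) = cub c d (Psi c d (z + a))" if "z \<in> hp 0" for z
    using 3[OF that] Psi_cub[OF con that] by simp
   show "cub c d (Psi c d z) ~= cub c d c & cub c d (Psi c d z) ~= cub c d d" if "z \<in> hp 0" for z
    using Psi_cub[OF con that] Psi_notin_fk[OF con hp_mult3[OF that]] con fk_cub unfolding con_def by auto
  qed (use Psi_continuous[OF con] Suc.prems ze in \<open>auto simp: hp_def\<close>)
  moreover have 11: "11 \<in> hp 10" by (simp add: hp_def)
  ultimately have "exp (11 - (11 + a)) = 1"
   using Psi_inj_near[OF con 11 ha[OF 11]] by simp
  then obtain m :: int where m: "11 = 11 + a + 2 * pi * \<i> * of_int m"
   using exp_eq_1_int by blast
  hence "ze = ze' + 2 * pi * \<i> * of_int m" unfolding ze by (simp add: add.assoc)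
  thus ?case by blast
 qed
 moreover obtain k where "3^k * ze \<in> hp 10" "3^k * ze' \<in> hp 10"
 proof -
  obtain k1 where k1: "3^k1 * ze \<in> hp 10" using Re_3k_large[of ze 10] assms by (auto simp: hp_def)
  obtain k2 where k2: "3^k2 * ze' \<in> hp 10" using Re_3k_large[of ze' 10] assms by (auto simp: hp_def)
  have "3^(k1 + k2) * ze \<in> hp 10" "3^(k1 + k2) * ze' \<in> hp 10"
   using hp_mult_pow3[OF k1, of k2] hp_mult_pow3[OF k2, of k1] by (simp_all add: power_add mult_ac)
  thus ?thesis using that by blast
 qed
 ultimately show ?thesis using that by blast
qed

text \<open>The three points \<open>t l\<close> have distinct images in a fibre of at most three
  elements, so they exhaust it.\<close>

lemma Psi_surj_step:
 assumes con: "con c d" and z: "cub c d z = Psi c d ze" and ze: "ze \<in> hp 0"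
 obtains ze' where "ze' \<in> hp 0" "Psi c d ze' = z" "3 * ze' = ze \<or> 3 * ze' = ze + 2 * pi * \<i> \<or> 3 * ze' = ze + 4 * pi * \<i>"
proof -
 define t where "t l = (ze + 2 * pi * \<i> * of_nat l) / 3" for l :: nat
 have t: "t l \<in> hp 0" for l using ze by (simp add: t_def hp_def)
 have ct: "cub c d (Psi c d (t l)) = Psi c d ze" for l
 proof -
  have "3 * t l = ze + 2 * pi * \<i> * of_nat l" by (simp add: t_def)
  thus ?thesis
   using Psi_cub[OF con t[of l]] Psi_period_nat[OF con ze, of l] by (simp only:)
 qed
 have inj: "inj_on (%l. Psi c d (t l)) {0,1,2}"
 proof (rule inj_onI)
  fix l m :: nat assume lm: "l \<in> {0,1,2}" "m \<in> {0,1,2}" "Psi c d (t l) = Psi c d (t m)"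
  obtain n :: int where "t l = t m + 2 * pi * \<i> * of_int n"
   using Psi_inj[OF con t t lm(3)] by blast
  hence "3 * t l = 3 * t m + 3 * (2 * pi * \<i> * of_int n)" by (simp add: algebra_simps)
  moreover have "3 * t k = ze + 2 * pi * \<i> * of_nat k" for k by (simp add: t_def)
  ultimately have "2 * pi * \<i> * of_nat l = 2 * pi * \<i> * (of_nat m + of_int (3 * n))"
   by (simp add: algebra_simps)
  hence "(of_nat l :: complex) = of_nat m + of_int (3 * n)" by simp
  hence "of_int (int l) = (of_int (int m + 3 * n) :: complex)" by simp
  hence "int l = int m + 3 * n" by (simp only: of_int_eq_iff)
  moreover have "l <= 2" "m <= 2" using lm(1,2) by auto
  ultimately show "l = m" by presburger
 qed
 let ?A = "{w. cub c d w = Psi c d ze}" and ?B = "(%l. Psi c d (t l)) ` {0,1,2}"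
 obtain r1 r2 r3 where r: "!!z. cub c d z - Psi c d ze = (z - r1) * (z - r2) * (z - r3)"
  using cub_roots by blast
 have "?A \<subseteq> {r1, r2, r3}"
 proof
  fix w assume "w \<in> ?A"
  hence "(w - r1) * (w - r2) * (w - r3) = 0" using r[of w] by simp
  thus "w \<in> {r1, r2, r3}" by simp
 qed
 hence "card ?A <= card {r1, r2, r3}" by (intro card_mono) auto
 also have "... <= 3" by (simp add: card_insert_if)
 also have "3 = card ?B" using card_image[OF inj] by simp
 finally have BA: "?B = ?A"
  using ct by (intro card_seteq finite_cub_vimage) auto
 have "z \<in> ?A" using z by simp
 hence "z \<in> ?B" unfolding BA .
 then obtain l where l: "l \<in> {0,1,2}" "Psi c d (t l) = z" by (elim imageE) simp
 hence "3 * t l = ze \<or> 3 * t l = ze + 2 * pi * \<i> \<or> 3 * t l = ze + 4 * pi * \<i>"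
  by (auto simp: t_def)
 thus ?thesis using that t l by blast
qed

lemma Psi_surj_large:
 assumes "con c d" "norm z > exp 11" obtains ze where "ze \<in> hp 10" "Psi c d ze = z"
proof -
 obtain P where P: "isPsi c d 10 P" "!!z. norm z > exp 11 ==> \<exists>ze\<in>hp 10. P ze = z"
  using isPsi_near_infinity[OF con_par[OF assms(1)]] by metis
 then obtain ze where ze: "ze \<in> hp 10" "P ze = z" using assms by blast
 hence "Psi c d ze = z" using Psi_eqI[OF assms(1) P(1) ze(1)] by (simp add: hp_def)
 with ze that show ?thesis by blast
qed

lemma Psi_surj:
 assumes con: "con c d" and "z \<notin> fk c d" obtains ze where "ze \<in> hp 0" "Psi c d ze = z"
proof -
 have "eventually (%n. norm ((cub c d ^^ n) z) > exp 11) sequentially"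
  using fk_unbounded[OF con_par[OF con] assms(2)] by (simp add: filterlim_at_top_dense)
 then obtain k where k: "norm ((cub c d ^^ k) z) > exp 11"
  by (auto simp: eventually_sequentially)
 have "\<exists>ze\<in>hp 0. Psi c d ze = z" if "norm ((cub c d ^^ k) z) > exp 11" for k
  using that
 proof (induction k arbitrary: z)
  case 0
  hence "norm z > exp 11" by simp
  then obtain ze where "ze \<in> hp 10" "Psi c d ze = z" using Psi_surj_large[OF con] by blast
  moreover from this have "ze \<in> hp 0" by (simp add: hp_def)
  ultimately show ?case by auto
 next
  case (Suc k)
  hence "norm ((cub c d ^^ k) (cub c d z)) > exp 11" by (simp add: funpow_swap1)
  then obtain ze where "ze \<in> hp 0" "Psi c d ze = cub c d z" using Suc.IH by blast
  thus ?case using Psi_surj_step[OF con, of z ze] by metis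
 qed
 with k that show ?thesis by blast
qed

section \<open>Bounds, boundary behaviour and parameter dependence of \<open>Psi\<close>\<close>

text \<open>If |z| exceeds 10, its orbit grows at least like the powers of |z| / 2 with exponents
  3^k and, near infinity, at most like those of exp(Re ze); extracting roots compares the bases. The
  bound does not involve the parameters, so all \<open>Psi\<close> together form a normal
  family.\<close>

lemma Psi_bound:
 assumes con: "con c d" and ze: "ze \<in> hp 0"
 shows "norm (Psi c d ze) <= max 10 (2 * exp (Re ze))"
proof (cases "norm (Psi c d ze) <= 10")
 case False
 let ?z = "Psi c d ze"
 obtain k where k: "3^k * ze \<in> hp 10" using Re_3k_large[of ze 10] ze unfolding hp_def by blast
 have "(norm ?z / 2)^(3^k) <= norm ((cub c d ^^ k) ?z) / 2"
  using cub_escape_iter[OF con_par[OF con], of ?z k] False by simp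
 also have "... = norm (Psi c d (3^k * ze)) / 2"
  by (simp add: Psi_iter[OF con ze])
 also have "... <= norm (exp (3^k * ze))"
  using Psi_near[OF con k] norm_triangle_ineq2[of "Psi c d (3^k * ze)" "exp (3^k * ze)"]
   norm_ge_zero[of "exp (3^k * ze)"] by linarith
 also have "exp (3^k * ze) = exp ze ^ (3^k)"
  by (simp flip: exp_of_nat_mult)
 also have "norm (exp ze ^ (3^k)) = exp (Re ze) ^ (3^k)"
  by (simp add: norm_power)
 finally have "norm ?z / 2 <= exp (Re ze)"
  by (rule power_le_imp_le_base[of _ "3^k - 1", simplified]) auto
 thus ?thesis by simp
qed auto

text \<open>For every fixed k the bound on the k-th iterate tends to 10 when the potential tends to
  0.\<close>

lemma Psi_boundary:
 assumes con: "con c d" and "!!n. ze n \<in> hp 0" "(%n. Re (ze n)) \<longlonglongrightarrow> 0" "(%n. Psi c d (ze n)) \<longlonglongrightarrow> z"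
 shows "z \<in> fk c d"
 unfolding fk_def
proof safe
 fix k
 have "(%n. norm ((cub c d ^^ k) (Psi c d (ze n)))) \<longlonglongrightarrow> norm ((cub c d ^^ k) z)"
  by (intro tendsto_intros assms)
 moreover have "(%n. max 10 (2 * exp (3^k * Re (ze n)))) \<longlonglongrightarrow> max 10 (2 * exp (3^k * 0))"
  by (intro tendsto_intros assms)
 moreover have "norm ((cub c d ^^ k) (Psi c d (ze n))) <= max 10 (2 * exp (3^k * Re (ze n)))" for n
 proof -
  have "norm (Psi c d (3^k * ze n)) <= max 10 (2 * exp (Re (3^k * ze n)))"
   by (intro Psi_bound con hp_mult_pow3 assms) simp
  moreover have "(3 :: complex)^k = of_real (3^k)" by simp
  hence "Re (3^k * ze n) = 3^k * Re (ze n)" by (simp only: times_complex.sel Re_complex_of_real Im_complex_of_real)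
  ultimately show ?thesis using Psi_iter[OF con assms(2)] by simp
 qed
 ultimately have "norm ((cub c d ^^ k) z) <= max 10 (2 * exp (3^k * 0))"
  by (intro LIMSEQ_le[of _ _ "%n. max 10 (2 * exp (3^k * Re (ze n)))"]) auto
 thus "norm ((cub c d ^^ k) z) <= 10" by simp
qed

text \<open>Normality and uniqueness: a sequence of bad parameters would have a limit function that
  satisfies all clauses of \<open>isPsi\<close> at \<open>c0\<close>, \<open>d0\<close>, hence
  equals \<open>Psi c0 d0\<close>.\<close>

lemma Psi_param_continuous:
 assumes con: "con c0 d0" and X: "compact X" "X \<subseteq> hp 0" and "eps > 0"
 obtains et where "et > 0" "!!c d ze. con c d ==> norm (c - c0) < et ==> norm (d - d0) < et ==> ze \<in> X
  ==> norm (Psi c d ze - Psi c0 d0 ze) < eps"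
proof -
 have "\<exists>et>0. \<forall>c d ze. con c d --> norm (c - c0) < et --> norm (d - d0) < et --> ze \<in> X
  --> norm (Psi c d ze - Psi c0 d0 ze) < eps"
 proof (rule ccontr)
  assume neg: "~ ?thesis"
  have "\<exists>c d ze. con c d & norm (c - c0) < inverse (real (Suc n)) & norm (d - d0) < inverse (real (Suc n)) & ze \<in> X
    & norm (Psi c d ze - Psi c0 d0 ze) >= eps" for n
   using neg by (metis inverse_positive_iff_positive not_le of_nat_0_less_iff zero_less_Suc)
  then obtain c d ze where cd: "!!n::nat. con (c n) (d n)" "!!n. norm (c n - c0) < inverse (real (Suc n))"
   "!!n. norm (d n - d0) < inverse (real (Suc n))" "!!n. ze n \<in> X"
   "!!n. norm (Psi (c n) (d n) (ze n) - Psi c0 d0 (ze n)) >= eps"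
   by metis
  have lim: "c \<longlonglongrightarrow> c0" "d \<longlonglongrightarrow> d0"
   by (rule LIM_zero_cancel, rule Lim_null_comparison[OF _ LIMSEQ_inverse_real_of_nat],
     use cd(2,3) less_imp_le in \<open>blast intro: always_eventually\<close>)+
  define H where "H = {Psi c d | c d. con c d}"
  obtain g r where g: "g holomorphic_on hp 0" "strict_mono (r :: nat => nat)"
   "!!x. x \<in> hp 0 ==> ((%n. Psi (c (r n)) (d (r n)) x) \<longlonglongrightarrow> g x)"
   "!!K. compact K ==> K \<subseteq> hp 0 ==> uniform_limit K ((%n. Psi (c n) (d n)) \<circ> r) g sequentially"
  proof (rule Montel[of "hp 0" H "%n. Psi (c n) (d n)"])
   show "h holomorphic_on hp 0" if "h \<in> H" for h
    using that Psi_holomorphic by (auto simp: H_def)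
   show "\<exists>B. \<forall>h\<in>H. \<forall>z\<in>K. norm (h z) <= B" if K: "compact K" "K \<subseteq> hp 0" for K
   proof -
    have "bounded (Re ` K)" using K(1)
     by (intro compact_imp_bounded compact_continuous_image continuous_intros)
    then obtain b where b: "!!z. z \<in> K ==> \<bar>Re z\<bar> <= b" by (auto simp: bounded_iff)
    have "norm (h z) <= max 10 (2 * exp b)" if "h \<in> H" "z \<in> K" for h z
    proof -
     have "norm (h z) <= max 10 (2 * exp (Re z))"
      using that K(2) Psi_bound by (auto simp: H_def)
     also have "... <= max 10 (2 * exp b)"
     proof (rule max.mono)
      have "exp (Re z) <= exp b" using b[OF that(2)] by simp
      thus "2 * exp (Re z) <= 2 * exp b" by simp
     qed simp
     finally show ?thesis .
    qed
    thus ?thesis by blast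
   qed
   show "range (%n. Psi (c n) (d n)) \<subseteq> H" using cd by (auto simp: H_def)
  qed auto
  have lim': "(%n. c (r n)) \<longlonglongrightarrow> c0" "(%n. d (r n)) \<longlonglongrightarrow> d0"
   using LIMSEQ_subseq_LIMSEQ[OF lim(1) g(2)] LIMSEQ_subseq_LIMSEQ[OF lim(2) g(2)] by (auto simp: o_def)
  have "isPsi c0 d0 0 g"
   unfolding isPsi_def
  proof (intro conjI ballI)
   fix z assume z: "z \<in> hp 0"
   have "(%n. cub (c (r n)) (d (r n)) (Psi (c (r n)) (d (r n)) z)) \<longlonglongrightarrow> cub c0 d0 (g z)"
    by (intro tendsto_intros lim' g z)
   hence "(%n. Psi (c (r n)) (d (r n)) (3 * z)) \<longlonglongrightarrow> cub c0 d0 (g z)"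
    using Psi_cub cd z by simp
   thus "cub c0 d0 (g z) = g (3 * z)"
    using g(3)[OF hp_mult3[OF z]] LIMSEQ_unique by auto
   have "(%n. Psi (c (r n)) (d (r n)) z) \<longlonglongrightarrow> g (z + 2 * pi * \<i>)"
    using g(3)[OF hp_period[OF z]] Psi_period cd z by simp
   thus "g (z + 2 * pi * \<i>) = g z" using g(3)[OF z] LIMSEQ_unique by blast
  next
   fix z assume "z \<in> hp (max 0 10)"
   hence z: "z \<in> hp 10" "z \<in> hp 0" by (auto simp: hp_def)
   have "(%n. norm (Psi (c (r n)) (d (r n)) z - exp z)) \<longlonglongrightarrow> norm (g z - exp z)"
    by (intro tendsto_intros g z)
   thus "norm (g z - exp z) <= 1/10 * norm (exp z)"
    by (rule LIMSEQ_le_const2) (use Psi_near cd z in blast)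
  qed (use g in auto)
  hence eq: "g z = Psi c0 d0 z" if "z \<in> hp 0" for z
   using Psi_eqI[OF con] that by blast
  have "uniform_limit X ((%n. Psi (c n) (d n)) \<circ> r) g sequentially"
   using g(4) X by blast
  hence "eventually (%n. \<forall>z\<in>X. dist (Psi (c (r n)) (d (r n)) z) (g z) < eps) sequentially"
   using \<open>eps > 0\<close> by (auto simp: uniform_limit_iff)
  then obtain n where "\<forall>z\<in>X. dist (Psi (c (r n)) (d (r n)) z) (g z) < eps"
   by (auto simp: eventually_sequentially)
  hence "dist (Psi (c (r n)) (d (r n)) (ze (r n))) (g (ze (r n))) < eps" using cd(4) by blast
  moreover have "g (ze (r n)) = Psi c0 d0 (ze (r n))" using eq X(2) cd(4) by blast
  ultimately show False
   using cd(5)[of "r n"] by (simp add: dist_norm)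
 qed
 thus ?thesis using that by blast
qed

section \<open>Inverse branches and contraction at Misiurewicz parameters\<close>

definition PC :: "complex => complex => complex set" where
 "PC c d = {(cub c d ^^ Suc i) c | i. True} \<union> {(cub c d ^^ Suc i) d | i. True}"

lemma PC_crit: "(cub c d ^^ n) (cub c d c) \<in> PC c d" "(cub c d ^^ n) (cub c d d) \<in> PC c d"
 unfolding PC_def by (auto simp: funpow_swap1)

definition branch :: "complex => complex => nat => complex set => (complex => complex) => bool" where
 "branch c d n B g \<longleftrightarrow> g holomorphic_on B & (\<forall>y\<in>B. (cub c d ^^ n) (g y) = y)"

text \<open>One pull-back at a time: a branch of order n cannot take a critical value, since its
  n-th iterate would be a postcritical point of the ball. So the branch lifts through the cubic once
  more.\<close>

lemma branch_exists:
 assumes "ball x r \<inter> PC c d = {}" "(cub c d ^^ n) a \<in> ball x r"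
 obtains g where "branch c d n (ball x r) g" "g ((cub c d ^^ n) a) = a"
proof -
 have "\<exists>g. branch c d n (ball x r) g & g ((cub c d ^^ n) a) = a"
  using assms(2)
 proof (induction n arbitrary: a)
  case 0
  show ?case by (intro exI[of _ "%z. z"]) (auto simp: branch_def)
 next
  case (Suc n)
  define z0 where "z0 = (cub c d ^^ Suc n) a"
  have z0: "z0 \<in> ball x r" "z0 = (cub c d ^^ n) (cub c d a)"
   using Suc.prems by (simp_all add: z0_def funpow_swap1)
  then obtain g where g: "branch c d n (ball x r) g" "g z0 = cub c d a"
   using Suc.IH[of "cub c d a"] by auto
  have nc: "g z ~= cub c d c & g z ~= cub c d d" if "z \<in> ball x r" for z
  proof -
   have "(cub c d ^^ n) (g z) = z" using g that by (auto simp: branch_def)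
   thus ?thesis using assms(1) that PC_crit[where c=c and d=d and n=n] by (metis disjoint_iff)
  qed
  have ghol: "g holomorphic_on ball x r" using g by (simp add: branch_def)
  obtain G where G: "G holomorphic_on ball x r" "G z0 = a" "!!z. z \<in> ball x r ==> cub c d (G z) = g z"
   by (rule cub_lift[OF open_ball convex_ball z0(1) ghol nc g(2)[symmetric]]) blast+
  have "(cub c d ^^ Suc n) (G z) = z" if "z \<in> ball x r" for z
   using G(3)[OF that] g that by (simp add: funpow_swap1 branch_def)
  thus ?case using G unfolding branch_def z0_def by blast
 qed
 thus ?thesis using that by blast
qed

lemma branch_inverse: "branch c d n B g ==> z \<in> g ` B ==> g ((cub c d ^^ n) z) = z"
 by (auto simp: branch_def)

lemma branch_inj: "branch c d n B g ==> inj_on g B"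
 unfolding branch_def by (metis inj_onI)

lemma branch_open: "branch c d n B g ==> open B ==> open (g ` B)"
 using branch_inj open_mapping_thm3 by (auto simp: branch_def)

text \<open>Where the second branch takes values in the image of the first one, the first one
  inverts the iterate and both agree. This set is open, and the common value makes it
  nonempty.\<close>

lemma branch_unique:
 assumes g: "branch c d n (ball x r) g" and g': "branch c d n (ball x r) g'"
  and w: "w \<in> g ` ball x r" "w \<in> g' ` ball x r" and z: "z \<in> ball x r"
 shows "g z = g' z"
proof -
 let ?S = "ball x r \<inter> g' -` (g ` ball x r)"
 have hol: "g holomorphic_on ball x r" "g' holomorphic_on ball x r"
  using g g' by (simp_all add: branch_def)
 have S1: "open ?S"
  by (rule continuous_open_preimage[OF holomorphic_on_imp_continuous_on[OF hol(2)] open_ball branch_open[OF g open_ball]])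
 have S2: "?S ~= {}"
 proof -
  obtain y where "y \<in> ball x r" "w = g' y" using w(2) by (rule imageE)
  hence "y \<in> ?S" using w(1) by simp
  thus ?thesis unfolding ex_in_conv[symmetric] ..
 qed
 have S3: "g y = g' y" if "y \<in> ?S" for y
 proof -
  have "g ((cub c d ^^ n) (g' y)) = g' y" using branch_inverse[OF g, of "g' y"] that by blast
  moreover have "(cub c d ^^ n) (g' y) = y" using g' that by (simp add: branch_def)
  ultimately show ?thesis by simp
 qed
 show ?thesis
  by (rule analytic_continuation_open[OF S1 open_ball S2 connected_ball Int_lower1 hol S3 z])
qed

text \<open>The images of all branches are open, cover the preimage of the ball, and are equal or
  disjoint; a connected set cannot meet two of them.\<close>

lemma connected_in_branch:
 assumes disj: "ball x r \<inter> PC c d = {}" and g: "branch c d n (ball x r) g"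
  and C: "connected C" "(cub c d ^^ n) ` C \<subseteq> ball x r" "a \<in> C" "a \<in> g ` ball x r"
 shows "C \<subseteq> g ` ball x r"
proof (rule ccontr)
 assume neg: "~ ?thesis"
 let ?B = "ball x r"
 let ?U = "\<Union>{g' ` ?B | g'. branch c d n ?B g' & g' ` ?B \<inter> g ` ?B = {}}"
 have o: "open (g ` ?B)" by (rule branch_open[OF g open_ball])
 have o': "open ?U"
 proof (rule open_Union, rule ballI)
  fix T assume "T \<in> {g' ` ?B | g'. branch c d n ?B g' & g' ` ?B \<inter> g ` ?B = {}}"
  then obtain g' where "T = g' ` ?B" "branch c d n ?B g'" by blast
  thus "open T" using branch_open open_ball by blast
 qed
 have c1: "C \<subseteq> g ` ?B \<union> ?U"
 proof
  fix z assume z: "z \<in> C"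
  show "z \<in> g ` ?B \<union> ?U"
  proof (cases "z \<in> g ` ?B")
   case False
   have "(cub c d ^^ n) z \<in> ?B" using C z by blast
   then obtain g' where g': "branch c d n ?B g'" "g' ((cub c d ^^ n) z) = z"
    using branch_exists[OF disj] by blast
   have "g' ` ?B \<inter> g ` ?B = {}"
   proof (rule ccontr)
    assume "g' ` ?B \<inter> g ` ?B ~= {}"
    then obtain w where "w \<in> g ` ?B" "w \<in> g' ` ?B" by blast
    hence "g ((cub c d ^^ n) z) = z"
     using branch_unique[OF g g'(1)] \<open>(cub c d ^^ n) z \<in> ?B\<close> g'(2) by metis
    with False \<open>(cub c d ^^ n) z \<in> ?B\<close> show False by force
   qed
   moreover have "z \<in> g' ` ?B" using g'(2) \<open>(cub c d ^^ n) z \<in> ?B\<close> by force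
   ultimately show ?thesis using g'(1) by blast
  qed auto
 qed
 have c2: "g ` ?B \<inter> ?U \<inter> C = {}" by blast
 have c3: "g ` ?B \<inter> C ~= {}" using C(3,4) by blast
 obtain z where "z \<in> C" "z \<notin> g ` ?B" using neg by blast
 hence "z \<in> ?U" using subsetD[OF c1, of z] by (simp only: Un_iff simp_thms)
 hence "z \<in> ?U \<inter> C" using \<open>z \<in> C\<close> by (rule IntI)
 hence c4: "?U \<inter> C ~= {}" unfolding ex_in_conv[symmetric] ..
 have "U \<inter> C = {} \<or> V \<inter> C = {}" if "open U" "open V" "U \<inter> V \<inter> C = {}" "C \<subseteq> U \<union> V" for U V
  using connectedD[OF C(1) that] .
 from this[OF o o' c2 c1] show False using c3 c4 by argo
qed

text \<open>A value of modulus above 11 would be driven further out by the iterates and could not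
  return to the ball.\<close>

lemma branch_norm:
 assumes "par c d" "branch c d n (ball x r) g" "norm x <= 10" "r <= 1" "y \<in> ball x r"
 shows "norm (g y) <= 11"
proof (rule ccontr)
 assume "~ ?thesis"
 hence "norm ((cub c d ^^ n) (g y)) >= 2^n * norm (g y)" "norm (g y) > 11"
  using cub_escape_iter[OF assms(1), of "g y" n] by auto
 moreover have "1 * norm (g y) <= 2^n * norm (g y)" by (intro mult_right_mono) auto
 ultimately have "norm y > 11" using assms(2,5) by (auto simp: branch_def)
 moreover have "norm y <= norm x + dist x y" using norm_triangle_sub[of y x] by (simp add: dist_norm norm_minus_commute)
 ultimately show False using assms by auto
qed

section \<open>Normal families of iterates and of inverse branches\<close>

lemma branch_Montel:
 assumes "par c d" "norm x <= 10" "r <= 1" "!!k::nat. branch c d (n k) (ball x r) (g k)"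
 obtains G q where "G holomorphic_on ball x r" "strict_mono (q :: nat => nat)"
  "!!K. compact K ==> K \<subseteq> ball x r ==> uniform_limit K (%k. g (q k)) G sequentially"
proof (rule Montel[of "ball x r" "range g" g])
 show "!!h. h \<in> range g ==> h holomorphic_on ball x r"
  using assms(4) by (auto simp: branch_def)
 show "\<exists>B. \<forall>h\<in>range g. \<forall>z\<in>K. norm (h z) <= B" if "compact K" "K \<subseteq> ball x r" for K
  using branch_norm[OF assms(1) assms(4) assms(2,3)] that by (intro exI[of _ 11]) blast
qed (use that in \<open>auto simp: o_def\<close>)

lemma fk_Montel:
 assumes "open W" "W \<subseteq> fk c d"
 obtains G q where "G holomorphic_on W" "strict_mono (q :: nat => nat)"
  "!!K. compact K ==> K \<subseteq> W ==> uniform_limit K (%k. cub c d ^^ n (q k)) G sequentially"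
proof (rule Montel[of W "range (%n. cub c d ^^ n)" "%k. cub c d ^^ n k"])
 show "h holomorphic_on W" if "h \<in> range (%n. cub c d ^^ n)" for h
 proof -
  obtain n where "h = cub c d ^^ n" using \<open>h \<in> _\<close> by blast
  thus ?thesis using holomorphic_cub_funpow[of "%z. z" W, where c = c and d = d and n = n] by simp
 qed
 show "\<exists>B. \<forall>h\<in>range (%n. cub c d ^^ n). \<forall>z\<in>K. norm (h z) <= B" if "compact K" "K \<subseteq> W" for K
  using that assms(2) by (intro exI[of _ 10]) (auto simp: fk_def)
qed (use that assms in \<open>auto simp: o_def\<close>)

lemma uniform_limit_compose_tendsto:
 fixes f :: "nat => complex => complex"
 assumes "uniform_limit C f g sequentially" "continuous_on C g" "eventually (%k. y k \<in> C) sequentially"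
  "y \<longlonglongrightarrow> y0" "y0 \<in> C"
 shows "(%k. f k (y k)) \<longlonglongrightarrow> g y0"
proof (rule Lim_transform)
 show "(%k. g (y k)) \<longlonglongrightarrow> g y0"
  using continuous_on_tendsto_compose[OF assms(2,4,5,3)] .
 show "(%k. f k (y k) - g (y k)) \<longlonglongrightarrow> 0"
  unfolding tendsto_iff
 proof safe
  fix e :: real assume "e > 0"
  hence "eventually (%k. \<forall>x\<in>C. dist (f k x) (g x) < e) sequentially"
   using assms(1) by (auto simp: uniform_limit_iff)
  with assms(3) show "eventually (%k. dist (f k (y k) - g (y k)) 0 < e) sequentially"
   by eventually_elim (auto simp: dist_norm)
 qed
qed

lemma filterlim_ge_ident: "(!!n. n <= k n) ==> filterlim k at_top (sequentially :: nat filter)"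
 by (rule filterlim_at_top_mono[OF filterlim_ident]) simp

text \<open>If values tending to \<open>G x0\<close> were omitted by \<open>g k\<close> for
  infinitely many k, Hurwitz applied to the differences would leave G - G(x0) without zeros.\<close>

lemma Hurwitz_cover:
 fixes g :: "nat => complex => complex"
 assumes D: "open D" "connected D" and hol: "!!k. g k holomorphic_on D" "G holomorphic_on D"
  and ul: "!!K. compact K ==> K \<subseteq> D ==> uniform_limit K g G sequentially"
  and nc: "~ G constant_on D" and x0: "x0 \<in> D"
 obtains ro k0 where "ro > 0" "!!k. k >= k0 ==> ball (G x0) ro \<subseteq> g k ` D"
proof -
 have "\<exists>ro>0. \<exists>k0. \<forall>k\<ge>k0. ball (G x0) ro \<subseteq> g k ` D"
 proof (rule ccontr)
  assume neg: "~ ?thesis"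
  have "\<exists>k\<ge>n. \<exists>u. dist (G x0) u < inverse (real (Suc n)) & u \<notin> g k ` D" for n
  proof -
   have "inverse (real (Suc n)) > 0" by simp
   hence "~ (\<forall>k\<ge>n. ball (G x0) (inverse (real (Suc n))) \<subseteq> g k ` D)" using neg by blast
   thus ?thesis by (meson mem_ball subsetI)
  qed
  then obtain k u where k: "!!n. k n >= n" and u: "!!n. dist (G x0) (u n) < inverse (real (Suc n))" "!!n. u n \<notin> g (k n) ` D"
   by metis
  have klim: "filterlim k at_top sequentially"
   using k by (rule filterlim_ge_ident)
  have ulim: "u \<longlonglongrightarrow> G x0"
   by (rule LIM_zero_cancel, rule Lim_null_comparison[OF _ LIMSEQ_inverse_real_of_nat])
    (use u(1) less_imp_le in \<open>auto intro!: always_eventually simp: dist_norm norm_minus_commute\<close>)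
  have "G x0 - G x0 ~= 0"
  proof (rule Hurwitz_no_zeros[OF D, of "%n z. g (k n) z - u n" "%z. G z - G x0"])
   show "uniform_limit K (%n z. g (k n) z - u n) (%z. G z - G x0) sequentially" if "compact K" "K \<subseteq> D" for K
   proof (rule uniform_limit_minus)
    show "uniform_limit K (%n. g (k n)) G sequentially"
     using filterlim_compose[OF ul[OF that] klim] .
    show "uniform_limit K (%n z. u n) (%z. G x0) sequentially"
     using ulim by (auto simp: uniform_limit_iff tendsto_iff elim: eventually_mono)
   qed
   show "~ (%z. G z - G x0) constant_on D"
    using nc unfolding constant_on_def by (metis diff_add_cancel)
   show "g (k n) z - u n ~= 0" if "z \<in> D" for n z
    using u(2)[of n] imageI[OF that, of "g (k n)"] by auto
  qed (use hol x0 in \<open>auto intro!: holomorphic_intros\<close>)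
  thus False by simp
 qed
 thus ?thesis using that by blast
qed

text \<open>Each point of \<open>B\<close> is brought back to the ball by iterates of unbounded
  order, so its orbit does not escape.\<close>

lemma fk_of_cover:
 assumes "par c d" "!!k::nat. branch c d (n k) (ball x r) (g k)" "norm x <= 10" "r <= 1"
  "filterlim n at_top sequentially" "!!k. k >= k0 ==> B \<subseteq> g k ` ball x r"
 shows "B \<subseteq> fk c d"
proof
 fix z assume z: "z \<in> B"
 show "z \<in> fk c d"
 proof (rule fk_bounded_subseqI[OF assms(1,5), of k0 z 11])
  fix k assume "k >= k0"
  then obtain y where y: "y \<in> ball x r" "z = g k y" using assms(6) z by blast
  hence "(cub c d ^^ n k) z = y" using assms(2) by (simp add: branch_def)
  moreover have "norm y <= norm x + dist x y" using norm_triangle_sub[of y x] by (simp add: dist_norm norm_minus_commute)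
  ultimately show "norm ((cub c d ^^ n k) z) <= 11" using y assms by auto
 qed
qed

text \<open>The branches are chosen to take the iterates of \<open>z0\<close> back to
  \<open>z0\<close>. They undo the iterates on a fixed disc about \<open>z0\<close>, and the
  identity passes to the limit: a limit of iterates with a value off the postcritical set has a
  limit of inverse branches as a left inverse.\<close>

lemma branch_limit:
 assumes par: "par c d" and b: "norm b <= 10" "r <= 1" "ball b r \<inter> PC c d = {}"
  and n: "filterlim n at_top sequentially" and Om: "open Om" "z0 \<in> Om" and h: "continuous_on Om h" "h z0 \<in> ball b r"
  and ul: "!!K. compact K ==> K \<subseteq> Om ==> uniform_limit K (%k::nat. cub c d ^^ n k) h sequentially"
 obtains Ga ga N t where "Ga holomorphic_on ball b r" "filterlim N at_top sequentially"
  "!!k::nat. branch c d (N k) (ball b r) (ga k)"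
  "!!K. compact K ==> K \<subseteq> ball b r ==> uniform_limit K ga Ga sequentially"
  "t > 0" "ball z0 t \<subseteq> Om" "!!z. z \<in> ball z0 t ==> h z \<in> ball b r & Ga (h z) = z"
proof -
 \<comment> \<open>A third of the distance of \<open>h z0\<close> from the boundary of the ball: one
   part for the continuity of \<open>h\<close>, one for the convergence of the iterates, and one
   left over for the compact set \<open>C\<close>.\<close>
 define s where "s = (r - dist b (h z0)) / 3"
 have s: "s > 0" "dist b (h z0) = r - 3 * s" using h by (auto simp: s_def field_simps)
 have "isCont h z0" using h(1) Om continuous_on_eq_continuous_at by blast
 then obtain t1 where t1: "t1 > 0" "!!z. dist z z0 < t1 ==> dist (h z) (h z0) < s"
  using s(1) unfolding continuous_at_eps_delta by blast
 obtain t2 where t2: "t2 > 0" "cball z0 t2 \<subseteq> Om" using Om open_contains_cball by blast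
 define t where "t = min (t1/2) t2"
 have t: "t > 0" "cball z0 t \<subseteq> Om" "!!z. z \<in> cball z0 t ==> dist (h z) (h z0) < s"
  using t1 t2 by (auto simp: t_def dist_commute)
 have "uniform_limit (cball z0 t) (%k. cub c d ^^ n k) h sequentially" using ul t by auto
 hence "eventually (%k. \<forall>z\<in>cball z0 t. dist ((cub c d ^^ n k) z) (h z) < s) sequentially"
  using s by (auto simp: uniform_limit_iff)
 then obtain k1 where k1': "\<forall>k\<ge>k1. \<forall>z\<in>cball z0 t. dist ((cub c d ^^ n k) z) (h z) < s"
  unfolding eventually_sequentially by blast
 have k1: "dist ((cub c d ^^ n k) z) (h z) < s" if "k >= k1" "z \<in> cball z0 t" for k z
  using k1' that by blast
 define C where "C = cball b (r - s)"
 have C: "compact C" "C \<subseteq> ball b r" using s by (auto simp: C_def)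
 have inC: "(cub c d ^^ n k) z \<in> C" if "k >= k1" "z \<in> cball z0 t" for k z
 proof -
  have "dist b ((cub c d ^^ n k) z) <= dist b (h z0) + dist (h z0) (h z) + dist (h z) ((cub c d ^^ n k) z)"
   using dist_triangle[of b "(cub c d ^^ n k) z" "h z0"] dist_triangle[of "h z0" "(cub c d ^^ n k) z" "h z"] by linarith
  thus ?thesis using k1[OF that] t(3)[OF that(2)] s by (simp add: C_def dist_commute)
 qed
 have hC: "h z \<in> C" if "z \<in> cball z0 t" for z
 proof -
  have "dist b (h z) <= dist b (h z0) + dist (h z0) (h z)" by (rule dist_triangle)
  thus ?thesis using t(3)[OF that] s by (simp add: C_def dist_commute)
 qed
 have "\<exists>g. branch c d (n (k + k1)) (ball b r) g & g ((cub c d ^^ n (k + k1)) z0) = z0" for k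
 proof -
  have "(cub c d ^^ n (k + k1)) z0 \<in> ball b r" using inC[of "k + k1" z0] t(1) C(2) by auto
  from branch_exists[OF b(3) this] show ?thesis by blast
 qed
 then obtain g where g: "!!k. branch c d (n (k + k1)) (ball b r) (g k)" "!!k. g k ((cub c d ^^ n (k + k1)) z0) = z0"
  by metis
 obtain Ga q where G: "Ga holomorphic_on ball b r" "strict_mono (q :: nat => nat)"
  "!!K. compact K ==> K \<subseteq> ball b r ==> uniform_limit K (%k. g (q k)) Ga sequentially"
  by (rule branch_Montel[where n = "%k. n (k + k1)" and g = g, OF par b(1,2) g(1)]) blast
 define N where "N k = n (q k + k1)" for k
 have qlim: "filterlim (%k. q k + k1) at_top sequentially"
  using filterlim_at_top_mono[OF filterlim_subseq[OF G(2)]] by auto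
 have N: "filterlim N at_top sequentially"
  unfolding N_def using filterlim_compose[OF n qlim] .
 have br: "branch c d (N k) (ball b r) (g (q k))" for k using g(1) by (simp add: N_def)
 have inv: "g (q k) ((cub c d ^^ N k) z) = z" if "z \<in> ball z0 t" for k z
 proof (rule analytic_continuation_open[of "ball z0 t \<inter> g (q k) ` ball b r" "ball z0 t" "%z. g (q k) ((cub c d ^^ N k) z)" "%z. z"])
  show "open (ball z0 t \<inter> g (q k) ` ball b r)" using branch_open[OF br] by auto
  have z0C: "(cub c d ^^ N k) z0 \<in> ball b r" using inC[of "q k + k1" z0] C t by (auto simp: N_def)
  hence "z0 \<in> g (q k) ` ball b r" using g(2)[of "q k"] unfolding N_def by (metis imageI)
  hence "z0 \<in> ball z0 t \<inter> g (q k) ` ball b r" using t(1) by simp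
  thus "ball z0 t \<inter> g (q k) ` ball b r ~= {}" by blast
  show "(%z. g (q k) ((cub c d ^^ N k) z)) holomorphic_on ball z0 t"
  proof -
   have "(g (q k) \<circ> (%z. (cub c d ^^ N k) z)) holomorphic_on ball z0 t"
   proof (rule holomorphic_on_compose_gen)
    show "(%z. (cub c d ^^ N k) z) holomorphic_on ball z0 t" by (intro holomorphic_intros)
    show "g (q k) holomorphic_on ball b r" using br by (simp add: branch_def)
    show "(%z. (cub c d ^^ N k) z) ` ball z0 t \<subseteq> ball b r"
     using inC[of "q k + k1"] C by (force simp: N_def)
   qed
   thus ?thesis by (simp add: o_def)
  qed
  show "g (q k) ((cub c d ^^ N k) y) = y" if "y \<in> ball z0 t \<inter> g (q k) ` ball b r" for y
   using branch_inverse[OF br] that by blast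
 qed (use that in \<open>auto intro: holomorphic_intros\<close>)
 have "Ga (h z) = z" if z: "z \<in> ball z0 t" for z
 proof -
  have zc: "z \<in> cball z0 t" using z by auto
  have "uniform_limit (cball z0 t) (%k. cub c d ^^ N k) h sequentially"
   unfolding N_def using filterlim_compose[OF ul[OF _ t(2)] qlim] by simp
  hence "(%k. (cub c d ^^ N k) z) \<longlonglongrightarrow> h z"
   by (rule tendsto_uniform_limitI) (rule zc)
  hence "(%k. g (q k) ((cub c d ^^ N k) z)) \<longlonglongrightarrow> Ga (h z)"
  proof (rule uniform_limit_compose_tendsto[where f = "%k. g (q k)" and g = Ga and C = C, rotated 3])
   show "uniform_limit C (%k. g (q k)) Ga sequentially" using G(3) C by blast
   show "continuous_on C Ga" using G(1) C holomorphic_on_imp_continuous_on continuous_on_subset by blast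
   show "\<forall>\<^sub>F k in sequentially. (cub c d ^^ N k) z \<in> C" using inC zc by (auto simp: N_def)
  qed (use hC zc in auto)
  thus ?thesis using inv[OF z] by (simp add: LIMSEQ_const_iff)
 qed
 moreover have "h z \<in> ball b r" if "z \<in> ball z0 t" for z using hC[of z] C that by auto
 ultimately have *: "h z \<in> ball b r & Ga (h z) = z" if "z \<in> ball z0 t" for z using that by blast
 have "ball z0 t \<subseteq> Om" using t(2) by auto
 from that[OF G(1) N br G(3) t(1) this *] show ?thesis by blast
qed

lemma nonconstant_inverse:
 fixes t :: real and Ga :: "complex => complex"
 assumes "t > 0" "!!z. z \<in> ball z0 t ==> h z \<in> S & Ga (h z) = z"
 shows "~ Ga constant_on S"
proof
 assume "Ga constant_on S"
 then obtain a where a: "!!x. x \<in> S ==> Ga x = a" by (auto simp: constant_on_def)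
 have "z0 + of_real (t/2) \<in> ball z0 t" "z0 \<in> ball z0 t" using assms(1) by (auto simp: dist_norm)
 from assms(2)[OF this(1)] assms(2)[OF this(2)] have "z0 + of_real (t/2) = z0" using a by metis
 thus False using assms(1) by simp
qed

text \<open>A nonconstant limit would make some iterates converge to the identity on a component
  \<open>W\<close> of the interior, as on a rotation domain. The boundary of \<open>W\<close> is
  infinite and so has a point outside the finite postcritical set. There the inverse branches also
  tend to the identity, which puts a disc about a boundary point into the filled Julia set.\<close>

lemma branch_limit_constant:
 assumes par: "par c d" and PC: "finite (PC c d)" and x: "norm x <= 10" "0 < r" "r <= 1" "ball x r \<inter> PC c d = {}"
  and n: "filterlim n at_top sequentially" and g: "!!k::nat. branch c d (n k) (ball x r) (g k)"
  and G: "G holomorphic_on ball x r"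
  and ul: "!!K. compact K ==> K \<subseteq> ball x r ==> uniform_limit K g G sequentially"
 shows "G constant_on ball x r"
proof (rule ccontr)
 assume nc: "~ G constant_on ball x r"
 let ?F = "%n. cub c d ^^ n"
 have xD: "x \<in> ball x r" using x by simp
 have ghol: "g k holomorphic_on ball x r" for k using g by (simp add: branch_def)
 \<comment> \<open>A disc covered by branches of all large orders lies in the filled Julia set, so
   the iterates are a normal family on it.\<close>
 obtain ro k0 where ro: "ro > 0" "!!k. k >= k0 ==> ball (G x) ro \<subseteq> g k ` ball x r"
  by (rule Hurwitz_cover[OF open_ball connected_ball ghol G ul nc xD]) blast+
 define V where "V = ball (G x) ro"
 have V: "V \<subseteq> fk c d" unfolding V_def by (rule fk_of_cover[OF par g x(1,3) n ro(2)])
 obtain h r1 where h: "h holomorphic_on V" "strict_mono (r1 :: nat => nat)"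
  "!!K. compact K ==> K \<subseteq> V ==> uniform_limit K (%k. ?F (n (r1 k))) h sequentially"
  by (rule fk_Montel[OF _ V, of n]) (auto simp: V_def)
 define N where "N k = n (r1 k)" for k
 have N: "filterlim N at_top sequentially"
  unfolding N_def using filterlim_compose[OF n filterlim_subseq[OF h(2)]] .
 define C where "C = cball (G x) (ro/2)"
 have C: "compact C" "C \<subseteq> V" using ro(1) by (auto simp: C_def V_def)
 have contG: "continuous_on (ball x r) G" using G holomorphic_on_imp_continuous_on by blast
 hence "isCont G x" using xD continuous_on_eq_continuous_at open_ball by blast
 then obtain s1 where s1: "s1 > 0" "!!y. dist y x < s1 ==> dist (G y) (G x) < ro/2"
  using ro(1) unfolding continuous_at_eps_delta by (meson half_gt_zero)
 define s where "s = min s1 r"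
 have s: "s > 0" "s <= r" "!!y. y \<in> ball x s ==> dist (G y) (G x) < ro/2"
  using s1 x by (auto simp: s_def dist_commute)
 have gG: "(%k. g k y) \<longlonglongrightarrow> G y" if "y \<in> ball x r" for y
  using tendsto_uniform_limitI[OF ul[of "{y}"]] that by auto
 have evC: "eventually (%k. g k y \<in> C) sequentially" if "y \<in> ball x s" for y
 proof -
  have "eventually (%k. dist (g k y) (G x) < ro/2) sequentially"
   using gG[of y] s(2) s(3)[OF that] that
   by (intro order_tendstoD(2)[OF tendsto_dist[OF _ tendsto_const, of _ "G y"]]) auto
  thus ?thesis by eventually_elim (auto simp: C_def dist_commute)
 qed
 have GC: "G y \<in> C" if "y \<in> ball x s" for y using s(3)[OF that] by (auto simp: C_def dist_commute)
 have conth: "continuous_on C h" using h(1) C holomorphic_on_imp_continuous_on continuous_on_subset by blast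
 have ulh: "uniform_limit C (%k. ?F (N k)) h sequentially" using h(3) C by (simp add: N_def)
 have xfk: "ball x s \<subseteq> fk c d"
 proof
  fix y assume y: "y \<in> ball x s"
  then obtain k where "g k y \<in> C" using evC[OF y] by (auto simp: eventually_sequentially)
  hence "g k y \<in> fk c d" using C V by blast
  hence "?F (n k) (g k y) \<in> fk c d" by (rule fk_funpow)
  moreover have "?F (n k) (g k y) = y" using g y s(2) by (auto simp: branch_def)
  ultimately show "y \<in> fk c d" by simp
 qed
 have hG: "(%k. ?F (N (a k)) (g (r1 (b k)) y)) \<longlonglongrightarrow> h (G y)"
  if "y \<in> ball x s" "filterlim a at_top sequentially" "filterlim b at_top sequentially" for y a b
 proof (rule uniform_limit_compose_tendsto[where f = "%k. ?F (N (a k))" and g = h and C = C])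
  have rb: "filterlim (%k. r1 (b k)) at_top sequentially"
   using filterlim_compose[OF filterlim_subseq[OF h(2)] that(3)] .
  show "uniform_limit C (%k. ?F (N (a k))) h sequentially" by (rule filterlim_compose[OF ulh that(2)])
  show "\<forall>\<^sub>F k in sequentially. g (r1 (b k)) y \<in> C"
   by (rule eventually_compose_filterlim[OF evC[OF that(1)] rb])
  show "(%k. g (r1 (b k)) y) \<longlonglongrightarrow> G y"
   using filterlim_compose[OF gG rb, of y] that(1) s(2) by auto
 qed (use conth GC that in auto)
 have hGy: "h (G y) = y" if "y \<in> ball x s" for y
 proof -
  have "?F (N k) (g (r1 k) y) = y" for k using g that s(2) by (auto simp: branch_def N_def)
  thus ?thesis using hG[OF that filterlim_ident filterlim_ident] by (simp add: LIMSEQ_const_iff)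
 qed
 \<comment> \<open>Differences of the return times that still tend to infinity; the corresponding
   iterates converge to the identity near \<open>x\<close>.\<close>
 have "\<exists>b\<ge>a. N b >= N a + a" for a
 proof -
  have "eventually (%b. N b >= N a + a) sequentially" using N by (simp add: filterlim_at_top)
  then obtain b0 where "!!b. b >= b0 ==> N b >= N a + a" by (auto simp: eventually_sequentially)
  thus ?thesis by (intro exI[of _ "max a b0"]) auto
 qed
 then obtain q where q: "!!a. q a >= a" "!!a. N (q a) >= N a + a" by metis
 define m where "m a = N (q a) - N a" for a
 have m: "filterlim m at_top sequentially"
 proof (rule filterlim_ge_ident)
  show "a <= m a" for a using q(2)[of a] by (simp add: m_def)
 qed
 have qlim: "filterlim q at_top sequentially"
  using q(1) by (rule filterlim_ge_ident)
 have Fm: "(%a. ?F (m a) y) \<longlonglongrightarrow> y" if "y \<in> ball x s" for y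
 proof -
  have "?F (m a) y = ?F (N (q a)) (g (r1 a) y)" for a
  proof -
   have "?F (N a) (g (r1 a) y) = y" using g that s(2) by (auto simp: branch_def N_def)
   moreover have "N (q a) = m a + N a" using q(2)[of a] by (simp add: m_def)
   ultimately show ?thesis by (simp add: funpow_add)
  qed
  thus ?thesis using hG[OF that qlim filterlim_ident] hGy[OF that] by simp
 qed
 define W where "W = connected_component_set (interior (fk c d)) x"
 have xint: "x \<in> interior (fk c d)" using xfk s(1) by (auto simp: mem_interior)
 have W: "open W" "connected W" "x \<in> W" "W \<subseteq> fk c d"
  using xint interior_subset connected_component_subset[of "interior (fk c d)" x] unfolding W_def
  by (auto simp: open_connected_component connected_component_refl_eq)
 have Wmax: "T \<subseteq> W" if T: "connected T" "T \<subseteq> interior (fk c d)" "T \<inter> W ~= {}" for T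
 proof -
  obtain y where y: "y \<in> T" "y \<in> W" using T by blast
  hence "connected_component_set (interior (fk c d)) y = W"
   unfolding W_def using connected_component_eq by metis
  thus ?thesis using connected_component_maximal[OF y(1) T(1,2)] by simp
 qed
 obtain E r2 where E: "E holomorphic_on W" "strict_mono (r2 :: nat => nat)"
  "!!K. compact K ==> K \<subseteq> W ==> uniform_limit K (%k. ?F (m (r2 k))) E sequentially"
  by (rule fk_Montel[OF W(1,4), of m]) blast
 have sub: "ball x s \<subseteq> W"
 proof (rule Wmax)
  have "x \<in> ball x s \<inter> W" using s(1) W(3) by simp
  thus "ball x s \<inter> W ~= {}" by blast
 qed (use xfk in \<open>auto simp: interior_maximal\<close>)
 have Eid: "E z = z" if "z \<in> W" for z
 proof (rule analytic_continuation_open[of "ball x s" W E "%z. z"])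
  show "E y = y" if "y \<in> ball x s" for y
  proof -
   have "(%k. ?F (m (r2 k)) y) \<longlonglongrightarrow> E y"
    using tendsto_uniform_limitI[OF E(3)[of "{y}"]] sub that by auto
   moreover have "(%k. ?F (m (r2 k)) y) \<longlonglongrightarrow> y"
    using filterlim_compose[OF Fm[OF that] filterlim_subseq[OF E(2)]] .
   ultimately show ?thesis using LIMSEQ_unique by blast
  qed
 qed (use W E sub s that in \<open>auto intro: holomorphic_intros\<close>)
 \<comment> \<open>Removing a finite boundary would not disconnect the plane, but \<open>W\<close>
   has to be separated from the point 20, which escapes.\<close>
 obtain b where b: "b \<in> frontier W" "b \<notin> PC c d"
 proof (rule ccontr)
  assume "~ thesis"
  hence "frontier W \<subseteq> PC c d" using that by blast
  hence fin: "finite (frontier W)" using PC finite_subset by blast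
  have "connected (UNIV - frontier W)"
   using connected_open_delete_finite[of UNIV "frontier W"] fin connected_UNIV by auto
  moreover have "(UNIV - frontier W) \<inter> W ~= {}" using W by (auto simp: frontier_def interior_open)
  moreover have "20 \<notin> closure W"
  proof
   assume "20 \<in> closure W"
   hence "20 \<in> fk c d" using W(4) closed_fk closure_minimal by blast
   thus False using fk_bounded by fastforce
  qed
  hence "20 \<in> (UNIV - frontier W) - W"
   using subsetD[OF closure_subset[of W], of 20] by (auto simp: frontier_def)
  hence "(UNIV - frontier W) - W ~= {}" unfolding ex_in_conv[symmetric] ..
  ultimately have "(UNIV - frontier W) \<inter> frontier W ~= {}" by (intro connected_Int_frontier)
  thus False by blast
 qed
 have bfk: "b \<in> fk c d" using b(1) closure_minimal[OF W(4) closed_fk] unfolding frontier_def by blast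
 have "open (- PC c d)" using PC by (simp add: finite_imp_closed open_Compl)
 then obtain e where e: "e > 0" "ball b e \<subseteq> - PC c d" using b(2) open_contains_ball by blast
 define r3 where "r3 = min e 1"
 have r3: "r3 > 0" "r3 <= 1" "ball b r3 \<inter> PC c d = {}" using e by (auto simp: r3_def)
 have "b \<in> closure W" using b by (simp add: frontier_def)
 then obtain z0 where z0: "z0 \<in> W" "z0 \<in> ball b r3"
  using r3(1) by (auto simp: closure_approachable dist_commute)
 have mr: "filterlim (%k. m (r2 k)) at_top sequentially"
  using filterlim_compose[OF m filterlim_subseq[OF E(2)]] .
 have contE: "continuous_on W E" using E(1) holomorphic_on_imp_continuous_on by blast
 have Ez0: "E z0 \<in> ball b r3" using Eid z0 by simp
 obtain Ga ga M t where L: "Ga holomorphic_on ball b r3" "filterlim M at_top sequentially"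
  "!!k::nat. branch c d (M k) (ball b r3) (ga k)"
  "!!K. compact K ==> K \<subseteq> ball b r3 ==> uniform_limit K ga Ga sequentially"
  "t > 0" "ball z0 t \<subseteq> W" "!!z. z \<in> ball z0 t ==> E z \<in> ball b r3 & Ga (E z) = z"
  by (rule branch_limit[OF par fk_bounded[OF bfk] r3(2,3) mr W(1) z0(1) contE Ez0 E(3)]) blast+
 have Gid: "Ga z = z" if "z \<in> ball b r3" for z
 proof (rule analytic_continuation_open[of "ball z0 t" "ball b r3" Ga "%z. z"])
  show "ball z0 t \<subseteq> ball b r3" using L(6,7) Eid by fastforce
  show "Ga z = z" if "z \<in> ball z0 t" for z using L(6) L(7)[OF that] Eid that by auto
 qed (use L that in \<open>auto intro: holomorphic_intros\<close>)
 have bb: "b \<in> ball b r3" using r3 by simp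
 obtain ro' k1 where ro': "ro' > 0" "!!k. k >= k1 ==> ball (Ga b) ro' \<subseteq> ga k ` ball b r3"
 proof (rule Hurwitz_cover[OF open_ball connected_ball _ L(1,4) _ bb])
  show "ga k holomorphic_on ball b r3" for k using L(3) by (simp add: branch_def)
  show "~ Ga constant_on ball b r3" using nonconstant_inverse[OF L(5,7)] by blast
 qed blast+
 have "ball b ro' \<subseteq> fk c d"
  using fk_of_cover[OF par L(3) fk_bounded[OF bfk] r3(2) L(2) ro'(2)] Gid[OF bb] by simp
 hence bi: "ball b ro' \<subseteq> interior (fk c d)" by (simp add: interior_maximal)
 obtain w where "w \<in> W" "dist w b < ro'" using \<open>b \<in> closure W\<close> ro'(1) unfolding closure_approachable by blast
 hence "w \<in> ball b ro' \<inter> W" by (simp add: dist_commute)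
 hence "ball b ro' \<inter> W ~= {}" by blast
 from Wmax[OF connected_ball bi this] have "b \<in> W" using ro'(1) centre_in_ball[of b ro'] by blast
 thus False using b(1) W(1) by (simp add: frontier_def interior_open)
qed

text \<open>Both critical points are eventually mapped to the fixed point 0, whose multiplier is 3cd.\<close>

definition mis :: "complex => complex => bool" where
 "mis c d \<longleftrightarrow> par c d & (\<exists>m. (cub c d ^^ m) c = 0) & (\<exists>m. (cub c d ^^ m) d = 0) & norm (3 * c * d) > 1"

lemma mis_commute: "mis c d \<longleftrightarrow> mis d c"
 unfolding mis_def by (auto simp: cub_commute[of d c] par_commute[of d c] mult_ac)

lemma mis_par: "mis c d ==> par c d"
 by (simp add: mis_def)

lemma mis_con: "mis c d ==> con c d"
 unfolding mis_def con_def using fk_funpow_iff zero_in_fk by metis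

lemma funpow_zero_ge: "(cub c d ^^ m) z = 0 ==> m <= n ==> (cub c d ^^ n) z = 0"
 using funpow_add[of "n - m" m "cub c d"] by (auto simp: o_def)

lemma mis_PC:
 assumes "mis c d"
 obtains m where "finite (PC c d)" "!!q. q \<in> PC c d ==> (cub c d ^^ m) q = 0" "PC c d \<subseteq> fk c d"
proof -
 obtain m1 m2 where m: "(cub c d ^^ m1) c = 0" "(cub c d ^^ m2) d = 0"
  using assms by (auto simp: mis_def)
 define m where "m = max m1 m2"
 have m0: "(cub c d ^^ n) c = 0" "(cub c d ^^ n) d = 0" if "n >= m" for n
  using m that funpow_zero_ge by (auto simp: m_def)
 have fin: "PC c d \<subseteq> (%i. (cub c d ^^ i) c) ` {..Suc m} \<union> (%i. (cub c d ^^ i) d) ` {..Suc m}"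
 proof
  fix q assume "q \<in> PC c d"
  then obtain i where i: "q = (cub c d ^^ Suc i) c \<or> q = (cub c d ^^ Suc i) d" by (auto simp: PC_def)
  show "q \<in> (%i. (cub c d ^^ i) c) ` {..Suc m} \<union> (%i. (cub c d ^^ i) d) ` {..Suc m}"
  proof (cases "i <= m")
   case False
   hence "q = (cub c d ^^ m) c" using i m0[of "Suc i"] m0[of m] by auto
   thus ?thesis by auto
  next
   case True
   hence "Suc i \<in> {..Suc m}" by simp
   thus ?thesis using i by blast
  qed
 qed
 have z: "(cub c d ^^ m) ((cub c d ^^ i) w) = (cub c d ^^ (m + i)) w" for i w by (simp add: funpow_add)
 show ?thesis
 proof
  show "finite (PC c d)" using fin by (rule finite_subset) auto
  show "(cub c d ^^ m) q = 0" if "q \<in> PC c d" for q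
   using that unfolding PC_def by (auto simp only: mem_Collect_eq Un_iff z intro!: m0)
  show "PC c d \<subseteq> fk c d"
   using mis_con[OF assms] fk_funpow unfolding PC_def con_def by blast
 qed
qed

section \<open>Repulsion at 0 and empty interior\<close>

lemma cub_repelling:
 assumes "norm (3 * c * d) > 1"
 obtains r \<mu> where "r > 0" "\<mu> > 1" "!!z. norm z < r ==> norm (cub c d z) >= \<mu> * norm z"
proof -
 define \<mu> where "\<mu> = (1 + norm (3 * c * d)) / 2"
 have mu: "\<mu> > 1" "\<mu> < norm (cubq c d 0 0)" using assms by (auto simp: \<mu>_def cubq_same)
 have "((%z. norm (cubq c d z 0)) \<longlongrightarrow> norm (cubq c d 0 0)) (nhds 0)"
  by (intro tendsto_intros filterlim_ident)
 hence "eventually (%z. norm (cubq c d z 0) > \<mu>) (nhds 0)"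
  using mu(2) order_tendstoD(1) by blast
 then obtain r where r: "r > 0" "!!z. dist z 0 < r ==> norm (cubq c d z 0) > \<mu>"
  unfolding eventually_nhds_metric by blast
 have "norm (cub c d z) >= \<mu> * norm z" if "norm z < r" for z
 proof -
  have "norm (cub c d z) = norm z * norm (cubq c d z 0)"
   using cub_diff[of c d z 0] by (simp add: norm_mult)
  moreover have "\<mu> <= norm (cubq c d z 0)" using r(2)[of z] that by simp
  ultimately show ?thesis using mult_right_mono[of \<mu> "norm (cubq c d z 0)" "norm z"] by (simp add: mult.commute)
 qed
 thus ?thesis using that r(1) mu(1) by blast
qed

text \<open>Near the repelling fixed point the modulus grows by a fixed factor, so an orbit tends to
  0 only by reaching it.\<close>

lemma orbit_not_to_0:
 assumes rep: "norm (3 * c * d) > 1" and lim: "(%n. (cub c d ^^ n) u) \<longlonglongrightarrow> 0"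
 obtains n where "(cub c d ^^ n) u = 0"
proof -
 obtain r \<mu> where r: "r > 0" "\<mu> > 1" "!!z. norm z < r ==> norm (cub c d z) >= \<mu> * norm z"
  using cub_repelling[OF rep] by blast
 have "eventually (%n. norm ((cub c d ^^ n) u) < r) sequentially"
  using lim r(1) by (auto dest!: tendstoD simp: dist_norm)
 then obtain N where N: "!!n. n >= N ==> norm ((cub c d ^^ n) u) < r"
  by (auto simp: eventually_sequentially)
 have grow: "\<mu>^k * norm ((cub c d ^^ N) u) <= norm ((cub c d ^^ (N + k)) u)" for k
 proof (induction k)
  case (Suc k)
  have "\<mu>^Suc k * norm ((cub c d ^^ N) u) <= \<mu> * norm ((cub c d ^^ (N + k)) u)"
   using Suc r(2) by (simp add: mult.assoc)
  also have "... <= norm (cub c d ((cub c d ^^ (N + k)) u))" using r(3) N by simp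
  finally show ?case by simp
 qed auto
 have "(cub c d ^^ N) u = 0"
 proof (rule ccontr)
  assume "(cub c d ^^ N) u ~= 0"
  hence pos: "norm ((cub c d ^^ N) u) > 0" by simp
  obtain k where "r / norm ((cub c d ^^ N) u) < \<mu>^k" using real_arch_pow[OF r(2)] by blast
  hence "r < \<mu>^k * norm ((cub c d ^^ N) u)" using pos by (simp add: divide_less_eq)
  thus False using grow[of k] N[of "N + k"] by simp
 qed
 thus ?thesis using that by blast
qed

text \<open>An interior point outside the countable set of preimages of 0 returns to a definite
  distance from 0 infinitely often. Going back \<open>m\<close> steps from such times yields a limit
  point outside the postcritical set; there the limit of branches from \<open>branch_limit\<close>
  has a right inverse, against \<open>branch_limit_constant\<close>.\<close>

lemma interior_fk_empty:
 assumes mis: "mis c d" shows "interior (fk c d) = {}"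
proof (rule ccontr)
 assume ne: "interior (fk c d) ~= {}"
 let ?U = "interior (fk c d)" and ?F = "%n. cub c d ^^ n"
 note par = mis_par[OF mis]
 obtain m where m: "finite (PC c d)" "!!q. q \<in> PC c d ==> ?F m q = 0" "PC c d \<subseteq> fk c d"
  using mis_PC[OF mis] by blast
 have "countable (\<Union>n. {z. ?F n z = 0})"
  using finite_funpow_cub_vimage by (intro countable_UN) (auto intro: countable_finite)
 moreover have "uncountable ?U"
 proof -
  obtain z where "z \<in> ?U" using ne by blast
  then obtain e where "e > 0" "ball z e \<subseteq> ?U" using open_contains_ball open_interior by blast
  thus ?thesis using uncountable_ball countable_subset by blast
 qed
 ultimately obtain u where u: "u \<in> ?U" "!!n. ?F n u ~= 0"
 proof -
  assume c: "countable (\<Union>n. {z. ?F n z = 0})" and nc: "uncountable ?U"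
  hence "~ ?U \<subseteq> (\<Union>n. {z. ?F n z = 0})" using countable_subset by blast
  thus ?thesis using that by blast
 qed
 have ufk: "?F n u \<in> fk c d" for n using u(1) interior_subset fk_funpow by blast
 have "~ (%n. ?F n u) \<longlonglongrightarrow> 0"
  using orbit_not_to_0[of c d u] mis u(2) by (auto simp: mis_def)
 then obtain e where e: "e > 0" "~ eventually (%n. norm (?F n u) < e) sequentially"
  unfolding tendsto_iff by (auto simp: dist_norm)
 \<comment> \<open>The additional m leaves room for going back m steps, while the reduced times
   still tend to infinity.\<close>
 hence "\<forall>k. \<exists>n\<ge>k + m. norm (?F n u) >= e"
  unfolding eventually_sequentially by (meson not_le)
 then obtain n where n: "!!k. n k >= k + m" "!!k. norm (?F (n k) u) >= e" by metis
 have "\<forall>k. ?F (n k - m) u \<in> fk c d" using ufk by blast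
 then obtain x q where x: "x \<in> fk c d" "strict_mono (q :: nat => nat)" "((%k. ?F (n k - m) u) \<circ> q) \<longlonglongrightarrow> x"
  using compact_fk[of c d] unfolding compact_def by metis
 define N where "N k = n (q k) - m" for k
 have NF: "(%k. ?F (N k) u) \<longlonglongrightarrow> x" using x(3) by (simp add: o_def N_def)
 have N: "filterlim N at_top sequentially"
 proof (rule filterlim_ge_ident)
  show "k <= N k" for k using n(1)[of "q k"] seq_suble[OF x(2), of k] by (simp add: N_def)
 qed
 have "x \<notin> PC c d"
 proof
  assume "x \<in> PC c d"
  hence "?F m x = 0" by (rule m)
  moreover have "(%k. norm (?F m (?F (N k) u))) \<longlonglongrightarrow> norm (?F m x)" by (intro tendsto_intros NF)
  moreover have "norm (?F m (?F (N k) u)) >= e" for k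
  proof -
   have "m + N k = n (q k)" using n(1)[of "q k"] by (simp add: N_def)
   hence "?F m (?F (N k) u) = ?F (n (q k)) u" by (metis funpow_add o_apply)
   thus ?thesis using n(2) by simp
  qed
  ultimately have "e <= 0" using LIMSEQ_le_const[of "%k. norm (?F m (?F (N k) u))"] by force
  thus False using e by simp
 qed
 moreover have "open (- PC c d)" using m(1) by (simp add: finite_imp_closed open_Compl)
 ultimately obtain r0 where r0: "r0 > 0" "ball x r0 \<subseteq> - PC c d" using open_contains_ball by blast
 define r where "r = min r0 1"
 have r: "r > 0" "r <= 1" "ball x r \<inter> PC c d = {}" using r0 by (auto simp: r_def)
 obtain h r1 where h: "h holomorphic_on ?U" "strict_mono (r1 :: nat => nat)"
  "!!K. compact K ==> K \<subseteq> ?U ==> uniform_limit K (%k. ?F (N (r1 k))) h sequentially"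
  by (rule fk_Montel[OF open_interior interior_subset, where n = N]) blast
 have "(%k. ?F (N (r1 k)) u) \<longlonglongrightarrow> h u"
  using tendsto_uniform_limitI[OF h(3)[of "{u}"]] u(1) by auto
 moreover have "(%k. ?F (N (r1 k)) u) \<longlonglongrightarrow> x"
  using filterlim_compose[OF NF filterlim_subseq[OF h(2)]] .
 ultimately have hu: "h u \<in> ball x r" using LIMSEQ_unique r(1) by force
 have Nr: "filterlim (%k. N (r1 k)) at_top sequentially"
  using filterlim_compose[OF N filterlim_subseq[OF h(2)]] .
 obtain Ga ga M t where L: "Ga holomorphic_on ball x r" "filterlim M at_top sequentially"
  "!!k::nat. branch c d (M k) (ball x r) (ga k)"
  "!!K. compact K ==> K \<subseteq> ball x r ==> uniform_limit K ga Ga sequentially"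
  "t > 0" "ball u t \<subseteq> ?U" "!!z. z \<in> ball u t ==> h z \<in> ball x r & Ga (h z) = z"
  by (rule branch_limit[OF par fk_bounded[OF x(1)] r(2,3) Nr open_interior u(1)
     holomorphic_on_imp_continuous_on[OF h(1)] hu h(3)]) blast+
 have "Ga constant_on ball x r"
  by (rule branch_limit_constant[OF par m(1) fk_bounded[OF x(1)] r L(2,3,1,4)])
 thus False using nonconstant_inverse[OF L(5,7)] by blast
qed

section \<open>Shrinking of connected preimages\<close>

text \<open>Smallness is asked of arbitrary connected sets mapped into the ball rather than of
  images of branches, because the ball may contain postcritical points, where branches do not
  exist.\<close>

definition sm :: "complex => complex => nat => complex => real => real => bool" where
 "sm c d n x r e \<longleftrightarrow> (\<forall>C. connected C --> (cub c d ^^ n) ` C \<subseteq> ball x r --> (\<forall>a\<in>C. \<forall>b\<in>C. dist a b <= e))"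

lemma smI: "(!!C a b. connected C ==> (cub c d ^^ n) ` C \<subseteq> ball x r ==> a \<in> C ==> b \<in> C ==> dist a b <= e) ==> sm c d n x r e"
 unfolding sm_def by blast

lemma smD: "sm c d n x r e ==> connected C ==> (cub c d ^^ n) ` C \<subseteq> ball x r ==> a \<in> C ==> b \<in> C ==> dist a b <= e"
 unfolding sm_def by blast

definition gd :: "complex => complex => complex => real => bool" where
 "gd c d x r \<longleftrightarrow> r > 0 & (\<forall>e>0. \<exists>n0. \<forall>n\<ge>n0. sm c d n x r e)"

lemma sm_mono: "sm c d n x r e ==> ball x' r' \<subseteq> ball x r ==> sm c d n x' r' e"
 unfolding sm_def by (meson order_trans)

lemma gd_finite:
 assumes "finite Y" "!!y. y \<in> Y ==> gd c d y (r y)" "e > 0"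
 obtains N where "!!n y. n >= N ==> y \<in> Y ==> sm c d n y (r y) e"
proof -
 have "\<exists>N. \<forall>n\<ge>N. \<forall>y\<in>Y. sm c d n y (r y) e"
  using assms(1,2)
 proof (induction Y rule: finite_induct)
  case (insert y Y)
  then obtain N where N: "!!n y. n >= N ==> y \<in> Y ==> sm c d n y (r y) e" by auto
  have "gd c d y (r y)" using insert.prems by simp
  then obtain N' where N': "!!n. n >= N' ==> sm c d n y (r y) e" unfolding gd_def using assms(3) by blast
  show ?case using N N' by (intro exI[of _ "max N N'"]) auto
 qed auto
 thus ?thesis using that by blast
qed

lemma gd_finite_uniform:
 assumes "finite Y" "!!y. y \<in> Y ==> \<exists>r. gd c d y r" "(b::real) > 0"
 obtains r where "0 < r" "r <= b" "!!e. e > 0 ==> \<exists>N. \<forall>n\<ge>N. \<forall>y\<in>Y. sm c d n y r e"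
proof -
 have "\<forall>y\<in>Y. \<exists>r. gd c d y r" using assms(2) by blast
 from bchoice[OF this] obtain ro where ro: "\<forall>y\<in>Y. gd c d y (ro y)" ..
 have pos: "ro y > 0" if "y \<in> Y" for y using ro that by (auto simp: gd_def)
 define r where "r = Min (insert b (ro ` Y))"
 have r: "r > 0" "r <= b" "!!y. y \<in> Y ==> r <= ro y"
  using assms(1,3) pos unfolding r_def by (auto intro!: Min_le)
 have "\<exists>N. \<forall>n\<ge>N. \<forall>y\<in>Y. sm c d n y r e" if e: "e > 0" for e
 proof -
  obtain N where N: "!!n y. n >= N ==> y \<in> Y ==> sm c d n y (ro y) e"
   by (rule gd_finite[OF assms(1) _ e, of c d ro]) (use ro in blast)+
  have "sm c d n y r e" if "n >= N" "y \<in> Y" for n y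
   by (rule sm_mono[OF N[OF that]]) (use r(3)[OF that(2)] in auto)
  thus ?thesis by blast
 qed
 from that[OF r(1,2) this] show ?thesis .
qed

text \<open>Connected sets that stay large lie in images of branches, and all limits of branches are
  constant. Halving the radius provides the compact set on which the convergence is uniform.\<close>

lemma good_not_PC:
 assumes mis: "mis c d" and x: "x \<in> fk c d" "x \<notin> PC c d"
 shows "\<exists>r. gd c d x r"
proof -
 note par = mis_par[OF mis]
 obtain m where fin: "finite (PC c d)" using mis_PC[OF mis] by blast
 have "open (- PC c d)" using fin by (simp add: finite_imp_closed open_Compl)
 then obtain r0 where r0: "r0 > 0" "ball x r0 \<subseteq> - PC c d" using x(2) open_contains_ball by blast
 define r where "r = min r0 1"
 have r: "r > 0" "r <= 1" "ball x r \<inter> PC c d = {}" using r0 by (auto simp: r_def)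
 have "\<exists>n0. \<forall>n\<ge>n0. sm c d n x (r/2) e" if e: "e > 0" for e
 proof (rule ccontr)
  assume neg: "~ ?thesis"
  hence "\<forall>k. \<exists>n\<ge>k. \<exists>C a b. connected C & (cub c d ^^ n) ` C \<subseteq> ball x (r/2) & a \<in> C & b \<in> C & dist a b > e"
   unfolding sm_def by (meson not_le)
  then obtain n C a b where n: "!!k. n k >= k" and C: "!!k. connected (C k)" "!!k. (cub c d ^^ n k) ` C k \<subseteq> ball x (r/2)"
   "!!k::nat. a k \<in> C k" "!!k. b k \<in> C k" "!!k. dist (a k) (b k) > e" by metis
  have half: "ball x (r/2) \<subseteq> ball x r" using r(1) by auto
  have "\<exists>g. branch c d (n k) (ball x r) g & g ((cub c d ^^ n k) (a k)) = a k" for k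
  proof -
   have "(cub c d ^^ n k) (a k) \<in> ball x r" using C(2,3)[of k] half by blast
   from branch_exists[OF r(3) this] show ?thesis by blast
  qed
  then obtain g where g: "!!k. branch c d (n k) (ball x r) (g k)" "!!k. g k ((cub c d ^^ n k) (a k)) = a k"
   by metis
  have gb: "g k ((cub c d ^^ n k) (b k)) = b k" for k
  proof -
   have "(cub c d ^^ n k) (a k) \<in> ball x r" using C(2,3)[of k] half by blast
   hence "a k \<in> g k ` ball x r" using g(2)[of k] by (metis imageI)
   moreover have "(cub c d ^^ n k) ` C k \<subseteq> ball x r" using C(2)[of k] half by blast
   ultimately have "C k \<subseteq> g k ` ball x r"
    by (intro connected_in_branch[OF r(3) g(1) C(1) _ C(3)])
   thus ?thesis using branch_inverse[OF g(1)] C(4) by blast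
  qed
  obtain G q where G: "G holomorphic_on ball x r" "strict_mono (q :: nat => nat)"
   "!!K. compact K ==> K \<subseteq> ball x r ==> uniform_limit K (%k. g (q k)) G sequentially"
   by (rule branch_Montel[where n = n and g = g, OF par fk_bounded[OF x(1)] r(2) g(1)]) blast
  have nq: "filterlim (%k. n (q k)) at_top sequentially"
   using filterlim_compose[OF filterlim_ge_ident filterlim_subseq[OF G(2)], of n] n by blast
  have "G constant_on ball x r"
   by (rule branch_limit_constant[OF par fin fk_bounded[OF x(1)] r nq g(1) G(1,3)])
  then obtain a0 where a0: "!!y. y \<in> ball x r ==> G y = a0" by (auto simp: constant_on_def)
  have cb: "cball x (r/2) \<subseteq> ball x r" using r(1) by auto
  have "uniform_limit (cball x (r/2)) (%k. g (q k)) G sequentially" using G(3) cb by simp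
  hence "eventually (%k. \<forall>y\<in>cball x (r/2). dist (g (q k) y) (G y) < e/2) sequentially"
   using e unfolding uniform_limit_iff by (meson half_gt_zero)
  then obtain k where k: "\<forall>y\<in>cball x (r/2). dist (g (q k) y) (G y) < e/2"
   by (auto simp: eventually_sequentially)
  have *: "dist (g (q k) y) a0 < e/2" if "y \<in> ball x (r/2)" for y
   using k a0[of y] that half cb by (auto dest!: bspec[of _ _ y])
  have "(cub c d ^^ n (q k)) (a (q k)) \<in> ball x (r/2)" "(cub c d ^^ n (q k)) (b (q k)) \<in> ball x (r/2)"
   using C(2-4)[of "q k"] by blast+
  from *[OF this(1)] *[OF this(2)] have "dist (a (q k)) (b (q k)) < e"
   using g(2) gb dist_triangle_half_l by metis
  thus False using C(5)[of "q k"] by simp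
 qed
 thus ?thesis unfolding gd_def using r(1) by (intro exI[of _ "r/2"]) auto
qed

lemma connected_in_balls:
 fixes Y :: "complex set"
 assumes "finite Y" "connected C" "C ~= {}" "C \<subseteq> (\<Union>y\<in>Y. ball y e)"
  and sep: "!!y y'. y \<in> Y ==> y' \<in> Y ==> y ~= y' ==> 2 * e <= dist y y'"
 obtains y where "y \<in> Y" "C \<subseteq> ball y e"
proof -
 obtain z y where z: "z \<in> C" "y \<in> Y" "z \<in> ball y e" using assms by blast
 define V where "V = (\<Union>y'\<in>Y - {y}. ball y' e)"
 have "C \<subseteq> ball y e"
 proof (rule ccontr)
  assume "~ ?thesis"
  then obtain w where w: "w \<in> C" "w \<notin> ball y e" by blast
  then obtain y' where "y' \<in> Y" "w \<in> ball y' e" using assms(4) by blast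
  hence "w \<in> V" using w by (auto simp: V_def)
  have disj: "ball y e \<inter> V = {}"
  proof -
   have "ball y e \<inter> ball y' e = {}" if "y' \<in> Y - {y}" for y'
    using sep[of y y'] z(2) that by (intro disjoint_ballI) auto
   thus ?thesis unfolding V_def by blast
  qed
  have V: "open V" unfolding V_def by blast
  have "C \<subseteq> ball y e \<union> V" using assms(4) unfolding V_def by blast
  from connectedD[OF assms(2) open_ball V _ this] disj have "ball y e \<inter> C = {} \<or> V \<inter> C = {}" by blast
  thus False using z w \<open>w \<in> V\<close> by blast
 qed
 thus ?thesis using that z by blast
qed

text \<open>With radius \<open>E^3\<close> in the image every point is within \<open>E\<close> of a
  preimage of \<open>x\<close>, and the balls of radius \<open>E\<close> about the preimages are
  disjoint, so a connected set lies in one of them.\<close>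

lemma cub_connected_small:
 assumes "e > 0"
 obtains ro where "ro > 0" "!!C. connected C ==> C ~= {} ==> cub c d ` C \<subseteq> ball x ro ==> \<exists>y. cub c d y = x & C \<subseteq> ball y e"
proof -
 let ?Y = "{y. cub c d y = x}"
 define D where "D = insert e ((%(u, v). dist u v / 2) ` {(u, v) \<in> ?Y \<times> ?Y. u ~= v})"
 have D: "finite D" "\<forall>t\<in>D. t > 0" "D ~= {}"
  unfolding D_def using assms finite_cub_vimage by (auto intro!: finite_imageI intro: finite_subset[of _ "?Y \<times> ?Y"])
 define E where "E = Min D"
 have E: "E > 0" "E <= e" "!!u v. u \<in> ?Y ==> v \<in> ?Y ==> u ~= v ==> 2 * E <= dist u v"
 proof -
  show "E > 0" unfolding E_def using D by (subst Min_gr_iff) auto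
  show "E <= e" unfolding E_def using D by (intro Min_le) (auto simp: D_def)
  fix u v assume "u \<in> ?Y" "v \<in> ?Y" "u ~= v"
  hence "dist u v / 2 \<in> D" unfolding D_def by force
  hence "E <= dist u v / 2" unfolding E_def using D by (intro Min_le) auto
  thus "2 * E <= dist u v" by simp
 qed
 show ?thesis
 proof
  show "E^3 > 0" using E by simp
  fix C assume C: "connected C" "C ~= {}" "cub c d ` C \<subseteq> ball x (E^3)"
  have "C \<subseteq> (\<Union>y\<in>?Y. ball y E)"
  proof
   fix z assume "z \<in> C"
   hence "norm (cub c d z - x) < E^3" using C(3) by (auto simp: dist_norm norm_minus_commute)
   then obtain w where "cub c d w = x" "norm (z - w) < E" using E(1) cub_root_near by metis
   thus "z \<in> (\<Union>y\<in>?Y. ball y E)" by (auto simp: dist_norm norm_minus_commute)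
  qed
  then obtain y where "y \<in> ?Y" "C \<subseteq> ball y E"
   using connected_in_balls[OF finite_cub_vimage C(1,2)] E(3) by blast
  thus "\<exists>y. cub c d y = x & C \<subseteq> ball y e" using E(2) by (intro exI[of _ y]) auto
 qed
qed

lemma cub_iter_connected_small:
 assumes "e > 0"
 obtains ro where "ro > 0" "!!C. connected C ==> C ~= {} ==> (cub c d ^^ l) ` C \<subseteq> ball x ro ==> \<exists>y. (cub c d ^^ l) y = x & C \<subseteq> ball y e"
proof -
 have "\<exists>ro>0. \<forall>C. connected C --> C ~= {} --> (cub c d ^^ l) ` C \<subseteq> ball x ro --> (\<exists>y. (cub c d ^^ l) y = x & C \<subseteq> ball y e)"
  using assms
 proof (induction l arbitrary: x)
  case 0
  thus ?case by (intro exI[of _ e]) auto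
 next
  case (Suc l)
  let ?Y = "{y. cub c d y = x}"
  let ?P = "%y r. r > 0 & (\<forall>C. connected C --> C ~= {} --> (cub c d ^^ l) ` C \<subseteq> ball y r --> (\<exists>w. (cub c d ^^ l) w = y & C \<subseteq> ball w e))"
  have "\<forall>y. \<exists>r. ?P y r" using Suc.IH[OF Suc.prems] by blast
  from choice[OF this] obtain ro where ro: "\<forall>y. ?P y (ro y)" ..
  define e' where "e' = Min (insert 1 (ro ` ?Y))"
  have e': "e' > 0" "!!y. y \<in> ?Y ==> e' <= ro y"
   unfolding e'_def using finite_cub_vimage ro by (auto intro!: Min_le)
  obtain r where r: "r > 0" "!!C. connected C ==> C ~= {} ==> cub c d ` C \<subseteq> ball x r ==> \<exists>y. cub c d y = x & C \<subseteq> ball y e'"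
   by (rule cub_connected_small[OF e'(1), of c d x]) blast
  have "\<exists>y. (cub c d ^^ Suc l) y = x & C \<subseteq> ball y e"
   if C: "connected C" "C ~= {}" "(cub c d ^^ Suc l) ` C \<subseteq> ball x r" for C
  proof -
   have "connected ((cub c d ^^ l) ` C)" using C(1) by (intro connected_continuous_image continuous_intros)
   moreover have "cub c d ` (cub c d ^^ l) ` C \<subseteq> ball x r" using C(3) by (simp add: image_image)
   ultimately obtain y where y: "cub c d y = x" "(cub c d ^^ l) ` C \<subseteq> ball y e'"
    using r(2)[of "(cub c d ^^ l) ` C"] C(2) by blast
   hence "(cub c d ^^ l) ` C \<subseteq> ball y (ro y)" using e'(2)[of y] by auto
   then obtain w where "(cub c d ^^ l) w = y" "C \<subseteq> ball w e" using ro C(1,2) by blast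
   thus ?thesis using y(1) by (intro exI[of _ w]) simp
  qed
  thus ?case using r(1) by blast
 qed
 thus ?thesis using that by blast
qed

text \<open>A connected set that n + 1 iterates map close to \<open>x\<close> is mapped by n
  iterates close to one of the finitely many preimages of \<open>x\<close>. This holds for critical
  preimages as well.\<close>

lemma gd_step:
 assumes "!!y. cub c d y = x ==> \<exists>r. gd c d y r" shows "\<exists>r. gd c d x r"
proof -
 let ?Y = "{y. cub c d y = x}"
 obtain e' where e': "e' > 0" "e' <= 1" "!!e. e > 0 ==> \<exists>N. \<forall>n\<ge>N. \<forall>y\<in>?Y. sm c d n y e' e"
 proof (rule gd_finite_uniform)
  show "finite ?Y" by (rule finite_cub_vimage)
  show "\<exists>r. gd c d y r" if "y \<in> ?Y" for y using assms that by blast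
  show "(1::real) > 0" by simp
 qed blast
 obtain ro where ro: "ro > 0" "!!C. connected C ==> C ~= {} ==> cub c d ` C \<subseteq> ball x ro ==> \<exists>y. cub c d y = x & C \<subseteq> ball y e'"
  by (rule cub_connected_small[OF e'(1), of c d x]) blast
 have "\<exists>n0. \<forall>n\<ge>n0. sm c d n x ro e" if e: "e > 0" for e
 proof -
  obtain N where N: "\<forall>n\<ge>N. \<forall>y\<in>?Y. sm c d n y e' e" using e'(3)[OF e] by blast
  have "sm c d n x ro e" if n: "n >= Suc N" for n
  proof (rule smI)
   fix C a b assume C: "connected C" "(cub c d ^^ n) ` C \<subseteq> ball x ro" "a \<in> C" "b \<in> C"
   obtain n' where n': "n = Suc n'" "n' >= N" using n by (cases n) auto
   have "connected ((cub c d ^^ n') ` C)" using C(1) by (intro connected_continuous_image continuous_intros)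
   moreover have "cub c d ` (cub c d ^^ n') ` C \<subseteq> ball x ro" using C(2) n' by (simp add: image_image)
   ultimately obtain y where y: "cub c d y = x" "(cub c d ^^ n') ` C \<subseteq> ball y e'"
    using ro(2)[of "(cub c d ^^ n') ` C"] C(3) by blast
   hence "sm c d n' y e' e" using N n'(2) by blast
   from smD[OF this C(1) y(2) C(3,4)] show "dist a b <= e" .
  qed
  thus ?thesis by blast
 qed
 thus ?thesis unfolding gd_def using ro(1) by blast
qed

text \<open>All postcritical points reach 0 within \<open>m\<close> steps, so a point with nonzero
  m-th iterate is covered by \<open>good_not_PC\<close>. Each use of \<open>gd_step\<close> lowers
  the number of iterates by one, until only \<open>x ~= 0\<close> is required.\<close>

lemma gd_nonzero:
 assumes mis: "mis c d" and x: "x \<in> fk c d" "x ~= 0"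
 shows "\<exists>r. gd c d x r"
proof -
 obtain m where m: "!!q. q \<in> PC c d ==> (cub c d ^^ m) q = 0" by (rule mis_PC[OF mis]) blast
 have "\<forall>x\<in>fk c d. (cub c d ^^ (m - i)) x ~= 0 --> (\<exists>r. gd c d x r)" if "i <= m" for i
  using that
 proof (induction i)
  case 0
  thus ?case using good_not_PC[OF mis] m by auto
 next
  case (Suc i)
  show ?case
  proof (intro ballI impI)
   fix x assume x: "x \<in> fk c d" "(cub c d ^^ (m - Suc i)) x ~= 0"
   show "\<exists>r. gd c d x r"
   proof (rule gd_step)
    fix y assume y: "cub c d y = x"
    have "m - i = Suc (m - Suc i)" using Suc by simp
    hence "(cub c d ^^ (m - i)) y = (cub c d ^^ (m - Suc i)) x" using y by (simp add: funpow_swap1)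
    moreover have "y \<in> fk c d" using y x(1) fk_cubD[OF mis_par[OF mis]] by blast
    ultimately show "\<exists>r. gd c d y r" using Suc x(2) by auto
   qed
  qed
 qed
 from this[of m] x show ?thesis by simp
qed

text \<open>Pulled back near 0, a set is either contracted by the repelling multiplier or comes
  close to another preimage of 0, where smallness is known. A set that is still large has therefore
  stayed near 0 and has been contracted all the time.\<close>

lemma gd_zero:
 assumes mis: "mis c d" shows "\<exists>r. gd c d 0 r"
proof -
 let ?F = "%n. cub c d ^^ n"
 have rep: "norm (3 * c * d) > 1" using mis by (simp add: mis_def)
 obtain r \<mu> where r: "r > 0" "\<mu> > 1" "!!z. norm z < r ==> norm (cub c d z) >= \<mu> * norm z"
  by (rule cub_repelling[OF rep]) blast
 let ?Y = "{y. cub c d y = 0} - {0}"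
 have finY: "finite ?Y" using finite_cub_vimage by blast
 have good: "\<exists>r. gd c d y r" if y: "y \<in> ?Y" for y
 proof -
  have "cub c d y \<in> fk c d" using y by simp
  hence "y \<in> fk c d" using fk_cubD[OF mis_par[OF mis]] by blast
  thus ?thesis using gd_nonzero[OF mis] y by blast
 qed
 obtain e' where e': "e' > 0" "e' <= r" "!!e. e > 0 ==> \<exists>N. \<forall>n\<ge>N. \<forall>y\<in>?Y. sm c d n y e' e"
  by (rule gd_finite_uniform[OF finY good r(1)]) blast+
 obtain ro0 where ro0: "ro0 > 0" "!!C. connected C ==> C ~= {} ==> cub c d ` C \<subseteq> ball 0 ro0 ==> \<exists>y. cub c d y = 0 & C \<subseteq> ball y e'"
  by (rule cub_connected_small[OF e'(1), of c d 0]) blast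
 have "\<exists>n0. \<forall>n\<ge>n0. sm c d n 0 ro0 e" if e: "e > 0" for e
 proof -
  obtain N where N: "\<forall>n\<ge>N. \<forall>y\<in>?Y. sm c d n y e' e" using e'(3)[OF e] by blast
  have e2: "e/2 > 0" using e by simp
  obtain ro1 where ro1: "ro1 > 0" "!!C. connected C ==> C ~= {} ==> ?F N ` C \<subseteq> ball 0 ro1 ==> \<exists>y. ?F N y = 0 & C \<subseteq> ball y (e/2)"
   by (rule cub_iter_connected_small[OF e2, where c = c and d = d and l = N and x = 0]) blast
  \<comment> \<open>So many contractions near 0 bring the set into the ball of radius
    \<open>ro1\<close>, from which the remaining N pull-backs cannot make it larger than
    \<open>e\<close>.\<close>
  obtain I where I: "ro0 / ro1 < \<mu>^I" using real_arch_pow[OF r(2)] by blast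
  have roI: "ro0 / \<mu>^I < ro1" using I ro1(1) r(2) by (simp add: divide_less_eq mult.commute)
  have "sm c d n 0 ro0 e" if n: "n >= N + I" for n
  proof (rule smI, rule ccontr)
   fix C a b assume C: "connected C" "?F n ` C \<subseteq> ball 0 ro0" and ab: "a \<in> C" "b \<in> C" "~ dist a b <= e"
   have ne: "C ~= {}" using ab by blast
   have step: "?F (n - i) ` C \<subseteq> ball 0 (ro0 / \<mu>^i)" if "i <= n - N" for i
    using that
   proof (induction i)
    case 0
    thus ?case using C(2) by simp
   next
    case (Suc i)
    define j where "j = n - Suc i"
    have j: "n - i = Suc j" "j >= N" using Suc.prems n by (auto simp: j_def)
    have IH: "cub c d ` ?F j ` C \<subseteq> ball 0 (ro0 / \<mu>^i)" using Suc j by (simp add: image_image)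
    have "1 * ro0 <= \<mu>^i * ro0" using r(2) ro0(1) by (intro mult_right_mono one_le_power) auto
    hence "ro0 / \<mu>^i <= ro0" using r(2) by (simp add: divide_le_eq mult.commute)
    hence "cub c d ` ?F j ` C \<subseteq> ball 0 ro0" using IH by fastforce
    moreover have "connected (?F j ` C)" using C(1) by (intro connected_continuous_image continuous_intros)
    ultimately obtain y where y: "cub c d y = 0" "?F j ` C \<subseteq> ball y e'" using ro0(2)[of "?F j ` C"] ne by blast
    have "y = 0"
    proof (rule ccontr)
     assume "y ~= 0"
     hence "sm c d j y e' e" using y N j(2) by simp
     from smD[OF this C(1) y(2) ab(1,2)] ab(3) show False by blast
    qed
    show ?case
    proof (rule image_subsetI)
     fix z assume z: "z \<in> C"
     have "?F j z \<in> ball 0 e'" using y(2) \<open>y = 0\<close> z by blast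
     hence "\<mu> * norm (?F j z) <= norm (cub c d (?F j z))" using r(3)[of "?F j z"] e'(2) by simp
     also have "cub c d (?F j z) \<in> ball 0 (ro0 / \<mu>^i)" using IH z by blast
     hence "norm (cub c d (?F j z)) < ro0 / \<mu>^i" by simp
     finally have "norm (?F j z) < ro0 / \<mu>^i / \<mu>" using r(2) by (simp add: less_divide_eq mult_ac)
     thus "?F (n - Suc i) z \<in> ball 0 (ro0 / \<mu>^Suc i)" by (simp add: j_def mult.commute)
    qed
   qed
   have nN: "n - (n - N) = N" using n by simp
   have "ro0 / \<mu>^(n - N) <= ro0 / \<mu>^I"
    using r(2) ro0(1) n by (intro divide_left_mono power_increasing mult_pos_pos) auto
   hence "ball 0 (ro0 / \<mu>^(n - N)) \<subseteq> ball (0::complex) ro1" using roI by auto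
   hence "?F N ` C \<subseteq> ball 0 ro1" using step[of "n - N"] nN by (metis order.trans order_refl)
   then obtain y where y: "C \<subseteq> ball y (e/2)" using ro1(2)[OF C(1) ne] by blast
   have "dist y a < e/2" "dist y b < e/2" using y ab by auto
   thus False using ab(3) dist_triangle[of a b y] by (simp add: dist_commute)
  qed
  thus ?thesis by blast
 qed
 thus ?thesis unfolding gd_def using ro0(1) by blast
qed

text \<open>The radius \<open>de\<close> is a Lebesgue number of a cover of the compact filled Julia
  set by good balls of half size.\<close>

lemma shrinking:
 assumes mis: "mis c d"
 obtains de where "de > 0" "!!e. e > 0 ==> \<exists>n0. \<forall>n\<ge>n0. \<forall>x\<in>fk c d. sm c d n x de e"
proof -
 have "\<forall>x\<in>fk c d. \<exists>r. gd c d x r"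
  using gd_nonzero[OF mis] gd_zero[OF mis] by blast
 from bchoice[OF this] obtain r where r: "\<forall>x\<in>fk c d. gd c d x (r x)" ..
 have rpos: "r x > 0" if "x \<in> fk c d" for x using r that by (auto simp: gd_def)
 have cover: "fk c d \<subseteq> (\<Union>x\<in>fk c d. ball x (r x / 2))"
 proof
  fix x assume "x \<in> fk c d"
  moreover from this have "x \<in> ball x (r x / 2)" using rpos by simp
  ultimately show "x \<in> (\<Union>x\<in>fk c d. ball x (r x / 2))" by blast
 qed
 obtain X where X: "X \<subseteq> fk c d" "finite X" "fk c d \<subseteq> (\<Union>x\<in>X. ball x (r x / 2))"
  by (rule compactE_image[OF compact_fk _ cover]) auto
 define de where "de = Min (insert 1 ((%x. r x / 2) ` X))"
 have de: "de > 0"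
  unfolding de_def using X(1,2) rpos by auto
 have de2: "de <= r x / 2" if "x \<in> X" for x
  unfolding de_def using X(2) that by (intro Min_le) auto
 have "\<exists>n0. \<forall>n\<ge>n0. \<forall>x\<in>fk c d. sm c d n x de e" if e: "e > 0" for e
 proof -
  obtain N where N: "!!n y. n >= N ==> y \<in> X ==> sm c d n y (r y) e"
   by (rule gd_finite[OF X(2) _ e, of c d r]) (use r X(1) in blast)+
  have "sm c d n x de e" if nx: "n >= N" "x \<in> fk c d" for n x
  proof -
   obtain y where y: "y \<in> X" "x \<in> ball y (r y / 2)" using X(3) nx(2) by blast
   have "ball x de \<subseteq> ball y (r y)"
   proof
    fix z assume "z \<in> ball x de"
    thus "z \<in> ball y (r y)" using y de2[OF y(1)] dist_triangle[of y z x] by (auto simp: dist_commute)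
   qed
   from sm_mono[OF N[OF nx(1) y(1)] this] show ?thesis .
  qed
  thus ?thesis by blast
 qed
 with de that show ?thesis by blast
qed

section \<open>Landing of external rays\<close>

lemma Complex_hp [simp]: "Complex a th \<in> hp s \<longleftrightarrow> s < a"
 by (simp add: hp_def)

lemma three_Complex: "3 * Complex a th = Complex (3 * a) (3 * th)"
 by (simp add: complex_eq_iff)

lemma pow3_Complex: "3^k * Complex a th = Complex (3^k * a) (3^k * th)"
 by (induction k) (simp_all add: three_Complex mult.assoc)

lemma Psi_ray_cub: "con c d ==> 0 < a ==> cub c d (Psi c d (Complex a th)) = Psi c d (Complex (3 * a) (3 * th))"
 using Psi_cub[of c d "Complex a th"] by (simp add: three_Complex)

lemma Psi_ray_iter: "con c d ==> 0 < a ==> (cub c d ^^ k) (Psi c d (Complex a th)) = Psi c d (Complex (3^k * a) (3^k * th))"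
 using Psi_iter[of c d "Complex a th" k] by (simp add: pow3_Complex)

lemma Complex_period: "Complex a (th + 2 * pi * of_int n) = Complex a th + 2 * pi * \<i> * of_int n"
 by (simp add: complex_eq_iff)

lemma Psi_ray_period: "con c d ==> 0 < a ==> Psi c d (Complex a (th + 2 * pi * of_int n)) = Psi c d (Complex a th)"
 unfolding Complex_period by (rule Psi_period_int) auto

lemma angle_reduce: obtains n :: int where "0 <= th + 2 * pi * of_int n" "th + 2 * pi * of_int n <= 2 * pi"
proof -
 define n where "n = - \<lfloor>th / (2 * pi)\<rfloor>"
 have "of_int (- n) <= th / (2 * pi)" "th / (2 * pi) < of_int (- n) + 1"
  unfolding n_def minus_minus by (rule of_int_floor_le, rule real_of_int_floor_add_one_gt)
 hence "of_int (- n) * (2 * pi) <= th" "th < (of_int (- n) + 1) * (2 * pi)"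
  using pi_gt_zero by (simp_all add: le_divide_eq divide_less_eq)
 hence "0 <= th + 2 * pi * of_int n" "th + 2 * pi * of_int n <= 2 * pi" by (simp_all add: algebra_simps)
 thus ?thesis using that by blast
qed

lemma Psi_ray_bound:
 assumes "con c d" "0 < a" "a <= 1" shows "norm (Psi c d (Complex a th)) <= 10"
proof -
 have "norm (Psi c d (Complex a th)) <= max 10 (2 * exp a)" using Psi_bound[of c d "Complex a th"] assms by simp
 moreover have "exp a <= exp 1" using assms by simp
 moreover have "exp 1 <= (3::real)" by (rule exp_le)
 ultimately show ?thesis by linarith
qed

lemma continuous_on_Psi_ray:
 assumes "con c d" "!!x. x \<in> S ==> 0 < f x" "continuous_on S f" "continuous_on S g"
 shows "continuous_on S (%x. Psi c d (Complex (f x) (g x)))"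
proof -
 have "continuous_on S (%x. Complex (f x) (g x))"
  unfolding Complex_eq using assms by (intro continuous_intros)
 moreover have "(%x. Complex (f x) (g x)) ` S \<subseteq> hp 0" using assms(2) by auto
 ultimately show ?thesis
  using continuous_on_compose2[OF Psi_continuous[OF assms(1)]] by blast
qed

lemma divide_pow3_le: "0 <= s ==> s / 3^n <= (s::real)"
 using divide_left_mono[of 1 "3^n" s] by simp

lemma subdivide_dist:
 fixes f :: "real => 'a::metric_space"
 assumes "!!x y. A <= x ==> x <= y ==> y <= B ==> y - x <= h ==> dist (f x) (f y) <= e"
  and "A <= x" "x <= y" "y <= B" "y - x <= real m * h" "h >= 0" "e >= 0"
 shows "dist (f x) (f y) <= real m * e"
 using assms(2-5)
proof (induction m arbitrary: y)
 case (Suc m)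
 show ?case
 proof (cases "y - x <= h")
  case True
  hence "dist (f x) (f y) <= 1 * e" using assms(1) Suc.prems by simp
  also have "... <= real (Suc m) * e" using assms(7) by (intro mult_right_mono) auto
  finally show ?thesis .
 next
  case False
  have "dist (f x) (f (y - h)) <= real m * e"
   using Suc.prems False assms(6) by (intro Suc.IH) (auto simp: algebra_simps)
  moreover have "dist (f (y - h)) (f y) <= e" using assms(1)[of "y - h" y] Suc.prems False assms(6) by simp
  ultimately show ?thesis using dist_triangle[of "f x" "f y" "f (y - h)"] by (simp add: algebra_simps)
 qed
qed auto

lemma cub_funpow_param:
 assumes "e > 0" "B >= 0"
 obtains et where "et > 0" "!!c d z. norm (c - c0) < et ==> norm (d - d0) < et ==> norm z <= B ==>
   norm ((cub c d ^^ N) z - (cub c0 d0 ^^ N) z) < e"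
proof -
 let ?f = "%(p, z). (cub (fst p) (snd p) ^^ N) (z :: complex)"
 let ?K = "(cball c0 1 \<times> cball d0 1) \<times> cball (0::complex) B"
 have "compact ?K" by (intro compact_Times compact_cball)
 moreover have "continuous_on ?K ?f"
  unfolding case_prod_beta by (intro continuous_intros)
 ultimately have uc: "uniformly_continuous_on ?K ?f" by (rule compact_uniformly_continuous[rotated])
 obtain et0 where et0: "et0 > 0" "!!x x'. x \<in> ?K ==> x' \<in> ?K ==> dist x' x < et0 ==> dist (?f x') (?f x) < e"
  by (rule uniformly_continuous_onE[OF uc assms(1)]) blast
 define et where "et = min 1 (et0/2)"
 have "norm ((cub c d ^^ N) z - (cub c0 d0 ^^ N) z) < e"
  if *: "norm (c - c0) < et" "norm (d - d0) < et" "norm z <= B" for c d z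
 proof -
  have "dist ((c, d), z) ((c0, d0), z) = dist (c, d) (c0, d0)" by (simp add: dist_prod_def)
  also have "... <= dist c c0 + dist d d0" unfolding dist_prod_def by (auto intro: sqrt_sum_squares_le_sum)
  also have "... < et0" using * by (auto simp: et_def dist_norm)
  finally have "dist (?f ((c, d), z)) (?f ((c0, d0), z)) < e"
   using * by (intro et0(2)) (auto simp: et_def dist_norm norm_minus_commute)
  thus ?thesis by (simp add: dist_norm)
 qed
 moreover have "et > 0" using et0(1) by (simp add: et_def)
 ultimately show ?thesis using that by blast
qed

text \<open>Points of potential tending to 0 accumulate, and by \<open>Psi_boundary\<close> they do
  so in the filled Julia set.\<close>

lemma Psi_near_fk:
 assumes con: "con c d" and e: "e > 0"
 obtains s where "s > 0" "s <= 1" "!!a th. 0 < a ==> a <= s ==> \<exists>x\<in>fk c d. dist (Psi c d (Complex a th)) x < e"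
proof -
 have "\<exists>s>0. s <= 1 & (\<forall>a th. 0 < a --> a <= s --> (\<exists>x\<in>fk c d. dist (Psi c d (Complex a th)) x < e))"
 proof (rule ccontr)
  assume neg: "~ ?thesis"
  have "\<exists>a th. 0 < a & a <= inverse (real (Suc n)) & (\<forall>x\<in>fk c d. e <= dist (Psi c d (Complex a th)) x)" for n
  proof -
   have "inverse (real (Suc n)) > 0" "inverse (real (Suc n)) <= 1" by (auto simp: inverse_le_1_iff)
   thus ?thesis using neg by (meson not_le)
  qed
  then obtain a th where a: "!!n. 0 < a n" "!!n. a n <= inverse (real (Suc n))"
   "!!n x. x \<in> fk c d ==> e <= dist (Psi c d (Complex (a n) (th n))) x" by metis
  have a1: "a n <= 1" for n using a(2)[of n] by (rule order_trans) (auto simp: inverse_le_1_iff)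
  have alim: "a \<longlonglongrightarrow> 0"
   by (rule Lim_null_comparison[OF _ LIMSEQ_inverse_real_of_nat]) (use a less_imp_le in \<open>auto intro!: always_eventually simp: abs_of_pos\<close>)
  have "\<forall>n. Psi c d (Complex (a n) (th n)) \<in> cball 0 10" using Psi_ray_bound[OF con a(1) a1] by simp
  then obtain z q where z: "strict_mono (q :: nat => nat)" "((%n. Psi c d (Complex (a n) (th n))) \<circ> q) \<longlonglongrightarrow> z"
   by (rule seq_compactE[OF compact_imp_seq_compact[OF compact_cball]]) blast
  have "z \<in> fk c d"
  proof (rule Psi_boundary[OF con, of "%n. Complex (a (q n)) (th (q n))"])
   show "(%n. Re (Complex (a (q n)) (th (q n)))) \<longlonglongrightarrow> 0"
    using LIMSEQ_subseq_LIMSEQ[OF alim z(1)] by (simp add: o_def)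
   show "(%n. Psi c d (Complex (a (q n)) (th (q n)))) \<longlonglongrightarrow> z" using z(2) by (simp add: o_def)
  qed (use a in auto)
  moreover have "eventually (%n. dist (((%n. Psi c d (Complex (a n) (th n))) \<circ> q) n) z < e) sequentially"
   using z(2) e by (rule tendstoD)
  then obtain n where "dist (Psi c d (Complex (a (q n)) (th (q n)))) z < e" by (auto simp: eventually_sequentially)
  ultimately show False using a(3)[of z "q n"] by simp
 qed
 thus ?thesis using that by blast
qed

definition tl :: "complex => complex => real => real => bool" where
 "tl c d s e \<longleftrightarrow> (\<forall>th a b. 0 < a --> a <= s --> 0 < b --> b <= s --> dist (Psi c d (Complex a th)) (Psi c d (Complex b th)) <= e)"

text \<open>A bounded range of potentials is cut into \<open>m\<close> pieces that are short by
  uniform continuity. Pulling back n times makes each piece at most \<open>D / m\<close> without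
  changing their number, because the n-th iterate just multiplies potentials by 3^n.\<close>

lemma ray_pieces:
 assumes mis: "mis c d" and D: "D > 0" and N: "N > 0" and e: "e > 0"
 obtains s where "s > 0" "s <= 1" "!!th a b. s / 3^N <= a ==> a <= b ==> b <= s ==> dist (Psi c d (Complex a th)) (Psi c d (Complex b th)) <= D"
  "!!a th. 0 < a ==> a <= s ==> \<exists>x\<in>fk c d. dist (Psi c d (Complex a th)) x < e"
proof -
 note con = mis_con[OF mis]
 obtain de where de: "de > 0" "!!e. e > 0 ==> \<exists>n0. \<forall>n\<ge>n0. \<forall>x\<in>fk c d. sm c d n x de e"
  by (rule shrinking[OF mis]) blast
 have "min (de/2) e > 0" using de(1) e by simp
 then obtain s1 where s1: "s1 > 0" "s1 <= 1" "!!a th. 0 < a ==> a <= s1 ==> \<exists>x\<in>fk c d. dist (Psi c d (Complex a th)) x < min (de/2) e"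
  by (rule Psi_near_fk[OF con]) blast
 let ?R = "{s1 / 3^N .. s1} \<times> {0..2*pi}"
 let ?f = "%p. Psi c d (Complex (fst p) (snd p))"
 have s1N: "0 < s1 / 3^N" using s1 by simp
 have "continuous_on ?R ?f"
  using s1N by (intro continuous_on_Psi_ray con continuous_intros) auto
 hence uc: "uniformly_continuous_on ?R ?f" by (rule compact_uniformly_continuous) (intro compact_Times compact_Icc)
 obtain ka where ka: "ka > 0" "!!x x'. x \<in> ?R ==> x' \<in> ?R ==> dist x' x < ka ==> dist (?f x') (?f x) < de/2"
  by (rule uniformly_continuous_onE[OF uc, of "de/2"]) (use de(1) in simp, blast)
 have small: "dist (Psi c d (Complex a th)) (Psi c d (Complex b th)) < de/2"
  if ab: "a \<in> {s1/3^N..s1}" "b \<in> {s1/3^N..s1}" "\<bar>a - b\<bar> < ka" for a b th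
 proof -
  obtain n :: int where n: "0 <= th + 2 * pi * of_int n" "th + 2 * pi * of_int n <= 2 * pi" by (rule angle_reduce)
  have "dist (?f (a, th + 2 * pi * of_int n)) (?f (b, th + 2 * pi * of_int n)) < de/2"
   using ab n by (intro ka(2)) (auto simp: dist_prod_def dist_real_def)
  moreover have "0 < a" "0 < b" using ab s1N by auto
  ultimately show ?thesis using Psi_ray_period[OF con] by simp
 qed
 obtain m where m: "s1 < real m * (ka/2)" using ex_less_of_nat_mult[of "ka/2" s1] ka(1) by auto
 have m0: "m > 0" using m s1 by (cases m) auto
 obtain n where n: "!!x. x \<in> fk c d ==> sm c d n x de (D / real m)"
  using de(2)[of "D / real m"] D m0 by auto
 define s where "s = s1 / 3^n"
 have s: "s > 0" "s <= s1" using s1 by (auto simp: s_def intro: divide_pow3_le)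
 show ?thesis
 proof
  show "s > 0" "s <= 1" using s s1 by auto
  show "\<exists>x\<in>fk c d. dist (Psi c d (Complex a th)) x < e" if "0 < a" "a <= s" for a th
   using s1(3)[of a th] that s by auto
  fix th a b assume ab: "s / 3^N <= a" "a <= b" "b <= s"
  let ?h = "ka / 2 / 3^n"
  have pc: "dist (Psi c d (Complex x th)) (Psi c d (Complex y th)) <= D / real m"
   if xy: "s / 3^N <= x" "x <= y" "y <= s" "y - x <= ?h" for x y
  proof -
   have x0: "x > 0" using xy(1) s1N s(1) by (smt (verit) divide_pos_pos zero_less_power)
   let ?C = "(%t. Psi c d (Complex t th)) ` {x..y}"
   have C: "connected ?C"
    using x0 by (intro connected_continuous_image continuous_on_Psi_ray con continuous_intros) auto
   have sc: "3^n * t \<in> {s1/3^N..s1}" if "t \<in> {x..y}" for t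
   proof -
    have "s/3^N <= t" "t <= s" using that xy by auto
    hence "3^n * (s/3^N) <= 3^n * t" "3^n * t <= 3^n * s"
     by (auto simp only: intro!: mult_left_mono zero_le_power zero_le_numeral)
    moreover have "3^n * s = s1" "3^n * (s/3^N) = s1/3^N" by (simp_all add: s_def)
    ultimately show ?thesis by simp
   qed
   have dt: "\<bar>3^n * t - 3^n * x\<bar> < ka" if "t \<in> {x..y}" for t
   proof -
    have "\<bar>3^n * t - 3^n * x\<bar> = 3^n * (t - x)" using that by (simp add: abs_mult flip: right_diff_distrib)
    also have "... <= 3^n * ?h" using that xy by (intro mult_left_mono) auto
    also have "... = ka/2" by simp
    finally show ?thesis using ka(1) by simp
   qed
   have "0 < 3^n * x" "3^n * x <= s1" using x0 sc[of x] xy by auto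
   then obtain w where w: "w \<in> fk c d" "dist (Psi c d (Complex (3^n * x) (3^n * th))) w < de/2"
    using s1(3)[of "3^n * x" "3^n * th"] by auto
   have "(cub c d ^^ n) ` ?C \<subseteq> ball w de"
   proof (clarsimp simp: image_image)
    fix t assume t: "x <= t" "t <= y"
    have "(cub c d ^^ n) (Psi c d (Complex t th)) = Psi c d (Complex (3^n * t) (3^n * th))"
     using x0 t by (intro Psi_ray_iter con) auto
    moreover have "dist (Psi c d (Complex (3^n * t) (3^n * th))) (Psi c d (Complex (3^n * x) (3^n * th))) < de/2"
     using t xy by (intro small sc dt) auto
    ultimately show "dist w ((cub c d ^^ n) (Psi c d (Complex t th))) < de"
     using w(2) dist_triangle_half_l by (metis dist_commute)
   qed
   from smD[OF n[OF w(1)] C this, of "Psi c d (Complex x th)" "Psi c d (Complex y th)"] show ?thesis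
    using xy by auto
  qed
  have "dist (Psi c d (Complex a th)) (Psi c d (Complex b th)) <= real m * (D / real m)"
  proof (rule subdivide_dist[of "s/3^N" s ?h "%t. Psi c d (Complex t th)"])
   have "b - a <= s" using ab s by (smt (verit) divide_pos_pos zero_less_power)
   also have "s <= real m * ?h" using divide_right_mono[of s1 "real m * (ka/2)" "3^n"] m by (simp add: s_def)
   finally show "b - a <= real m * ?h" .
  qed (use pc ab ka(1) D in auto)
  thus "dist (Psi c d (Complex a th)) (Psi c d (Complex b th)) <= D" using m0 by simp
 qed
qed

text \<open>Tails of rays stay short for all nearby parameters in the connectedness locus. The centers of the
 contracted balls are kept in the filled Julia set of the Misiurewicz map, because the filled Julia set
 is only upper semicontinuous.\<close>

lemma tail_stability:
 assumes mis: "mis c0 d0" and e: "e > 0"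
 obtains et s where "et > 0" "s > 0"
  "!!c d. con c d ==> norm (c - c0) < et ==> norm (d - d0) < et ==> tl c d s e"
  "!!c d th. con c d ==> norm (c - c0) < et ==> norm (d - d0) < et ==> dist (Psi c d (Complex s th)) (Psi c0 d0 (Complex s th)) <= e"
proof -
 note con0 = mis_con[OF mis]
 obtain de where de: "de > 0" "!!e. e > 0 ==> \<exists>n0. \<forall>n\<ge>n0. \<forall>x\<in>fk c0 d0. sm c0 d0 n x de e"
  by (rule shrinking[OF mis]) blast
 \<comment> \<open>Two errors of size \<open>D\<close> have to fit into the contraction radius
   \<open>de\<close>, and two distances of size \<open>D\<close> into the tolerance
   \<open>e\<close>.\<close>
 define D where "D = min (de/2) (e/2)"
 have D: "D > 0" "2 * D <= de" "2 * D <= e" using de(1) e by (auto simp: D_def)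
 obtain n0 where n0: "!!n x. n >= n0 ==> x \<in> fk c0 d0 ==> sm c0 d0 n x de (D/8)"
  using de(2)[of "D/8"] D(1) by auto
 define N where "N = Suc n0"
 have N: "N > 0" "!!x. x \<in> fk c0 d0 ==> sm c0 d0 N x de (D/8)" using n0 by (auto simp: N_def)
 have D8: "D/8 > 0" using D by simp
 obtain s where s: "s > 0" "s <= 1"
  "!!th a b. s / 3^N <= a ==> a <= b ==> b <= s ==> dist (Psi c0 d0 (Complex a th)) (Psi c0 d0 (Complex b th)) <= D/8"
  "!!a th. 0 < a ==> a <= s ==> \<exists>x\<in>fk c0 d0. dist (Psi c0 d0 (Complex a th)) x < D/8"
  by (rule ray_pieces[OF mis D8 N(1) D8]) blast
 have sN: "0 < s / 3^N" "s / 3^N <= s" using s by (auto intro: divide_pow3_le)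
 obtain et1 where et1: "et1 > 0" "!!c d z. norm (c - c0) < et1 ==> norm (d - d0) < et1 ==> norm z <= 10 ==>
   norm ((cub c d ^^ N) z - (cub c0 d0 ^^ N) z) < D"
  by (rule cub_funpow_param[OF D(1), of 10 c0 d0 N]) auto
 let ?X = "(%p. Complex (fst p) (snd p)) ` ({s/3^N..s} \<times> {0..2*pi})"
 have X: "compact ?X" "?X \<subseteq> hp 0"
 proof -
  show "compact ?X" unfolding Complex_eq
   by (intro compact_continuous_image compact_Times compact_Icc continuous_intros)
  show "?X \<subseteq> hp 0" using sN by auto
 qed
 obtain et2 where et2: "et2 > 0" "!!c d ze. con c d ==> norm (c - c0) < et2 ==> norm (d - d0) < et2 ==> ze \<in> ?X
  ==> norm (Psi c d ze - Psi c0 d0 ze) < D/8"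
  by (rule Psi_param_continuous[OF con0 X D8]) blast
 define et where "et = min et1 et2"
 have near: "dist (Psi c d (Complex a th)) (Psi c0 d0 (Complex a th)) < D/8"
  if cd: "con c d" "norm (c - c0) < et" "norm (d - d0) < et" and a: "s/3^N <= a" "a <= s" for c d a th
 proof -
  obtain n :: int where n: "0 <= th + 2 * pi * of_int n" "th + 2 * pi * of_int n <= 2 * pi" by (rule angle_reduce)
  have "Complex a (th + 2 * pi * of_int n) \<in> ?X" using a n by force
  hence "norm (Psi c d (Complex a (th + 2 * pi * of_int n)) - Psi c0 d0 (Complex a (th + 2 * pi * of_int n))) < D/8"
   using et2(2) cd by (auto simp: et_def)
  moreover have "0 < a" using a sN by linarith
  ultimately show ?thesis using Psi_ray_period[OF cd(1)] Psi_ray_period[OF con0] by (simp add: dist_norm)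
 qed
 \<comment> \<open>Induction over the fundamental pieces of the ray, for all angles at once. The
   lower part is moved by N iterates of the unperturbed map, which differ from those of the
   perturbed map by less than \<open>D\<close>; it thus lies over a ball of radius \<open>de\<close>
   and has size at most \<open>D/8\<close>. The top piece is close to the unperturbed ray, which
   supplies the new centre.\<close>
 have tail: "\<exists>x\<in>fk c0 d0. \<forall>a. s / 3^(N * k) <= a --> a <= s --> dist x (Psi c d (Complex a th)) < D"
  if cd: "con c d" "norm (c - c0) < et" "norm (d - d0) < et" for c d k th
 proof (induction k arbitrary: th)
  case 0
  obtain x where x: "x \<in> fk c0 d0" "dist (Psi c0 d0 (Complex s th)) x < D/8" using s(1) s(4)[of s th] by auto
  have "dist x (Psi c d (Complex s th)) <= dist (Psi c d (Complex s th)) (Psi c0 d0 (Complex s th)) + dist (Psi c0 d0 (Complex s th)) x"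
   by (metis dist_commute dist_triangle)
  also have "... < D/8 + D/8" using near[OF cd, of s th] sN x(2) by (intro add_strict_mono) auto
  also have "... <= D" using D by simp
  finally show ?case using x(1) by (intro bexI[of _ x]) auto
 next
  case (Suc k)
  obtain x where x: "x \<in> fk c0 d0" "!!a. s / 3^(N * k) <= a ==> a <= s ==> dist x (Psi c d (Complex a (3^N * th))) < D"
   using Suc.IH[of "3^N * th"] by blast
  let ?t = "s / 3^(N * Suc k)"
  have t0: "?t > 0" "?t <= s / 3^N" using s(1) by (auto intro!: divide_left_mono power_increasing)
  let ?Y = "(%a. Psi c d (Complex a th)) ` {?t..s/3^N}"
  have Y: "connected ?Y"
   using t0 by (intro connected_continuous_image continuous_on_Psi_ray cd continuous_intros) (auto intro: less_le_trans)
  have FY: "(cub c0 d0 ^^ N) ` ?Y \<subseteq> ball x de"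
  proof
   fix w assume "w \<in> (cub c0 d0 ^^ N) ` ?Y"
   then obtain a where a: "?t <= a" "a <= s / 3^N" and w: "w = (cub c0 d0 ^^ N) (Psi c d (Complex a th))"
    by (elim imageE) (simp only: atLeastAtMost_iff, blast)
   have a0: "0 < a" "a <= 1" using less_le_trans[OF t0(1) a(1)] a(2) sN(2) s(2) by linarith+
   have "s / 3^(N * k) = 3^N * ?t" by (simp add: power_add)
   hence "s / 3^(N * k) <= 3^N * a" using a(1) by (metis mult_left_mono zero_le_numeral zero_le_power)
   moreover have "3^N * a <= s" using a(2) by (simp add: field_simps)
   ultimately have "dist x (Psi c d (Complex (3^N * a) (3^N * th))) < D" by (rule x(2))
   hence 1: "dist x ((cub c d ^^ N) (Psi c d (Complex a th))) < D" using Psi_ray_iter[OF cd(1) a0(1)] by simp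
   have "norm ((cub c d ^^ N) (Psi c d (Complex a th)) - (cub c0 d0 ^^ N) (Psi c d (Complex a th))) < D"
    using cd by (intro et1(2) Psi_ray_bound a0) (auto simp: et_def)
   hence 2: "dist ((cub c d ^^ N) (Psi c d (Complex a th))) ((cub c0 d0 ^^ N) (Psi c d (Complex a th))) < D"
    by (simp add: dist_norm)
   show "w \<in> ball x de"
    unfolding w mem_ball using 1 2 D(2) dist_triangle[of x "(cub c0 d0 ^^ N) (Psi c d (Complex a th))" "(cub c d ^^ N) (Psi c d (Complex a th))"] by linarith
  qed
  have diam: "dist (Psi c d (Complex a th)) (Psi c d (Complex (s/3^N) th)) <= D/8" if "?t <= a" "a <= s/3^N" for a
   using smD[OF N(2)[OF x(1)] Y FY, of "Psi c d (Complex a th)" "Psi c d (Complex (s/3^N) th)"] that t0 by auto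
  obtain x' where x': "x' \<in> fk c0 d0" "dist (Psi c0 d0 (Complex s th)) x' < D/8" using s(1) s(4)[of s th] by auto
  have up: "dist x' (Psi c d (Complex a th)) < 3 * (D/8)" if "s/3^N <= a" "a <= s" for a
  proof -
   have "dist x' (Psi c d (Complex a th)) <= dist x' (Psi c0 d0 (Complex s th)) + dist (Psi c0 d0 (Complex s th)) (Psi c0 d0 (Complex a th))
     + dist (Psi c0 d0 (Complex a th)) (Psi c d (Complex a th))"
    using dist_triangle[of x' "Psi c d (Complex a th)" "Psi c0 d0 (Complex s th)"]
     dist_triangle[of "Psi c0 d0 (Complex s th)" "Psi c d (Complex a th)" "Psi c0 d0 (Complex a th)"] by linarith
   moreover have "dist (Psi c0 d0 (Complex s th)) (Psi c0 d0 (Complex a th)) <= D/8"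
    using s(3)[of a s th] that by (simp add: dist_commute)
   ultimately show ?thesis using x'(2) near[OF cd that, of th] by (simp add: dist_commute)
  qed
  have "dist x' (Psi c d (Complex a th)) < D" if a: "?t <= a" "a <= s" for a
  proof (cases "s/3^N <= a")
   case True
   thus ?thesis using up[of a] a D by simp
  next
   case False
   hence "dist (Psi c d (Complex a th)) (Psi c d (Complex (s/3^N) th)) <= D/8" using diam a by simp
   moreover have "dist x' (Psi c d (Complex (s/3^N) th)) < 3 * (D/8)" using up[of "s/3^N"] sN by simp
   ultimately show ?thesis
    using D dist_triangle[of x' "Psi c d (Complex a th)" "Psi c d (Complex (s/3^N) th)"] by (simp add: dist_commute)
  qed
  thus ?case using x'(1) by blast
 qed
 show ?thesis
 proof
  show "et > 0" "s > 0" using et1 et2 s by (auto simp: et_def)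
  show "dist (Psi c d (Complex s th)) (Psi c0 d0 (Complex s th)) <= e"
   if "con c d" "norm (c - c0) < et" "norm (d - d0) < et" for c d th
   using near[OF that, of s th] sN D by simp
  fix c d assume cd: "con c d" "norm (c - c0) < et" "norm (d - d0) < et"
  show "tl c d s e"
   unfolding tl_def
  proof safe
   fix th a b assume ab: "0 < a" "a <= s" "0 < b" "b <= s"
   define u where "u = min a b"
   have u: "u > 0" "u <= a" "u <= b" using ab by (auto simp: u_def)
   obtain k where k: "s / u < 3^k" using real_arch_pow[of 3 "s / u"] by auto
   have "(3::real)^k <= 3^(N * k)" using N(1) by (intro power_increasing) auto
   hence "s / u < 3^(N * k)" using k by linarith
   hence "s / 3^(N * k) < u" using u(1) by (simp add: divide_less_eq mult.commute)
   hence le: "s / 3^(N * k) <= a" "s / 3^(N * k) <= b" using u by linarith+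
   obtain x where x: "\<forall>a. s / 3^(N * k) <= a --> a <= s --> dist x (Psi c d (Complex a th)) < D"
    using tail[OF cd, of k th] by blast
   have "dist x (Psi c d (Complex a th)) < D" "dist x (Psi c d (Complex b th)) < D"
    using x le ab by blast+
   thus "dist (Psi c d (Complex a th)) (Psi c d (Complex b th)) <= e"
    using D(3) dist_triangle[of "Psi c d (Complex a th)" "Psi c d (Complex b th)" x] by (simp add: dist_commute)
  qed
 qed
qed

section \<open>Landing points under uniform landing\<close>

definition UL :: "complex => complex => bool" where
 "UL c d \<longleftrightarrow> con c d & (\<forall>e>0. \<exists>s>0. tl c d s e)"

lemma mis_UL:
 assumes "mis c d" shows "UL c d"
 unfolding UL_def
proof (intro conjI allI impI)
 show con: "con c d" by (rule mis_con[OF assms])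
 fix e :: real assume "e > 0"
 then obtain et s where "et > 0" "s > 0" "!!c' d'. con c' d' ==> norm (c' - c) < et ==> norm (d' - d) < et ==> tl c' d' s e"
  by (rule tail_stability[OF assms]) blast
 thus "\<exists>s>0. tl c d s e" using con by (intro exI[of _ s]) auto
qed

definition gam :: "complex => complex => real => complex" where
 "gam c d th = lim (%n. Psi c d (Complex (inverse (real (Suc n))) th))"

lemma tl_commute: "tl c d = tl d c" and gam_commute: "gam c d = gam d c" and UL_commute: "UL c d = UL d c"
 unfolding tl_def UL_def gam_def by (simp_all add: Psi_commute[of c d] con_commute[of c d] tl_def)

lemma UL_con: "UL c d ==> con c d"
 by (simp add: UL_def)

lemma gam_seq:
 assumes "UL c d" shows "(%n. Psi c d (Complex (inverse (real (Suc n))) th)) \<longlonglongrightarrow> gam c d th"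
proof -
 have "Cauchy (%n. Psi c d (Complex (inverse (real (Suc n))) th))"
 proof (rule metric_CauchyI)
  fix e :: real assume "e > 0"
  then obtain s where s: "s > 0" "tl c d s (e/2)" using assms unfolding UL_def by (meson half_gt_zero)
  obtain M where M: "inverse (real (Suc M)) < s" using reals_Archimedean[OF s(1)] by blast
  have le: "inverse (real (Suc m)) <= s" if "m >= M" for m
  proof -
   have "inverse (real (Suc m)) <= inverse (real (Suc M))" using that by (intro le_imp_inverse_le) auto
   thus ?thesis using M by linarith
  qed
  have "dist (Psi c d (Complex (inverse (real (Suc m))) th)) (Psi c d (Complex (inverse (real (Suc n))) th)) < e"
   if "m >= M" "n >= M" for m n
  proof -
   have "dist (Psi c d (Complex (inverse (real (Suc m))) th)) (Psi c d (Complex (inverse (real (Suc n))) th)) <= e/2"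
    using s(2) le[OF that(1)] le[OF that(2)] unfolding tl_def by simp
   thus ?thesis using \<open>e > 0\<close> by simp
  qed
  thus "\<exists>M. \<forall>m\<ge>M. \<forall>n\<ge>M. dist (Psi c d (Complex (inverse (real (Suc m))) th)) (Psi c d (Complex (inverse (real (Suc n))) th)) < e"
   by blast
 qed
 thus ?thesis unfolding gam_def using Cauchy_convergent convergent_LIMSEQ_iff by blast
qed

lemma gam_tail:
 assumes "UL c d" "tl c d s e" "0 < a" "a <= s" shows "dist (Psi c d (Complex a th)) (gam c d th) <= e"
proof -
 obtain M where M: "inverse (real (Suc M)) < s" using reals_Archimedean[of s] assms by auto
 have "dist (Psi c d (Complex a th)) (Psi c d (Complex (inverse (real (Suc n))) th)) <= e" if "n >= M" for n
 proof -
  have "inverse (real (Suc n)) <= inverse (real (Suc M))" using that by (intro le_imp_inverse_le) auto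
  hence "inverse (real (Suc n)) <= s" using M by linarith
  moreover have "0 < inverse (real (Suc n))" by simp
  ultimately show ?thesis using assms(2-4) unfolding tl_def by blast
 qed
 moreover have "(%n. dist (Psi c d (Complex a th)) (Psi c d (Complex (inverse (real (Suc n))) th))) \<longlonglongrightarrow> dist (Psi c d (Complex a th)) (gam c d th)"
  by (intro tendsto_intros gam_seq assms)
 ultimately show ?thesis by (intro LIMSEQ_le_const2) blast+
qed

lemma gam_lim:
 assumes "UL c d" "a \<longlonglongrightarrow> 0" "!!n. 0 < a n" shows "(%n. Psi c d (Complex (a n) th)) \<longlonglongrightarrow> gam c d th"
proof (rule metric_LIMSEQ_I)
 fix e :: real assume e: "e > 0"
 then obtain s where s: "s > 0" "tl c d s (e/2)" using assms(1) unfolding UL_def by (meson half_gt_zero)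
 obtain M where "!!n. n >= M ==> a n < s"
  using order_tendstoD(2)[OF assms(2) s(1)] by (auto simp: eventually_sequentially)
 hence "dist (Psi c d (Complex (a n) th)) (gam c d th) <= e/2" if "n >= M" for n
  using gam_tail[OF assms(1) s(2) assms(3)] that less_imp_le by blast
 thus "\<exists>M. \<forall>n\<ge>M. dist (Psi c d (Complex (a n) th)) (gam c d th) < e"
  using e by (intro exI[of _ M]) force
qed

lemma gam_cub:
 assumes "UL c d" shows "cub c d (gam c d th) = gam c d (3 * th)"
proof -
 have "(%n. cub c d (Psi c d (Complex (inverse (real (Suc n))) th))) \<longlonglongrightarrow> cub c d (gam c d th)"
  by (intro tendsto_intros gam_seq assms)
 hence "(%n. Psi c d (Complex (3 * inverse (real (Suc n))) (3 * th))) \<longlonglongrightarrow> cub c d (gam c d th)"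
  using Psi_ray_cub[OF UL_con[OF assms]] by simp
 moreover have "(%n. Psi c d (Complex (3 * inverse (real (Suc n))) (3 * th))) \<longlonglongrightarrow> gam c d (3 * th)"
 proof (rule gam_lim[OF assms])
  show "(%n. 3 * inverse (real (Suc n))) \<longlonglongrightarrow> 0" using tendsto_mult_right_zero[OF LIMSEQ_inverse_real_of_nat] by simp
 qed auto
 ultimately show ?thesis using LIMSEQ_unique by blast
qed

lemma gam_iter: "UL c d ==> (cub c d ^^ k) (gam c d th) = gam c d (3^k * th)"
 by (induction k) (simp_all add: gam_cub mult.assoc)

lemma gam_period: "UL c d ==> gam c d (th + 2 * pi * of_int n) = gam c d th"
 unfolding gam_def using Psi_ray_period[OF UL_con] by simp

lemma gam_in_fk: "UL c d ==> gam c d th \<in> fk c d"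
 by (rule Psi_boundary[OF UL_con _ _ gam_seq]) (use LIMSEQ_inverse_real_of_nat in auto)

lemma gam_continuous:
 assumes "UL c d" shows "continuous_on S (gam c d)"
proof -
 have "continuous_on UNIV (gam c d)"
 proof (rule uniform_limit_theorem)
  show "\<forall>\<^sub>F n in sequentially. continuous_on UNIV (%th. Psi c d (Complex (inverse (real (Suc n))) th))"
   by (intro always_eventually allI continuous_on_Psi_ray UL_con assms continuous_intros) auto
  show "uniform_limit UNIV (%n th. Psi c d (Complex (inverse (real (Suc n))) th)) (gam c d) sequentially"
   unfolding uniform_limit_iff
  proof safe
   fix e :: real assume e: "e > 0"
   then obtain s where s: "s > 0" "tl c d s (e/2)" using assms(1) unfolding UL_def by (meson half_gt_zero)
   have "eventually (%n. inverse (real (Suc n)) < s) sequentially"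
    by (rule order_tendstoD(2)[OF LIMSEQ_inverse_real_of_nat s(1)])
   thus "\<forall>\<^sub>F n in sequentially. \<forall>th\<in>UNIV. dist (Psi c d (Complex (inverse (real (Suc n))) th)) (gam c d th) < e"
   proof eventually_elim
    case (elim n)
    show ?case
    proof
     fix th
     have "dist (Psi c d (Complex (inverse (real (Suc n))) th)) (gam c d th) <= e/2"
      using gam_tail[OF assms s(2)] elim by simp
     thus "dist (Psi c d (Complex (inverse (real (Suc n))) th)) (gam c d th) < e" using e by simp
    qed
   qed
  qed
 qed auto
 thus ?thesis using continuous_on_subset by blast
qed

text \<open>A boundary point is a limit of escaping points, each on some ray. Their potentials tend
  to 0, since otherwise a fixed iterate would already be far out, and their angles
  accumulate.\<close>

lemma gam_onto_frontier:
 assumes UL: "UL c d" and z: "z \<in> frontier (fk c d)" obtains th where "0 <= th" "th <= 2 * pi" "gam c d th = z"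
proof -
 note con = UL_con[OF UL]
 have zc: "z \<in> closure (- fk c d)" "z \<in> fk c d" using z closed_fk by (auto simp: frontier_closures)
 then obtain w where w: "!!n. w n \<notin> fk c d" "w \<longlonglongrightarrow> z" unfolding closure_sequential by auto
 have "\<exists>a th. 0 < a & 0 <= th & th <= 2 * pi & Psi c d (Complex a th) = w n" for n
 proof -
  obtain ze where ze: "ze \<in> hp 0" "Psi c d ze = w n" using Psi_surj[OF con w(1)] by blast
  obtain m :: int where m: "0 <= Im ze + 2 * pi * of_int m" "Im ze + 2 * pi * of_int m <= 2 * pi" by (rule angle_reduce)
  have "Psi c d (Complex (Re ze) (Im ze + 2 * pi * of_int m)) = w n"
   using Psi_ray_period[OF con, of "Re ze" "Im ze" m] ze by (simp add: hp_def)
  thus ?thesis using ze m by (intro exI[of _ "Re ze"] exI conjI) (auto simp: hp_def)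
 qed
 then obtain a th where a: "!!n. 0 < a n" "!!n. 0 <= th n" "!!n. th n <= 2 * pi" "!!n. Psi c d (Complex (a n) (th n)) = w n"
  by metis
 have alim: "a \<longlonglongrightarrow> 0"
 proof (rule ccontr)
  assume "~ a \<longlonglongrightarrow> 0"
  then obtain eps where eps: "eps > 0" "!!M. \<exists>n\<ge>M. \<bar>a n\<bar> >= eps"
   unfolding LIMSEQ_iff by (auto simp: not_less)
  obtain k where k: "3^k * eps > 20" using real_arch_pow[of 3 "20 / eps"] eps(1) by (auto simp: divide_less_eq)
  have "(%n. norm ((cub c d ^^ k) (w n))) \<longlonglongrightarrow> norm ((cub c d ^^ k) z)" by (intro tendsto_intros w)
  moreover have "norm ((cub c d ^^ k) z) < 11" using fk_bounded[OF fk_funpow[OF zc(2)], of k] by simp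
  ultimately have "eventually (%n. norm ((cub c d ^^ k) (w n)) < 11) sequentially" by (rule order_tendstoD(2))
  then obtain M where M: "!!n. n >= M ==> norm ((cub c d ^^ k) (w n)) < 11" by (auto simp: eventually_sequentially)
  obtain n where n: "n >= M" "a n >= eps" using eps(2)[of M] a(1) by (auto simp: abs_of_pos)
  let ?ze = "Complex (3^k * a n) (3^k * th n)"
  have "3^k * eps <= 3^k * a n" using n by simp
  hence "10 < 3^k * a n" using k by linarith
  hence h: "?ze \<in> hp 10" by simp
  have "(cub c d ^^ k) (w n) = Psi c d ?ze" using Psi_ray_iter[OF con a(1)] a(4) by metis
  moreover have "norm (Psi c d ?ze - exp ?ze) <= 1/10 * norm (exp ?ze)" by (rule Psi_near[OF con h])
  ultimately have "norm (exp ?ze) <= 20"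
   using M[OF n(1)] norm_triangle_ineq2[of "exp ?ze" "Psi c d ?ze"] by (simp add: norm_minus_commute)
  thus False using norm_exp_ge_1000[OF h] by linarith
 qed
 have "\<forall>n. th n \<in> {0..2*pi}" using a by simp
 then obtain t q where t: "t \<in> {0..2*pi}" "strict_mono (q :: nat => nat)" "(th \<circ> q) \<longlonglongrightarrow> t"
  by (rule seq_compactE[OF compact_imp_seq_compact[OF compact_Icc]]) blast
 have "isCont (gam c d) t" using gam_continuous[OF UL, of UNIV] by (simp add: continuous_on_eq_continuous_at)
 hence 1: "(%n. gam c d (th (q n))) \<longlonglongrightarrow> gam c d t" using isCont_tendsto_compose[OF _ t(3)] by (simp add: o_def)
 have 2: "(%n. w (q n)) \<longlonglongrightarrow> z" using LIMSEQ_subseq_LIMSEQ[OF w(2) t(2)] by (simp add: o_def)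
 have "(%n. w (q n) - gam c d (th (q n))) \<longlonglongrightarrow> 0"
 proof (rule LIMSEQ_I)
  fix e :: real assume e: "e > 0"
  then obtain s where s: "s > 0" "tl c d s (e/2)" using UL unfolding UL_def by (meson half_gt_zero)
  have "eventually (%n. a (q n) < s) sequentially"
   using order_tendstoD(2)[OF LIMSEQ_subseq_LIMSEQ[OF alim t(2)] s(1)] by (simp add: o_def)
  then obtain M where M: "!!n. n >= M ==> a (q n) < s" by (auto simp: eventually_sequentially)
  have "norm (w (q n) - gam c d (th (q n)) - 0) < e" if "n >= M" for n
   using gam_tail[OF UL s(2) a(1)[of "q n"], of "th (q n)"] M[OF that] a(4) e by (simp add: dist_norm)
  thus "\<exists>M. \<forall>n\<ge>M. norm (w (q n) - gam c d (th (q n)) - 0) < e" by blast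
 qed
 from tendsto_diff[OF 2 this] have "(%n. gam c d (th (q n))) \<longlonglongrightarrow> z" by simp
 hence "gam c d t = z" using 1 LIMSEQ_unique by blast
 thus ?thesis using that t(1) by auto
qed

text \<open>Short tails reduce the comparison to the fixed potential \<open>s\<close>. Of the five
  parts of \<open>e\<close>, two are for the tails of both maps, one is for the change of parameter,
  one for the change of angle, and one is spare.\<close>

lemma gam_stability:
 assumes mis: "mis c0 d0" and e: "e > 0"
 obtains et where "et > 0" "!!c d th th0. UL c d ==> norm (c - c0) < et ==> norm (d - d0) < et ==> \<bar>th - th0\<bar> < et ==>
  dist (gam c d th) (gam c0 d0 th0) < e"
proof -
 have e4: "e/5 > 0" using e by simp
 note UL0 = mis_UL[OF mis]
 obtain et1 s where *: "et1 > 0" "s > 0"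
  "!!c d. con c d ==> norm (c - c0) < et1 ==> norm (d - d0) < et1 ==> tl c d s (e/5)"
  "!!c d th. con c d ==> norm (c - c0) < et1 ==> norm (d - d0) < et1 ==> dist (Psi c d (Complex s th)) (Psi c0 d0 (Complex s th)) <= e/5"
  by (rule tail_stability[OF mis e4]) blast
 have uc0: "uniformly_continuous_on {-1..2*pi+1} (gam c0 d0)"
  by (rule compact_uniformly_continuous[OF gam_continuous[OF UL0] compact_Icc])
 obtain et2 where et2: "et2 > 0" "!!x x'. x \<in> {-1..2*pi+1} ==> x' \<in> {-1..2*pi+1} ==> dist x' x < et2 ==> dist (gam c0 d0 x') (gam c0 d0 x) < e/5"
  by (rule uniformly_continuous_onE[OF uc0 e4]) blast
 have uc: "dist (gam c0 d0 x') (gam c0 d0 x) < e/5" if "\<bar>x' - x\<bar> < min 1 et2" for x x'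
 proof -
  obtain n :: int where n: "0 <= x + 2 * pi * of_int n" "x + 2 * pi * of_int n <= 2 * pi" by (rule angle_reduce)
  have "dist (gam c0 d0 (x' + 2 * pi * of_int n)) (gam c0 d0 (x + 2 * pi * of_int n)) < e/5"
   using n that by (intro et2(2)) (auto simp: dist_real_def)
  thus ?thesis by (simp add: gam_period[OF UL0])
 qed
 define et where "et = min et1 (min 1 et2)"
 have "dist (gam c d th) (gam c0 d0 th0) < e"
  if UL: "UL c d" and cd: "norm (c - c0) < et" "norm (d - d0) < et" "\<bar>th - th0\<bar> < et" for c d th th0
 proof -
  have "dist (Psi c d (Complex s th)) (gam c d th) <= e/5"
   by (rule gam_tail[OF UL *(3)[OF UL_con[OF UL]] *(2)]) (use cd in \<open>auto simp: et_def\<close>)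
  moreover have "dist (Psi c d (Complex s th)) (Psi c0 d0 (Complex s th)) <= e/5"
   by (rule *(4)[OF UL_con[OF UL]]) (use cd in \<open>auto simp: et_def\<close>)
  moreover have "dist (Psi c0 d0 (Complex s th)) (gam c0 d0 th) <= e/5"
   by (rule gam_tail[OF UL0 *(3)[OF UL_con[OF UL0]] *(2)]) (use *(1) in auto)
  moreover have "dist (gam c0 d0 th) (gam c0 d0 th0) < e/5"
   by (rule uc) (use cd in \<open>auto simp: et_def\<close>)
  ultimately show ?thesis
   using dist_triangle[of "gam c d th" "gam c0 d0 th0" "Psi c d (Complex s th)"]
    dist_triangle[of "Psi c d (Complex s th)" "gam c0 d0 th0" "Psi c0 d0 (Complex s th)"]
    dist_triangle[of "Psi c0 d0 (Complex s th)" "gam c0 d0 th0" "gam c0 d0 th"] e by (simp add: dist_commute)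
 qed
 moreover have "et > 0" using *(1) et2(1) by (simp add: et_def)
 ultimately show ?thesis using that by blast
qed

section \<open>Sectors\<close>

lemma Psi_ray_inj:
 assumes "con c d" "0 < x" "0 < x'" "Psi c d (Complex x t) = Psi c d (Complex x' t')"
 obtains n :: int where "x = x'" "t = t' + 2 * pi * of_int n"
proof -
 obtain n :: int where "Complex x t = Complex x' t' + 2 * pi * \<i> * of_int n"
  by (rule Psi_inj[OF assms(1) _ _ assms(4)]) (use assms in auto)
 hence "x = x'" "t = t' + 2 * pi * of_int n" by (simp_all add: complex_eq_iff)
 thus ?thesis using that by blast
qed

lemma int_period_small:
 assumes "t = t' + 2 * pi * of_int n" "\<bar>t - t'\<bar> < 2 * pi" shows "t = t'"
proof -
 have "2 * pi * \<bar>of_int n\<bar> < 2 * pi * 1" using assms by (simp add: abs_mult)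
 hence "\<bar>of_int n :: real\<bar> < 1" by (simp only: mult_less_cancel_left_pos pi_gt_zero mult_pos_pos zero_less_numeral)
 hence "n = 0" by linarith
 thus ?thesis using assms by simp
qed

lemma Psi_ray_inj_small:
 assumes "con c d" "0 < x" "0 < x'" "Psi c d (Complex x t) = Psi c d (Complex x' t')" "\<bar>t - t'\<bar> < 2 * pi"
 shows "x = x' & t = t'"
 using Psi_ray_inj[OF assms(1-4)] int_period_small[OF _ assms(5)] by metis

definition ray :: "complex => complex => real => real => complex" where
 "ray c d th t = (if t <= 0 then gam c d th else Psi c d (Complex t th))"

lemma ray_arc:
 assumes UL: "UL c d" shows "arc (ray c d th)"
 unfolding arc_def path_def
proof
 note con = UL_con[OF UL]
 show "continuous_on {0..1} (ray c d th)"
  unfolding continuous_on_def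
 proof
  fix t :: real assume t: "t \<in> {0..1}"
  show "(ray c d th \<longlongrightarrow> ray c d th t) (at t within {0..1})"
  proof (cases "t = 0")
   case True
   show ?thesis
    unfolding tendsto_iff
   proof safe
    fix e :: real assume e: "e > 0"
    then obtain s where s: "s > 0" "tl c d s (e/2)" using UL unfolding UL_def by (meson half_gt_zero)
    have "dist (ray c d th x) (ray c d th t) < e" if "x \<in> {0..1}" "dist x t < s" for x
    proof (cases "x = 0")
     case False
     hence "dist (Psi c d (Complex x th)) (gam c d th) <= e/2"
      using that True by (intro gam_tail[OF UL s(2)]) (auto simp: dist_real_def)
     thus ?thesis using e that False True by (simp add: ray_def)
    qed (use True e in simp)
    thus "\<forall>\<^sub>F x in at t within {0..1}. dist (ray c d th x) (ray c d th t) < e"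
     unfolding eventually_at using s(1) by blast
   qed
  next
   case False
   hence t0: "t > 0" using t by simp
   have "continuous_on {0<..} (%x. Psi c d (Complex x th))"
    by (intro continuous_on_Psi_ray con continuous_intros) auto
   hence "continuous_on {0<..} (ray c d th)"
    by (rule continuous_on_eq) (simp add: ray_def)
   hence "isCont (ray c d th) t" using t0 by (simp add: continuous_on_eq_continuous_at)
   thus ?thesis unfolding isCont_def by (rule tendsto_within_subset) simp
  qed
 qed
 show "inj_on (ray c d th) {0..1}"
 proof (rule inj_onI)
  fix x y :: real assume xy: "x \<in> {0..1}" "y \<in> {0..1}" "ray c d th x = ray c d th y"
  have *: "ray c d th t \<in> fk c d \<longleftrightarrow> t = 0" if "t \<in> {0..1}" for t
   using that gam_in_fk[OF UL] Psi_notin_fk[OF con] by (auto simp: ray_def)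
  show "x = y"
  proof (cases "x = 0 \<or> y = 0")
   case True
   thus ?thesis using * xy by metis
  next
   case False
   thus ?thesis using Psi_ray_inj_small[OF con, of x y th th] xy by (simp add: ray_def)
  qed
 qed
qed

lemma ray_image: "path_image (ray c d th) = insert (gam c d th) {Psi c d (Complex t th) | t. 0 < t & t <= 1}"
proof -
 have "{0..1::real} = insert 0 {t. 0 < t & t <= 1}" by auto
 thus ?thesis unfolding path_image_def by (auto simp: ray_def)
qed

text \<open>Two rays landing at the same point, closed up along an equipotential, form a Jordan curve that meets
 the filled Julia set in the common landing point only.\<close>

lemma sector_inside_outside:
 assumes UL: "UL c d" and p: "gam c d a = p" "gam c d b = p" and ab: "a < b" "b < a + 2 * pi"
 obtains I U where "open I" "open U" "I \<inter> U = {}" "fk c d - {p} \<subseteq> I \<union> U"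
  "!!u. a < u ==> u < b ==> gam c d u ~= p ==> gam c d u \<in> I"
  "!!v. b < v ==> v < a + 2 * pi ==> gam c d v ~= p ==> gam c d v \<in> U"
proof -
 note con = UL_con[OF UL]
 define lev where "lev t = Psi c d (Complex 1 (a + t * (b - a)))" for t :: real
 have lev_arc: "arc lev"
  unfolding arc_def path_def
 proof
  show "continuous_on {0..1} lev"
   unfolding lev_def by (intro continuous_on_Psi_ray con continuous_intros) auto
  show "inj_on lev {0..1}"
  proof (rule inj_onI)
   fix x y :: real assume xy: "x \<in> {0..1}" "y \<in> {0..1}" "lev x = lev y"
   have "x * (b - a) <= 1 * (b - a)" "y * (b - a) <= 1 * (b - a)" "0 <= x * (b - a)" "0 <= y * (b - a)"
    using xy(1,2) ab by (intro mult_right_mono mult_nonneg_nonneg; simp)+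
   moreover have "\<bar>(a + X) - (a + Y)\<bar> < 2 * pi" if "X <= 1 * (b - a)" "Y <= 1 * (b - a)" "0 <= X" "0 <= Y" for X Y
   proof -
    have "X - Y < 2 * pi" "Y - X < 2 * pi" using that ab by simp_all
    thus ?thesis by (simp add: abs_less_iff)
   qed
   ultimately have "\<bar>(a + x * (b - a)) - (a + y * (b - a))\<bar> < 2 * pi" by blast
   hence "a + x * (b - a) = a + y * (b - a)"
    using Psi_ray_inj_small[OF con, of 1 1 "a + x * (b - a)" "a + y * (b - a)"] xy(3) by (simp add: lev_def)
   thus "x = y" using ab by simp
  qed
 qed
 have lev_im: "path_image lev = {Psi c d (Complex 1 t) | t. a <= t & t <= b}"
 proof -
  have "{Psi c d (Complex 1 t) | t. a <= t & t <= b} \<subseteq> path_image lev"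
  proof clarify
   fix t assume t: "a <= t" "t <= b"
   have "lev ((t - a) / (b - a)) = Psi c d (Complex 1 t)" using ab by (simp add: lev_def)
   moreover have "(t - a) / (b - a) \<in> {0..1}" using t ab by (auto simp: divide_le_eq)
   ultimately show "Psi c d (Complex 1 t) \<in> path_image lev" unfolding path_image_def by (metis imageI)
  qed
  moreover have "path_image lev \<subseteq> {Psi c d (Complex 1 t) | t. a <= t & t <= b}"
  proof
   fix w assume "w \<in> path_image lev"
   then obtain x where x: "x \<in> {0..1}" "w = lev x" by (auto simp: path_image_def)
   have "x * (b - a) <= 1 * (b - a)" using x ab by (intro mult_right_mono) auto
   moreover have "0 <= x * (b - a)" using x ab by simp
   moreover have "a <= a + X & a + X <= b" if "X <= 1 * (b - a)" "0 <= X" for X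
    using that by simp
   ultimately have "a <= a + x * (b - a)" "a + x * (b - a) <= b" by blast+
   thus "w \<in> {Psi c d (Complex 1 t) | t. a <= t & t <= b}" using x(2) unfolding lev_def by blast
  qed
  ultimately show ?thesis by blast
 qed
 define g where "g = (ray c d a +++ lev) +++ reversepath (ray c d b)"
 have ends: "pathstart (ray c d a) = p" "pathfinish (ray c d a) = pathstart lev" "pathfinish lev = pathfinish (ray c d b)" "pathstart (ray c d b) = p"
  using p by (simp_all add: pathstart_def pathfinish_def ray_def lev_def)
 have eqS: "t = t'" if "Psi c d (Complex x t) = Psi c d (Complex x' t')" "0 < x" "0 < x'" "t \<in> {a..b}" "t' \<in> {a..b}" for x x' t t'
  using Psi_ray_inj_small[OF con that(2,3,1)] that(4,5) ab by auto
 have eqX: "x = x'" if "Psi c d (Complex x t) = Psi c d (Complex x' t')" "0 < x" "0 < x'" for x x' t t'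
  using Psi_ray_inj[OF con that(2,3,1)] by metis
 have pn: "Psi c d (Complex x t) ~= p" if "0 < x" for x t
  using Psi_notin_fk[OF con, of "Complex x t"] gam_in_fk[OF UL, of a] p(1) that by auto
 have arc1: "arc (ray c d a +++ lev)"
 proof (rule arc_join[OF ray_arc[OF UL] lev_arc ends(2)])
  show "path_image (ray c d a) \<inter> path_image lev \<subseteq> {pathstart lev}"
  proof
   fix w assume w: "w \<in> path_image (ray c d a) \<inter> path_image lev"
   then obtain t where t: "w = Psi c d (Complex 1 t)" "a <= t" "t <= b" unfolding lev_im by blast
   hence "w ~= gam c d a" using pn[of 1 t] p by simp
   then obtain x where x: "w = Psi c d (Complex x a)" "0 < x" "x <= 1" using w unfolding ray_image by blast
   have "t = a" using eqS[of 1 t x a] t x ab by simp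
   thus "w \<in> {pathstart lev}" using t by (simp add: pathstart_def lev_def)
  qed
 qed
 have im1: "path_image (ray c d a +++ lev) = path_image (ray c d a) \<union> path_image lev"
  using ends(2) by (rule path_image_join)
 have simp: "simple_path g"
  unfolding g_def
 proof (rule simple_path_join_loop)
  show "arc (ray c d a +++ lev)" by (rule arc1)
  show "arc (reversepath (ray c d b))" using ray_arc[OF UL] by (simp add: arc_reversepath)
  show "pathfinish (ray c d a +++ lev) = pathstart (reversepath (ray c d b))" using ends by simp
  show "pathfinish (reversepath (ray c d b)) = pathstart (ray c d a +++ lev)" using ends by simp
  show "path_image (ray c d a +++ lev) \<inter> path_image (reversepath (ray c d b))
    \<subseteq> {pathstart (ray c d a +++ lev), pathstart (reversepath (ray c d b))}"
  proof
   fix w assume w: "w \<in> path_image (ray c d a +++ lev) \<inter> path_image (reversepath (ray c d b))"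
   show "w \<in> {pathstart (ray c d a +++ lev), pathstart (reversepath (ray c d b))}"
   proof (cases "w = p")
    case False
    then obtain x where x: "w = Psi c d (Complex x b)" "0 < x" "x <= 1"
     using w p unfolding path_image_reversepath ray_image by blast
    have "w \<notin> path_image (ray c d a)"
    proof
     assume "w \<in> path_image (ray c d a)"
     then obtain y where "w = Psi c d (Complex y a)" "0 < y" using False p unfolding ray_image by blast
     thus False using eqS[of x b y a] x ab by simp
    qed
    hence "w \<in> path_image lev" using w im1 by blast
    then obtain t where t: "w = Psi c d (Complex 1 t)" "a <= t" "t <= b" unfolding lev_im by blast
    hence "t = b" using eqS[of x b 1 t] x ab by simp
    hence "w = pathfinish (ray c d b)" using t(1) by (simp add: pathfinish_def ray_def)
    thus ?thesis by simp
   qed (use ends in simp)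
  qed
 qed
 have loop: "pathfinish g = pathstart g" using ends by (simp add: g_def)
 have img: "path_image g = path_image (ray c d a) \<union> path_image lev \<union> path_image (ray c d b)"
  unfolding g_def using ends im1 by (subst path_image_join) auto
 have img_cases: "\<exists>x t. w = Psi c d (Complex x t) & 0 < x & x <= 1 & a <= t & t <= b & (x = 1 \<or> t = a \<or> t = b)"
  if w: "w \<in> path_image g" "w ~= p" for w
 proof -
  have "w \<in> path_image lev \<or> (\<exists>x. w = Psi c d (Complex x a) & 0 < x & x <= 1) \<or> (\<exists>x. w = Psi c d (Complex x b) & 0 < x & x <= 1)"
   using w p unfolding img ray_image by auto
  thus ?thesis
  proof (elim disjE exE conjE)
   assume "w \<in> path_image lev"
   then obtain t where "w = Psi c d (Complex 1 t)" "a <= t" "t <= b" unfolding lev_im by blast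
   thus ?thesis by (intro exI[of _ 1] exI[of _ t]) simp
  next
   fix x assume "w = Psi c d (Complex x a)" "0 < x" "x <= 1"
   thus ?thesis using ab by (intro exI[of _ x] exI[of _ a]) simp
  next
   fix x assume "w = Psi c d (Complex x b)" "0 < x" "x <= 1"
   thus ?thesis using ab by (intro exI[of _ x] exI[of _ b]) simp
  qed
 qed
 let ?I = "inside (path_image g)" and ?U = "outside (path_image g)"
 note J = Jordan_inside_outside[OF simp loop]
 have gfk: "path_image g \<inter> fk c d \<subseteq> {p}"
  unfolding img lev_im ray_image using p Psi_notin_fk[OF con] by auto
 \<comment> \<open>Regions of the parametrisation that miss the curve: the strip between the two
   angles below potential 1, and the complementary strip, to be joined with everything above
   potential 1.\<close>
 define O1 where "O1 = {z. 0 < Re z & Re z < 1 & a < Im z & Im z < b}"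
 define O2 where "O2 = {z. 0 < Re z & b < Im z & Im z < a + 2 * pi}"
 have conv: "connected O1" "connected O2"
 proof -
  have "O1 = {z. Re z > 0} \<inter> {z. Re z < 1} \<inter> {z. Im z > a} \<inter> {z. Im z < b}" by (auto simp: O1_def)
  hence "convex O1" by (auto intro!: convex_Int convex_halfspace_Re_gt convex_halfspace_Re_lt convex_halfspace_Im_gt convex_halfspace_Im_lt)
  thus "connected O1" by (rule convex_connected)
  have "O2 = {z. Re z > 0} \<inter> {z. Im z > b} \<inter> {z. Im z < a + 2 * pi}" by (auto simp: O2_def)
  hence "convex O2" by (auto intro!: convex_Int convex_halfspace_Re_gt convex_halfspace_Im_gt convex_halfspace_Im_lt)
  thus "connected O2" by (rule convex_connected)
 qed
 have sub: "O1 \<subseteq> hp 0" "O2 \<union> hp 1 \<subseteq> hp 0" by (auto simp: O1_def O2_def hp_def)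
 have c1: "connected (Psi c d ` O1)"
  using conv(1) sub(1) Psi_continuous[OF con] by (intro connected_continuous_image) (auto intro: continuous_on_subset)
 have "Complex 2 ((b + a + 2 * pi)/2) \<in> O2 \<inter> hp 1" using ab by (simp add: O2_def)
 hence "connected (O2 \<union> hp 1)" using conv(2) by (intro connected_Un) auto
 hence c2: "connected (Psi c d ` (O2 \<union> hp 1))"
  using sub(2) Psi_continuous[OF con] by (intro connected_continuous_image) (auto intro: continuous_on_subset)
 have disj1: "Psi c d z \<notin> path_image g" if z: "z \<in> O1" for z
 proof
  assume "Psi c d z \<in> path_image g"
  have z0: "0 < Re z" "Re z < 1" "Im z \<in> {a..b}" "Im z ~= a" "Im z ~= b" using z by (auto simp: O1_def)
  have "Psi c d z ~= p" using pn[OF z0(1), of "Im z"] by simp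
  with \<open>Psi c d z \<in> path_image g\<close> obtain x t where xt: "Psi c d z = Psi c d (Complex x t)" "0 < x" "x <= 1" "a <= t" "t <= b" "x = 1 \<or> t = a \<or> t = b"
   using img_cases by blast
  hence eq: "Psi c d (Complex (Re z) (Im z)) = Psi c d (Complex x t)" by simp
  have "Re z = x" using eqX[OF eq z0(1) xt(2)] .
  moreover have "Im z = t" using eqS[OF eq z0(1) xt(2)] z0 xt by simp
  ultimately show False using z0 xt(6) by auto
 qed
 have disj2: "Psi c d z \<notin> path_image g" if z: "z \<in> O2 \<union> hp 1" for z
 proof
  assume "Psi c d z \<in> path_image g"
  have z0: "0 < Re z" using z by (auto simp: O2_def hp_def)
  have "Psi c d z ~= p" using pn[OF z0, of "Im z"] by simp
  with \<open>Psi c d z \<in> path_image g\<close> obtain x t where xt: "Psi c d z = Psi c d (Complex x t)" "0 < x" "x <= 1" "a <= t" "t <= b"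
   using img_cases by blast
  hence "Psi c d (Complex (Re z) (Im z)) = Psi c d (Complex x t)" by simp
  hence "Re z = x" by (rule eqX) (use z0 xt in auto)
  hence zO: "z \<in> O2" using z xt by (auto simp: hp_def)
  have "\<bar>Im z - t\<bar> < 2 * pi" using zO xt by (auto simp: O2_def)
  hence "Im z = t" using Psi_ray_inj_small[OF con z0 xt(2), of "Im z" t] xt(1) by simp
  thus False using zO xt by (auto simp: O2_def)
 qed
 have comp: "T \<subseteq> ?I \<or> T \<subseteq> ?U" if "connected T" "T \<inter> path_image g = {}" for T
 proof -
  have "T \<subseteq> ?I \<union> ?U" using J that(2) by blast
  moreover have "?I \<inter> ?U \<inter> T = {}" using J by blast
  ultimately have "?I \<inter> T = {} \<or> ?U \<inter> T = {}" using connectedD[OF that(1), of ?I ?U] J by blast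
  thus ?thesis using \<open>T \<subseteq> ?I \<union> ?U\<close> by blast
 qed
 \<comment> \<open>\<open>Psi\<close> is comparable to \<open>exp\<close> far out, so the image is
   unbounded and cannot be inside.\<close>
 have U2: "Psi c d ` (O2 \<union> hp 1) \<subseteq> ?U"
 proof (rule ccontr)
  assume "~ ?thesis"
  hence "Psi c d ` (O2 \<union> hp 1) \<subseteq> ?I" using comp[OF c2] disj2 by blast
  hence "bounded (Psi c d ` (O2 \<union> hp 1))" using J bounded_subset by blast
  then obtain B where B: "!!z. z \<in> hp 1 ==> norm (Psi c d z) <= B" unfolding bounded_iff by blast
  obtain k where k: "2^k > 2 * (\<bar>B\<bar> + 1)" using real_arch_pow[of 2 "2 * (\<bar>B\<bar> + 1)"] by auto
  let ?z = "of_real (11 + 2^k) :: complex"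
  have k0: "(0::real) < 2^k" by simp
  hence "(10::real) < 11 + 2^k" "(1::real) < 11 + 2^k" by linarith+
  hence h: "?z \<in> hp 10" "?z \<in> hp 1" unfolding hp_def by (simp_all only: mem_Collect_eq Re_complex_of_real)
  have "norm (Psi c d ?z - exp ?z) <= 1/10 * norm (exp ?z)" by (rule Psi_near[OF con h(1)])
  moreover have "norm (exp ?z) >= 1 + (11 + 2^k)"
   using exp_ge_add_one_self[of "11 + 2^k"] by (simp add: norm_exp_eq_Re)
  moreover have "norm (exp ?z) - norm (Psi c d ?z) <= norm (Psi c d ?z - exp ?z)"
   unfolding norm_minus_commute[of "Psi c d ?z"] by (rule norm_triangle_ineq2)
  ultimately have "norm (Psi c d ?z) >= (1 + (11 + 2^k)) / 2"
   using k0 by argo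
  thus False using B[OF h(2)] k by simp
 qed
 \<comment> \<open>Every point of the curve is a boundary point of the inside. Near the middle of
   the equipotential arc, inside points can only come from the strip below the arc.\<close>
 have I1: "Psi c d ` O1 \<subseteq> ?I"
 proof (rule ccontr)
  assume "~ ?thesis"
  hence U1: "Psi c d ` O1 \<subseteq> ?U" using comp[OF c1] disj1 by blast
  define t0 where "t0 = (a + b) / 2"
  define eps where "eps = min (1/2) ((b - a) / 4)"
  let ?B = "ball (Complex 1 t0) eps"
  have eps: "eps > 0" "eps <= 1/2" "eps <= (b - a)/4"
  proof -
   show "eps > 0" using ab by (simp add: eps_def)
   show "eps <= 1/2" unfolding eps_def by (rule min.cobounded1)
   show "eps <= (b - a)/4" unfolding eps_def by (rule min.cobounded2)
  qed
  have Bz: "\<bar>Re z - 1\<bar> < 1/2 & \<bar>Im z - t0\<bar> < (b - a)/4" if "z \<in> ?B" for z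
  proof -
   have "norm (z - Complex 1 t0) < eps" using that by (simp add: dist_norm norm_minus_commute)
   hence "\<bar>Re (z - Complex 1 t0)\<bar> < eps" "\<bar>Im (z - Complex 1 t0)\<bar> < eps"
    using abs_Re_le_cmod abs_Im_le_cmod le_less_trans by blast+
   thus ?thesis using eps by simp
  qed
  have BO: "z \<in> hp 0 & a < Im z & Im z < b" if "z \<in> ?B" for z
   using Bz[OF that] unfolding hp_def t0_def mem_Collect_eq by argo
  have inj: "inj_on (Psi c d) ?B"
  proof (rule inj_onI)
   fix x y assume xy: "x \<in> ?B" "y \<in> ?B" "Psi c d x = Psi c d y"
   have "0 < Re x" "0 < Re y" "\<bar>Im x - Im y\<bar> < 2 * pi" using BO[OF xy(1)] BO[OF xy(2)] ab by (auto simp: hp_def)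
   thus "x = y" using Psi_ray_inj_small[OF con, of "Re x" "Re y" "Im x" "Im y"] xy(3) by (simp add: complex_eq_iff)
  qed
  have "?B \<subseteq> hp 0" using BO by blast
  hence "open (Psi c d ` ?B)"
   using open_mapping_thm3[OF _ open_ball inj] Psi_holomorphic[OF con] holomorphic_on_subset by blast
  moreover have "Psi c d (Complex 1 t0) \<in> Psi c d ` ?B" using eps by simp
  moreover have "Psi c d (Complex 1 t0) \<in> path_image lev" unfolding lev_im t0_def using ab by auto
  hence "Psi c d (Complex 1 t0) \<in> frontier ?I" using J img by auto
  hence "Psi c d (Complex 1 t0) \<in> closure ?I" by (simp add: frontier_def)
  ultimately have "Psi c d ` ?B \<inter> ?I ~= {}" by (metis IntI empty_iff open_Int_closure_eq_empty)
  then obtain z where z: "z \<in> ?B" "Psi c d z \<in> ?I" by blast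
  have "Re z < 1 \<or> Re z > 1 \<or> Re z = 1" by linarith
  thus False
  proof (elim disjE)
   assume "Re z < 1"
   hence "z \<in> O1" using BO[OF z(1)] by (simp add: O1_def hp_def)
   thus False using U1 z(2) J by blast
  next
   assume "Re z > 1"
   hence "z \<in> O2 \<union> hp 1" by (simp add: hp_def)
   thus False using U2 z(2) J by blast
  next
   assume "Re z = 1"
   hence "Psi c d z = Psi c d (Complex 1 (Im z))" by (metis complex.collapse)
   hence "Psi c d z \<in> path_image lev" unfolding lev_im using BO[OF z(1)] by (auto intro!: exI[of _ "Im z"])
   hence "Psi c d z \<in> path_image g" using img by blast
   thus False using z(2) J by blast
  qed
 qed
 have lim: "gam c d th \<in> closure T" if "!!x. 0 < x ==> x < 1 ==> Psi c d (Complex x th) \<in> T" for th T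
 proof -
  have "Psi c d (Complex (inverse (real (Suc (Suc n)))) th) \<in> T" for n
  proof (rule that)
   show "inverse (real (Suc (Suc n))) < 1" by (subst inverse_less_1_iff) auto
  qed auto
  thus ?thesis
   unfolding closure_sequential
   by (intro exI[of _ "%n. Psi c d (Complex (inverse (real (Suc (Suc n)))) th)"] conjI allI LIMSEQ_Suc[OF gam_seq[OF UL, of th]]) simp
 qed
 show ?thesis
 proof (rule that[of ?I ?U])
  show "open ?I" "open ?U" "?I \<inter> ?U = {}" using J by blast+
  show "fk c d - {p} \<subseteq> ?I \<union> ?U" using gfk J by blast
  show "gam c d u \<in> ?I" if u: "a < u" "u < b" "gam c d u ~= p" for u
  proof -
   have "gam c d u \<in> closure ?I"
    using I1 u by (intro lim) (auto simp: O1_def image_subset_iff)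
   moreover have "gam c d u \<notin> path_image g" using gfk gam_in_fk[OF UL, of u] u(3) by blast
   ultimately show ?thesis using J closure_Un_frontier[of ?I] by (auto simp: closure_def frontier_def)
  qed
  show "gam c d v \<in> ?U" if v: "b < v" "v < a + 2 * pi" "gam c d v ~= p" for v
  proof -
   have "gam c d v \<in> closure ?U"
    using U2 v by (intro lim) (auto simp: O2_def image_subset_iff)
   moreover have "gam c d v \<notin> path_image g" using gfk gam_in_fk[OF UL, of v] v(3) by blast
   ultimately show ?thesis using J closure_Un_frontier[of ?U] by (auto simp: closure_def frontier_def)
  qed
 qed
qed

lemma sector_sep:
 assumes "UL c d" "gam c d a = p" "gam c d b = p" "a < b" "b < a + 2 * pi"
  "a < u" "u < b" "b < v" "v < a + 2 * pi" "gam c d u ~= p" "gam c d v ~= p"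
  "connected C" "C \<subseteq> fk c d - {p}" "gam c d u \<in> C" "gam c d v \<in> C"
 shows False
proof -
 obtain I U where IU: "open I" "open U" "I \<inter> U = {}" "fk c d - {p} \<subseteq> I \<union> U"
  "gam c d u \<in> I" "gam c d v \<in> U"
  using sector_inside_outside[OF assms(1-5)] assms(6-11) by metis
 thus False using connectedD[OF assms(12) IU(1,2)] assms(13-15) by blast
qed

text \<open>Crossing chords have a common landing point: separation is applied to the connected set
  that consists of the landing point of \<open>u\<close> and \<open>v\<close>.\<close>

lemma unlinked:
 assumes "UL c d" "gam c d a = gam c d b" "gam c d u = gam c d v" "a < u" "u < b" "b < v" "v < a + 2 * pi"
 shows "gam c d u = gam c d a"
proof (rule ccontr)
 assume "gam c d u ~= gam c d a"
 thus False
  using sector_sep[OF assms(1) refl assms(2)[symmetric] _ _ assms(4-7), of "{gam c d u}"] assms gam_in_fk[OF assms(1), of u] by auto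
qed

text \<open>Points of equal potential on the two rays are distinct and have the same image, so
  \<open>cubq\<close> vanishes on them. In the limit the two points coincide and the derivative
  vanishes.\<close>

lemma gam_critical:
 assumes UL: "UL c d" and "gam c d a = gam c d b" "3 * a = 3 * b + 2 * pi * of_int m" "!!n::int. a ~= b + 2 * pi * of_int n"
 shows "gam c d a = c \<or> gam c d a = d"
proof -
 note con = UL_con[OF UL]
 let ?z = "%n. Psi c d (Complex (inverse (real (Suc n))) a)" and ?w = "%n. Psi c d (Complex (inverse (real (Suc n))) b)"
 have "cubq c d (?z n) (?w n) = 0" for n
 proof -
  have "?z n ~= ?w n"
   using Psi_ray_inj[OF con, of "inverse (real (Suc n))" "inverse (real (Suc n))" a b] assms(4) by auto
  moreover have "cub c d (?z n) = cub c d (?w n)"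
   using Psi_ray_cub[OF con, of "inverse (real (Suc n))"] Psi_ray_period[OF con, of "3 * inverse (real (Suc n))" "3 * b" m] assms(3) by simp
  ultimately show ?thesis using cub_diff[of c d "?z n" "?w n"] by simp
 qed
 moreover have "(%n. cubq c d (?z n) (?w n)) \<longlonglongrightarrow> cubq c d (gam c d a) (gam c d b)"
  by (intro tendsto_intros gam_seq UL)
 ultimately have "cubq c d (gam c d a) (gam c d a) = 0" using assms(2) by (simp add: LIMSEQ_const_iff)
 thus ?thesis by (simp add: cubq_same)
qed

section \<open>Pulling back coincidences of landing points\<close>

lemma cub_fiber3:
 assumes "cub c d x1 = y" "cub c d x2 = y" "cub c d x3 = y" "x1 ~= x2" "x1 ~= x3" "x2 ~= x3" "cub c d w = y"
 shows "w \<in> {x1, x2, x3}"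
proof -
 obtain r1 r2 r3 where r: "!!z. cub c d z - y = (z - r1) * (z - r2) * (z - r3)"
  using cub_roots by blast
 have "z \<in> {r1, r2, r3}" if "cub c d z = y" for z
 proof -
  have "(z - r1) * (z - r2) * (z - r3) = 0" using r[of z] that by simp
  thus ?thesis by simp
 qed
 from this[OF assms(1)] this[OF assms(2)] this[OF assms(3)] this[OF assms(7)] assms(4-6) show ?thesis by blast
qed

lemma cub_crit_fiber: "cub c d w = cub c d c ==> w = c \<or> w = (3 * d - c) / 2"
 using cub_diff_crit[of c d w] by simp

lemma cub_crit_fiber': "cub c d w = cub c d d ==> w = d \<or> w = (3 * c - d) / 2"
 using cub_crit_fiber[of d c w] by (simp add: cub_commute[of d c])

lemma mod_interval: obtains n :: int where "a <= th + 2 * pi * of_int n" "th + 2 * pi * of_int n < a + 2 * pi"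
proof -
 obtain n :: int where n: "0 <= (th - a) + 2 * pi * of_int n" "(th - a) + 2 * pi * of_int n <= 2 * pi" by (rule angle_reduce)
 show ?thesis
 proof (cases "(th - a) + 2 * pi * of_int n = 2 * pi")
  case True
  thus ?thesis using pi_gt_zero by (intro that[of "n - 1"]) (auto simp: algebra_simps)
 next
  case False
  thus ?thesis using n by (intro that[of n]) auto
 qed
qed

text \<open>A sector narrower than 2 pi/3 cannot contain both angles of a critical pair, so by
  \<open>unlinked\<close> no ray inside it lands at a critical point different from the vertex
  \<open>p\<close>. The translates of \<open>al\<close> by 2 pi/3 and 4 pi/3 provide the other
  points of the fibre of \<open>y\<close> and lie outside, which leaves the landing point of
  \<open>al\<close> for \<open>be\<close>. If \<open>y\<close> is a critical value, its fibre has
  only one noncritical point.\<close>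

lemma gam_pullback:
 assumes UL: "UL c d" and p: "gam c d a = p" "gam c d b = p" "a < b" "b - a < 2 * pi / 3"
  and albe: "a < al" "al < b" "a < be" "be < b" "gam c d (3 * al) = y" "gam c d (3 * be) = y" "y ~= cub c d p"
  and crit: "gam c d q = c" "gam c d (q + 2 * pi / 3) = c" "gam c d q' = d" "gam c d (q' + 2 * pi / 3) = d"
 shows "gam c d al = gam c d be & gam c d al ~= c & gam c d al ~= d"
proof -
 have out: "gam c d u ~= gam c d v" if "a < u" "u < b" "b < v" "v < a + 2 * pi" "cub c d (gam c d u) = y" for u v
  using unlinked[OF UL _ _ that(1-4)] p that(5) albe(7) by metis
 have nc: "gam c d th ~= e" if th: "a < th" "th < b" "gam c d (3 * th) = y" and e: "gam c d r = e" "gam c d (r + 2 * pi / 3) = e" for th e r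
 proof
  assume eq: "gam c d th = e"
  have ye: "cub c d e = y" using gam_cub[OF UL, of th] th(3) eq by simp
  hence ep: "e ~= p" using albe(7) by blast
  obtain n :: int where n: "a <= r + 2 * pi * of_int n" "r + 2 * pi * of_int n < a + 2 * pi" by (rule mod_interval)
  let ?r = "r + 2 * pi * of_int n"
  have re: "gam c d ?r = e" using e by (simp add: gam_period[OF UL])
  have "gam c d (r + 2 * pi / 3 + 2 * pi * of_int n) = e" using e by (simp only: gam_period[OF UL])
  hence re2: "gam c d (?r + 2 * pi / 3) = e" by (simp add: add_ac)
  have "?r ~= a" "?r ~= b" using re p ep by auto
  then consider "a < ?r" "?r < b" | "b < ?r" using n by linarith
  thus False
  proof cases
   case 1
   have "b < ?r + 2 * pi / 3" "?r + 2 * pi / 3 < a + 2 * pi" using 1 p(3,4) by linarith+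
   from out[OF th(1,2) this] show False using eq re2 ye by simp
  next
   case 2
   from out[OF th(1,2) 2 n(2)] show False using eq re ye by simp
  qed
 qed
 have na: "gam c d al ~= c" "gam c d al ~= d" "gam c d be ~= c" "gam c d be ~= d"
  using nc[OF albe(1,2,5) crit(1,2)] nc[OF albe(1,2,5) crit(3,4)] nc[OF albe(3,4,6) crit(1,2)] nc[OF albe(3,4,6) crit(3,4)] by auto
 have Fa: "cub c d (gam c d al) = y" "cub c d (gam c d be) = y" using albe(5,6) gam_cub[OF UL] by auto
 have "gam c d al = gam c d be"
 proof (cases "y = cub c d c \<or> y = cub c d d")
  case True
  thus ?thesis using cub_crit_fiber[of c d] cub_crit_fiber'[of c d] na Fa by metis
 next
  case False
  have Fk: "cub c d (gam c d (al + 2 * pi * of_int k / 3)) = y" for k :: int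
  proof -
   have e: "3 * (al + 2 * pi * of_int k / 3) = 3 * al + 2 * pi * of_int k" by simp
   have "cub c d (gam c d (al + 2 * pi * of_int k / 3)) = gam c d (3 * al + 2 * pi * of_int k)"
    unfolding gam_cub[OF UL] e ..
   thus ?thesis unfolding gam_period[OF UL] albe(5) .
  qed
  have ne: "gam c d (al + 2 * pi * of_int k / 3) ~= gam c d (al + 2 * pi * of_int l / 3)" if "~ 3 dvd (k - l)" for k l :: int
  proof
   assume "gam c d (al + 2 * pi * of_int k / 3) = gam c d (al + 2 * pi * of_int l / 3)"
   hence "gam c d (al + 2 * pi * of_int k / 3) = c \<or> gam c d (al + 2 * pi * of_int k / 3) = d"
   proof (rule gam_critical[OF UL])
    show "3 * (al + 2 * pi * of_int k / 3) = 3 * (al + 2 * pi * of_int l / 3) + 2 * pi * of_int (k - l)"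
     by (simp add: algebra_simps)
    fix n :: int
    show "al + 2 * pi * of_int k / 3 ~= al + 2 * pi * of_int l / 3 + 2 * pi * of_int n"
    proof
     assume "al + 2 * pi * of_int k / 3 = al + 2 * pi * of_int l / 3 + 2 * pi * of_int n"
     hence "pi * of_int k = pi * (of_int l + 3 * of_int n)" by (simp add: field_simps)
     hence "of_int k = (of_int l + 3 * of_int n :: real)" by (simp only: mult_cancel_left pi_neq_zero simp_thms)
     hence "k = l + 3 * n" by linarith
     thus False using that by simp
    qed
   qed
   thus False using Fk[of k] False by auto
  qed
  have "gam c d be \<in> {gam c d (al + 2 * pi * of_int 0 / 3), gam c d (al + 2 * pi * of_int 1 / 3), gam c d (al + 2 * pi * of_int 2 / 3)}"
   by (rule cub_fiber3[OF Fk Fk Fk ne ne ne Fa(2)]) auto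
  moreover have "gam c d be ~= gam c d (al + 2 * pi * of_int 1 / 3)"
   by (rule out[OF albe(3,4)]) (use albe p Fa in auto)
  moreover have "gam c d be ~= gam c d (al + 2 * pi * of_int 2 / 3)"
   by (rule out[OF albe(3,4)]) (use albe p Fa in auto)
  ultimately show ?thesis by simp
 qed
 thus ?thesis using na by blast
qed

section \<open>The odd map\<close>

text \<open>The critical points are plus and minus i * \<open>y0\<close>, and the map acts on the
  imaginary axis as \<open>h0\<close>. Since h0(y0) = 2 y0^3 and the positive zero of
  \<open>h0\<close> is sqrt 3 * \<open>y0\<close>, the requirement h0(h0(y0)) = 0 is met by 2 y0^2 =
  sqrt 3.\<close>

definition y0 :: real where "y0 = sqrt (sqrt 3 / 2)"
definition w0 :: complex where "w0 = Complex 0 y0"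
definition g0 :: "real => complex" where "g0 = gam w0 (- w0)"
definition h0 :: "real => real" where "h0 y = 3 * y0^2 * y - y^3"

lemma y0_sq: "y0^2 = sqrt 3 / 2" "y0 > 0"
 unfolding y0_def by simp_all

lemma sqrt3_bounds: "17/10 < sqrt 3" "sqrt 3 < 18/10"
 by (rule real_less_rsqrt, simp add: power2_eq_square) (rule real_less_lsqrt; simp add: power2_eq_square)

lemma y0_less: "y0 < 1"
proof -
 have "y0^2 < 1^2" using y0_sq sqrt3_bounds by simp
 thus ?thesis by (rule power2_less_imp_less) simp
qed

lemma cub_w0: "cub w0 (- w0) z = z^3 + of_real (3 * y0^2) * z"
 by (simp add: cub_def w0_def complex_eq_iff power2_eq_square power3_eq_cube algebra_simps)

lemma cub_w0_imag: "cub w0 (- w0) (Complex 0 y) = Complex 0 (h0 y)"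
 unfolding cub_w0 h0_def by (simp add: complex_eq_iff power2_eq_square power3_eq_cube)

lemma cub_w0_minus: "cub w0 (- w0) (- z) = - cub w0 (- w0) z"
 by (simp add: cub_w0)

lemma cub_w0_cnj: "cub w0 (- w0) (cnj z) = cnj (cub w0 (- w0) z)"
 by (simp add: cub_w0)

lemma h0_y0: "h0 y0 = sqrt 3 * y0" "h0 (sqrt 3 * y0) = 0"
proof -
 have "h0 y0 = 2 * y0^2 * y0" by (simp add: h0_def power2_eq_square power3_eq_cube)
 thus "h0 y0 = sqrt 3 * y0" by (simp add: y0_sq)
 have "(sqrt 3 * y0)^3 = (sqrt 3)^2 * y0^2 * (sqrt 3 * y0)" by (simp only: power2_eq_square power3_eq_cube mult_ac)
 thus "h0 (sqrt 3 * y0) = 0" by (simp add: h0_def)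
qed

lemma cub_w0_w0: "cub w0 (- w0) w0 = Complex 0 (sqrt 3 * y0)"
 unfolding w0_def[THEN arg_cong, of "cub w0 (- w0)"] cub_w0_imag h0_y0 ..

lemma norm_w0: "norm w0 = y0"
 using y0_sq by (simp add: w0_def cmod_def)

lemma mult_w0: "3 * w0 * (- w0) = of_real (3 * y0^2)"
 by (simp add: w0_def complex_eq_iff power2_eq_square)

lemma mis_w0: "mis w0 (- w0)"
proof -
 have z: "Complex 0 0 = 0" by (simp add: complex_eq_iff)
 have 1: "(cub w0 (- w0) ^^ 2) w0 = 0"
  by (simp add: numeral_2_eq_2 cub_w0_w0 cub_w0_imag h0_y0 z)
 hence "(cub w0 (- w0) ^^ 2) (- w0) = 0" by (simp add: numeral_2_eq_2 cub_w0_minus)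
 moreover have "norm (3 * w0 * (- w0)) > 1"
  unfolding mult_w0 using sqrt3_bounds by (simp add: y0_sq)
 ultimately show ?thesis
  using 1 y0_less y0_sq unfolding mis_def par_def by (auto simp: norm_w0)
qed

lemmas con_w0 = mis_con[OF mis_w0] and UL_w0 = mis_UL[OF mis_w0]

lemma cub_w0_gam: "cub w0 (- w0) (g0 th) = g0 (3 * th)"
 unfolding g0_def by (rule gam_cub[OF UL_w0])

lemma g0_period: "g0 (th + 2 * pi * of_int n) = g0 th"
 unfolding g0_def by (rule gam_period[OF UL_w0])

text \<open>The map has real coefficients, so the conjugated function satisfies all clauses of
  \<open>isPsi\<close> and uniqueness applies.\<close>

lemma Psi_w0_cnj:
 assumes "0 < Re ze" shows "Psi w0 (- w0) (cnj ze) = cnj (Psi w0 (- w0) ze)"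
proof -
 let ?P = "%ze. cnj (Psi w0 (- w0) (cnj ze))"
 have hc: "cnj z \<in> hp s \<longleftrightarrow> z \<in> hp s" for z s by (simp add: hp_def)
 have "isPsi w0 (- w0) 0 ?P"
  unfolding isPsi_def
 proof (intro conjI ballI)
  have im: "cnj ` hp 0 = hp 0"
  proof -
   have "z \<in> cnj ` hp 0" if "z \<in> hp 0" for z using that hc[of z 0] by (intro image_eqI[of _ _ "cnj z"]) auto
   thus ?thesis by (auto simp: hp_def)
  qed
  have "cnj \<circ> Psi w0 (- w0) \<circ> cnj holomorphic_on hp 0"
   using Psi_holomorphic[OF con_w0] im by (intro holomorphic_on_compose_cnj_cnj) auto
  thus "?P holomorphic_on hp 0" by (simp add: o_def)
  fix ze assume ze: "ze \<in> hp 0"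
  show "cub w0 (- w0) (?P ze) = ?P (3 * ze)"
   using Psi_cub[OF con_w0, of "cnj ze"] ze hc by (simp add: cub_w0_cnj)
  have "cnj (ze + 2 * pi * \<i>) = cnj ze + 2 * pi * \<i> * of_int (-1)" by (simp add: algebra_simps)
  thus "?P (ze + 2 * pi * \<i>) = ?P ze"
   using Psi_period_int[OF con_w0, of "cnj ze" "-1"] ze hc by simp
 next
  fix ze assume "ze \<in> hp (max 0 10)"
  hence "cnj ze \<in> hp 10" by (simp add: hp_def)
  from Psi_near[OF con_w0 this] have "norm (cnj (Psi w0 (- w0) (cnj ze) - exp (cnj ze))) <= 1/10 * norm (cnj (exp (cnj ze)))"
   unfolding complex_mod_cnj .
  thus "norm (?P ze - exp ze) <= 1/10 * norm (exp ze)" by (simp add: exp_cnj)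
 qed
 from Psi_eqI[OF con_w0 this, of ze] assms have "cnj (Psi w0 (- w0) (cnj ze)) = Psi w0 (- w0) ze" by (simp add: hp_def)
 thus ?thesis by (metis complex_cnj_cnj)
qed

text \<open>Oddness becomes translation by pi * i, because exp(pi * i) = -1; this translation
  commutes with tripling up to a full period.\<close>

lemma Psi_w0_minus:
 assumes "0 < Re ze" shows "Psi w0 (- w0) (ze + pi * \<i>) = - Psi w0 (- w0) ze"
proof -
 let ?P = "%ze. - Psi w0 (- w0) (ze + pi * \<i>)"
 have hc: "z + pi * \<i> \<in> hp s \<longleftrightarrow> z \<in> hp s" for z s by (simp add: hp_def)
 have "isPsi w0 (- w0) 0 ?P"
  unfolding isPsi_def
 proof (intro conjI ballI)
  show "?P holomorphic_on hp 0"
   using holomorphic_on_shift[OF Psi_holomorphic[OF con_w0], of "hp 0" "pi * \<i>"] hc by (intro holomorphic_intros) auto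
  fix ze assume ze: "ze \<in> hp 0"
  have e: "3 * (ze + pi * \<i>) = (3 * ze + pi * \<i>) + 2 * pi * \<i>" by (simp add: algebra_simps)
  have "3 * ze + pi * \<i> \<in> hp 0" using hp_mult3[OF ze] hc by simp
  hence "Psi w0 (- w0) (3 * (ze + pi * \<i>)) = Psi w0 (- w0) (3 * ze + pi * \<i>)"
   unfolding e by (rule Psi_period[OF con_w0])
  thus "cub w0 (- w0) (?P ze) = ?P (3 * ze)"
   using Psi_cub[OF con_w0, of "ze + pi * \<i>"] ze hc by (simp add: cub_w0_minus)
  have "ze + 2 * pi * \<i> + pi * \<i> = (ze + pi * \<i>) + 2 * pi * \<i>" by simp
  thus "?P (ze + 2 * pi * \<i>) = ?P ze"
   using Psi_period[OF con_w0, of "ze + pi * \<i>"] ze hc by (simp only:)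
 next
  fix ze assume "ze \<in> hp (max 0 10)"
  hence "ze + pi * \<i> \<in> hp 10" by (simp add: hp_def)
  moreover have "exp (ze + pi * \<i>) = - exp ze" by (simp add: exp_add)
  ultimately have "norm (Psi w0 (- w0) (ze + pi * \<i>) - (- exp ze)) <= 1/10 * norm (- exp ze)"
   using Psi_near[OF con_w0, of "ze + pi * \<i>"] by (simp only:)
  moreover have "norm (?P ze - exp ze) = norm (Psi w0 (- w0) (ze + pi * \<i>) - (- exp ze))"
   by (metis norm_minus_commute uminus_add_conv_diff diff_minus_eq_add add.commute)
  ultimately show "norm (?P ze - exp ze) <= 1/10 * norm (exp ze)" by (simp only: norm_minus_cancel)
 qed
 from Psi_eqI[OF con_w0 this, of ze] assms have "- Psi w0 (- w0) (ze + pi * \<i>) = Psi w0 (- w0) ze" by (simp add: hp_def)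
 thus ?thesis by (metis minus_minus)
qed

lemma cnj_Complex: "cnj (Complex a b) = Complex a (- b)"
 by (simp add: complex_eq_iff)

lemma g0_cnj: "g0 (- th) = cnj (g0 th)"
proof -
 have "(%n. cnj (Psi w0 (- w0) (Complex (inverse (real (Suc n))) th))) \<longlonglongrightarrow> cnj (g0 th)"
  unfolding g0_def by (intro tendsto_intros gam_seq UL_w0)
 moreover have "cnj (Psi w0 (- w0) (Complex (inverse (real (Suc n))) th)) = Psi w0 (- w0) (Complex (inverse (real (Suc n))) (- th))" for n
  using Psi_w0_cnj[of "Complex (inverse (real (Suc n))) th"] by (simp add: cnj_Complex)
 ultimately have "(%n. Psi w0 (- w0) (Complex (inverse (real (Suc n))) (- th))) \<longlonglongrightarrow> cnj (g0 th)" by simp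
 thus ?thesis unfolding g0_def using gam_seq[OF UL_w0, of "- th"] LIMSEQ_unique by blast
qed

lemma g0_minus: "g0 (th + pi) = - g0 th"
proof -
 have "(%n. - Psi w0 (- w0) (Complex (inverse (real (Suc n))) th)) \<longlonglongrightarrow> - g0 th"
  unfolding g0_def by (intro tendsto_intros gam_seq UL_w0)
 moreover have "- Psi w0 (- w0) (Complex (inverse (real (Suc n))) th) = Psi w0 (- w0) (Complex (inverse (real (Suc n))) (th + pi))" for n
 proof -
  have "Complex (inverse (real (Suc n))) (th + pi) = Complex (inverse (real (Suc n))) th + pi * \<i>" by (simp add: complex_eq_iff)
  thus ?thesis using Psi_w0_minus[of "Complex (inverse (real (Suc n))) th"] by simp
 qed
 ultimately have "(%n. Psi w0 (- w0) (Complex (inverse (real (Suc n))) (th + pi))) \<longlonglongrightarrow> - g0 th" by simp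
 thus ?thesis unfolding g0_def using gam_seq[OF UL_w0, of "th + pi"] LIMSEQ_unique by blast
qed

lemma g0_reflect: "g0 (pi - th) = - cnj (g0 th)"
 using g0_minus[of "- th"] by (simp add: g0_cnj)

section \<open>Explicit landing points of the odd map\<close>

text \<open>The landing point at angle 0 is fixed by the map and, by conjugation, real. The only
  real fixed point is 0, because \<open>3 * y0^2\<close> exceeds 1.\<close>

lemma g0_0: "g0 0 = 0" "g0 pi = 0"
proof -
 have re: "cnj (g0 0) = g0 0" using g0_cnj[of 0] by simp
 then obtain x where x: "g0 0 = of_real x" by (metis Reals_cnj_iff Reals_cases)
 have "cub w0 (- w0) (g0 0) = g0 0" using cub_w0_gam[of 0] by simp
 hence "of_real (x^3 + 3 * y0^2 * x) = (of_real x :: complex)" unfolding x cub_w0 by simp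
 hence "x^3 + 3 * y0^2 * x = x" by (simp only: of_real_eq_iff)
 hence "x * (x^2 + (3 * y0^2 - 1)) = 0" by (simp add: power2_eq_square power3_eq_cube algebra_simps)
 moreover have "x^2 + (3 * y0^2 - 1) > 0" using y0_sq sqrt3_bounds zero_le_power2[of x] by linarith
 ultimately have "x = 0" by simp
 thus "g0 0 = 0" using x by simp
 thus "g0 pi = 0" using g0_minus[of 0] by simp
qed

text \<open>In the strip of angles between 0 and pi the map \<open>Psi\<close> is never real, since
  conjugate points have different angles. The sign of the imaginary part is read off at potential 11
  and angle pi/2, and it passes to the landing points.\<close>

lemma Im_g0:
 assumes "0 <= th" "th <= pi" shows "Im (g0 th) >= 0"
proof (cases "th = 0 \<or> th = pi")
 case False
 hence th: "0 < th" "th < pi" using assms by auto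
 let ?S = "{z. 0 < Re z & 0 < Im z & Im z < pi}" and ?Psi = "Psi w0 (- w0)"
 have "?S = {z. Re z > 0} \<inter> {z. Im z > 0} \<inter> {z. Im z < pi}" by auto
 hence "convex ?S" by (auto intro!: convex_Int convex_halfspace_Re_gt convex_halfspace_Im_gt convex_halfspace_Im_lt)
 hence conn: "connected ?S" by (rule convex_connected)
 have cont: "continuous_on ?S (%z. Im (?Psi z))"
  using Psi_continuous[OF con_w0] by (intro continuous_intros) (auto simp: hp_def intro: continuous_on_subset)
 have nz: "Im (?Psi z) ~= 0" if z: "z \<in> ?S" for z
 proof
  assume "Im (?Psi z) = 0"
  hence "cnj (?Psi z) = ?Psi z" by (simp add: complex_eq_iff)
  moreover have "cnj z = Complex (Re z) (- Im z)" by (simp add: complex_eq_iff)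
  ultimately have "?Psi (Complex (Re z) (Im z)) = ?Psi (Complex (Re z) (- Im z))"
   using Psi_w0_cnj[of z] z by (simp add: hp_def)
  hence "Im z = - Im z"
   using Psi_ray_inj_small[OF con_w0, of "Re z" "Re z" "Im z" "- Im z"] z by auto
  thus False using z by simp
 qed
 have "Complex 11 (pi/2) \<in> ?S" by simp
 moreover have "Im (?Psi (Complex 11 (pi/2))) > 0"
 proof -
  let ?z = "Complex 11 (pi/2)"
  have "norm (?Psi ?z - exp ?z) <= 1/10 * norm (exp ?z)" by (rule Psi_near[OF con_w0]) simp
  hence "\<bar>Im (?Psi ?z - exp ?z)\<bar> <= 1/10 * exp 11"
   using abs_Im_le_cmod[of "?Psi ?z - exp ?z"] by (simp add: norm_exp_eq_Re)
  moreover have "Im (exp ?z) = exp 11" by (simp add: Im_exp)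
  moreover have "exp (11::real) > 0" by simp
  ultimately show ?thesis unfolding minus_complex.sel by linarith
 qed
 ultimately have pos: "Im (?Psi z) > 0" if "z \<in> ?S" for z
 proof (rule_tac ccontr)
  assume S: "Complex 11 (pi/2) \<in> ?S" "Im (?Psi (Complex 11 (pi/2))) > 0" and "~ 0 < Im (?Psi z)"
  hence "Im (?Psi z) <= 0" by simp
  hence "{Im (?Psi z)..Im (?Psi (Complex 11 (pi/2)))} \<subseteq> (%z. Im (?Psi z)) ` ?S"
   by (intro connected_contains_Icc connected_continuous_image cont conn imageI S that)
  hence "0 \<in> (%z. Im (?Psi z)) ` ?S" using S(2) \<open>Im (?Psi z) <= 0\<close> by (meson atLeastAtMost_iff less_imp_le subsetD)
  thus False using nz by (elim imageE) metis
 qed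
 have "(%n. Im (?Psi (Complex (inverse (real (Suc n))) th))) \<longlonglongrightarrow> Im (g0 th)"
  unfolding g0_def by (intro tendsto_intros gam_seq UL_w0)
 thus ?thesis
 proof (rule LIMSEQ_le_const)
  show "\<exists>N. \<forall>n\<ge>N. 0 <= Im (?Psi (Complex (inverse (real (Suc n))) th))"
   using pos th by (intro exI[of _ 0]) (auto intro!: less_imp_le)
 qed
qed (auto simp: g0_0)

text \<open>The landing point is a preimage of 0. It is not 0 itself: the angles pi/3 and pi have
  the same triple modulo 2 pi, so they cannot land together at a noncritical point.
  \<open>Im_g0\<close> selects the upper one of the remaining two.\<close>

lemma g0_third: "g0 (pi/3) = Complex 0 (sqrt 3 * y0)" "g0 (2*pi/3) = Complex 0 (sqrt 3 * y0)"
proof -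
 let ?z = "g0 (pi/3)"
 have "cub w0 (- w0) ?z = 0" using cub_w0_gam[of "pi/3"] g0_0 by simp
 hence "?z * (?z^2 + of_real (3 * y0^2)) = 0"
  unfolding cub_w0 by (simp add: power2_eq_square power3_eq_cube algebra_simps)
 moreover have "?z ~= 0"
 proof
  assume "?z = 0"
  hence "gam w0 (- w0) (pi/3) = gam w0 (- w0) pi" using g0_0 by (simp add: g0_def)
  hence "gam w0 (- w0) (pi/3) = w0 \<or> gam w0 (- w0) (pi/3) = - w0"
  proof (rule gam_critical[OF UL_w0, where m = "-1"])
   show "pi/3 ~= pi + 2 * pi * of_int n" for n
   proof
    assume "pi/3 = pi + 2 * pi * of_int n"
    hence "pi * (1 + 3 * of_int n) = 0" by (simp add: field_simps)
    hence "1 + 3 * real_of_int n = 0" by simp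
    hence "of_int (1 + 3 * n) = (0::real)" by simp
    hence "1 + 3 * n = 0" by (simp only: of_int_eq_0_iff)
    thus False by presburger
   qed
  qed simp
  thus False using \<open>?z = 0\<close> y0_sq(2) by (auto simp: g0_def w0_def complex_eq_iff)
 qed
 ultimately have "?z^2 = - of_real (3 * y0^2)" by (simp add: eq_neg_iff_add_eq_0)
 also have "... = (Complex 0 (sqrt 3 * y0))^2"
  by (simp add: complex_eq_iff power2_eq_square)
 finally have "?z = Complex 0 (sqrt 3 * y0) \<or> ?z = - Complex 0 (sqrt 3 * y0)"
  by (rule power2_eq_iff[THEN iffD1])
 moreover have "Im ?z >= 0" by (rule Im_g0) auto
 moreover have "Im (- Complex 0 (sqrt 3 * y0)) < 0" using y0_sq(2) by simp
 ultimately show 1: "?z = Complex 0 (sqrt 3 * y0)" by force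
 have "g0 (2*pi/3) = g0 (pi - pi/3)" by (rule arg_cong[of _ _ g0]) simp
 thus "g0 (2*pi/3) = Complex 0 (sqrt 3 * y0)" using g0_reflect[of "pi/3"] 1 by (simp add: complex_eq_iff)
qed

text \<open>Up to full turns the triples are pi/3 and 2 pi/3, so these rays land over the critical
  value; the co-critical point is excluded by its negative imaginary part.\<close>

lemma g0_crit:
 assumes "th \<in> {pi/9, 2*pi/9, 7*pi/9, 8*pi/9}" shows "g0 th = w0"
proof -
 have "3 * (pi/9) = pi/3" "3 * (2*pi/9) = 2*pi/3" by simp_all
 moreover have "3 * (7*pi/9) = pi/3 + 2 * pi * of_int 1" "3 * (8*pi/9) = 2*pi/3 + 2 * pi * of_int 1" by simp_all
 ultimately have "g0 (3 * th) = Complex 0 (sqrt 3 * y0)"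
  using assms g0_third g0_period[of "pi/3" 1] g0_period[of "2*pi/3" 1] by (elim insertE) (simp_all only: empty_iff)
 hence "cub w0 (- w0) (g0 th) = cub w0 (- w0) w0" by (simp add: cub_w0_gam cub_w0_w0)
 hence "g0 th = w0 \<or> g0 th = (3 * (- w0) - w0) / 2" by (rule cub_crit_fiber)
 moreover have "th = pi/9 \<or> th = 2*pi/9 \<or> th = 7*pi/9 \<or> th = 8*pi/9" using assms by simp
 hence "0 <= th" "th <= pi" using pi_gt_zero by linarith+
 hence "Im (g0 th) >= 0" by (rule Im_g0)
 moreover have "Im ((3 * (- w0) - w0) / 2) < 0" using y0_sq(2) by (simp add: w0_def)
 ultimately show ?thesis by force
qed

text \<open>The critical value of \<open>h0\<close> is the end point of the interval, so the
  interval is invariant. Hence the corresponding imaginary segment belongs to the filled Julia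
  set.\<close>

lemma h0_bound:
 assumes "\<bar>y\<bar> <= sqrt 3 * y0" shows "\<bar>h0 y\<bar> <= sqrt 3 * y0"
proof -
 have pos: "0 <= h0 y & h0 y <= sqrt 3 * y0" if "0 <= y" "y <= sqrt 3 * y0" for y
 proof
  have "y^2 <= (sqrt 3 * y0)^2" using that by (intro power_mono) auto
  hence "y^2 <= 3 * y0^2" by (simp add: power_mult_distrib)
  hence "0 <= y * (3 * y0^2 - y^2)" using that by simp
  thus "0 <= h0 y" by (simp add: h0_def power2_eq_square power3_eq_cube algebra_simps)
  have "0 <= (y - y0)^2 * (y + 2 * y0)" using that y0_sq by simp
  also have "... = 2 * y0^2 * y0 - h0 y" by (simp add: h0_def power2_eq_square power3_eq_cube algebra_simps)
  finally show "h0 y <= sqrt 3 * y0" by (simp add: y0_sq)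
 qed
 show ?thesis
 proof (cases "y >= 0")
  case True
  thus ?thesis using pos[of y] assms by simp
 next
  case False
  moreover have "h0 (- y) = - h0 y" by (simp add: h0_def)
  ultimately show ?thesis using pos[of "- y"] assms by simp
 qed
qed

lemma imag_in_fk:
 assumes "\<bar>y\<bar> <= sqrt 3 * y0" shows "Complex 0 y \<in> fk w0 (- w0)"
proof -
 have "\<exists>y'. \<bar>y'\<bar> <= sqrt 3 * y0 & (cub w0 (- w0) ^^ n) (Complex 0 y) = Complex 0 y'" for n
 proof (induction n)
  case 0
  show ?case by (rule exI[of _ y]) (simp add: assms)
 next
  case (Suc n)
  then obtain y' where y': "\<bar>y'\<bar> <= sqrt 3 * y0" "(cub w0 (- w0) ^^ n) (Complex 0 y) = Complex 0 y'" by auto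
  show ?case by (rule exI[of _ "h0 y'"]) (simp add: y' cub_w0_imag h0_bound)
 qed
 note ex = this
 have "norm (Complex 0 y') <= 10" if "\<bar>y'\<bar> <= sqrt 3 * y0" for y'
 proof -
  have "sqrt 3 * y0 <= 18/10 * 1" using sqrt3_bounds y0_less y0_sq by (intro mult_mono) auto
  thus ?thesis using that by (simp add: cmod_def)
 qed
 note bd = this
 have "norm ((cub w0 (- w0) ^^ n) (Complex 0 y)) <= 10" for n
  using ex[of n] bd by (elim exE conjE) simp
 thus ?thesis unfolding fk_def by simp
qed

text \<open>The equation h0 = r has one root in (0, y0), one above y0 and one below 0, and
  \<open>Im_g0\<close> excludes the last. The upper root would be joined to the landing point at
  angle pi/3 by a segment in the filled Julia set that misses \<open>w0\<close>, although the rays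
  at pi/9 and 8 pi/9 separate the two angles.\<close>

lemma g0_pull:
 assumes th: "0 < th" "th <= 2*pi/9" and r: "g0 th = Complex 0 r" "0 < r" "r <= y0"
 obtains r' where "0 < r'" "r' < y0" "r' < r" "h0 r' = r" "g0 (th/3) = Complex 0 r'"
proof -
 let ?z = "g0 (th/3)"
 have "h0 0 = 0" by (simp add: h0_def)
 moreover have "r < h0 y0"
 proof -
  have "1 * y0 < sqrt 3 * y0" using sqrt3_bounds y0_sq by (intro mult_strict_right_mono) auto
  thus ?thesis using r unfolding h0_y0 by linarith
 qed
 ultimately obtain r' where r': "0 <= r'" "r' <= y0" "h0 r' = r"
  using IVT'[of h0 0 r y0] r y0_sq unfolding h0_def by (force intro!: continuous_intros)
 have r'0: "0 < r'" using r' r(2) \<open>h0 0 = 0\<close> by (cases "r' = 0") auto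
 have r'1: "r' < y0" using r' \<open>r < h0 y0\<close> by (cases "r' = y0") auto
 have "r' * r' < y0 * y0" using r'0 r'1 by (intro mult_strict_mono) auto
 hence hr: "h0 r' > r' * 1"
 proof -
  have "3 * y0^2 - r'^2 > 1" using \<open>r' * r' < y0 * y0\<close> y0_sq sqrt3_bounds by (simp add: power2_eq_square)
  hence "r' * (3 * y0^2 - r'^2) > r' * 1" using r'0 by (intro mult_strict_left_mono)
  thus ?thesis by (simp add: h0_def power2_eq_square power3_eq_cube algebra_simps)
 qed
 have Fz: "cub w0 (- w0) ?z = cub w0 (- w0) (Complex 0 r')"
  using cub_w0_gam[of "th/3"] r r' by (simp add: cub_w0_imag)
 have "?z = Complex 0 r'"
 proof (rule ccontr)
  assume ne: "?z ~= Complex 0 r'"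
  \<comment> \<open>Square root of the discriminant of y^2 + r' y + r'^2 - 3 y0^2, the factor of the
    equation that remains after splitting off r'.\<close>
  define D where "D = sqrt (12 * y0^2 - 3 * r'^2)"
  have D2: "D^2 = 12 * y0^2 - 3 * r'^2"
  proof -
   have "12 * y0^2 - 3 * r'^2 >= 0" using \<open>r' * r' < y0 * y0\<close> zero_le_square[of y0] unfolding power2_eq_square by linarith
   thus ?thesis unfolding D_def by simp
  qed
  have D0: "D >= 0"
   using D2 \<open>r' * r' < y0 * y0\<close> zero_le_square[of y0] unfolding D_def power2_eq_square by (intro real_sqrt_ge_zero) linarith
  have D1: "D > 3 * y0"
  proof -
   have "(3 * y0)^2 < D^2" unfolding D2 using \<open>r' * r' < y0 * y0\<close> by (simp add: power2_eq_square)
   thus ?thesis using D0 by (rule power2_less_imp_less)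
  qed
  have "cubq w0 (- w0) ?z (Complex 0 r') = 0" using cub_diff[of w0 "- w0" ?z "Complex 0 r'"] Fz ne by simp
  moreover have "cubq w0 (- w0) ?z (Complex 0 r') = (?z - Complex 0 ((- r' + D)/2)) * (?z - Complex 0 ((- r' - D)/2))"
  proof -
   have "(?z - Complex 0 ((- r' + D)/2)) * (?z - Complex 0 ((- r' - D)/2)) = ?z^2 + Complex 0 r' * ?z + of_real ((D^2 - r'^2)/4)"
    by (simp add: complex_eq_iff power2_eq_square field_simps)
   also have "(D^2 - r'^2)/4 = 3 * y0^2 - r'^2" unfolding D2 by simp
   finally show ?thesis by (simp add: cubq_def w0_def complex_eq_iff power2_eq_square algebra_simps)
  qed
  ultimately have "?z = Complex 0 ((- r' + D)/2) \<or> ?z = Complex 0 ((- r' - D)/2)" by simp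
  moreover have "Im ?z >= 0" using th by (intro Im_g0) auto
  moreover have "Im (Complex 0 ((- r' - D)/2)) < 0" using r'0 D1 y0_sq by simp
  ultimately have z: "?z = Complex 0 ((- r' + D)/2)" by force
  define s where "s = (- r' + D)/2"
  have s1: "y0 < s" unfolding s_def using D1 r'1 by simp
  have s2: "s <= sqrt 3 * y0"
  proof (rule ccontr)
   assume "~ ?thesis"
   hence "(sqrt 3 * y0)^2 < s^2" using y0_sq by (intro power_strict_mono) auto
   hence "s * (3 * y0^2 - s^2) < 0" using s1 y0_sq(2) by (intro mult_pos_neg) (auto simp: power_mult_distrib)
   moreover have "h0 s = r"
    using Fz z r' by (simp add: s_def cub_w0_imag)
   hence "s * (3 * y0^2 - s^2) = r" by (simp add: h0_def power2_eq_square power3_eq_cube algebra_simps)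
   ultimately show False using r by simp
  qed
  let ?C = "Complex 0 ` {s..sqrt 3 * y0}"
  have C: "connected ?C" unfolding Complex_eq by (intro connected_continuous_image continuous_intros) auto
  show False
  proof (rule sector_sep[OF UL_w0, of "pi/9" w0 "8*pi/9" "pi/3" "th/3 + 2 * pi * of_int 1" ?C])
   show "gam w0 (- w0) (pi/9) = w0" "gam w0 (- w0) (8*pi/9) = w0" using g0_crit by (auto simp: g0_def)
   show "?C \<subseteq> fk w0 (- w0) - {w0}"
   proof
    fix x assume "x \<in> ?C"
    then obtain t where t: "x = Complex 0 t" "s <= t" "t <= sqrt 3 * y0" by auto
    hence "\<bar>t\<bar> <= sqrt 3 * y0" using s1 y0_sq(2) by simp
    thus "x \<in> fk w0 (- w0) - {w0}" using imag_in_fk t s1 by (auto simp: w0_def)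
   qed
   have g3: "gam w0 (- w0) (th/3 + 2 * pi * of_int 1) = Complex 0 s"
    using g0_period[of "th/3" 1] z by (simp add: g0_def s_def)
   thus "gam w0 (- w0) (th/3 + 2 * pi * of_int 1) \<in> ?C" "gam w0 (- w0) (th/3 + 2 * pi * of_int 1) ~= w0"
    using s1 s2 by (auto simp: w0_def)
   have g4: "gam w0 (- w0) (pi/3) = Complex 0 (sqrt 3 * y0)" using g0_third by (simp add: g0_def)
   thus "gam w0 (- w0) (pi/3) \<in> ?C" "gam w0 (- w0) (pi/3) ~= w0"
    using s1 s2 by (auto simp: w0_def)
  qed (use th C pi_gt_zero in auto)
 qed
 thus ?thesis using that[of r'] r'0 r'1 r'(3) hr by simp
qed

lemma h0_inj:
 assumes "0 < r" "r < y0" "0 < r'" "r' < y0" "h0 r = h0 r'" shows "r = r'"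
proof -
 have "r * r < y0 * y0" "r * r' < y0 * y0" "r' * r' < y0 * y0" using assms by (intro mult_strict_mono; auto)+
 hence "3 * y0^2 - (r^2 + r * r' + r'^2) > 0" by (simp add: power2_eq_square)
 moreover have "h0 r - h0 r' = (r - r') * (3 * y0^2 - (r^2 + r * r' + r'^2))"
  by (simp add: h0_def power2_eq_square power3_eq_cube algebra_simps)
 ultimately show ?thesis using assms(5) by simp
qed

text \<open>Division of the angles by 3 makes the landing points descend on the imaginary axis
  towards 0. The two critical angles stay together because \<open>h0\<close> is injective on (0,
  y0), and reflection in the axis adds the angles pi - th / 3^j.\<close>

lemma g0_chain:
 obtains r where "r 0 = y0" "!!j. 0 < r j" "!!j. r (Suc j) <= r 1" "r 1 < y0"
  "!!j th. th \<in> {pi/9, 2*pi/9} ==> g0 (th / 3^j) = Complex 0 (r j) & g0 (pi - th / 3^j) = Complex 0 (r j)"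
proof -
 define r where "r j = Im (g0 (pi/9 / 3^j))" for j
 have main: "g0 (pi/9 / 3^j) = Complex 0 (r j) & g0 (2*pi/9 / 3^j) = Complex 0 (r j) & 0 < r j & r j <= y0
  & r (Suc j) < r j & r (Suc j) < y0" for j
 proof (induction j)
  have step: "g0 (pi/9 / 3^Suc j) = Complex 0 (r (Suc j)) & g0 (2*pi/9 / 3^Suc j) = Complex 0 (r (Suc j)) & 0 < r (Suc j) & r (Suc j) < y0 & r (Suc j) < r j"
   if IH: "g0 (pi/9 / 3^j) = Complex 0 (r j)" "g0 (2*pi/9 / 3^j) = Complex 0 (r j)" "0 < r j" "r j <= y0" for j
  proof -
   have le: "pi/9 / 3^j <= 2*pi/9" "2*pi/9 / 3^j <= 2*pi/9"
    using divide_pow3_le[of "pi/9" j] divide_pow3_le[of "2*pi/9" j] pi_gt_zero by (simp_all del: pi_gt_zero)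
   obtain r1 where r1: "0 < r1" "r1 < y0" "r1 < r j" "h0 r1 = r j" "g0 (pi/9 / 3^j / 3) = Complex 0 r1"
    using g0_pull[OF _ le(1) IH(1,3,4)] by auto
   obtain r2 where r2: "0 < r2" "r2 < y0" "h0 r2 = r j" "g0 (2*pi/9 / 3^j / 3) = Complex 0 r2"
    using g0_pull[OF _ le(2) IH(2,3,4)] by auto
   have "r1 = r2" using h0_inj r1 r2 by auto
   moreover have "r (Suc j) = r1" using r1(5) by (simp add: r_def mult.commute)
   ultimately show ?thesis using r1 r2 by (simp add: mult.commute)
  qed
  case 0
  have b: "g0 (pi/9 / 3^0) = Complex 0 (r 0)" "g0 (2*pi/9 / 3^0) = Complex 0 (r 0)" "0 < r 0" "r 0 <= y0"
   using g0_crit y0_sq(2) by (auto simp: r_def w0_def)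
  thus ?case using step[OF b] by auto
  case (Suc j)
  hence "g0 (pi/9 / 3^Suc j) = Complex 0 (r (Suc j)) & g0 (2*pi/9 / 3^Suc j) = Complex 0 (r (Suc j)) & 0 < r (Suc j) & r (Suc j) < y0"
   using step[of j] by blast
  thus ?case using step[of "Suc j"] by auto
 qed
 have mono: "r (Suc j) <= r 1" for j
 proof (induction j)
  case (Suc j)
  thus ?case using main[of "Suc j"] by linarith
 qed auto
 show ?thesis
 proof (rule that[of r])
  show "r 0 = y0" using g0_crit by (simp add: r_def w0_def)
  show "r 1 < y0" using main[of 0] by simp
  show "g0 (th / 3^j) = Complex 0 (r j) & g0 (pi - th / 3^j) = Complex 0 (r j)" if "th \<in> {pi/9, 2*pi/9}" for j th
  proof -
   have "g0 (th / 3^j) = Complex 0 (r j)" using main[of j] that by (elim insertE) (simp_all only: empty_iff)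
   thus ?thesis by (simp add: g0_reflect complex_eq_iff)
  qed
 qed (use main mono in blast)+
qed

section \<open>Perturbation of critical relations\<close>

lemma contour_integral_continuous_param:
 assumes f: "continuous_on (U \<times> path_image g) (%(c, w). f c w)" and g: "path g"
  and g': "continuous_on {0..1} (%t. vector_derivative g (at t))"
 shows "continuous_on U (%c. contour_integral g (f c))"
proof -
 have g1: "continuous_on {0..1} g" using g by (simp add: path_def)
 have "continuous_on (U \<times> cbox 0 1) (%(x, t). f x (g t) * vector_derivative g (at t))"
 proof -
  have "continuous_on (U \<times> {0..1}) (%z. (%(c, w). f c w) (fst z, g (snd z)))"
   by (rule continuous_on_compose2[OF f]) (auto intro!: continuous_intros continuous_on_compose2[OF g1] simp: path_image_def)
  moreover have "continuous_on (U \<times> {0..1}) (%z. vector_derivative g (at (snd z)))"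
   by (rule continuous_on_compose2[OF g']) (auto intro!: continuous_intros)
  ultimately have "continuous_on (U \<times> {0..1}) (%z. (%(c, w). f c w) (fst z, g (snd z)) * vector_derivative g (at (snd z)))"
   by (rule continuous_on_mult)
  thus ?thesis by (simp add: case_prod_unfold)
 qed
 hence "continuous_on U (%x. integral (cbox 0 1) (%t. f x (g t) * vector_derivative g (at t)))"
  by (rule integral_continuous_on_param)
 thus ?thesis by (simp add: contour_integral_integral)
qed

text \<open>Morera: after interchanging the integrations, the inner integral over a triangle
  vanishes by Cauchy.\<close>

lemma contour_integral_holomorphic_param:
 assumes U: "open U" and f: "continuous_on (U \<times> path_image g) (%(c, w). f c w)"
  and hol: "!!w. w \<in> path_image g ==> (%c. f c w) holomorphic_on U" and g: "valid_path g"
  and g': "continuous_on {0..1} (%t. vector_derivative g (at t))"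
 shows "(%c. contour_integral g (f c)) holomorphic_on U"
proof -
 have pg: "path g" using g by (rule valid_path_imp_path)
 have "(%c. contour_integral g (f c)) analytic_on U"
 proof (rule Morera_triangle)
  show "continuous_on U (%c. contour_integral g (f c))"
   by (rule contour_integral_continuous_param[OF f pg g'])
  show "convex hull {a,b,c} \<subseteq> U --> contour_integral (linepath a b) (%c. contour_integral g (f c)) +
    contour_integral (linepath b c) (%c. contour_integral g (f c)) + contour_integral (linepath c a) (%c. contour_integral g (f c)) = 0" for a b c
  proof
   assume sub: "convex hull {a,b,c} \<subseteq> U"
   have seg: "closed_segment a b \<subseteq> U" "closed_segment b c \<subseteq> U" "closed_segment c a \<subseteq> U"
    unfolding segment_convex_hull using sub by (meson hull_mono order_trans insert_subset subset_insertI empty_subsetI insertI1 insertI2)+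
   let ?I = "%p q w. contour_integral (linepath p q) (%c. f c w)"
   have swap: "contour_integral (linepath p q) (%c. contour_integral g (f c)) = contour_integral g (?I p q)"
    if "closed_segment p q \<subseteq> U" for p q
    by (rule contour_integral_swap) (use that g g' in \<open>auto intro: continuous_on_subset[OF f]\<close>)
   have int: "?I p q contour_integrable_on g" if "closed_segment p q \<subseteq> U" for p q
   proof -
    have "continuous_on (path_image g \<times> U) (%z. (%(c, w). f c w) (snd z, fst z))"
     by (rule continuous_on_compose2[OF f]) (auto intro!: continuous_intros)
    hence "continuous_on (path_image g \<times> path_image (linepath p q)) (%(w, c). f c w)"
     using that by (auto simp: case_prod_unfold elim!: continuous_on_subset)
    hence c: "continuous_on (path_image g) (?I p q)"
     by (rule contour_integral_continuous_param) auto
    have "continuous_on {0..1} (%t. ?I p q (g t) * vector_derivative g (at t))"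
     using pg by (intro continuous_intros g' continuous_on_compose2[OF c]) (auto simp: path_def path_image_def)
    thus ?thesis
     unfolding contour_integrable_on by (rule integrable_continuous_real)
   qed
   have z: "?I a b w + ?I b c w + ?I c a w = 0" if "w \<in> path_image g" for w
   proof -
    have h: "(%c. f c w) holomorphic_on convex hull {a,b,c}" using hol[OF that] sub by (rule holomorphic_on_subset)
    have "continuous_on (convex hull {a,b,c}) (%c. f c w)" using h by (rule holomorphic_on_imp_continuous_on)
    thus ?thesis using Cauchy_theorem_triangle[OF h] by (intro has_chain_integral_chain_integral3)
   qed
   have "contour_integral g (?I a b) + contour_integral g (?I b c) + contour_integral g (?I c a) =
     contour_integral g (%w. ?I a b w + ?I b c w + ?I c a w)"
    using int seg by (simp add: contour_integral_add contour_integrable_add)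
   also have "... = contour_integral g (%w. 0)" by (rule contour_integral_eq) (rule z)
   also have "... = 0" by simp
   finally show "contour_integral (linepath a b) (%c. contour_integral g (f c)) +
    contour_integral (linepath b c) (%c. contour_integral g (f c)) + contour_integral (linepath c a) (%c. contour_integral g (f c)) = 0"
    by (simp add: swap seg)
  qed
 qed (fact U)
 thus ?thesis by (rule analytic_imp_holomorphic)
qed

text \<open>The argument principle with weight \<open>h\<close>; all zeros are inside the circle and
  have winding number 1.\<close>

lemma weighted_zero_sum:
 assumes f: "f holomorphic_on ball z e'" and h: "h holomorphic_on ball z e'" and e: "0 < e" "e < e'"
  and fin: "finite {w \<in> ball z e. f w = 0}" and zeros: "!!w. w \<in> ball z e' ==> f w = 0 ==> w \<in> ball z e"
 shows "(\<Sum>p | p \<in> ball z e & f p = 0. of_int (zorder f p) * h p) = contour_integral (circlepath z e) (%w. deriv f w * h w / f w) / (2 * pi * \<i>)"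
proof -
 let ?Z = "{w \<in> ball z e'. f w = 0 \<or> w \<in> {}}"
 have Z: "?Z = {p. p \<in> ball z e & f p = 0}" using zeros e by auto
 have "contour_integral (circlepath z e) (%w. deriv f w * h w / f w) = 2 * pi * \<i> * (\<Sum>p\<in>?Z. winding_number (circlepath z e) p * h p * zorder f p)"
 proof (rule argument_principle)
  show "path_image (circlepath z e) \<subseteq> ball z e' - ?Z"
  proof
   fix x assume "x \<in> path_image (circlepath z e)"
   hence x: "dist z x = e" using e by simp
   thus "x \<in> ball z e' - ?Z" using e zeros[of x] by auto
  qed
  show "\<forall>w. w \<notin> ball z e' --> winding_number (circlepath z e) w = 0"
   using e by (auto intro!: winding_number_zero_outside[of _ "cball z e"] simp: sphere_def)
  show "finite ?Z" using fin unfolding Z by simp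
 qed (use f h e in auto)
 also have "(\<Sum>p\<in>?Z. winding_number (circlepath z e) p * h p * zorder f p) = (\<Sum>p\<in>?Z. of_int (zorder f p) * h p)"
 proof (rule sum.cong[OF refl])
  fix p assume "p \<in> ?Z"
  hence "norm (p - z) < e" using zeros[of p] by (auto simp: dist_norm norm_minus_commute)
  thus "winding_number (circlepath z e) p * h p * zorder f p = of_int (zorder f p) * h p"
   by (simp add: winding_number_circlepath)
 qed
 finally show ?thesis unfolding Z by simp
qed

definition zs :: "(complex => complex => complex) => complex => real => complex => complex set" where
 "zs B d0 s c = {d. d \<in> ball d0 s & B c d = 0}"

text \<open>A sum over all zeros with multiplicity is unaffected by their branching. Near
  \<open>c0\<close> it is a sum of integrals over fixed small circles about the zeros of
  \<open>B c0\<close>. Holomorphy of \<open>f\<close> is required on a neighbourhood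
  \<open>W\<close> of the zero set only, so that \<open>f\<close> may have poles elsewhere.\<close>

lemma trace_holomorphic:
 assumes contB: "continuous_on UNIV (%(c, d). B c d)" and contBd: "continuous_on UNIV (%(c, d). Bd c d)"
  and der: "!!c d. (B c has_field_derivative Bd c d) (at d)"
  and holB: "!!d. (%c. B c d) holomorphic_on UNIV" and holBd: "!!d. (%c. Bd c d) holomorphic_on UNIV"
  and U: "open U" and s: "s > 0" and nz: "!!c d. c \<in> U ==> d \<in> sphere d0 s ==> B c d ~= 0"
  and W: "open W" and contf: "continuous_on W (%(c, d). f c d)"
  and f1: "!!c d. (c, d) \<in> W ==> (%c. f c d) field_differentiable (at c)"
  and f2: "!!c d. (c, d) \<in> W ==> f c field_differentiable (at d)"
  and ZW: "!!c d. c \<in> U ==> d \<in> zs B d0 s c ==> (c, d) \<in> W"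
 shows "(%c. \<Sum>d\<in>zs B d0 s c. of_int (zorder (B c) d) * f c d) holomorphic_on U" and "!!c. c \<in> U ==> finite (zs B d0 s c)"
proof -
 have hol: "B c holomorphic_on S" for c S
  using der by (meson field_differentiable_at_within field_differentiable_def holomorphic_onI)
 show fin: "finite (zs B d0 s c)" if "c \<in> U" for c
 proof -
  have "\<exists>x. x \<in> sphere d0 s" using s by (intro exI[of _ "d0 + of_real s"]) (simp add: dist_norm)
  then obtain x where x: "x \<in> sphere d0 s" by blast
  have "finite {z \<in> cball d0 s. B c z = 0}"
  proof (cases "\<exists>z. B c z = 0")
   case True
   then obtain z where "B c z = 0" by blast
   hence "~ B c constant_on UNIV" using nz[OF that x] by (metis UNIV_I constant_on_def)
   thus ?thesis by (intro holomorphic_compact_finite_zeros[of _ UNIV] hol) auto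
  qed auto
  thus ?thesis by (rule finite_subset[rotated]) (auto simp: zs_def)
 qed
 have "\<exists>T. open T & c0 \<in> T & (%c. \<Sum>d\<in>zs B d0 s c. of_int (zorder (B c) d) * f c d) holomorphic_on T" if c0: "c0 \<in> U" for c0
 proof -
  let ?Z = "zs B d0 s c0"
  \<comment> \<open>The doubled discs are the domains for the argument principle and must be
    disjoint as well, hence the separation by more than \<open>4 * e\<close>.\<close>
  have "eventually (%e. \<forall>z\<in>?Z. ball c0 e \<times> ball z (2*e) \<subseteq> W & ball z (2*e) \<subseteq> ball d0 s & (\<forall>z'\<in>?Z. z' = z \<or> dist z z' > 4 * e)) (at_right (0::real))"
  proof (intro eventually_ball_finite ballI fin[OF c0] eventually_conj)
   fix z assume z: "z \<in> ?Z"
   then obtain A1 A2 where A: "open A1" "open A2" "(c0, z) \<in> A1 \<times> A2" "A1 \<times> A2 \<subseteq> W"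
    using ZW[OF c0 z] W open_prod_elim[of W "(c0, z)"] by blast
   obtain r1 where r1: "r1 > 0" "ball c0 r1 \<subseteq> A1" using A by (meson mem_Sigma_iff open_contains_ball)
   obtain r2 where r2: "r2 > 0" "ball z r2 \<subseteq> A2" using A by (meson mem_Sigma_iff open_contains_ball)
   have "eventually (%e::real. e < min r1 (r2/2)) (at_right 0)"
    using r1 r2 by (intro eventually_at_right_real[of 0 "min r1 (r2/2)", THEN eventually_mono]) auto
   thus "eventually (%e. ball c0 e \<times> ball z (2*e) \<subseteq> W) (at_right (0::real))"
   proof eventually_elim
    case (elim e)
    hence "ball c0 e \<subseteq> A1" "ball z (2*e) \<subseteq> A2" using r1(2) r2(2) by (auto simp: subset_eq)
    thus ?case using A(4) by blast
   qed
   have "z \<in> ball d0 s" using z by (simp add: zs_def)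
   then obtain r3 where r3: "r3 > 0" "ball z r3 \<subseteq> ball d0 s" by (meson open_ball open_contains_ball)
   have "eventually (%e::real. e < r3/2) (at_right 0)"
    using r3 by (intro eventually_at_right_real[of 0 "r3/2", THEN eventually_mono]) auto
   thus "eventually (%e. ball z (2*e) \<subseteq> ball d0 s) (at_right (0::real))"
    by eventually_elim (use r3(2) in \<open>auto simp: subset_eq\<close>)
   fix z' assume "z' \<in> ?Z"
   show "eventually (%e. z' = z \<or> dist z z' > 4 * e) (at_right (0::real))"
   proof (cases "z' = z")
    case False
    have "eventually (%e::real. e < dist z z' / 4) (at_right 0)"
     using False by (intro eventually_at_right_real[of 0 "dist z z' / 4", THEN eventually_mono]) auto
    thus ?thesis by eventually_elim auto
   qed simp
  qed
  moreover have "eventually (%e. e > 0) (at_right (0::real))" by (rule eventually_at_right_less)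
  ultimately have "eventually (%e. e > 0 & (\<forall>z\<in>?Z. ball c0 e \<times> ball z (2*e) \<subseteq> W & ball z (2*e) \<subseteq> ball d0 s & (\<forall>z'\<in>?Z. z' = z \<or> dist z z' > 4 * e))) (at_right (0::real))"
   by eventually_elim simp
  from eventually_happens'[OF trivial_limit_at_right_real this]
  obtain e where ee: "e > 0 & (\<forall>z\<in>?Z. ball c0 e \<times> ball z (2*e) \<subseteq> W & ball z (2*e) \<subseteq> ball d0 s & (\<forall>z'\<in>?Z. z' = z \<or> dist z z' > 4 * e))"
   by (elim exE)
  hence e0: "e > 0" by (rule conjunct1)
  have e: "ball c0 e \<times> ball z (2*e) \<subseteq> W & ball z (2*e) \<subseteq> ball d0 s" if "z \<in> ?Z" for z
   using ee[THEN conjunct2, rule_format, OF that] by simp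
  have e2: "dist z z' > 4 * e" if "z \<in> ?Z" "z' \<in> ?Z" "z' ~= z" for z z'
   using ee[THEN conjunct2, THEN bspec, OF that(1)] that(2,3) by blast
  \<comment> \<open>Outside the small discs \<open>B c0\<close> has no zeros in the closed disc, and
    by the tube lemma this persists for \<open>c\<close> near \<open>c0\<close>.\<close>
  let ?K = "cball d0 s - (\<Union>z\<in>?Z. ball z e)"
  have K: "compact ?K" by (intro compact_diff open_UN) auto
  have "open {z. (%(c, d). B c d) z ~= 0}" by (intro open_Collect_neq contB continuous_intros)
  moreover have "{c0} \<times> ?K \<subseteq> {z. (%(c, d). B c d) z ~= 0}"
  proof -
   have "B c0 d ~= 0" if "d \<in> ?K" for d
   proof
    assume "B c0 d = 0"
    hence "d \<notin> sphere d0 s" using nz[OF c0] by blast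
    hence "d \<in> ?Z" using that \<open>B c0 d = 0\<close> by (auto simp: zs_def)
    thus False using that e0 by auto
   qed
   thus ?thesis by auto
  qed
  ultimately obtain X0 where X0: "c0 \<in> X0" "open X0" "X0 \<times> ?K \<subseteq> {z. (%(c, d). B c d) z ~= 0}"
   using Elementary_Topology.tube_lemma[OF K] by metis
  define T where "T = X0 \<inter> ball c0 e \<inter> U"
  have T: "open T" "c0 \<in> T" unfolding T_def using X0 e0 c0 U by auto
  have loc: "\<exists>z\<in>?Z. d \<in> ball z e" if "c \<in> T" "d \<in> ball d0 s" "B c d = 0" for c d
  proof (rule ccontr)
   assume "~ ?thesis"
   hence "(c, d) \<in> X0 \<times> ?K" using that by (auto simp: T_def)
   hence "(c, d) \<in> {z. (%(c, d). B c d) z ~= 0}" using X0(3) by (rule subsetD[rotated])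
   thus False using that(3) by simp
  qed
  have uniq: "z = z'" if "z \<in> ?Z" "z' \<in> ?Z" "d \<in> ball z (2*e)" "d \<in> ball z' (2*e)" for z z' d
  proof (rule ccontr)
   assume "z ~= z'"
   hence "dist z z' > 4 * e" using e2[OF that(1,2)] by auto
   moreover have "dist z z' < 4 * e" using dist_triangle[of z z' d] that(3,4) by (simp add: dist_commute)
   ultimately show False by simp
  qed
  have zsU: "zs B d0 s c = (\<Union>z\<in>?Z. {p. p \<in> ball z e & B c p = 0})" if "c \<in> T" for c
  proof -
   have "ball z e \<subseteq> ball d0 s" if "z \<in> ?Z" for z using e[OF that] e0 by (auto simp: subset_eq)
   thus ?thesis using loc[OF that] unfolding zs_def[of B d0 s c] by blast
  qed
  have sum: "(\<Sum>d\<in>zs B d0 s c. of_int (zorder (B c) d) * f c d) =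
    (\<Sum>z\<in>?Z. contour_integral (circlepath z e) (%w. Bd c w * f c w / B c w) / (2 * pi * \<i>))" if c: "c \<in> T" for c
  proof -
   have finc: "finite (zs B d0 s c)" using fin c by (simp add: T_def)
   have "(\<Sum>d\<in>zs B d0 s c. of_int (zorder (B c) d) * f c d) = (\<Sum>z\<in>?Z. \<Sum>d\<in>{p. p \<in> ball z e & B c p = 0}. of_int (zorder (B c) d) * f c d)"
    unfolding zsU[OF c]
   proof (rule sum.UNION_disjoint)
    show "\<forall>z\<in>?Z. finite {p. p \<in> ball z e & B c p = 0}"
     using finc unfolding zsU[OF c] by (auto intro: finite_subset[rotated])
    show "\<forall>z\<in>?Z. \<forall>z'\<in>?Z. z ~= z' --> {p. p \<in> ball z e & B c p = 0} \<inter> {p. p \<in> ball z' e & B c p = 0} = {}"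
    proof (intro ballI impI)
     fix z z' assume z: "z \<in> ?Z" "z' \<in> ?Z" "z ~= z'"
     have False if "p \<in> ball z e" "p \<in> ball z' e" for p
      using uniq[OF z(1,2), of p] that z(3) e0 by (auto simp: mem_ball)
     thus "{p. p \<in> ball z e & B c p = 0} \<inter> {p. p \<in> ball z' e & B c p = 0} = {}" by blast
    qed
   qed (rule fin[OF c0])
   also have "... = (\<Sum>z\<in>?Z. contour_integral (circlepath z e) (%w. Bd c w * f c w / B c w) / (2 * pi * \<i>))"
   proof (rule sum.cong[OF refl])
    fix z assume z: "z \<in> ?Z"
    have "(\<Sum>d\<in>{p. p \<in> ball z e & B c p = 0}. of_int (zorder (B c) d) * f c d) =
      contour_integral (circlepath z e) (%w. deriv (B c) w * f c w / B c w) / (2 * pi * \<i>)"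
    proof (rule weighted_zero_sum)
     show "B c holomorphic_on ball z (2*e)" by (rule hol)
     show "f c holomorphic_on ball z (2*e)"
     proof (rule holomorphic_onI)
      fix x assume "x \<in> ball z (2*e)"
      hence "(c, x) \<in> W" using e[OF z] c by (auto simp: T_def)
      thus "f c field_differentiable at x within ball z (2*e)" using f2 field_differentiable_at_within by blast
     qed
     show "finite {w \<in> ball z e. B c w = 0}" using finc z unfolding zsU[OF c] by (rule_tac finite_subset[rotated]) auto
     fix w assume w: "w \<in> ball z (2*e)" "B c w = 0"
     have "w \<in> ball d0 s" using w(1) e[OF z] by blast
     from loc[OF c this w(2)] obtain z' where z': "z' \<in> ?Z" "w \<in> ball z' e" by (elim bexE)
     hence "z = z'" using uniq[OF z z'(1) w(1)] e0 by auto
     thus "w \<in> ball z e" using z' by simp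
    qed (use e0 in auto)
    moreover have "deriv (B c) = Bd c" using der by (auto intro: DERIV_imp_deriv)
    ultimately show "(\<Sum>d\<in>{p. p \<in> ball z e & B c p = 0}. of_int (zorder (B c) d) * f c d) =
      contour_integral (circlepath z e) (%w. Bd c w * f c w / B c w) / (2 * pi * \<i>)" by simp
   qed
   finally show ?thesis .
  qed
  have "(%c. contour_integral (circlepath z e) (%w. Bd c w * f c w / B c w)) holomorphic_on T" if z: "z \<in> ?Z" for z
  proof (rule contour_integral_holomorphic_param)
   have inW: "(c, w) \<in> W" if "c \<in> T" "w \<in> path_image (circlepath z e)" for c w
    using e[OF z] that e0 by (auto simp: T_def dist_commute)
   have nzB: "B c w ~= 0" if "c \<in> T" "w \<in> path_image (circlepath z e)" for c w
   proof
    assume "B c w = 0"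
    have w: "w \<in> ball z (2*e)" "w \<notin> ball z e" using that e0 by (auto simp: dist_commute)
    have "w \<in> ball d0 s" using w(1) e[OF z] by blast
    from loc[OF that(1) this \<open>B c w = 0\<close>] obtain z' where z': "z' \<in> ?Z" "w \<in> ball z' e" by (elim bexE)
    hence "z = z'" using uniq[OF z z'(1) w(1)] e0 by auto
    thus False using z' w by simp
   qed
   show "continuous_on (T \<times> path_image (circlepath z e)) (%(c, w). Bd c w * f c w / B c w)"
   proof -
    have "continuous_on (T \<times> path_image (circlepath z e)) (%z. (%(c, d). Bd c d) z * (%(c, d). f c d) z / (%(c, d). B c d) z)"
     using nzB inW by (intro continuous_intros continuous_on_subset[OF contB] continuous_on_subset[OF contBd] continuous_on_subset[OF contf]) auto
    thus ?thesis by (simp add: case_prod_unfold)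
   qed
   fix w assume w: "w \<in> path_image (circlepath z e)"
   have "(%c. f c w) holomorphic_on T"
    using f1 inW[OF _ w] by (meson field_differentiable_at_within holomorphic_onI)
   thus "(%c. Bd c w * f c w / B c w) holomorphic_on T"
    using nzB[OF _ w] by (intro holomorphic_intros holomorphic_on_subset[OF holB] holomorphic_on_subset[OF holBd]) auto
  qed (use T in \<open>auto simp: vector_derivative_circlepath intro!: continuous_intros\<close>)
  hence "(%c. \<Sum>z\<in>?Z. contour_integral (circlepath z e) (%w. Bd c w * f c w / B c w) / (2 * pi * \<i>)) holomorphic_on T"
   by (intro holomorphic_intros) auto
  hence "(%c. \<Sum>d\<in>zs B d0 s c. of_int (zorder (B c) d) * f c d) holomorphic_on T"
   by (rule holomorphic_transform) (simp add: sum)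
  thus ?thesis using T by blast
 qed
 note loc = this
 show "(%c. \<Sum>d\<in>zs B d0 s c. of_int (zorder (B c) d) * f c d) holomorphic_on U"
 proof (rule holomorphic_onI)
  fix x assume "x \<in> U"
  from loc[OF this] obtain T where T: "open T" "x \<in> T" and
   h: "(%c. \<Sum>d\<in>zs B d0 s c. of_int (zorder (B c) d) * f c d) holomorphic_on T" by (elim exE conjE)
  show "(%c. \<Sum>d\<in>zs B d0 s c. of_int (zorder (B c) d) * f c d) field_differentiable at x within U"
   by (rule field_differentiable_at_within[OF holomorphic_on_imp_differentiable_at[OF h T]])
 qed
qed

lemma zorder_zero_pos:
 assumes "f holomorphic_on UNIV" "f z = 0" "f w ~= 0" shows "zorder f z > 0"
 using zorder_exist_zero[of f UNIV z] assms by (auto split: if_splits)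

text \<open>The zero set of \<open>B\<close> may be branched over \<open>cs\<close>, so its points
  cannot be followed as functions of c; traces avoid this. If \<open>A\<close> never equals
  \<open>u\<close> on the zero set, the trace of 1 / (A - u) is holomorphic in c. It is bounded on a
  circle where \<open>A\<close> stays away from 0, but at the centre it is at least 1 / |u|.\<close>

lemma perturb:
 assumes contB: "continuous_on UNIV (%(c, d). B c d)" and contBd: "continuous_on UNIV (%(c, d). Bd c d)"
  and der: "!!c d. (B c has_field_derivative Bd c d) (at d)"
  and holB: "!!d. (%c. B c d) holomorphic_on UNIV" and holBd: "!!d. (%c. Bd c d) holomorphic_on UNIV"
  and contA: "continuous_on UNIV (%(c, d). A c d)" and holA1: "!!d. (%c. A c d) holomorphic_on UNIV"
  and holA2: "!!c. A c holomorphic_on UNIV"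
  and zero: "A cs ds = 0" "B cs ds = 0" and fin: "finite {c. \<exists>d. A c d = 0 & B c d = 0}" and nonz: "B cs dn ~= 0"
  and R: "R > 0" and contu: "!!j. continuous_on (ball cs R \<times> ball ds R) (%(c, d). u j c d)"
  and u1: "!!j c d. c \<in> ball cs R ==> d \<in> ball ds R ==> (%c. u j c d) field_differentiable (at c)"
  and u2: "!!j c d. c \<in> ball cs R ==> d \<in> ball ds R ==> (u j c) field_differentiable (at d)"
  and unif: "!!e. e > 0 ==> eventually (%j. \<forall>c\<in>ball cs R. \<forall>d\<in>ball ds R. norm (u j c d) < e) sequentially"
  and unz: "!!j. u j cs ds ~= 0" and eps: "eps > 0"
 shows "eventually (%j. \<exists>c\<in>ball cs eps. \<exists>d\<in>ball ds eps. B c d = 0 & A c d = u j c d) sequentially"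
proof -
 define \<mu> where "\<mu> = min R eps"
 have \<mu>: "\<mu> > 0" "\<mu> <= R" "\<mu> <= eps" using R eps by (auto simp: \<mu>_def)
 have holBc: "B c holomorphic_on S" for c S
  using der by (meson field_differentiable_at_within field_differentiable_def holomorphic_onI)
 have "~ B cs constant_on UNIV" using zero nonz by (metis UNIV_I constant_on_def)
 hence "finite {z \<in> cball ds (\<mu>/2). B cs z = 0}"
  by (intro holomorphic_compact_finite_zeros[of _ UNIV] holBc) auto
 then obtain s0 where s0: "s0 > 0" "!!x. x \<in> cball ds (\<mu>/2) ==> B cs x = 0 ==> x ~= ds ==> s0 <= dist ds x"
  using finite_set_avoid[of "{z \<in> cball ds (\<mu>/2). B cs z = 0}" ds] by auto
 define s where "s = min (s0/2) (\<mu>/2)"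
 have s: "s > 0" "s < s0" "s <= \<mu>/2" using s0 \<mu> by (auto simp: s_def)
 have Bs: "B cs d ~= 0" if "d \<in> cball ds s" "d ~= ds" for d
  using s0(2)[of d] that s by fastforce
 have "open {z. (%(c, d). B c d) z ~= 0}" by (intro open_Collect_neq contB continuous_intros)
 moreover have "{cs} \<times> sphere ds s \<subseteq> {z. (%(c, d). B c d) z ~= 0}" using Bs s by auto
 ultimately obtain X0 where X0: "cs \<in> X0" "open X0" "X0 \<times> sphere ds s \<subseteq> {z. (%(c, d). B c d) z ~= 0}"
  using Elementary_Topology.tube_lemma[of "sphere ds s"] by (metis compact_sphere)
 obtain r1 where r1: "r1 > 0" "ball cs r1 \<subseteq> X0" using X0 by (meson open_contains_ball)
 \<comment> \<open>Finiteness of the common zeros isolates \<open>cs\<close>, so that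
   \<open>A\<close> has no zero on the part of the zero set of \<open>B\<close> over the circle of
   radius \<open>r\<close>.\<close>
 obtain r2 where r2: "r2 > 0" "!!c d. A c d = 0 ==> B c d = 0 ==> c ~= cs ==> r2 <= dist cs c"
  using finite_set_avoid[OF fin, of cs] by blast
 define r3 where "r3 = min r1 (min r2 \<mu>)"
 define r where "r = r3/2"
 have r: "r > 0" "r < r3" "r < r2" "r3 <= \<mu>" "r3 <= r1" using r1 r2 \<mu> by (auto simp: r_def r3_def)
 define U where "U = ball cs r3"
 have nz: "B c d ~= 0" if "c \<in> U" "d \<in> sphere ds s" for c d
 proof -
  have "(c, d) \<in> X0 \<times> sphere ds s" using that r r1(2) by (auto simp: U_def)
  hence "(c, d) \<in> {z. (%(c, d). B c d) z ~= 0}" using X0(3) by (rule subsetD[rotated])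
  thus ?thesis by simp
 qed
 \<comment> \<open>The number of zeros with multiplicity, written as the trace of 1, so that
   \<open>trace_holomorphic\<close> also gives its continuity.\<close>
 let ?N = "%c. \<Sum>d\<in>zs B ds s c. of_int (zorder (B c) d) * (1::complex)"
 have N: "?N holomorphic_on U" and finz: "!!c. c \<in> U ==> finite (zs B ds s c)"
  using trace_holomorphic[where f = "%c d. 1" and W = UNIV and U = U, OF contB contBd der holB holBd _ s(1) nz]
  by (auto simp: U_def)
 have sphU: "cball cs r \<subseteq> U" using r by (auto simp: U_def)
 have zpos: "zorder (B c) d > 0" if "c \<in> U" "d \<in> zs B ds s c" for c d
 proof -
  have "ds + of_real s \<in> sphere ds s" using s by (simp add: dist_norm)
  thus ?thesis using nz[OF that(1)] that(2) by (intro zorder_zero_pos holBc) (auto simp: zs_def)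
 qed
 have "compact (?N ` cball cs r)"
  by (intro compact_continuous_image holomorphic_on_imp_continuous_on holomorphic_on_subset[OF N sphU]) auto
 hence "bounded (?N ` cball cs r)" by (rule compact_imp_bounded)
 then obtain M where M0: "M > 0 & (\<forall>x\<in>?N ` cball cs r. norm x <= M)" unfolding bounded_pos by (elim exE)
 have M: "!!c. c \<in> cball cs r ==> norm (?N c) <= M" "M > 0"
  using M0[THEN conjunct2, rule_format, OF imageI] M0 by simp_all
 let ?K = "(sphere cs r \<times> cball ds s) \<inter> {z. (%(c, d). B c d) z = 0}"
 have "compact ?K"
  by (intro compact_Int_closed compact_Times closed_Collect_eq contB continuous_intros) auto
 hence cK: "compact ((%z. norm ((%(c, d). A c d) z)) ` ?K)"
  by (intro compact_continuous_image continuous_intros continuous_on_subset[OF contA]) auto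
 obtain m where m: "m > 0" "!!c d. c \<in> sphere cs r ==> d \<in> cball ds s ==> B c d = 0 ==> norm (A c d) >= m"
 proof (cases "?K = {}")
  case True
  have False if "c \<in> sphere cs r" "d \<in> cball ds s" "B c d = 0" for c d
  proof -
   have "(c, d) \<in> ?K" using that by simp
   thus False unfolding True by simp
  qed
  note noK = this
  show ?thesis
  proof (rule that[of 1])
   show "1 <= norm (A c d)" if "c \<in> sphere cs r" "d \<in> cball ds s" "B c d = 0" for c d
    using noK[OF that] by simp
  qed simp
 next
  case False
  then obtain a where a: "a \<in> ?K" "!!b. b \<in> ?K ==> norm ((%(c, d). A c d) a) <= norm ((%(c, d). A c d) b)"
  proof -
   have "(%z. norm ((%(c, d). A c d) z)) ` ?K ~= {}" using False by blast
   from compact_attains_inf[OF cK this] obtain x where x: "x \<in> (%z. norm ((%(c, d). A c d) z)) ` ?K"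
    "!!t. t \<in> (%z. norm ((%(c, d). A c d) z)) ` ?K ==> x <= t" by (elim bexE) metis
   from x(1) obtain a0 where a0: "a0 \<in> ?K" "x = norm ((%(c, d). A c d) a0)" by (elim imageE)
   show thesis by (rule that[OF a0(1)]) (use x(2)[OF imageI] a0(2) in simp)
  qed
  obtain a1 a2 where a12: "a = (a1, a2)" by force
  have "A a1 a2 ~= 0"
  proof
   assume "A a1 a2 = 0"
   thus False using r2(2)[of a1 a2] a(1) r a12 by auto
  qed
  show ?thesis
  proof (rule that[of "norm (A a1 a2)"])
   show "norm (A a1 a2) > 0" using \<open>A a1 a2 ~= 0\<close> by simp
   show "norm (A c d) >= norm (A a1 a2)" if "c \<in> sphere cs r" "d \<in> cball ds s" "B c d = 0" for c d
    using a(2)[of "(c, d)"] that a12 by simp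
  qed
 qed
 \<comment> \<open>For |u| < e the trace is at most 2 M / m on the circle, whereas at the centre it
   is at least 1 / e = 2 (M + 1) / m.\<close>
 define e where "e = m / (2 * (M + 1))"
 have e: "e > 0" using m M by (simp add: e_def)
 have eM: "e * (2 * (M + 1)) = m" using M by (simp add: e_def)
 have em: "e < m / 2"
 proof -
  have "m / 2 = e * (M + 1)" using eM by (simp add: algebra_simps)
  also have "... > e * 1" using e M by (intro mult_strict_left_mono) auto
  finally show ?thesis by simp
 qed
 show ?thesis
  using unif[OF e]
 proof eventually_elim
  case (elim j)
  show ?case
  proof (rule ccontr)
   assume contra: "~ ?thesis"
   let ?D = "ball cs R \<times> ball ds R" and ?g = "%z. (%(c, d). A c d) z - (%(c, d). u j c d) z"
   have gc: "continuous_on ?D ?g" by (intro continuous_intros contu continuous_on_subset[OF contA]) auto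
   define W where "W = {z \<in> ?D. ?g z ~= 0}"
   have W: "open W"
   proof -
    have "open (?D \<inter> ?g -` (- {0}))" using gc by (intro continuous_open_preimage open_Times) auto
    moreover have "?D \<inter> ?g -` (- {0}) = W" unfolding W_def by blast
    ultimately show ?thesis by metis
   qed
   let ?f = "%c d. 1 / (A c d - u j c d)"
   let ?T = "%c. \<Sum>d\<in>zs B ds s c. of_int (zorder (B c) d) * ?f c d"
   have T: "?T holomorphic_on U"
   proof (rule trace_holomorphic(1)[where W = W, OF contB contBd der holB holBd _ s(1) nz W])
    show "open U" by (simp add: U_def)
    have "continuous_on W (%z. 1 / ?g z)"
     by (intro continuous_intros continuous_on_subset[OF gc]) (auto simp: W_def)
    thus "continuous_on W (%(c, d). ?f c d)" by (simp add: case_prod_unfold)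
    fix c d
    {
     assume "(c, d) \<in> W"
     hence cd: "c \<in> ball cs R" "d \<in> ball ds R" "A c d - u j c d ~= 0" by (auto simp: W_def)
     show "(%c. ?f c d) field_differentiable (at c)"
      using cd holA1[of d] by (intro derivative_intros u1 field_differentiable_divide field_differentiable_diff) (auto simp: holomorphic_on_def)
     show "?f c field_differentiable (at d)"
      using cd holA2[of c] by (intro derivative_intros u2 field_differentiable_divide field_differentiable_diff) (auto simp: holomorphic_on_def)
    }
    assume "c \<in> U" "d \<in> zs B ds s c"
    hence *: "c \<in> ball cs \<mu>" "d \<in> ball ds \<mu>" "B c d = 0" using r s \<mu> by (auto simp: U_def zs_def)
    hence "A c d ~= u j c d" using contra \<mu> by auto
    thus "(c, d) \<in> W" using * \<mu> by (auto simp: W_def)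
   qed
   have "norm (?T cs) <= (2 / m) * M"
   proof (rule maximum_modulus_frontier[of ?T "ball cs r"])
    show "?T holomorphic_on interior (ball cs r)" using T sphU by (auto elim!: holomorphic_on_subset)
    show "continuous_on (closure (ball cs r)) ?T"
     using T sphU r by (auto intro!: holomorphic_on_imp_continuous_on elim!: holomorphic_on_subset)
    fix c assume "c \<in> frontier (ball cs r)"
    hence c: "c \<in> sphere cs r" "c \<in> cball cs r" "c \<in> U" using r sphU by auto
    have "norm (?T c) <= (\<Sum>d\<in>zs B ds s c. norm (of_int (zorder (B c) d) * ?f c d))" by (rule norm_sum)
    also have "... <= (\<Sum>d\<in>zs B ds s c. of_int (zorder (B c) d) * (2/m))"
    proof (rule sum_mono)
     fix d assume d: "d \<in> zs B ds s c"
     hence "norm (A c d) >= m" using m(2)[OF c(1)] by (auto simp: zs_def)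
     moreover have "norm (u j c d) < e" using elim d r s \<mu> c by (auto simp: zs_def)
     ultimately have "norm (A c d - u j c d) >= m / 2" using em norm_triangle_ineq2[of "A c d" "u j c d"] by linarith
     hence "norm (?f c d) <= 2 / m" using m(1) by (simp add: norm_divide divide_simps)
     thus "norm (of_int (zorder (B c) d) * ?f c d) <= of_int (zorder (B c) d) * (2/m)"
      unfolding norm_mult using zpos[OF c(3) d] by (intro mult_mono) auto
    qed
    also have "... = (2/m) * (\<Sum>d\<in>zs B ds s c. of_int (zorder (B c) d))" by (simp add: sum_distrib_left mult.commute)
    also have "(\<Sum>d\<in>zs B ds s c. of_int (zorder (B c) d)) = norm (?N c)"
    proof -
     have "?N c = of_real (\<Sum>d\<in>zs B ds s c. of_int (zorder (B c) d))" by simp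
     moreover have "(\<Sum>d\<in>zs B ds s c. real_of_int (zorder (B c) d)) >= 0" by (intro sum_nonneg) (use zpos[OF c(3)] in force)
     ultimately show ?thesis by (metis abs_of_nonneg norm_of_real)
    qed
    also have "(2/m) * norm (?N c) <= (2/m) * M" using M(1)[OF c(2)] m by (intro mult_left_mono) auto
    finally show "norm (?T c) <= (2 / m) * M" .
   qed (use r in auto)
   moreover have "norm (?T cs) >= 1 / e"
   proof -
    have "d = ds" if "d \<in> ball ds s" "B cs d = 0" for d using Bs[of d] that by force
    hence z1: "zs B ds s cs = {ds}" using zero s by (auto simp: zs_def)
    have cU: "cs \<in> U" using r by (simp add: U_def)
    have n1: "\<bar>real_of_int (zorder (B cs) ds)\<bar> >= 1" using zpos[OF cU] z1 by force
    have "norm (u j cs ds) < e" using elim R by auto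
    moreover have "norm (u j cs ds) > 0" using unz[of j] by simp
    ultimately have "1 / e <= 1 / norm (u j cs ds)" using e by (intro divide_left_mono mult_pos_pos) simp_all
    also have "... = 1 * norm (?f cs ds)" by (simp add: zero norm_divide)
    also have "... <= \<bar>real_of_int (zorder (B cs) ds)\<bar> * norm (?f cs ds)" using n1 by (intro mult_right_mono) auto
    finally show ?thesis by (simp add: z1 norm_mult norm_divide)
   qed
   ultimately have "1 / e <= (2 / m) * M" by linarith
   hence "m <= e * (2 * M)" using e m by (simp add: field_simps)
   hence "e * (2 * (M + 1)) <= e * (2 * M)" using eM by simp
   thus False using e by (simp add: algebra_simps)
  qed
 qed
qed

section \<open>Elimination for the two critical relations\<close>

text \<open>Bivariate polynomials are polynomials in d with coefficients in c, so that
  pseudo-division with respect to d is available.\<close>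

definition bi :: "complex poly poly => complex => complex => complex" where
 "bi P c d = poly (poly P [:d:]) c"

lemma bi_simps [simp]:
 "bi 0 c d = 0" "bi 1 c d = 1" "bi (pCons a P) c d = poly a c + d * bi P c d" "bi (P + Q) c d = bi P c d + bi Q c d"
 "bi (P - Q) c d = bi P c d - bi Q c d" "bi (P * Q) c d = bi P c d * bi Q c d"
 "bi (smult a P) c d = poly a c * bi P c d" "bi (P ^ n) c d = bi P c d ^ n"
 by (simp_all add: bi_def)

lemma continuous_on_bi: "continuous_on UNIV (%(c, d). bi P c d)"
proof (induction P)
 case (pCons a P)
 have "continuous_on UNIV (%z. poly a (fst z) + snd z * (%(c, d). bi P c d) (z::complex \<times> complex))"
  by (intro continuous_intros pCons)
 thus ?case by (simp add: case_prod_unfold)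
qed (simp add: case_prod_unfold)

lemma holomorphic_bi: "(%c. bi P c d) holomorphic_on S"
 unfolding bi_def by (intro holomorphic_intros)

lemma bi_deriv: "(bi P c has_field_derivative bi (pderiv P) c d) (at d)"
proof (induction P)
 case 0
 have "bi 0 c = (%d. 0)" by auto
 thus ?case by simp
next
 case (pCons a P)
 have e: "bi (pCons a P) c = (%d. poly a c + d * bi P c d)" by auto
 show ?case unfolding e pderiv_pCons
  by (rule derivative_eq_intros pCons refl)+ (simp add: algebra_simps)
qed

lemma bi_map_poly: "poly (map_poly (%q. poly q c) P) d = bi P c d"
 by (induction P) (simp_all add: map_poly_pCons)

text \<open>By pseudo-division an element G of least degree in the ideal of A and B divides both, up
  to nonzero factors in c alone. If G has degree 0 in d, common zeros lie over its roots in c.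
  Otherwise G has a zero d for all but finitely many c, and A and B vanish there too.\<close>

lemma bi_common_zeros:
 fixes A B :: "complex poly poly"
 assumes B: "B ~= 0"
 shows "finite {c. \<exists>d. bi A c d = 0 & bi B c d = 0} \<or> (\<exists>S. finite S & (\<forall>c. c \<notin> S --> (\<exists>d. bi A c d = 0 & bi B c d = 0)))"
proof -
 define I where "I = {G. G ~= 0 & (\<exists>U V. G = U * A + V * B)}"
 have "B \<in> I" unfolding I_def using B by (simp, intro exI[of _ 0] exI[of _ 1]) simp
 then obtain G where G: "G \<in> I" "!!H. H \<in> I ==> degree G <= degree H"
  using ex_has_least_nat[of "%G. G \<in> I" B degree] by blast
 obtain U V where UV: "G = U * A + V * B" and G0: "G ~= 0" using G(1) by (auto simp: I_def)
 have quot: "\<exists>a Q. a ~= 0 & smult a H = G * Q" if H: "H = U' * A + V' * B" for H U' V'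
 proof -
  obtain a Q where aQ: "a ~= 0" "smult a H = G * Q + pseudo_mod H G" using pseudo_mod(1)[OF G0] by blast
  have "pseudo_mod H G = smult a H - G * Q" using aQ by simp
  also have "... = (smult a U' - Q * U) * A + (smult a V' - Q * V) * B"
   unfolding H UV by (simp add: algebra_simps smult_add_right)
  finally have "pseudo_mod H G = 0 \<or> pseudo_mod H G \<in> I" by (auto simp: I_def)
  hence "pseudo_mod H G = 0" using pseudo_mod(2)[OF G0, of H] G(2) by force
  thus ?thesis using aQ by auto
 qed
 show ?thesis
 proof (cases "degree G = 0")
  case True
  then obtain r where r: "G = [:r:]" by (meson degree_eq_zeroE)
  hence "r ~= 0" using G0 by auto
  have "poly r c = 0" if "bi A c d = 0" "bi B c d = 0" for c d
  proof -
   have "bi G c d = 0" unfolding UV using that by simp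
   thus ?thesis unfolding r by simp
  qed
  hence "{c. \<exists>d. bi A c d = 0 & bi B c d = 0} \<subseteq> {c. poly r c = 0}" by auto
  thus ?thesis using poly_roots_finite[OF \<open>r ~= 0\<close>] finite_subset by blast
 next
  case False
  obtain a Q where a: "a ~= 0" "smult a A = G * Q" using quot[of A 1 0] by auto
  obtain b Q' where b: "b ~= 0" "smult b B = G * Q'" using quot[of B 0 1] by auto
  define S where "S = {c. poly a c = 0} \<union> {c. poly b c = 0} \<union> {c. poly (lead_coeff G) c = 0}"
  have "finite S" unfolding S_def using a b G0 by (intro finite_UnI poly_roots_finite) auto
  moreover have "\<exists>d. bi A c d = 0 & bi B c d = 0" if c: "c \<notin> S" for c
  proof -
   let ?p = "map_poly (%q. poly q c) G"
   have "coeff ?p (degree G) ~= 0" using c by (simp add: coeff_map_poly S_def)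
   hence "degree ?p >= degree G" by (rule le_degree)
   hence "degree ?p > 0" using False by simp
   then obtain d where "poly ?p d = 0" using alg_closed_imp_poly_has_root[of ?p] by auto
   hence d: "bi G c d = 0" by (simp add: bi_map_poly)
   have "bi (smult a A) c d = 0" "bi (smult b B) c d = 0" unfolding a b using d by simp_all
   thus ?thesis using c by (auto simp: S_def)
  qed
  ultimately have "finite S & (\<forall>c. c \<notin> S --> (\<exists>d. bi A c d = 0 & bi B c d = 0))" by simp
  thus ?thesis by (rule disjI2[OF exI])
 qed
qed

definition cubP :: "complex poly poly => complex poly poly" where
 "cubP Z = Z^3 - [:[:3/2:]:] * ([:[:0, 1:]:] + [:0, 1:]) * Z^2 + [:[:3:]:] * [:[:0, 1:]:] * [:0, 1:] * Z"

lemma bi_cubP: "bi ((cubP ^^ n) Z) c d = (cub c d ^^ n) (bi Z c d)"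
proof (induction n)
 case (Suc n)
 have "bi (cubP W) c d = cub c d (bi W c d)" for W
  by (simp add: cubP_def cub_def field_simps)
 thus ?case by (simp add: Suc)
qed simp

lemma cub_low:
 assumes "norm c <= ro" "norm d <= ro" "ro >= 1" "norm z >= 5 * ro"
 shows "norm (cub c d z) >= 5 * ro"
proof -
 have "norm (3/2 * (c + d) * z - 3 * c * d) <= norm (3/2 * (c + d) * z) + norm (3 * c * d)" by (rule norm_triangle_ineq4)
 also have "... <= 3/2 * (2 * ro) * norm z + 3 * ro * ro"
 proof -
  have "norm (c + d) <= 2 * ro" using norm_triangle_ineq[of c d] assms by simp
  hence "3/2 * norm (c + d) * norm z <= 3/2 * (2 * ro) * norm z" by (intro mult_right_mono) auto
  moreover have "3 * norm c * norm d <= 3 * ro * ro" using assms by (intro mult_mono) auto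
  moreover have "norm (3/2 * (c + d) * z) = 3/2 * norm (c + d) * norm z" "norm (3 * c * d) = 3 * norm c * norm d"
   by (simp_all only: norm_mult norm_divide norm_numeral)
  ultimately show ?thesis by linarith
 qed
 finally have 1: "norm (3/2 * (c + d) * z - 3 * c * d) <= 3 * ro * norm z + 3 * ro * ro" by simp
 have "ro * norm z <= norm z / 5 * norm z" using assms by (intro mult_right_mono) auto
 moreover have "ro * ro <= norm z / 5 * (norm z / 5)" using assms by (intro mult_mono) auto
 moreover have "1 <= norm z / 5 * (norm z / 5)" using assms mult_mono[of 1 "norm z / 5" 1 "norm z / 5"] by simp
 ultimately have "3 * (ro * norm z) + 3 * (ro * ro) + 1 <= norm z * norm z" by simp
 moreover have "norm (z^2) = norm z * norm z" by (simp only: norm_mult power2_eq_square)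
 moreover have "norm (z^2 - (3/2 * (c + d) * z - 3 * c * d)) >= norm (z^2) - norm (3/2 * (c + d) * z - 3 * c * d)"
  by (rule norm_triangle_ineq2)
 ultimately have "norm (z^2 - (3/2 * (c + d) * z - 3 * c * d)) >= 1" using 1 by (simp add: mult.assoc)
 hence "norm z * 1 <= norm z * norm (z^2 - (3/2 * (c + d) * z - 3 * c * d))" by (intro mult_left_mono) auto
 also have "... = norm (cub c d z)" unfolding norm_mult[symmetric] by (simp add: cub_def power2_eq_square power3_eq_cube algebra_simps)
 finally show ?thesis using assms by simp
qed

lemma cub_iter_nonzero:
 assumes "norm c <= ro" "norm d <= ro" "ro >= 1" "norm (cub c d z) >= 5 * ro" "z ~= 0"
 shows "(cub c d ^^ n) z ~= 0"
proof (cases n)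
 case (Suc k)
 have "norm ((cub c d ^^ Suc k) z) >= 5 * ro"
  by (induction k) (use assms cub_low[OF assms(1-3)] in auto)
 thus ?thesis using Suc assms(3) by auto
qed (use assms in auto)

lemma cub_at_crit: "cub c d d = - (1/2) * d^2 * (d - 3 * c)" "cub c d c = - (1/2) * c^2 * (c - 3 * d)"
 by (simp_all add: cub_def power2_eq_square power3_eq_cube field_simps)

text \<open>The critical values are -d^2 (d - 3 c) / 2 and -c^2 (c - 3 d) / 2. The first one is
  large unless d is close to 3 c, and then c is of comparable size and the second one is
  large.\<close>

lemma crit_escape_aux:
 assumes "norm c <= norm d" "norm d >= 15"
 shows "norm (cub c d c) >= 5 * norm d & c ~= 0 \<or> norm (cub c d d) >= 5 * norm d"
proof -
 let ?r = "norm d"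
 have r2: "?r * ?r >= 15 * 15" using assms by (intro mult_mono) auto
 have nd: "norm (cub c d d) = 1/2 * (?r * ?r) * norm (d - 3 * c)" and nc: "norm (cub c d c) = 1/2 * (norm c * norm c) * norm (c - 3 * d)"
  unfolding cub_at_crit by (simp_all add: norm_mult norm_power power2_eq_square)
 show ?thesis
 proof (cases "norm (d - 3 * c) >= ?r / 2")
  case True
  have "5 * ?r <= 1/2 * (15 * 15) * (?r/2)" by simp
  also have "... <= 1/2 * (?r * ?r) * norm (d - 3 * c)" using True assms by (intro mult_mono) auto
  finally show ?thesis using nd by simp
 next
  case False
  have "norm d <= norm (d - 3 * c) + norm (3 * c)" using norm_triangle_ineq[of "d - 3 * c" "3 * c"] by simp
  hence c: "norm c >= ?r / 6" using False by (simp add: norm_mult)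
  have "norm (8 * d) = norm (3 * (3 * d - c) - (d - 3 * c))" by (rule arg_cong[of _ _ norm]) simp
  also have "... <= norm (3 * (3 * d - c)) + norm (d - 3 * c)" by (rule norm_triangle_ineq4)
  also have "norm (3 * (3 * d - c)) = 3 * norm (c - 3 * d)" by (simp only: norm_mult norm_minus_commute norm_numeral)
  finally have "8 * ?r <= 3 * norm (c - 3 * d) + norm (d - 3 * c)" by (simp add: norm_mult)
  hence "norm (c - 3 * d) >= 2 * ?r" using False norm_ge_zero[of d] by linarith
  moreover have "norm c * norm c >= (15/6) * (15/6)" using c assms by (intro mult_mono) auto
  hence h: "1/2 * ((15/6) * (15/6)) <= 1/2 * (norm c * norm c)" by linarith
  ultimately have "1/2 * ((15/6) * (15/6)) * (2 * ?r) <= 1/2 * (norm c * norm c) * norm (c - 3 * d)"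
   by (intro mult_mono[OF h]) simp_all
  moreover have "5 * ?r <= 1/2 * ((15/6) * (15/6)) * (2 * ?r)" by simp
  ultimately have "5 * ?r <= 1/2 * (norm c * norm c) * norm (c - 3 * d)" by linarith
  thus ?thesis using nc c assms by auto
 qed
qed

text \<open>One critical value is so large that its orbit never reaches 0. So the two relations
  cannot have common solutions for all but finitely many c, which is the infinite alternative of
  \<open>bi_common_zeros\<close>.\<close>

lemma crit_escape:
 assumes "norm c >= 15" shows "(cub c d ^^ m) c ~= 0 \<or> (cub c d ^^ m') d ~= 0"
proof (cases "norm c <= norm d")
 case True
 hence d: "norm d >= 15" "d ~= 0" using assms by auto
 from crit_escape_aux[OF True d(1)] show ?thesis
  using cub_iter_nonzero[OF True order_refl, of c m] cub_iter_nonzero[OF True order_refl, of d m'] d by auto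
next
 case False
 hence le: "norm d <= norm c" and c: "c ~= 0" using assms by auto
 from crit_escape_aux[OF le assms] show ?thesis unfolding cub_commute[of d c]
  using cub_iter_nonzero[OF order_refl le, of c m] cub_iter_nonzero[OF order_refl le, of d m'] c assms by auto
qed

lemma perturb_cub:
 assumes c2: "norm cs <= 2" and zero: "(cub cs ds ^^ m) cs = 0" "(cub cs ds ^^ m') ds = 0"
  and R: "R > 0" and contu: "!!j. continuous_on (ball cs R \<times> ball ds R) (%(c, d). u j c d)"
  and u1: "!!j c d. c \<in> ball cs R ==> d \<in> ball ds R ==> (%c. u j c d) field_differentiable (at c)"
  and u2: "!!j c d. c \<in> ball cs R ==> d \<in> ball ds R ==> (u j c) field_differentiable (at d)"
  and unif: "!!e. e > 0 ==> eventually (%j. \<forall>c\<in>ball cs R. \<forall>d\<in>ball ds R. norm (u j c d) < e) sequentially"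
  and unz: "!!j. u j cs ds ~= 0" and eps: "eps > 0"
 shows "eventually (%j. \<exists>c\<in>ball cs eps. \<exists>d\<in>ball ds eps. (cub c d ^^ m') d = 0 & (cub c d ^^ m) c = u j c d) sequentially"
proof -
 define A where "A = (cubP ^^ m) [:[:0, 1:]:]"
 define B where "B = (cubP ^^ m') [:0, 1:]"
 have A: "bi A c d = (cub c d ^^ m) c" and B: "bi B c d = (cub c d ^^ m') d" for c d
  by (simp_all add: A_def B_def bi_cubP)
 \<comment> \<open>At d = 20, far beyond \<open>cs\<close>, the critical value escapes; hence the
   relation for d is not identically satisfied over \<open>cs\<close>.\<close>
 have n20: "bi B cs 20 ~= 0" unfolding B
 proof (rule cub_iter_nonzero[of _ 20])
  have "norm (20 - 3 * cs) >= 14" using norm_triangle_ineq2[of 20 "3 * cs"] c2 by (simp add: norm_mult)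
  moreover have "norm (cub cs 20 20) = 200 * norm (20 - 3 * cs)"
   unfolding cub_at_crit norm_mult by (simp add: norm_power)
  ultimately show "5 * 20 <= norm (cub cs 20 20)" by simp
 qed (use c2 in auto)
 have fin: "finite {c. \<exists>d. bi A c d = 0 & bi B c d = 0}"
 proof -
  have False if S: "finite S" "!!c. c \<notin> S ==> \<exists>d. bi A c d = 0 & bi B c d = 0" for S
  proof -
   have "bounded S" using S(1) by (rule finite_imp_bounded)
   then obtain b where b: "!!x. x \<in> S ==> norm x <= b" by (auto simp: bounded_iff)
   have "complex_of_real (15 + \<bar>b\<bar>) \<notin> S" using b[of "complex_of_real (15 + \<bar>b\<bar>)"] unfolding norm_of_real by force
   then obtain d where "bi A (complex_of_real (15 + \<bar>b\<bar>)) d = 0 & bi B (complex_of_real (15 + \<bar>b\<bar>)) d = 0" using S(2) by blast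
   thus False unfolding A B using crit_escape[where c = "complex_of_real (15 + \<bar>b\<bar>)" and d = d and m = m and m' = m'] unfolding norm_of_real by simp
  qed
  moreover have "B ~= 0" using n20 by auto
  ultimately show ?thesis using bi_common_zeros[of B A] by blast
 qed
 have "eventually (%j. \<exists>c\<in>ball cs eps. \<exists>d\<in>ball ds eps. bi B c d = 0 & bi A c d = u j c d) sequentially"
 proof (rule perturb[where Bd = "bi (pderiv B)" and dn = 20, OF continuous_on_bi continuous_on_bi bi_deriv holomorphic_bi holomorphic_bi continuous_on_bi holomorphic_bi _ _ _ fin n20 R contu u1 u2 unif unz eps])
  show "bi A c holomorphic_on UNIV" for c
   using bi_deriv by (meson field_differentiable_at_within field_differentiable_def holomorphic_onI)
 qed (use zero A B in auto)
 thus ?thesis by (simp add: A B)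
qed

section \<open>Persistence of orbits\<close>

text \<open>On the diagonal over \<open>K\<close> the quotient \<open>cubq\<close> is nonzero;
  compactness and the tube lemma extend this to a neighbourhood that is uniform in parameters and
  points.\<close>

lemma unif_inj:
 assumes K: "compact K" "c0 \<notin> K" "d0 \<notin> K"
 obtains r where "r > 0" "!!c d z w w'. norm (c - c0) < r ==> norm (d - d0) < r ==> z \<in> K ==> norm (w - z) < r ==> norm (w' - z) < r ==>
  cubq c d w w' ~= 0 & w ~= c & w ~= d"
proof -
 define g :: "(complex \<times> complex \<times> complex \<times> complex) \<times> complex => complex" where
  "g x = cubq (fst (fst x)) (fst (snd (fst x))) (snd x + fst (snd (snd (fst x)))) (snd x + snd (snd (snd (fst x))))" for x
 have "continuous_on UNIV g" unfolding g_def cubq_def by (intro continuous_intros) auto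
 hence W: "open {x. g x ~= 0}" by (intro open_Collect_neq continuous_intros)
 have "g ((c0, d0, 0, 0), z) ~= 0" if "z \<in> K" for z
  unfolding g_def using that K by (auto simp: cubq_same)
 hence "{(c0, d0, 0, 0)} \<times> K \<subseteq> {x. g x ~= 0}" by auto
 from Elementary_Topology.tube_lemma[OF K(1) W this]
 obtain X0 where X0: "(c0, d0, 0, 0) \<in> X0" "open X0" "X0 \<times> K \<subseteq> {x. g x ~= 0}" by (elim exE conjE)
 from X0(1,2) obtain e where e: "e > 0" "ball (c0, d0, 0, 0) e \<subseteq> X0" by (meson open_contains_ball)
 have main: "cubq c d w w' ~= 0" if "norm (c - c0) < e/4" "norm (d - d0) < e/4" "z \<in> K" "norm (w - z) < e/4" "norm (w' - z) < e/4" for c d z w w'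
 proof -
  have "dist (c0, d0, 0, 0) (c, d, w - z, w' - z) = norm (c - c0, d - d0, w - z, w' - z)"
   by (subst dist_commute) (simp add: dist_norm)
  also have "... <= norm (c - c0) + (norm (d - d0) + (norm (w - z) + norm (w' - z)))"
   by (intro order_trans[OF norm_Pair_le] add_left_mono order_refl)
  also have "... < e" using that by linarith
  finally have "(c, d, w - z, w' - z) \<in> X0" using e(2) by auto
  hence "((c, d, w - z, w' - z), z) \<in> {x. g x ~= 0}" using X0(3) that(3) by blast
  thus ?thesis by (simp add: g_def)
 qed
 show ?thesis
 proof (rule that[of "e/4"])
  fix c d z w w' assume *: "norm (c - c0) < e/4" "norm (d - d0) < e/4" "z \<in> K" "norm (w - z) < e/4" "norm (w' - z) < e/4"
  show "cubq c d w w' ~= 0 & w ~= c & w ~= d"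
   using main[OF *] main[OF *(1-4,4)] by (auto simp: cubq_same)
 qed (use e in simp)
qed

lemma cub_near:
 assumes "e > 0"
 obtains r where "r > 0" "!!c d w. norm (c - c0) < r ==> norm (d - d0) < r ==> norm (w - a) < r ==> norm ((cub c d ^^ n) w - (cub c0 d0 ^^ n) a) < e"
proof -
 have "((%x. (cub (fst x) (fst (snd x)) ^^ n) (snd (snd x))) \<longlongrightarrow> (cub c0 d0 ^^ n) a) (nhds (c0, d0, a))"
  using tendsto_cub_funpow[where c = fst and d = "%x. fst (snd x)" and f = "%x. snd (snd x)" and n = n and F = "nhds (c0, d0, a)"]
   tendsto_fst[OF filterlim_ident, of "(c0, d0, a)"] tendsto_fst[OF tendsto_snd[OF filterlim_ident], of "(c0, d0, a)"]
   tendsto_snd[OF tendsto_snd[OF filterlim_ident], of "(c0, d0, a)"] by simp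
 hence "eventually (%x. dist ((cub (fst x) (fst (snd x)) ^^ n) (snd (snd x))) ((cub c0 d0 ^^ n) a) < e) (nhds (c0, d0, a))"
  using assms by (simp add: tendsto_iff)
 then obtain r where r: "r > 0" "!!x. dist x (c0, d0, a) < r ==> dist ((cub (fst x) (fst (snd x)) ^^ n) (snd (snd x))) ((cub c0 d0 ^^ n) a) < e"
  unfolding eventually_nhds_metric by blast
 show ?thesis
 proof (rule that[of "r/3"])
  fix c d w assume *: "norm (c - c0) < r/3" "norm (d - d0) < r/3" "norm (w - a) < r/3"
  have "dist (c, d, w) (c0, d0, a) = norm (c - c0, d - d0, w - a)" by (simp add: dist_norm)
  also have "... <= norm (c - c0) + (norm (d - d0) + norm (w - a))"
   by (intro order_trans[OF norm_Pair_le] add_left_mono order_refl)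
  also have "... < r" using * by linarith
  finally show "norm ((cub c d ^^ n) w - (cub c0 d0 ^^ n) a) < e" using r(2)[of "(c, d, w)"] by (simp add: dist_norm)
 qed (use r in simp)
qed

text \<open>One radius serves parameters and points. Critical points are avoided before time n only,
  because at time n the orbit is allowed to hit one, as the branch point of a stage does.\<close>

definition chain_ok :: "complex => complex => nat => complex => real => bool" where
 "chain_ok c0 d0 n a r \<longleftrightarrow> (\<forall>c d. norm (c - c0) < r --> norm (d - d0) < r -->
  (\<forall>w w'. norm (w - a) < r --> norm (w' - a) < r --> (cub c d ^^ n) w = (cub c d ^^ n) w' --> w = w') &
  (\<forall>w i. norm (w - a) < r --> i < n --> (cub c d ^^ i) w ~= c & (cub c d ^^ i) w ~= d))"

lemma chain_okD:
 assumes "chain_ok c0 d0 n a r" "norm (c - c0) < r" "norm (d - d0) < r" "norm (w - a) < r"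
 shows "norm (w' - a) < r ==> (cub c d ^^ n) w = (cub c d ^^ n) w' ==> w = w'"
  "i < n ==> (cub c d ^^ i) w ~= c & (cub c d ^^ i) w ~= d"
 using assms unfolding chain_ok_def by blast+

lemma inj_chain:
 assumes "\<forall>i<n. (cub c0 d0 ^^ i) a ~= c0 & (cub c0 d0 ^^ i) a ~= d0"
 shows "\<exists>r>0. chain_ok c0 d0 n a r"
 using assms
proof (induction n arbitrary: a)
 case 0
 show ?case by (rule exI[of _ 1]) (simp add: chain_ok_def)
next
 case (Suc n)
 have "\<forall>i<n. (cub c0 d0 ^^ i) (cub c0 d0 a) ~= c0 & (cub c0 d0 ^^ i) (cub c0 d0 a) ~= d0"
 proof (intro allI impI)
  fix i assume "i < n"
  thus "(cub c0 d0 ^^ i) (cub c0 d0 a) ~= c0 & (cub c0 d0 ^^ i) (cub c0 d0 a) ~= d0"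
   using Suc.prems[rule_format, of "Suc i"] by (simp add: funpow_swap1)
 qed
 from Suc.IH[OF this] obtain r1 where r1: "r1 > 0" "chain_ok c0 d0 n (cub c0 d0 a) r1" by blast
 have "a ~= c0" "a ~= d0" using Suc.prems by force+
 hence "c0 \<notin> {a}" "d0 \<notin> {a}" by auto
 from unif_inj[OF compact_sing this] obtain r2 where r2: "r2 > 0" "!!c d z w w'. norm (c - c0) < r2 ==> norm (d - d0) < r2 ==> z \<in> {a} ==> norm (w - z) < r2 ==> norm (w' - z) < r2 ==>
  cubq c d w w' ~= 0 & w ~= c & w ~= d" by blast
 obtain r3 where r3: "r3 > 0" "!!c d w. norm (c - c0) < r3 ==> norm (d - d0) < r3 ==> norm (w - a) < r3 ==> norm ((cub c d ^^ 1) w - (cub c0 d0 ^^ 1) a) < r1"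
  by (rule cub_near[OF r1(1), where n = 1 and a = a and ?c0.0 = c0 and ?d0.0 = d0]) blast
 define r where "r = min r1 (min r2 r3)"
 have r: "r > 0" "r <= r1" "r <= r2" "r <= r3" using r1 r2 r3 by (auto simp: r_def)
 have "chain_ok c0 d0 (Suc n) a r"
  unfolding chain_ok_def
 proof (intro conjI allI impI)
  fix c d assume cd: "norm (c - c0) < r" "norm (d - d0) < r"
  have F: "norm (cub c d w - cub c0 d0 a) < r1" if "norm (w - a) < r" for w
   using r3(2)[of c d w] cd that r by simp
  have cd1: "norm (c - c0) < r1" "norm (d - d0) < r1" using cd r by simp_all
  show "w = w'" if w: "norm (w - a) < r" "norm (w' - a) < r" "(cub c d ^^ Suc n) w = (cub c d ^^ Suc n) w'" for w w'
  proof -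
   have "(cub c d ^^ n) (cub c d w) = (cub c d ^^ n) (cub c d w')" using w(3) by (simp add: funpow_swap1)
   hence "cub c d w = cub c d w'" by (rule chain_okD(1)[OF r1(2) cd1 F[OF w(1)] F[OF w(2)]])
   moreover have "cubq c d w w' ~= 0" using r2(2)[of c d a w w'] cd w r by simp
   ultimately show "w = w'" using cub_diff[of c d w w'] by simp
  qed
  fix w i assume w: "norm (w - a) < r" "i < Suc n"
  have "(cub c d ^^ i) w ~= c & (cub c d ^^ i) w ~= d"
  proof (cases i)
   case 0
   thus ?thesis using r2(2)[of c d a w w] cd w r by simp
  next
   case (Suc i')
   thus ?thesis using chain_okD(2)[OF r1(2) cd1 F[OF w(1)], of i'] w by (simp add: funpow_swap1)
  qed
  thus "(cub c d ^^ i) w ~= c" "(cub c d ^^ i) w ~= d" by simp_all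
 qed
 thus ?case using r(1) by blast
qed

text \<open>Joint continuity with separate complex differentiability is the form in which
  \<open>perturb\<close> takes its right-hand sides.\<close>

definition nice :: "real => complex => complex => (complex => complex => complex) => bool" where
 "nice R c0 d0 f \<longleftrightarrow> continuous_on (ball c0 R \<times> ball d0 R) (%(c, d). f c d) &
  (\<forall>c\<in>ball c0 R. \<forall>d\<in>ball d0 R. (%c. f c d) field_differentiable (at c) & f c field_differentiable (at d))"

lemma nice_mono: "nice R c0 d0 f ==> R' <= R ==> nice R' c0 d0 f"
 unfolding nice_def by (meson Sigma_mono continuous_on_subset subset_ball subsetD)

text \<open>\<open>cub_root_near\<close> gives a preimage close to the old one, and
  \<open>cubq\<close> nonzero on the ball identifies it with \<open>Z\<close>; this is continuity.
  Differentiability follows from \<open>cub_implicit_differentiable\<close>.\<close>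

lemma nice_pull:
 assumes y: "nice R c0 d0 y"
  and nz: "!!c d z w. c \<in> ball c0 R ==> d \<in> ball d0 R ==> z \<in> ball a e ==> w \<in> ball a e ==> cubq c d z w ~= 0"
  and Z: "!!c d. c \<in> ball c0 R ==> d \<in> ball d0 R ==> Z c d \<in> ball a e & cub c d (Z c d) = y c d"
 shows "nice R c0 d0 Z"
proof -
 let ?D = "ball c0 R \<times> ball d0 R"
 have D: "open ?D" by (intro open_Times) auto
 have cont: "isCont (%(c, d). Z c d) (c1, d1)" if cd1: "c1 \<in> ball c0 R" "d1 \<in> ball d0 R" for c1 d1
  unfolding continuous_at tendsto_iff
 proof (intro allI impI)
  fix eps :: real assume eps: "eps > 0"
  have "Z c1 d1 \<in> ball a e" using Z[OF cd1] by simp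
  then obtain r0 where r0: "r0 > 0" "ball (Z c1 d1) r0 \<subseteq> ball a e" by (meson open_ball open_contains_ball)
  define r where "r = min r0 eps"
  have r: "r > 0" "r <= r0" "r <= eps" using r0 eps by (auto simp: r_def)
  have yc: "isCont (%(c, d). y c d) (c1, d1)"
   using y D cd1 unfolding nice_def by (meson SigmaI continuous_on_eq_continuous_at)
  have "((%x. cub (fst x) (snd x) (Z c1 d1) - (%(c, d). y c d) x) \<longlongrightarrow> cub (fst (c1, d1)) (snd (c1, d1)) (Z c1 d1) - (%(c, d). y c d) (c1, d1)) (at (c1, d1))"
   by (intro tendsto_intros yc[unfolded continuous_at])
  hence "((%x. cub (fst x) (snd x) (Z c1 d1) - y (fst x) (snd x)) \<longlongrightarrow> 0) (at (c1, d1))"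
   using Z[OF cd1] by (simp add: case_prod_unfold)
  hence "eventually (%x. norm (cub (fst x) (snd x) (Z c1 d1) - y (fst x) (snd x)) < r^3) (at (c1, d1))"
   using r by (auto simp: tendsto_iff dist_norm)
  moreover have "eventually (%x. x \<in> ?D) (at (c1, d1))"
   using D cd1 by (intro eventually_at_in_open') auto
  ultimately show "eventually (%x. dist ((%(c, d). Z c d) x) ((%(c, d). Z c d) (c1, d1)) < eps) (at (c1, d1))"
  proof eventually_elim
   case (elim x)
   obtain c d where x: "x = (c, d)" by force
   have cd: "c \<in> ball c0 R" "d \<in> ball d0 R" using elim(2) x by auto
   obtain w where w: "cub c d w = y c d" "norm (Z c1 d1 - w) < r"
    by (rule cub_root_near[of c d "Z c1 d1" "y c d" r]) (use elim(1) x r in auto)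
   have "w \<in> ball (Z c1 d1) r0" using w(2) r by (simp add: dist_norm)
   hence "w \<in> ball a e" using r0(2) by blast
   hence "w = Z c d" using cub_diff[of c d w "Z c d"] w(1) Z[OF cd] nz[OF cd, of w "Z c d"] by simp
   thus ?case using w(2) r x by (simp add: dist_norm norm_minus_commute)
  qed
 qed
 have zc: "Z c d ~= c & Z c d ~= d" if "c \<in> ball c0 R" "d \<in> ball d0 R" for c d
  using nz[OF that, of "Z c d" "Z c d"] Z[OF that] by (auto simp: cubq_same)
 show ?thesis
  unfolding nice_def
 proof (intro conjI ballI)
  show "continuous_on ?D (%(c, d). Z c d)"
   using cont by (auto intro!: continuous_at_imp_continuous_on)
  fix c1 d1 assume cd1: "c1 \<in> ball c0 R" "d1 \<in> ball d0 R"
  have t: "((%(c, d). Z c d) \<longlongrightarrow> Z c1 d1) (nhds (c1, d1))"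
   using cont[OF cd1] tendsto_at_iff_tendsto_nhds[of "%(c, d). Z c d" "(c1, d1)"] by (simp add: continuous_at)
  have t1: "filterlim (%c. (c, d1)) (nhds (c1, d1)) (at c1)" and t2: "filterlim (%d. (c1, d)) (nhds (c1, d1)) (at d1)"
   by (intro tendsto_intros)+
  show "(%c. Z c d1) field_differentiable (at c1)"
  proof (rule cub_implicit_differentiable[where c = "%c. c" and d = "%c. d1" and y = "%c. y c d1"])
   show "(%c. y c d1) field_differentiable at c1" using y cd1 by (auto simp: nice_def)
   show "isCont (%c. Z c d1) c1" using filterlim_compose[OF t t1] by (simp add: continuous_at)
   have "eventually (%c. c \<in> ball c0 R) (nhds c1)" using cd1 by (intro eventually_nhds_in_open) auto
   thus "eventually (%c. cub c d1 (Z c d1) = y c d1) (nhds c1)"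
    by eventually_elim (use Z cd1 in auto)
  qed (use zc[OF cd1] in \<open>auto intro: derivative_intros\<close>)
  show "Z c1 field_differentiable (at d1)"
  proof (rule cub_implicit_differentiable[where c = "%d. c1" and d = "%d. d" and y = "%d. y c1 d"])
   show "(%d. y c1 d) field_differentiable at d1" using y cd1 by (auto simp: nice_def)
   show "isCont (Z c1) d1" using filterlim_compose[OF t t2] by (simp add: continuous_at)
   have "eventually (%d. d \<in> ball d0 R) (nhds d1)" using cd1 by (intro eventually_nhds_in_open) auto
   thus "eventually (%d. cub c1 d (Z c1 d) = y c1 d) (nhds d1)"
    by eventually_elim (use Z cd1 in auto)
  qed (use zc[OF cd1] in \<open>auto intro: derivative_intros\<close>)
 qed
qed

text \<open>An implicit function theorem for zeros of the n-th iterate, one pull-back at a time.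
  Uniqueness in the ball is kept in order to recognise landing points as values of \<open>Z\<close>
  later.\<close>

lemma root_chain:
 assumes "(cub c0 d0 ^^ n) a = 0" "\<forall>i<n. (cub c0 d0 ^^ i) a ~= c0 & (cub c0 d0 ^^ i) a ~= d0" "eps > 0"
 shows "\<exists>R e Z. R > 0 & e > 0 & e <= eps & nice R c0 d0 Z & (\<forall>c\<in>ball c0 R. \<forall>d\<in>ball d0 R.
  Z c d \<in> ball a e & (cub c d ^^ n) (Z c d) = 0 & (\<forall>w\<in>ball a e. (cub c d ^^ n) w = 0 --> w = Z c d))"
 using assms
proof (induction n arbitrary: a eps)
 case 0
 have "nice 1 c0 d0 (%c d. 0)" by (auto simp: nice_def case_prod_unfold)
 thus ?case using 0 by (intro exI[of _ 1] exI[of _ eps] exI[of _ "%c d. 0"]) auto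
next
 case (Suc n)
 have 1: "(cub c0 d0 ^^ n) (cub c0 d0 a) = 0" using Suc.prems(1) by (simp add: funpow_swap1)
 have 2: "\<forall>i<n. (cub c0 d0 ^^ i) (cub c0 d0 a) ~= c0 & (cub c0 d0 ^^ i) (cub c0 d0 a) ~= d0"
 proof (intro allI impI)
  fix i assume "i < n"
  thus "(cub c0 d0 ^^ i) (cub c0 d0 a) ~= c0 & (cub c0 d0 ^^ i) (cub c0 d0 a) ~= d0"
   using Suc.prems(2)[rule_format, of "Suc i"] by (simp add: funpow_swap1)
 qed
 have 3: "(0::real) < 1" by simp
 from Suc.IH[OF 1 2 3] obtain R1 e1 Z1 where R1: "R1 > 0" "e1 > 0" "nice R1 c0 d0 Z1"
  "\<forall>c\<in>ball c0 R1. \<forall>d\<in>ball d0 R1.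
  Z1 c d \<in> ball (cub c0 d0 a) e1 & (cub c d ^^ n) (Z1 c d) = 0 & (\<forall>w\<in>ball (cub c0 d0 a) e1. (cub c d ^^ n) w = 0 --> w = Z1 c d)"
  by (elim exE conjE)
 have "a ~= c0" "a ~= d0" using Suc.prems(2) by force+
 hence "c0 \<notin> {a}" "d0 \<notin> {a}" by auto
 from unif_inj[OF compact_sing this] obtain r2 where r2: "r2 > 0" "!!c d z w w'. norm (c - c0) < r2 ==> norm (d - d0) < r2 ==> z \<in> {a} ==> norm (w - z) < r2 ==> norm (w' - z) < r2 ==>
  cubq c d w w' ~= 0 & w ~= c & w ~= d" by blast
 obtain r3 where r3: "r3 > 0" "!!c d w. norm (c - c0) < r3 ==> norm (d - d0) < r3 ==> norm (w - a) < r3 ==> norm ((cub c d ^^ 1) w - (cub c0 d0 ^^ 1) a) < e1"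
  by (rule cub_near[OF R1(2), where n = 1 and a = a and ?c0.0 = c0 and ?d0.0 = d0]) blast
 define e where "e = min eps (min r2 r3)"
 have e: "e > 0" "e <= eps" "e <= r2" "e <= r3" using Suc.prems(3) r2 r3 by (auto simp: e_def)
 have Z10: "Z1 c0 d0 = cub c0 d0 a"
 proof -
  have "c0 \<in> ball c0 R1" "d0 \<in> ball d0 R1" "cub c0 d0 a \<in> ball (cub c0 d0 a) e1" using R1(1,2) by auto
  thus ?thesis using R1(4)[THEN bspec, THEN bspec, of c0 d0] 1 by metis
 qed
 have "isCont (%(c, d). Z1 c d) (c0, d0)"
 proof -
  have "open (ball c0 R1 \<times> ball d0 R1)" by (intro open_Times) auto
  thus ?thesis using R1(1,3) unfolding nice_def by (meson SigmaI centre_in_ball continuous_on_eq_continuous_at)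
 qed
 hence t: "((%(c, d). Z1 c d) \<longlongrightarrow> Z1 c0 d0) (nhds (c0, d0))"
  using tendsto_at_iff_tendsto_nhds[of "%(c, d). Z1 c d" "(c0, d0)"] by (simp add: continuous_at)
 have "((%x. cub (fst x) (snd x) a - (%(c, d). Z1 c d) x) \<longlongrightarrow> cub (fst (c0, d0)) (snd (c0, d0)) a - Z1 c0 d0) (nhds (c0, d0))"
  by (intro tendsto_intros t filterlim_ident)
 hence "eventually (%x. norm (cub (fst x) (snd x) a - Z1 (fst x) (snd x)) < e^3) (nhds (c0, d0))"
  using e(1) unfolding tendsto_iff by (auto simp: Z10 dist_norm case_prod_unfold dest!: spec[of _ "e^3"])
 then obtain r4 where r4: "r4 > 0" "!!x. dist x (c0, d0) < r4 ==> norm (cub (fst x) (snd x) a - Z1 (fst x) (snd x)) < e^3"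
  unfolding eventually_nhds_metric by blast
 define R where "R = min R1 (min r2 (min r3 (r4/2)))"
 have R: "R > 0" "R <= R1" "R <= r2" "R <= r3" "R <= r4/2" using R1 r2 r3 r4 by (auto simp: R_def)
 have ex: "\<exists>z. z \<in> ball a e & cub c d z = Z1 c d" if cd: "c \<in> ball c0 R" "d \<in> ball d0 R" for c d
 proof -
  have "dist (c, d) (c0, d0) = norm (c - c0, d - d0)" by (simp add: dist_norm)
  also have "... <= norm (c - c0) + norm (d - d0)" by (rule norm_Pair_le)
  also have "... < r4" using cd R(5) by (simp add: dist_norm norm_minus_commute)
  finally have "norm (cub c d a - Z1 c d) < e^3" using r4(2)[of "(c, d)"] by simp
  then obtain w where "cub c d w = Z1 c d" "norm (a - w) < e" by (rule cub_root_near[OF _ e(1)])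
  thus ?thesis by (auto simp: dist_norm)
 qed
 define Z where "Z c d = (SOME z. z \<in> ball a e & cub c d z = Z1 c d)" for c d
 have Z: "Z c d \<in> ball a e & cub c d (Z c d) = Z1 c d" if "c \<in> ball c0 R" "d \<in> ball d0 R" for c d
  unfolding Z_def by (rule someI_ex[OF ex[OF that]])
 have nz: "cubq c d z w ~= 0" if "c \<in> ball c0 R" "d \<in> ball d0 R" "z \<in> ball a e" "w \<in> ball a e" for c d z w
  using r2(2)[of c d a z w] that R e by (simp add: dist_norm norm_minus_commute)
 have "nice R c0 d0 Z" by (rule nice_pull[OF nice_mono[OF R1(3) R(2)] nz Z])
 moreover have "(cub c d ^^ Suc n) (Z c d) = 0" if cd: "c \<in> ball c0 R" "d \<in> ball d0 R" for c d
 proof -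
  have "c \<in> ball c0 R1" "d \<in> ball d0 R1" using cd R by auto
  hence "(cub c d ^^ n) (Z1 c d) = 0" using R1(4) by blast
  thus ?thesis using Z[OF cd] by (simp add: funpow_swap1)
 qed
 moreover have "w = Z c d" if cd: "c \<in> ball c0 R" "d \<in> ball d0 R" and w: "w \<in> ball a e" "(cub c d ^^ Suc n) w = 0" for c d w
 proof -
  have cd1: "c \<in> ball c0 R1" "d \<in> ball d0 R1" using cd R by auto
  have "norm ((cub c d ^^ 1) w - (cub c0 d0 ^^ 1) a) < e1"
   using r3(2)[of c d w] cd w(1) R e by (simp add: dist_norm norm_minus_commute)
  hence "cub c d w \<in> ball (cub c0 d0 a) e1" by (simp add: dist_norm norm_minus_commute)
  moreover have "(cub c d ^^ n) (cub c d w) = 0" using w(2) by (simp add: funpow_swap1)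
  ultimately have "cub c d w = Z1 c d" using R1(4) cd1 by blast
  thus ?thesis using cub_diff[of c d w "Z c d"] Z[OF cd] nz[OF cd w(1), of "Z c d"] by simp
 qed
 ultimately show ?case using R(1) e Z by (intro exI[of _ R] exI[of _ e] exI[of _ Z]) auto
qed

text \<open>The orbit of the critical value is noncritical for the next m - 1 steps, so these are
  injective nearby, and only the first step can identify points.\<close>

lemma crit_inj:
 assumes m: "m >= 1" and nc: "\<forall>i. 1 <= i --> i < m --> (cub c0 d0 ^^ i) c0 ~= c0 & (cub c0 d0 ^^ i) c0 ~= d0"
 obtains r where "r > 0"
  "!!c d w w'. norm (c - c0) < r ==> norm (d - d0) < r ==> norm (w - c0) < r ==> norm (w' - c0) < r ==> (cub c d ^^ m) w = (cub c d ^^ m) w' ==> cub c d w = cub c d w'"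
  "!!c d w i. norm (c - c0) < r ==> norm (d - d0) < r ==> norm (w - c0) < r ==> 1 <= i ==> i < m ==> (cub c d ^^ i) w ~= c & (cub c d ^^ i) w ~= d"
proof -
 obtain m0 where m0: "m = Suc m0" using m by (cases m) auto
 have "\<forall>i<m0. (cub c0 d0 ^^ i) (cub c0 d0 c0) ~= c0 & (cub c0 d0 ^^ i) (cub c0 d0 c0) ~= d0"
 proof (intro allI impI)
  fix i assume "i < m0"
  thus "(cub c0 d0 ^^ i) (cub c0 d0 c0) ~= c0 & (cub c0 d0 ^^ i) (cub c0 d0 c0) ~= d0"
   using nc[rule_format, of "Suc i"] by (simp add: m0 funpow_swap1)
 qed
 from inj_chain[OF this] obtain r1 where r1: "r1 > 0" "chain_ok c0 d0 m0 (cub c0 d0 c0) r1" by blast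
 obtain r3 where r3: "r3 > 0" "!!c d w. norm (c - c0) < r3 ==> norm (d - d0) < r3 ==> norm (w - c0) < r3 ==> norm ((cub c d ^^ 1) w - (cub c0 d0 ^^ 1) c0) < r1"
  by (rule cub_near[OF r1(1), where n = 1 and a = c0 and ?c0.0 = c0 and ?d0.0 = d0]) blast
 show ?thesis
 proof (rule that[of "min r1 r3"])
  fix c d w assume *: "norm (c - c0) < min r1 r3" "norm (d - d0) < min r1 r3" "norm (w - c0) < min r1 r3"
  hence **: "norm (c - c0) < r1" "norm (d - d0) < r1" "norm (cub c d w - cub c0 d0 c0) < r1"
   using r3(2)[of c d w] by simp_all
  {
   fix w' assume w': "norm (w' - c0) < min r1 r3" "(cub c d ^^ m) w = (cub c d ^^ m) w'"
   hence "(cub c d ^^ m0) (cub c d w) = (cub c d ^^ m0) (cub c d w')" by (simp add: m0 funpow_swap1)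
   moreover have "norm (cub c d w' - cub c0 d0 c0) < r1" using r3(2)[of c d w'] * w' by simp
   ultimately show "cub c d w = cub c d w'" using chain_okD(1)[OF r1(2) **] by blast
  }
  fix i assume i: "1 <= i" "i < m"
  then obtain i' where i': "i = Suc i'" by (cases i) auto
  thus "(cub c d ^^ i) w ~= c & (cub c d ^^ i) w ~= d"
   using chain_okD(2)[OF r1(2) **, of i'] i by (simp add: m0 funpow_swap1)
 qed (use r1 r3 in simp)
qed

text \<open>The j-fold pull-back of an angle along the branch fixing the base angle b.\<close>

definition pl :: "real => nat => real => real" where "pl b j al = b + (al - b) / 3^j"

lemma pl_0 [simp]: "pl b 0 al = al" by (simp add: pl_def)

lemma gam_period': "UL c d ==> th' = th + 2 * pi * of_int n ==> gam c d th' = gam c d th"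
 by (simp add: gam_period)

lemma cub_gam_pl:
 assumes "UL c d" "b = pi * of_int n"
 shows "cub c d (gam c d (pl b (Suc j) al)) = gam c d (pl b j al)"
proof -
 have "gam c d (3 * pl b (Suc j) al) = gam c d (pl b j al)"
  by (rule gam_period'[OF assms(1), of _ _ n]) (simp add: pl_def assms(2) field_simps)
 thus ?thesis using gam_cub[OF assms(1)] by simp
qed

section \<open>Facts that persist near the odd map\<close>

definition nang :: "real => real => real => bool" where
 "nang ro om al \<longleftrightarrow> (\<exists>a\<in>{pi/9, 2*pi/9}. \<bar>al - (om + a)\<bar> < ro)"

definition nang' :: "real => real => real => bool" where
 "nang' ro om al \<longleftrightarrow> (\<exists>a\<in>{pi/9, 2*pi/9}. \<bar>al - (om + (pi - a))\<bar> < ro)"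

text \<open>The last clause turns the chain on the imaginary axis into a persistent statement: rays
  near the critical angles that land together do so after any number j of pull-backs towards 0 along
  the base angles \<open>om\<close> and \<open>om + pi\<close>. Critical points are excluded only
  from j = 1 on, since for j = 0 the common landing point may be critical.\<close>

definition gfacts :: "real => real => complex => complex => real => bool" where
 "gfacts ro e1 c d om \<longleftrightarrow> gam c d om = 0 & gam c d (om + pi/3) = gam c d (om + 2*pi/3) & gam c d (om + pi/3) \<notin> {0, c, d} &
  (\<forall>th. \<bar>th - om\<bar> < ro --> norm (gam c d th) < e1) &
  (\<forall>al be ga j. nang ro om al --> nang ro om be --> nang' ro om ga --> gam c d al = gam c d be --> gam c d al = gam c d ga -->
    gam c d (pl om j al) = gam c d (pl om j be) & gam c d (pl om j al) = gam c d (pl (om + pi) j ga) &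
    (j >= 1 --> gam c d (pl om j al) \<notin> {c, d}))"

text \<open>The facts on landing points are conditional on \<open>UL\<close>, because they are
  stated for a full neighbourhood of parameters, in which rays need not land.\<close>

definition good :: "real => real => real => complex => complex => bool" where
 "good ro e0 e1 c d \<longleftrightarrow> par c d & norm (3 * c * d) > 1 & norm (c - d) > 3/2 &
  (\<forall>z w. norm z < e0 --> norm w < e0 --> norm (cubq c d z w) > 2) & (UL c d --> (\<forall>om\<in>{0, pi}. gfacts ro e1 c d om))"

lemma cubq_commute: "cubq c d = cubq d c"
 by (intro ext) (simp add: cubq_def algebra_simps)

lemma good_commute: "good ro e0 e1 c d \<longleftrightarrow> good ro e0 e1 d c"
proof -
 have e: "gam d c = gam c d" "cubq d c = cubq c d" "UL d c = UL c d" by (fact gam_commute cubq_commute UL_commute)+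
 have e2: "par d c = par c d" by (fact par_commute)
 have e3: "norm (d - c) = norm (c - d)" by (fact norm_minus_commute)
 have e4: "3 * d * c = 3 * c * d" by simp
 have e5: "{0, d, c} = {0, c, d}" "{d, c} = {c, d}" by (simp_all only: insert_commute)
 show ?thesis unfolding good_def gfacts_def e e2 e3 e4 e5 by (rule refl)
qed

text \<open>The odd map has multiplier 3 sqrt 3 / 2 at 0, about 2.598. The radii 1/50 and 1/10 are
  small enough to keep the difference quotient above 2.\<close>

lemma cubq_near_0:
 assumes "norm (c - w0) < 1/50" "norm (d + w0) < 1/50" "norm z < 1/10" "norm w < 1/10"
 shows "norm (cubq c d z w) > 2" "norm (3 * c * d) > 1" "norm (c - d) > 3/2" "par c d"
proof -
 have y9: "y0 > 9/10"
 proof -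
  have "(9/10)^2 < y0^2" using y0_sq sqrt3_bounds by (simp add: power2_eq_square)
  thus ?thesis by (rule power2_less_imp_less) (use y0_sq(2) in simp)
 qed
 have nw: "norm w0 < 1" "norm w0 > 9/10" using norm_w0 y0_less y9 by simp_all
 have nc: "norm c < 102/100" "norm d < 102/100"
  using assms(1,2) nw norm_triangle_ineq[of "c - w0" w0] norm_triangle_ineq4[of "d + w0" w0] by simp_all
 thus "par c d" by (simp add: par_def)
 have "norm (2 * w0) <= norm (c - d) + norm ((d + w0) - (c - w0))"
  using norm_triangle_ineq[of "c - d" "(d + w0) - (c - w0)"] by simp
 also have "norm ((d + w0) - (c - w0)) < 2/50" using norm_triangle_ineq4[of "d + w0" "c - w0"] assms by simp
 finally show "norm (c - d) > 3/2" using nw by (simp add: norm_mult)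
 have "norm (3 * w0 * (- w0)) = 3 * y0^2" unfolding mult_w0 norm_of_real by simp
 hence b0: "norm (3 * w0 * (- w0)) > 255/100" using y0_sq sqrt3_bounds by simp
 have "norm (3 * c * d - 3 * w0 * (- w0)) = norm (3 * c * (d + w0) - 3 * w0 * (c - w0))"
  by (rule arg_cong[of _ _ norm]) (simp add: algebra_simps)
 also have "... <= norm (3 * c * (d + w0)) + norm (3 * w0 * (c - w0))" by (rule norm_triangle_ineq4)
 also have "... <= 3 * (102/100) * (1/50) + 3 * 1 * (1/50)"
  unfolding norm_mult norm_numeral using assms nc nw by (intro add_mono mult_mono) auto
 finally have b1: "norm (3 * c * d - 3 * w0 * (- w0)) <= 13/100" by simp
 have b2: "norm (3 * c * d) > 242/100"
  using b0 b1 norm_triangle_ineq2[of "3 * w0 * (- w0)" "3 * c * d"] norm_minus_commute[of "3 * c * d" "3 * w0 * (- w0)"] by linarith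
 thus "norm (3 * c * d) > 1" by simp
 define X where "X = z * (z + w) + w * w - 3/2 * (c + d) * (z + w)"
 have "norm X <= 1/10 * (2/10) + 1/10 * (1/10) + 3/2 * (2/50) * (2/10)"
 proof -
  have zw: "norm (z + w) <= 2/10" using norm_triangle_ineq[of z w] assms by simp
  have cd: "norm (c + d) <= 2/50" using norm_triangle_ineq[of "c - w0" "d + w0"] assms by simp
  have "norm (3/2 * (c + d) * (z + w)) <= 3/2 * (2/50) * (2/10)"
   unfolding norm_mult norm_divide norm_numeral using zw cd by (intro mult_mono) auto
  moreover have "norm (z * (z + w)) <= 1/10 * (2/10)" "norm (w * w) <= 1/10 * (1/10)"
   unfolding norm_mult using zw assms by (intro mult_mono; simp)+
  ultimately show ?thesis unfolding X_def
   by (intro order_trans[OF norm_triangle_ineq4] add_mono order_trans[OF norm_triangle_ineq]) auto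
 qed
 moreover have e: "cubq c d z w = 3 * c * d + X"
  by (simp add: cubq_def X_def power2_eq_square algebra_simps)
 moreover have "norm (3 * c * d) <= norm (3 * c * d + X) + norm X"
  using norm_triangle_ineq4[of "3 * c * d + X" X] by simp
 ultimately show "norm (cubq c d z w) > 2" using b2 unfolding e by linarith
qed

text \<open>The relevant noncritical landing points of the odd map lie on the compact set
  \<open>K\<close>: the imaginary segment up to \<open>r 1\<close> and the two nonzero preimages of
  0. It misses the critical points, so the cubic is injective near each point of \<open>K\<close>,
  uniformly in the parameter. With stability of landing points, coincidences at level j pass to
  level j + 1 for all j.\<close>

lemma good_exists:
 "\<exists>ro e0 e1. ro > 0 & e0 > 0 & 0 < e1 & e1 <= e0 & e1 <= e0^3 & (\<forall>c d. norm (c - w0) < ro --> norm (d + w0) < ro --> good ro e0 e1 c d)"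
proof -
 obtain r where r: "r 0 = y0" "!!j. 0 < r j" "!!j. r (Suc j) <= r 1" "r 1 < y0"
  "!!j th. th \<in> {pi/9, 2*pi/9} ==> g0 (th / 3^j) = Complex 0 (r j) & g0 (pi - th / 3^j) = Complex 0 (r j)"
  by (rule g0_chain) blast
 define v where "v = Complex 0 (sqrt 3 * y0)"
 define K where "K = Complex 0 ` {- r 1..r 1} \<union> {v, - v}"
 have sy: "sqrt 3 * y0 > y0" using sqrt3_bounds y0_sq(2) mult_strict_right_mono[of 1 "sqrt 3" y0] by simp
 have compK: "compact K" unfolding K_def Complex_eq
  by (intro compact_Un compact_continuous_image continuous_intros) auto
 have wK: "w0 \<notin> K" "- w0 \<notin> K" using r(4) y0_sq(2) by (auto simp: K_def w0_def v_def complex_eq_iff) (use sy y0_sq(2) in linarith)+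
 obtain ra where ra: "ra > 0" "!!c d z w w'. norm (c - w0) < ra ==> norm (d - (- w0)) < ra ==> z \<in> K ==> norm (w - z) < ra ==> norm (w' - z) < ra ==>
  cubq c d w w' ~= 0 & w ~= c & w ~= d"
  using unif_inj[OF compK wK] by metis
 define e where "e = min ra (1/1000)"
 have e: "e > 0" "e <= ra" "e <= 1/1000" using ra by (auto simp: e_def)
 obtain et where et: "et > 0" "!!c d th th0. UL c d ==> norm (c - w0) < et ==> norm (d - (- w0)) < et ==> \<bar>th - th0\<bar> < et ==>
  dist (gam c d th) (gam w0 (- w0) th0) < e"
  using gam_stability[OF mis_w0 e(1)] by metis
 define ro where "ro = min et (min ra (1/50))"
 have ro: "ro > 0" "ro <= et" "ro <= ra" "ro <= 1/50" using et ra by (auto simp: ro_def)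
 \<comment> \<open>With 1/1000 = (1/10)^3, \<open>cub_root_near\<close> finds preimages in the
   larger disc for all points of the smaller one.\<close>
 have "good ro (1/10) (1/1000) c d" if cd: "norm (c - w0) < ro" "norm (d + w0) < ro" for c d
 proof -
  have cd50: "norm (c - w0) < 1/50" "norm (d + w0) < 1/50" using cd ro by simp_all
  have st: "norm (gam c d th - g0 th0) < e" if "UL c d" "\<bar>th - th0\<bar> < ro" for th th0
   using et(2)[OF that(1), of th th0] cd that(2) ro by (simp add: g0_def dist_norm)
  have inj: "w = w' & w \<notin> {c, d}" if "z \<in> K" "norm (w - z) < e" "norm (w' - z) < e" "cub c d w = cub c d w'" for z w w'
   using ra(2)[of c d z w w'] that cd ro e cub_diff[of c d w w'] by simp
  have "gfacts ro (1/1000) c d om" if UL: "UL c d" and om: "om \<in> {0, pi}" for om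
   unfolding gfacts_def
  proof (intro conjI allI impI)
   obtain n :: int where n: "om = pi * of_int n" using om by (metis insertE mult.right_neutral mult_zero_right of_int_0 of_int_1 singletonD)
   have g0om: "g0 om = 0" using om g0_0 by auto
   show near: "norm (gam c d th) < 1/1000" if "\<bar>th - om\<bar> < ro" for th
    using st[OF UL that] e g0om by simp
   have "gam c d (3 * om) = gam c d om" by (rule gam_period'[OF UL, of _ _ n]) (simp add: n)
   hence "cub c d (gam c d om) = gam c d om" using gam_cub[OF UL] by simp
   hence "gam c d om * cubq c d (gam c d om) 0 = gam c d om"
    using cub_diff[of c d "gam c d om" 0] by (simp add: cub_0)
   moreover have "norm (gam c d om) < 1/10" using near[of om] ro(1) by simp
   hence "cubq c d (gam c d om) 0 ~= 1" using cubq_near_0(1)[OF cd50, of "gam c d om" 0] by auto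
   ultimately show "gam c d om = 0" by simp
   note zero = this
   \<comment> \<open>By oddness, this sign turns the facts for base angle 0 into those for base
     angle pi.\<close>
   define sg where "sg = (if om = 0 then 1 else - 1 :: complex)"
   have gsg: "g0 (om + th) = sg * g0 th" for th
    using om g0_minus[of th] by (auto simp: sg_def add.commute)
   have vK: "sg * v \<in> K" by (auto simp: K_def sg_def)
   have nv: "norm (gam c d (om + pi/3) - sg * v) < e" "norm (gam c d (om + 2*pi/3) - sg * v) < e"
    using st[OF UL, of "om + pi/3" "om + pi/3"] st[OF UL, of "om + 2*pi/3" "om + 2*pi/3"] ro(1) g0_third unfolding gsg by (simp_all add: v_def)
   have c0: "cub c d (gam c d (om + pi/3)) = gam c d (om + pi)" "cub c d (gam c d (om + 2*pi/3)) = 0"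
    unfolding gam_cub[OF UL]
    by (rule gam_period'[OF UL, of _ _ n], simp add: n algebra_simps)
     (subst gam_period'[OF UL, of _ om "n + 1"], auto simp: n zero[unfolded n] algebra_simps)
   have p0: "gam c d (om + pi) = 0"
   proof -
    have n3: "norm (gam c d (om + pi)) < 1/10" using st[OF UL, of "om + pi" "om + pi"] gsg[of pi] g0_0 ro(1) e by simp
    have "gam c d (3 * (om + pi)) = gam c d (om + pi)" by (rule gam_period'[OF UL, of _ _ "n + 1"]) (simp add: n algebra_simps)
    hence "cub c d (gam c d (om + pi)) = gam c d (om + pi)" using gam_cub[OF UL] by simp
    hence "gam c d (om + pi) * cubq c d (gam c d (om + pi)) 0 = gam c d (om + pi)"
     using cub_diff[of c d "gam c d (om + pi)" 0] by (simp add: cub_0)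
    moreover have "cubq c d (gam c d (om + pi)) 0 ~= 1" using cubq_near_0(1)[OF cd50 n3, of 0] by auto
    ultimately show ?thesis by simp
   qed
   have eq: "gam c d (om + pi/3) = gam c d (om + 2*pi/3) & gam c d (om + pi/3) \<notin> {c, d}"
    by (rule inj[OF vK nv]) (simp only: c0 p0)
   thus "gam c d (om + pi/3) = gam c d (om + 2*pi/3)" by simp
   have "norm (sg * v) > 9/10"
   proof -
    have "y0 * y0 > 8/10 * 1" using y0_sq sqrt3_bounds by (simp add: power2_eq_square)
    moreover have "y0 * y0 < y0 * 1" using y0_less y0_sq(2) by (intro mult_strict_left_mono) auto
    moreover have "17/10 * y0 < sqrt 3 * y0" using sqrt3_bounds y0_sq(2) by (intro mult_strict_right_mono) auto
    moreover have "norm (sg * v) = sqrt 3 * y0" using y0_sq(2) by (simp add: sg_def v_def cmod_def abs_mult)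
    ultimately show ?thesis by linarith
   qed
   hence "gam c d (om + pi/3) ~= 0" using nv(1) e by auto
   thus "gam c d (om + pi/3) \<notin> {0, c, d}" using eq by blast
   fix al be ga j
   assume ang: "nang ro om al" "nang ro om be" "nang' ro om ga" "gam c d al = gam c d be" "gam c d al = gam c d ga"
   have K1: "sg * Complex 0 (r (Suc j)) \<in> K" for j
   proof -
    have "r (Suc j) \<in> {- r 1..r 1}" "- r (Suc j) \<in> {- r 1..r 1}" using r(3)[of j] r(2)[of "Suc j"] r(2)[of 1] by auto
    moreover have "- Complex 0 (r (Suc j)) = Complex 0 (- r (Suc j))" by (simp add: complex_eq_iff)
    ultimately show ?thesis by (auto simp: K_def sg_def)
   qed
   have sh: "\<bar>pl b j th - (b + a / 3^j)\<bar> < ro" if "\<bar>th - (b + a)\<bar> < ro" for b j th a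
   proof -
    have "pl b j th - (b + a / 3^j) = (th - (b + a)) / 3^j" by (simp add: pl_def diff_divide_distrib add_divide_distrib)
    hence "\<bar>pl b j th - (b + a / 3^j)\<bar> = \<bar>th - (b + a)\<bar> / 3^j" by (simp only: abs_divide abs_of_nonneg[OF zero_le_power[of "3::real" j]] zero_le_numeral)
    also have "... <= \<bar>th - (b + a)\<bar> / 1" by (intro divide_left_mono) auto
    finally show ?thesis using that by simp
   qed
   have n1: "norm (gam c d (pl om j th) - sg * Complex 0 (r j)) < e" if "nang ro om th" for j th
   proof -
    obtain a where a: "a \<in> {pi/9, 2*pi/9}" "\<bar>th - (om + a)\<bar> < ro" using \<open>nang ro om th\<close> unfolding nang_def by blast
    have "g0 (om + a / 3^j) = sg * Complex 0 (r j)" using gsg r(5)[OF a(1)] by simp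
    thus ?thesis using st[OF UL sh[OF a(2)]] by metis
   qed
   have n2: "norm (gam c d (pl (om + pi) j th) - sg * Complex 0 (r j)) < e" if "nang' ro om th" for j th
   proof -
    obtain a where a: "a \<in> {pi/9, 2*pi/9}" "\<bar>th - (om + (pi - a))\<bar> < ro" using \<open>nang' ro om th\<close> unfolding nang'_def by blast
    have "g0 (om + (pi - a / 3^j)) = sg * Complex 0 (r j)" using gsg r(5)[OF a(1)] by simp
    moreover have "\<bar>th - (om + pi + (- a))\<bar> < ro" using a(2) by (simp add: algebra_simps)
    hence "\<bar>pl (om + pi) j th - (om + pi + (- a) / 3^j)\<bar> < ro" by (rule sh)
    moreover have "om + pi + (- a) / 3^j = om + (pi - a / 3^j)" by simp
    ultimately show ?thesis using st[OF UL] by metis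
   qed
   have n': "om + pi = pi * of_int (n + 1)" using n by (simp add: algebra_simps)
   have step: "gam c d (pl om (Suc j) al) = gam c d (pl om (Suc j) be) & gam c d (pl om (Suc j) al) = gam c d (pl (om + pi) (Suc j) ga) &
     gam c d (pl om (Suc j) al) \<notin> {c, d}"
    if "gam c d (pl om j al) = gam c d (pl om j be) & gam c d (pl om j al) = gam c d (pl (om + pi) j ga)" for j
    using inj[OF K1 n1[OF ang(1)] n1[OF ang(2)]] inj[OF K1 n1[OF ang(1)] n2[OF ang(3)]] that
     cub_gam_pl[OF UL n, of j al] cub_gam_pl[OF UL n, of j be] cub_gam_pl[OF UL n', of j ga] by metis
   have all: "gam c d (pl om j al) = gam c d (pl om j be) & gam c d (pl om j al) = gam c d (pl (om + pi) j ga)" for j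
    by (induction j) (use ang(4,5) step in auto)
   from all[of j] show "gam c d (pl om j al) = gam c d (pl om j be)" "gam c d (pl om j al) = gam c d (pl (om + pi) j ga)" by blast+
   assume "j >= 1"
   thus "gam c d (pl om j al) \<notin> {c, d}" using step[OF all, of "j - 1"] by (cases j) auto
  qed
  thus ?thesis unfolding good_def using cubq_near_0[OF cd50] cubq_near_0(2-4)[OF cd50, of 0 0] by simp
 qed
 thus ?thesis using ro(1) by (intro exI[of _ ro] exI[of _ "1/10"] exI[of _ "1/1000"]) (simp add: power3_eq_cube)
qed

section \<open>The inductive step\<close>

text \<open>The critical point x has the angles q and q + pi/3^m together with their translates by 2 pi/3; the base angle is 0 or pi.\<close>

definition crp :: "real => complex => complex => complex => real => nat => real => bool" where
 "crp ro c d x om m q \<longleftrightarrow> m >= 1 & (cub c d ^^ m) x = 0 & (\<forall>i. 1 <= i --> i < m --> (cub c d ^^ i) x \<notin> {c, d}) &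
  (\<forall>th\<in>{q, q + pi/3^m, q + 2*pi/3, q + pi/3^m + 2*pi/3}. gam c d th = x) &
  (\<exists>n::int. 3^m * q = om + pi + 2 * pi * of_int n) & nang ro om q & nang ro om (q + pi/3^m)"

lemma crp_commute: "crp ro c d = crp ro d c"
 by (intro ext) (simp add: crp_def cub_commute[of c d] gam_commute[of c d] insert_commute)

text \<open>The offset a is replaced by pi/3 - a, which exchanges pi/9 and 2 pi/9.\<close>

lemma nang_shift: "nang ro om al ==> nang' ro om (al + 2*pi/3)"
 unfolding nang_def nang'_def
proof (elim bexE)
 fix a assume a: "a \<in> {pi/9, 2*pi/9}" "\<bar>al - (om + a)\<bar> < ro"
 have "al + 2*pi/3 - (om + (pi - (pi/3 - a))) = al - (om + a)" by simp
 moreover have "pi/3 - a \<in> {pi/9, 2*pi/9}" using a(1) by auto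
 ultimately show "\<exists>a\<in>{pi/9, 2*pi/9}. \<bar>al + 2*pi/3 - (om + (pi - a))\<bar> < ro" using a(2) by (intro bexI[of _ "pi/3 - a"]) simp_all
qed

lemma om_int: "om \<in> {0, pi} ==> \<exists>n::int. om = pi * of_int n"
 by (elim insertE) (auto intro: exI[of _ 0] exI[of _ 1])

lemma gam_pl_iter:
 assumes "UL c d" "b = pi * of_int n" shows "(cub c d ^^ i) (gam c d (pl b (i + j) al)) = gam c d (pl b j al)"
 by (induction i) (simp_all add: funpow_Suc_right cub_gam_pl[OF assms] del: funpow.simps)

text \<open>The angles \<open>ka1\<close> and \<open>ka2\<close> trisect the gap between two angles
  of the critical point \<open>x\<close>, so they land in the limb between these rays. After m
  iterates they are the angles pi/3 and 2 pi/3 beyond a base angle and land together at a nonzero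
  preimage of 0. \<open>gam_pullback\<close> carries the coincidence back along the orbit of
  \<open>x\<close> and then towards 0 along the base angle.\<close>

lemma kappa:
 fixes m :: nat and q :: real
 defines "ka1 \<equiv> q + pi / 3^(m+1)" and "ka2 \<equiv> q + 2 * pi / 3^(m+1)"
 assumes UL: "UL c d" and good: "good ro e0 e1 c d" and om: "om \<in> {0, pi}" and x: "crp ro c d x om m q"
  and cc: "crp ro c d c omc mc qc" and dd: "crp ro c d d omd md qd"
 shows "!!i. i < m ==> gam c d (3^i * ka1) \<notin> {c, d}"
  and "!!j. gam c d (pl om j ka1) = gam c d (pl om j ka2) & gam c d (pl om j ka1) \<notin> {c, d}"
  and "gam c d (3^m * ka1) \<notin> {0, c, d}" "cub c d (gam c d (3^m * ka1)) = 0"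
proof -
 let ?g = "gam c d"
 have m: "m >= 1" and m0: "(cub c d ^^ m) x = 0" and gx: "?g q = x" "?g (q + pi/3^m) = x" "?g (q + 2*pi/3) = x"
  and na: "nang ro om q" "nang ro om (q + pi/3^m)"
  using x by (auto simp: crp_def)
 obtain n :: int where n: "3^m * q = om + pi + 2 * pi * of_int n" using x by (auto simp: crp_def)
 have crit: "?g qc = c" "?g (qc + 2*pi/3) = c" "?g qd = d" "?g (qd + 2*pi/3) = d"
  using cc dd by (auto simp: crp_def)
 obtain l :: int where l: "om = pi * of_int l" using om_int[OF om] by auto
 have om': "pi - om \<in> {0, pi}" using om by auto
 have gf: "gfacts ro e1 c d om" "gfacts ro e1 c d (pi - om)" using good UL om om' by (auto simp: good_def)
 have k12: "3^m * ka1 = 3^m * q + pi/3" "3^m * ka2 = 3^m * q + 2*pi/3" by (simp_all add: ka1_def ka2_def field_simps)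
 have v1: "?g (3^m * ka1) = ?g (pi - om + pi/3)"
  by (rule gam_period'[OF UL, of _ _ "l + n"]) (unfold k12 n, simp add: l algebra_simps)
 have v2: "?g (3^m * ka2) = ?g (pi - om + 2*pi/3)"
  by (rule gam_period'[OF UL, of _ _ "l + n"]) (unfold k12 n, simp add: l algebra_simps)
 have v12: "?g (3^m * ka1) = ?g (3^m * ka2)" unfolding v1 v2 using gf(2) by (simp add: gfacts_def)
 show v: "?g (3^m * ka1) \<notin> {0, c, d}" unfolding v1 using gf(2) unfolding gfacts_def by blast
 show "cub c d (?g (3^m * ka1)) = 0"
 proof -
  have "?g (3 * (pi - om + pi/3)) = ?g om"
   by (rule gam_period'[OF UL, of _ _ "2 - 2 * l"]) (simp add: l algebra_simps)
  thus ?thesis unfolding v1 gam_cub[OF UL] using gf(1) by (simp add: gfacts_def)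
 qed
 have pi3: "0 < pi / (3 * 3^k) & pi / 3^k <= pi" for k :: nat
 proof -
  have "pi / 3^k <= pi / 1" by (intro divide_left_mono) auto
  thus ?thesis by simp
 qed
 \<comment> \<open>Backwards along the orbit of \<open>x\<close>. The vertex of the sector is an
   iterate of \<open>x\<close>, and in the step to \<open>Suc i\<close> its width is pi / 3^Suc i,
   at most pi/3.\<close>
 have K1: "?g (3^(m - i) * ka1) = ?g (3^(m - i) * ka2) & (i ~= 0 --> ?g (3^(m - i) * ka1) \<notin> {c, d})" if "i <= m" for i
  using that
 proof (induction i)
  case 0
  thus ?case using v12 by simp
 next
  case (Suc i)
  define l where "l = m - Suc i"
  have l: "m - i = Suc l" "m = l + Suc i" using Suc.prems by (auto simp: l_def)
  have a1: "3^l * (q + pi/3^m) = 3^l * q + pi / 3^Suc i" and k1: "3^l * ka1 = 3^l * q + pi / (3 * 3^Suc i)"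
   and k2: "3^l * ka2 = 3^l * q + 2 * (pi / (3 * 3^Suc i))"
   unfolding ka1_def ka2_def l(2) by (simp_all add: field_simps power_add)
  have pp: "?g (3^l * q) = (cub c d ^^ l) x" "?g (3^l * (q + pi/3^m)) = (cub c d ^^ l) x"
   using gam_iter[OF UL] gx by metis+
  have ppi: "pi / 3^Suc i = 3 * (pi / (3 * 3^Suc i))" by simp
  have "?g (3^l * ka1) = ?g (3^l * ka2) & ?g (3^l * ka1) ~= c & ?g (3^l * ka1) ~= d"
  proof (rule gam_pullback[OF UL pp _ _ _ _ _ _ _ _ _ crit])
   show "3^l * q < 3^l * (q + pi/3^m)" "3^l * q < 3^l * ka1" "3^l * ka1 < 3^l * (q + pi/3^m)" "3^l * q < 3^l * ka2" "3^l * ka2 < 3^l * (q + pi/3^m)"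
    unfolding a1 k1 k2 ppi using pi3[of "Suc i"] by linarith+
   have *: "x <= pi/3 ==> y + x - y < 2*pi/3" for x y :: real using pi_gt_zero by linarith
   have "pi / 3^Suc i <= pi / 3" using pi3[of i] by simp
   thus "3^l * (q + pi/3^m) - 3^l * q < 2*pi/3" unfolding a1 by (rule *)
   show "?g (3 * (3^l * ka1)) = ?g (3^Suc l * ka1)" by (simp add: mult.assoc)
   show "?g (3 * (3^l * ka2)) = ?g (3^Suc l * ka1)" using Suc l(1) by (simp add: mult.assoc)
   show "?g (3^Suc l * ka1) ~= cub c d ((cub c d ^^ l) x)"
   proof
    assume "?g (3^Suc l * ka1) = cub c d ((cub c d ^^ l) x)"
    hence "(cub c d ^^ i) (?g (3^Suc l * ka1)) = (cub c d ^^ i) ((cub c d ^^ Suc l) x)" by simp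
    also have "... = (cub c d ^^ (i + Suc l)) x" by (simp only: funpow_add o_apply)
    also have "... = 0" using m0 l by (simp add: add.commute)
    also have "(cub c d ^^ i) (?g (3^Suc l * ka1)) = ?g (3^m * ka1)"
     unfolding gam_iter[OF UL] l(2) by (simp add: power_add mult_ac)
    finally show False using v by simp
   qed
  qed
  thus ?case unfolding l_def by blast
 qed
 show K1': "?g (3^i * ka1) \<notin> {c, d}" if "i < m" for i
 proof -
  have "m - (m - i) = i" "m - i <= m" "m - i ~= 0" using that by auto
  thus ?thesis using K1[of "m - i"] by metis
 qed
 have n1: "nang' ro om (q + 2*pi/3)" using nang_shift[OF na(1)] .
 \<comment> \<open>The pulled-back angles of \<open>x\<close> land together by the last clause of
   \<open>gfacts\<close>; they bound the sector for the pull-backs towards 0.\<close>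
 have co: "?g (pl om j q) = ?g (pl om j (q + pi/3^m))" for j
  using gf(1) na n1 gx unfolding gfacts_def by metis
 show "?g (pl om j ka1) = ?g (pl om j ka2) & ?g (pl om j ka1) \<notin> {c, d}" for j
 proof (induction j)
  case 0
  have z: "3^(m - m) * x = x" for x :: real by simp
  have "m ~= 0" using m by simp
  thus ?case using K1[of m] unfolding z pl_0 by (metis order_refl)
 next
  case (Suc j)
  have p3: "(3::real)^Suc j > 0" by simp
  have d: "(x - om) / 3^Suc j < (y - om) / 3^Suc j \<longleftrightarrow> x < y" for x y
   by (simp add: divide_less_cancel)
  define z where "z = pi / 3^m"
  have z: "z > 0" by (simp add: z_def)
  have kz: "q + pi / 3^m = q + z" "ka1 = q + z/3" "ka2 = q + 2 * (z/3)" by (simp_all add: z_def ka1_def ka2_def)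
  have "?g (pl om (Suc j) ka1) = ?g (pl om (Suc j) ka2) & ?g (pl om (Suc j) ka1) ~= c & ?g (pl om (Suc j) ka1) ~= d"
  proof (rule gam_pullback[OF UL refl co[symmetric] _ _ _ _ _ _ _ _ _ crit])
   show "pl om (Suc j) q < pl om (Suc j) (q + pi/3^m)" "pl om (Suc j) q < pl om (Suc j) ka1"
    "pl om (Suc j) ka1 < pl om (Suc j) (q + pi/3^m)" "pl om (Suc j) q < pl om (Suc j) ka2" "pl om (Suc j) ka2 < pl om (Suc j) (q + pi/3^m)"
    unfolding pl_def add_less_cancel_left d kz using z by simp_all
   have "pl om (Suc j) (q + pi/3^m) - pl om (Suc j) q = pi / 3^(m + Suc j)"
    by (simp add: pl_def field_simps power_add)
   also have "... = (pi / 3^(m + j)) / 3" by simp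
   also have "... <= pi / 3" using pi3[of "m + j"] by (intro divide_right_mono) auto
   also have "... < 2*pi/3" using pi_gt_zero by linarith
   finally show "pl om (Suc j) (q + pi/3^m) - pl om (Suc j) q < 2*pi/3" .
   show "?g (3 * pl om (Suc j) ka1) = ?g (pl om j ka1)" "?g (3 * pl om (Suc j) ka2) = ?g (pl om j ka1)"
    using cub_gam_pl[OF UL l] gam_cub[OF UL] Suc by simp_all
   show "?g (pl om j ka1) ~= cub c d (?g (pl om (Suc j) q))"
   proof
    assume "?g (pl om j ka1) = cub c d (?g (pl om (Suc j) q))"
    hence "(cub c d ^^ m) ((cub c d ^^ j) (?g (pl om (j + 0) ka1))) = (cub c d ^^ m) ((cub c d ^^ j) (?g (pl om (j + 0) q)))"
     by (simp add: cub_gam_pl[OF UL l])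
    hence "(cub c d ^^ m) (?g ka1) = (cub c d ^^ m) (?g q)" unfolding gam_pl_iter[OF UL l] by simp
    hence "?g (3^m * ka1) = 0" using m0 gx by (simp add: gam_iter[OF UL])
    thus False using v by simp
   qed
  qed
  thus ?case by blast
 qed
qed

lemma good_pull0:
 assumes "good ro e0 e1 c d" "norm y < e1" "e1 <= e0^3" "e0 > 0"
 shows "\<exists>z. norm z < e0 & cub c d z = y"
proof -
 obtain w where "cub c d w = y" "norm (0 - w) < e0"
  by (rule cub_root_near[of c d 0 y e0]) (use assms in \<open>auto simp: cub_0\<close>)
 thus ?thesis by auto
qed

lemma good_expand:
 assumes "good ro e0 e1 c d" "norm z < e0" shows "norm z <= norm (cub c d z) / 2" "z \<notin> {c, d}"
proof -
 have "0 <= norm z" by simp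
 hence e0: "e0 > 0" using assms(2) by linarith
 hence "norm (cubq c d z 0) > 2" "norm (cubq c d z z) > 2" using assms by (auto simp: good_def)
 thus "z \<notin> {c, d}" by (auto simp: cubq_same)
 have "cub c d z = z * cubq c d z 0" using cub_diff[of c d z 0] by (simp add: cub_0)
 hence "norm z * 2 <= norm (cub c d z)" using \<open>norm (cubq c d z 0) > 2\<close> by (simp add: norm_mult mult_left_mono)
 thus "norm z <= norm (cub c d z) / 2" by simp
qed

text \<open>The prescribed value for the m-th iterate of c has to be a holomorphic function of the
  parameters also where rays do not land. So it is given by the implicit function \<open>Z\<close>
  and its pull-backs \<open>u j\<close> near 0. The parameter from \<open>perturb_cub\<close> is
  Misiurewicz, and only there the value is recognised as a landing point, by uniqueness of
  roots.\<close>

lemma perturb_gam: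
 fixes m' :: nat and q :: real
 defines "ka1 \<equiv> q + pi / 3^(m'+1)" and "ka2 \<equiv> q + 2 * pi / 3^(m'+1)"
 assumes mis: "mis c d" and N: "N > 0" "\<forall>c' d'. norm (c' - c) < N --> norm (d' - d) < N --> good ro e0 e1 c' d'"
  and es: "0 < e1" "e1 <= e0" "e1 <= e0^3" and ro: "ro > 0" and om: "om \<in> {0, pi}"
  and cc: "crp ro c d c omc m qc" and dd: "crp ro c d d om m' q" and eps: "eps > 0"
 shows "eventually (%j. \<exists>c' d'. norm (c' - c) < eps & norm (d' - d) < eps & mis c' d' & (cub c' d' ^^ m') d' = 0 &
  gam c' d' (pl om j ka1) = (cub c' d' ^^ m) c' & gam c' d' (pl om j ka2) = (cub c' d' ^^ m) c' &
  (cub c' d' ^^ (j + m' + 1)) ((cub c' d' ^^ m) c') = 0 & (\<forall>i < j + m' + 1. (cub c' d' ^^ i) ((cub c' d' ^^ m) c') \<notin> {c', d'})) sequentially"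
proof -
 have UL: "UL c d" using mis by (rule mis_UL)
 have good: "good ro e0 e1 c d" using N by simp
 note kap = kappa[OF UL good om dd cc dd, folded ka1_def ka2_def]
 obtain l :: int where l: "om = pi * of_int l" using om_int[OF om] by auto
 have m': "m' >= 1" using dd by (simp add: crp_def)
 obtain n0 :: int where n0: "3^m' * q = om + pi + 2 * pi * of_int n0" using dd by (auto simp: crp_def)
 have "eventually (%j. \<bar>ka1 - om\<bar> / 3^j < ro) sequentially" "eventually (%j. \<bar>ka2 - om\<bar> / 3^j < ro) sequentially"
  using ro by real_asymp+
 hence "eventually (%j. \<bar>ka1 - om\<bar> / 3^j < ro & \<bar>ka2 - om\<bar> / 3^j < ro) sequentially" by (rule eventually_conj)
 then obtain J where J: "!!j. j >= J ==> \<bar>ka1 - om\<bar> / 3^j < ro & \<bar>ka2 - om\<bar> / 3^j < ro" unfolding eventually_sequentially by blast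
 have J': "\<bar>pl om j ka1 - om\<bar> < ro & \<bar>pl om j ka2 - om\<bar> < ro" if "j >= J" for j
  using J[OF that] by (simp add: pl_def abs_divide)
 have small: "norm (gam c' d' th) < e1" if "UL c' d'" "good ro e0 e1 c' d'" "\<bar>th - om\<bar> < ro" for c' d' th
  using that om by (auto simp: good_def gfacts_def)
 \<comment> \<open>From level \<open>J\<close> on the rays land in the small disc about 0. The point
   \<open>a\<close> needs J iterates to reach the landing point of \<open>ka1\<close>, m' more to a
   preimage of 0, and one more to 0.\<close>
 define a where "a = gam c d (pl om J ka1)"
 define n where "n = J + m' + 1"
 have a1: "norm a < e1" unfolding a_def using small[OF UL good] J' by auto
 have aJ: "(cub c d ^^ (J + i)) a = gam c d (3^i * ka1)" for i
  using gam_pl_iter[OF UL l, of J 0 ka1] gam_iter[OF UL, of i ka1] by (simp add: a_def add.commute[of J] funpow_add)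
 have an: "(cub c d ^^ n) a = 0"
  using aJ[of m'] kap(4) by (simp add: n_def)
 have ai: "\<forall>i<n. (cub c d ^^ i) a ~= c & (cub c d ^^ i) a ~= d"
 proof (intro allI impI)
 fix i assume "i < n"
 show "(cub c d ^^ i) a ~= c & (cub c d ^^ i) a ~= d"
 proof (cases "i < J")
  case True
  hence "(cub c d ^^ i) a = gam c d (pl om (J - i) ka1)" unfolding a_def using gam_pl_iter[OF UL l, of i "J - i" ka1] by simp
  moreover have "gam c d (pl om (J - i) ka1) \<notin> {c, d}" using kap(2)[of "J - i"] by blast
  ultimately show ?thesis by simp
 next
  case False
  then obtain i' where i': "i = J + i'" using le_Suc_ex by (metis not_less)
  hence "i' < m' \<or> i' = m'" using \<open>i < n\<close> by (auto simp: n_def)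
  thus ?thesis unfolding i' aJ using kap(1)[of i'] kap(3) by auto
 qed
 qed
 have a0: "a ~= 0"
 proof
  assume "a = 0"
  hence "(cub c d ^^ (J + m')) a = 0" by (simp add: funpow_cub_0)
  thus False using kap(3) unfolding aJ by simp
 qed
 from inj_chain[OF ai] obtain r where r: "r > 0" "chain_ok c d n a r" by blast
 have "min r (e1 - norm a) > 0" using r a1 by simp
 from root_chain[OF an ai this] obtain R1 e Z where R1: "R1 > 0" "e > 0" "e <= min r (e1 - norm a)" "nice R1 c d Z" and Z:
  "\<forall>c'\<in>ball c R1. \<forall>d'\<in>ball d R1. Z c' d' \<in> ball a e & (cub c' d' ^^ n) (Z c' d') = 0 & (\<forall>w\<in>ball a e. (cub c' d' ^^ n) w = 0 --> w = Z c' d')"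
  by (elim exE conjE)
 obtain et where et: "et > 0" "!!c' d' th th0. UL c' d' ==> norm (c' - c) < et ==> norm (d' - d) < et ==> \<bar>th - th0\<bar> < et ==>
  dist (gam c' d' th) (gam c d th0) < e"
  using gam_stability[OF mis R1(2)] by metis
 define R where "R = min R1 (min r (min et N))"
 have R: "R > 0" "R <= R1" "R <= r" "R <= et" "R <= N" using R1 r et N by (auto simp: R_def)
 have inD: "norm (c' - c) < R" "norm (d' - d) < R" if "c' \<in> ball c R" "d' \<in> ball d R" for c' d'
  using that by (auto simp: dist_norm norm_minus_commute)
 have goodD: "good ro e0 e1 c' d'" if "c' \<in> ball c R" "d' \<in> ball d R" for c' d'
  using N(2)[rule_format] inD[OF that] R by simp
 have ZD: "Z c' d' \<in> ball a e" "(cub c' d' ^^ n) (Z c' d') = 0" "!!w. w \<in> ball a e ==> (cub c' d' ^^ n) w = 0 ==> w = Z c' d'"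
  if "c' \<in> ball c R" "d' \<in> ball d R" for c' d'
 proof -
  have "c' \<in> ball c R1" "d' \<in> ball d R1" using that R by auto
  thus "Z c' d' \<in> ball a e" "(cub c' d' ^^ n) (Z c' d') = 0" "!!w. w \<in> ball a e ==> (cub c' d' ^^ n) w = 0 ==> w = Z c' d'"
   using Z by blast+
 qed
 \<comment> \<open>Repeated pull-back of \<open>Z\<close> by the inverse branch at 0. The moduli at
   least halve at each level, so the value always stays in the disc where the chosen preimage
   exists.\<close>
 define u where "u j = rec_nat Z (%_ y c' d'. SOME z. norm z < e0 & cub c' d' z = y c' d') j" for j
 have u0: "u 0 = Z" by (simp add: u_def)
 have uS: "u (Suc j) c' d' = (SOME z. norm z < e0 & cub c' d' z = u j c' d')" for j c' d' by (simp add: u_def)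
 have step: "norm (u (Suc j) c' d') < e0 & cub c' d' (u (Suc j) c' d') = u j c' d'"
   if D: "c' \<in> ball c R" "d' \<in> ball d R" and b: "norm (u j c' d') < e1 / 2^j" for j c' d'
  proof -
   have "e1 / 2^j <= e1 / 1" using es by (intro divide_left_mono) auto
   hence b1: "norm (u j c' d') < e1" using b by simp
   have "e0 > 0" using es by linarith
   show ?thesis unfolding uS by (rule someI_ex[OF good_pull0[OF goodD[OF D] b1 es(3) \<open>e0 > 0\<close>]])
  qed
 have ub: "norm (u j c' d') < e1 / 2^j" if D: "c' \<in> ball c R" "d' \<in> ball d R" for j c' d'
  proof (induction j)
   case 0
   have "norm (Z c' d') <= norm a + norm (Z c' d' - a)" using norm_triangle_ineq[of a "Z c' d' - a"] by simp
   also have "norm (Z c' d' - a) < e" using ZD(1)[OF D] by (simp add: dist_norm norm_minus_commute)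
   finally show ?case using R1(3) by (simp add: u0)
  next
   case (Suc j)
   have "norm (u (Suc j) c' d') <= norm (u j c' d') / 2"
    using good_expand(1)[OF goodD[OF D], of "u (Suc j) c' d'"] step[OF D Suc] by simp
   thus ?case using Suc by simp
  qed
 have uc: "norm (u (Suc j) c' d') < e0 & cub c' d' (u (Suc j) c' d') = u j c' d'" if "c' \<in> ball c R" "d' \<in> ball d R" for j c' d'
  by (rule step[OF that ub[OF that]])
 have uit: "(cub c' d' ^^ i) (u (i + j) c' d') = u j c' d'" if "c' \<in> ball c R" "d' \<in> ball d R" for i j c' d'
  by (induction i) (simp_all add: funpow_Suc_right uc[OF that] del: funpow.simps)
 have un: "nice R c d (u j)" for j
 proof (induction j)
  case 0
  thus ?case using nice_mono[OF R1(4) R(2)] by (simp add: u0)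
 next
  case (Suc j)
  show ?case
  proof (rule nice_pull[OF Suc, of 0 e0])
   show "cubq c' d' z w ~= 0" if "c' \<in> ball c R" "d' \<in> ball d R" "z \<in> ball 0 e0" "w \<in> ball 0 e0" for c' d' z w
    using goodD[OF that(1,2)] that(3,4) unfolding good_def by force
   show "u (Suc j) c' d' \<in> ball 0 e0 & cub c' d' (u (Suc j) c' d') = u j c' d'" if "c' \<in> ball c R" "d' \<in> ball d R" for c' d'
    using uc[OF that] by simp
  qed
 qed
 have cR: "c \<in> ball c R" "d \<in> ball d R" using R by auto
 have unz: "u j c d ~= 0" for j
 proof
  assume "u j c d = 0"
  hence "Z c d = 0" using uit[OF cR, of j 0] by (simp add: u0 funpow_cub_0)
  moreover have "a = Z c d" using ZD(3)[OF cR, of a] an R1(2) by simp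
  ultimately show False using a0 by simp
 qed
 have "norm c <= 2" using mis by (auto simp: mis_def par_def)
 moreover have "(cub c d ^^ m) c = 0" "(cub c d ^^ m') d = 0" using cc dd by (auto simp: crp_def)
 ultimately have "eventually (%j. \<exists>c'\<in>ball c (min eps R). \<exists>d'\<in>ball d (min eps R). (cub c' d' ^^ m') d' = 0 & (cub c' d' ^^ m) c' = u j c' d') sequentially"
 proof (rule perturb_cub[OF _ _ _ R(1)])
  show "continuous_on (ball c R \<times> ball d R) (%(c, d). u j c d)" for j using un by (simp add: nice_def)
  show "(%c. u j c d') field_differentiable at c'" "u j c' field_differentiable at d'" if "c' \<in> ball c R" "d' \<in> ball d R" for j c' d'
   using un[of j] that by (auto simp: nice_def)
  show "eventually (%j. \<forall>c'\<in>ball c R. \<forall>d'\<in>ball d R. norm (u j c' d') < e) sequentially" if "e > 0" for e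
  proof -
   have "eventually (%j. e1 / 2^j < e) sequentially" using that by real_asymp
   thus ?thesis
   proof eventually_elim
    case (elim j)
    show ?case
    proof (intro ballI)
     fix c' d' assume "c' \<in> ball c R" "d' \<in> ball d R"
     from ub[OF this, of j] show "norm (u j c' d') < e" using elim by linarith
    qed
   qed
  qed
 qed (use unz eps R in auto)
 hence "eventually (%j. \<exists>c' d'. norm (c' - c) < eps & norm (d' - d) < eps & mis c' d' & (cub c' d' ^^ m') d' = 0 &
  gam c' d' (pl om (j + J) ka1) = (cub c' d' ^^ m) c' & gam c' d' (pl om (j + J) ka2) = (cub c' d' ^^ m) c' &
  (cub c' d' ^^ ((j + J) + m' + 1)) ((cub c' d' ^^ m) c') = 0 & (\<forall>i < (j + J) + m' + 1. (cub c' d' ^^ i) ((cub c' d' ^^ m) c') \<notin> {c', d'})) sequentially"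
 proof eventually_elim
  case (elim j)
  then obtain c' d' where cd: "c' \<in> ball c (min eps R)" "d' \<in> ball d (min eps R)" "(cub c' d' ^^ m') d' = 0" "(cub c' d' ^^ m) c' = u j c' d'"
   by (elim bexE conjE)
  have D: "c' \<in> ball c R" "d' \<in> ball d R" using cd by auto
  have jn: "j + J + m' + 1 = n + j" by (simp add: n_def)
  have zero: "(cub c' d' ^^ (n + j)) (u j c' d') = 0"
   using ZD(2)[OF D] uit[OF D, of j 0] by (simp add: funpow_add u0)
  have mis': "mis c' d'"
   unfolding mis_def
  proof (intro conjI)
   show "par c' d'" "1 < norm (3 * c' * d')" using goodD[OF D] by (auto simp: good_def)
   have "(cub c' d' ^^ (n + j + m)) c' = 0" using zero cd(4) by (simp add: funpow_add)
   thus "\<exists>m. (cub c' d' ^^ m) c' = 0" by blast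
  qed (use cd in blast)
  hence UL': "UL c' d'" by (rule mis_UL)
  \<comment> \<open>At level \<open>J\<close> stability puts the landing point into the ball in
    which \<open>Z\<close> is the only zero of the n-th iterate; afterwards injectivity on the disc
    of radius \<open>e0\<close> forces equality level by level.\<close>
  have link: "gam c' d' (pl om (j + J) ka) = u j c' d'"
   if ka: "ka = ka1 \<or> ka = ka2" for j ka
  proof (induction j)
   case 0
   have "gam c d (pl om J ka) = a" using ka kap(2)[of J] by (auto simp: a_def)
   hence "gam c' d' (pl om J ka) \<in> ball a e"
    using et(2)[OF UL', of "pl om J ka" "pl om J ka"] inD[OF D] R et(1) by (simp add: dist_commute)
   moreover have "(cub c' d' ^^ n) (gam c' d' (pl om J ka)) = 0"
   proof -
    have "(cub c' d' ^^ n) (gam c' d' (pl om J ka)) = (cub c' d' ^^ (m' + 1)) ((cub c' d' ^^ J) (gam c' d' (pl om (J + 0) ka)))"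
    proof -
     have "n = (m' + 1) + J" by (simp add: n_def)
     thus ?thesis by (simp only: funpow_add o_apply add_0_right)
    qed
    also have "... = gam c' d' (3^(m'+1) * ka)" unfolding gam_pl_iter[OF UL' l] unfolding gam_iter[OF UL'] by simp
    also have "... = 0"
    proof -
     have gf: "gam c' d' om = 0" "gam c' d' (pi - om) = 0"
      using goodD[OF D] UL' om by (auto simp: good_def gfacts_def)
     show ?thesis using ka
     proof
      assume k: "ka = ka1"
      have "gam c' d' (3^(m'+1) * ka) = gam c' d' om"
      proof (rule gam_period'[OF UL', of _ _ "l + 3 * n0 + 2"])
       have "3^(m'+1) * ka = 3 * (3^m' * q) + pi" unfolding k ka1_def by (simp add: field_simps)
       thus "3^(m'+1) * ka = om + 2 * pi * of_int (l + 3 * n0 + 2)" unfolding n0 by (simp add: l algebra_simps)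
      qed
      thus ?thesis using gf by simp
     next
      assume k: "ka = ka2"
      have "gam c' d' (3^(m'+1) * ka) = gam c' d' (pi - om)"
      proof (rule gam_period'[OF UL', of _ _ "2 * l + 3 * n0 + 2"])
       have "3^(m'+1) * ka = 3 * (3^m' * q) + 2 * pi" unfolding k ka2_def by (simp add: field_simps)
       thus "3^(m'+1) * ka = pi - om + 2 * pi * of_int (2 * l + 3 * n0 + 2)" unfolding n0 by (simp add: l algebra_simps)
      qed
      thus ?thesis using gf by simp
     qed
    qed
    finally show ?thesis .
   qed
   ultimately show ?case using ZD(3)[OF D] by (simp add: u0)
  next
   case (Suc j)
   have "cub c' d' (gam c' d' (pl om (Suc j + J) ka)) = u j c' d'"
    using cub_gam_pl[OF UL' l, of "j + J" ka] Suc by simp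
   moreover have "norm (gam c' d' (pl om (Suc j + J) ka)) < e0"
    using small[OF UL' goodD[OF D], of "pl om (Suc j + J) ka"] J'[of "Suc j + J"] ka es by force
   ultimately have "(gam c' d' (pl om (Suc j + J) ka) - u (Suc j) c' d') * cubq c' d' (gam c' d' (pl om (Suc j + J) ka)) (u (Suc j) c' d') = 0"
    "norm (cubq c' d' (gam c' d' (pl om (Suc j + J) ka)) (u (Suc j) c' d')) > 2"
    using cub_diff[of c' d' "gam c' d' (pl om (Suc j + J) ka)" "u (Suc j) c' d'"] uc[OF D, of j] goodD[OF D] by (auto simp: good_def)
   thus ?case by auto
  qed
  have nc: "(cub c' d' ^^ i) (u j c' d') \<notin> {c', d'}" if i: "i < n + j" for i
  proof (cases "i < j")
   case True
   then obtain k where k: "j = i + Suc k" by (metis add_Suc_right less_imp_Suc_add)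
   have "(cub c' d' ^^ i) (u j c' d') = u (Suc k) c' d'" using uit[OF D, of i "Suc k"] k by simp
   thus ?thesis using good_expand(2)[OF goodD[OF D], of "u (Suc k) c' d'"] uc[OF D, of k] by simp
  next
   case False
   then obtain k where k: "i = k + j" by (metis add.commute le_Suc_ex not_less)
   have "(cub c' d' ^^ i) (u j c' d') = (cub c' d' ^^ k) (Z c' d')" using uit[OF D, of j 0] by (simp add: k funpow_add u0)
   moreover have "norm (Z c' d' - a) < r" using ZD(1)[OF D] R1(3) by (simp add: dist_norm norm_minus_commute)
   ultimately show ?thesis using chain_okD(2)[OF r(2), of c' d' "Z c' d'" k] inD[OF D] R i k by simp
  qed
  show ?case unfolding jn
  proof (rule exI[of _ c'], rule exI[of _ d'], intro conjI allI impI)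
   show "norm (c' - c) < eps" "norm (d' - d) < eps" using cd(1,2) by (auto simp: dist_norm norm_minus_commute)
  qed (use mis' cd(3) link zero nc in \<open>auto simp: cd(4)\<close>)
 qed
 thus ?thesis by (subst (asm) eventually_sequentially_seg)
qed

section \<open>Persistence of critical angles and the exchange of the critical points\<close>

lemma good_gam_int:
 assumes "good ro e0 e1 c d" "UL c d" shows "gam c d (pi * of_int k) = 0"
proof (cases "even k")
 case True
 then obtain h where "k = 2 * h" by (elim evenE)
 hence "gam c d (pi * of_int k) = gam c d 0" by (intro gam_period'[OF assms(2), of _ _ h]) simp
 thus ?thesis using assms by (simp add: good_def gfacts_def)
next
 case False
 then obtain h where "k = 2 * h + 1" by (elim oddE)
 hence "gam c d (pi * of_int k) = gam c d pi" by (intro gam_period'[OF assms(2), of _ _ h]) (simp add: algebra_simps)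
 thus ?thesis using assms by (simp add: good_def gfacts_def)
qed

text \<open>The co-critical point is at distance 3/2 * |c - d| > 9/4 from \<open>d\<close>.\<close>

lemma co_critical_far:
 assumes "good ro e0 e1 c d" "norm (w - x) < 1/4" "norm (d - x) < 1/4" "cub c d w = cub c d d" shows "w = d"
proof (rule ccontr)
 assume "w ~= d"
 hence w: "w = (3 * c - d) / 2" using cub_crit_fiber'[OF assms(4)] by simp
 have "w - d = 3/2 * (c - d)" unfolding w by (simp add: field_simps)
 hence "norm (w - d) = 3/2 * norm (c - d)" by (simp only: norm_mult norm_divide norm_numeral)
 moreover have "norm (c - d) > 3/2" using assms(1) by (simp add: good_def)
 moreover have "norm (w - d) <= norm (w - x) + norm (d - x)" using norm_triangle_ineq4[of "w - x" "d - x"] by simp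
 ultimately show False using assms(2,3) by simp
qed

text \<open>The four rays land near \<open>d\<close>, at points that m iterates take to 0, as they
  take the new critical point. By \<open>crit_inj\<close> their images already agree after one step,
  and the co-critical point is too far away.\<close>

lemma pers_crit:
 assumes mis: "mis c d" and dd: "crp ro c d d om m q" and om: "om \<in> {0, pi}"
 obtains R where "R > 0" "!!c' d'. norm (c' - c) < R ==> norm (d' - d) < R ==> UL c' d' ==> good ro e0 e1 c' d' ==>
  (cub c' d' ^^ m) d' = 0 ==> crp ro c' d' d' om m q"
proof -
 let ?T = "{q, q + pi/3^m, q + 2*pi/3, q + pi/3^m + 2*pi/3}"
 have m: "m >= 1" using dd by (simp add: crp_def)
 obtain n :: int where n: "3^m * q = om + pi + 2 * pi * of_int n" using dd by (auto simp: crp_def)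
 obtain l :: int where l: "om = pi * of_int l" using om_int[OF om] by auto
 obtain m0 where m0: "m = Suc m0" using m by (cases m) auto
 \<comment> \<open>After m triplings the four angles are multiples of pi, where all rays land at
   0.\<close>
 have T: "\<exists>k::int. 3^m * th = pi * of_int k" if "th \<in> ?T" for th
 proof -
  have "3^m * (q + pi/3^m) = 3^m * q + pi" "3^m * (q + 2*pi/3) = 3^m * q + 2 * pi * 3^m0"
   "3^m * (q + pi/3^m + 2*pi/3) = 3^m * q + pi + 2 * pi * 3^m0"
   by (simp_all add: m0 field_simps)
  hence "3^m * th = pi * of_int (l + 1 + 2 * n) \<or> 3^m * th = pi * of_int (l + 2 + 2 * n) \<or>
    3^m * th = pi * of_int (l + 1 + 2 * n + 2 * 3^m0) \<or> 3^m * th = pi * of_int (l + 2 + 2 * n + 2 * 3^m0)"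
   using that unfolding n l by (auto simp: algebra_simps n l)
  thus ?thesis by blast
 qed
 have H: "\<forall>i. 1 <= i --> i < m --> (cub d c ^^ i) d ~= d & (cub d c ^^ i) d ~= c"
  using dd by (auto simp: crp_def cub_commute[of d c])
 obtain r where r: "r > 0"
  "!!c' d' w w'. norm (d' - d) < r ==> norm (c' - c) < r ==> norm (w - d) < r ==> norm (w' - d) < r ==> (cub d' c' ^^ m) w = (cub d' c' ^^ m) w' ==> cub d' c' w = cub d' c' w'"
  "!!c' d' w i. norm (d' - d) < r ==> norm (c' - c) < r ==> norm (w - d) < r ==> 1 <= i ==> i < m ==> (cub d' c' ^^ i) w ~= d' & (cub d' c' ^^ i) w ~= c'"
  by (rule crit_inj[OF m H]) blast
 obtain et where et: "et > 0" "!!c' d' th th0. UL c' d' ==> norm (c' - c) < et ==> norm (d' - d) < et ==> \<bar>th - th0\<bar> < et ==>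
  dist (gam c' d' th) (gam c d th0) < min r (1/4)"
  using gam_stability[OF mis, of "min r (1/4)"] r(1) by (metis min_less_iff_conj zero_less_divide_1_iff zero_less_numeral)
 show ?thesis
 proof (rule that[of "min r (min et (1/4))"])
  fix c' d' assume cd: "norm (c' - c) < min r (min et (1/4))" "norm (d' - d) < min r (min et (1/4))" and UL: "UL c' d'"
   and good: "good ro e0 e1 c' d'" and z: "(cub c' d' ^^ m) d' = 0"
  have "gam c' d' th = d'" if th: "th \<in> ?T" for th
  proof (rule co_critical_far[OF good])
   have "gam c d th = d" using dd th by (auto simp: crp_def)
   hence nr: "norm (gam c' d' th - d) < min r (1/4)" using et(2)[OF UL, of th th] et(1) cd by (simp add: dist_norm)
   thus "norm (gam c' d' th - d) < 1/4" "norm (d' - d) < 1/4" using cd by simp_all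
   have "(cub c' d' ^^ m) (gam c' d' th) = (cub c' d' ^^ m) d'"
    using T[OF th] good_gam_int[OF good UL] z by (auto simp: gam_iter[OF UL])
   thus "cub c' d' (gam c' d' th) = cub c' d' d'"
    using r(2)[of d' c' "gam c' d' th" d'] cd nr unfolding cub_commute[of d' c'] by simp
  qed
  moreover have "(cub c' d' ^^ i) d' \<notin> {c', d'}" if "1 <= i" "i < m" for i
   using r(3)[of d' c' d' i] cd that unfolding cub_commute[of d' c'] by simp
  ultimately show "crp ro c' d' d' om m q" using dd z unfolding crp_def by blast
 qed (use r et in simp)
qed

lemma nang_open:
 assumes "nang ro om q" obtains s where "s > 0" "!!x. \<bar>x - q\<bar> < s ==> nang ro om x"
proof -
 obtain a where a: "a \<in> {pi/9, 2*pi/9}" "\<bar>q - (om + a)\<bar> < ro" using assms unfolding nang_def by blast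
 show ?thesis
 proof (rule that[of "ro - \<bar>q - (om + a)\<bar>"])
  fix x assume "\<bar>x - q\<bar> < ro - \<bar>q - (om + a)\<bar>"
  hence "\<bar>x - (om + a)\<bar> < ro" by linarith
  thus "nang ro om x" using a(1) unfolding nang_def by blast
 qed (use a in simp)
qed

text \<open>Vieta for a fibre of three distinct points.\<close>

lemma three_roots_sum:
 assumes "cub c d x1 = cub c d x2" "cub c d x1 = cub c d x3" "x1 ~= x2" "x1 ~= x3" "x2 ~= x3"
 shows "x1 + x2 + x3 = 3/2 * (c + d)"
proof -
 have "cubq c d x1 x2 = 0" "cubq c d x1 x3 = 0" using cub_diff[of c d x1 x2] cub_diff[of c d x1 x3] assms by simp_all
 hence "cubq c d x1 x2 - cubq c d x1 x3 = 0" by simp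
 moreover have "cubq c d x1 x2 - cubq c d x1 x3 = (x2 - x3) * (x1 + x2 + x3 - 3/2 * (c + d))"
  by (simp add: cubq_def power2_eq_square field_simps)
 ultimately show ?thesis using assms(5) by simp
qed

text \<open>The three angles of the branch point are mapped by the k-th iterate to angles of the active critical point c: both sides of c
 at the angle q, and one side at its partner.\<close>

definition core :: "real => complex => complex => real => nat => real => nat => real => nat => real => real => real => bool" where
 "core ro c d om m q m' q' k t1 t2 t3 \<longleftrightarrow> om \<in> {0, pi} & mis c d & crp ro c d c om m q & crp ro c d d (pi - om) m' q' &
  (\<exists>n::int. 3^k * t1 = q + 2 * pi * of_int n) & (\<exists>n::int. 3^k * t2 = q + 2*pi/3 + 2 * pi * of_int n) & (\<exists>n::int. 3^k * t3 = q + pi/3^m + 2 * pi * of_int n) &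
  gam c d t1 = gam c d t2 & gam c d t1 = gam c d t3 & (\<forall>i<k. (cub c d ^^ i) (gam c d t1) \<notin> {c, d})"

lemma pow3_odd: obtains h :: int where "(3::real)^j = 2 * of_int h + 1"
proof -
 have "odd ((3::int)^j)" by simp
 then obtain h where "(3::int)^j = 2 * h + 1" by (elim oddE)
 hence "real_of_int (3^j) = real_of_int (2 * h + 1)" by simp
 thus ?thesis using that[of h] by simp
qed

text \<open>The new critical angle \<open>C1\<close> lies between \<open>X1\<close> and
  \<open>X2\<close>, and the chord from \<open>C1\<close> to \<open>C1 + 2*pi/3\<close> separates
  \<open>X1\<close> from \<open>X2\<close>, \<open>X1 + 2*pi/3\<close> and \<open>Y\<close>. All
  four rays are mapped by m iterates to rays landing at \<open>y\<close>, and near c' there are only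
  two possible landing points; hence the last three rays land together.\<close>

lemma step:
 assumes core: "core ro c d om m q m' q' k t1 t2 t3"
  and N: "N > 0" "\<forall>c' d'. norm (c' - c) < N --> norm (d' - d) < N --> good ro e0 e1 c' d'"
  and es: "0 < e1" "e1 <= e0" "e1 <= e0^3" and ro: "ro > 0" and eps: "eps > 0"
 shows "\<exists>c' d' mN qN kN s1 s2 s3. norm (c' - c) < eps & norm (d' - d) < eps & kN > k & \<bar>s1 - t1\<bar> < eps & \<bar>s2 - t2\<bar> < eps & \<bar>s3 - t3\<bar> < eps &
  core ro d' c' (pi - om) m' q' mN qN kN s2 s3 s1"
proof -
 define b where "b = pi - om"
 have om: "om \<in> {0, pi}" and b: "b \<in> {0, pi}" and mis: "mis c d" and cc: "crp ro c d c om m q" and dd: "crp ro c d d b m' q'"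
  and tt: "gam c d t1 = gam c d t2" "gam c d t1 = gam c d t3" and tnc: "\<forall>i<k. (cub c d ^^ i) (gam c d t1) ~= c & (cub c d ^^ i) (gam c d t1) ~= d"
  using core by (auto simp: core_def b_def)
 obtain n1 n2 n3 :: int where n123: "3^k * t1 = q + 2 * pi * of_int n1" "3^k * t2 = q + 2*pi/3 + 2 * pi * of_int n2" "3^k * t3 = q + pi/3^m + 2 * pi * of_int n3"
  using core by (auto simp: core_def)
 obtain l :: int where l: "om = pi * of_int l" using om_int[OF om] by auto
 obtain bl :: int where bl: "b = pi * of_int bl" using om_int[OF b] by auto
 have m: "m >= 1" "m' >= 1" using cc dd by (auto simp: crp_def)
 obtain n n' :: int where n: "3^m * q = om + pi + 2 * pi * of_int n" "3^m' * q' = b + pi + 2 * pi * of_int n'"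
  using cc dd by (auto simp: crp_def)
 have gq: "gam c d q = c" "gam c d (q + pi/3^m) = c" "gam c d (q + 2*pi/3) = c" using cc by (auto simp: crp_def)
 define ka1 ka2 where "ka1 = q' + pi / 3^(m'+1)" and "ka2 = q' + 2 * pi / 3^(m'+1)"
 have H: "\<forall>i. 1 <= i --> i < m --> (cub c d ^^ i) c ~= c & (cub c d ^^ i) c ~= d" using cc by (auto simp: crp_def)
 obtain rc where rc: "rc > 0"
  "!!c' d' w w'. norm (c' - c) < rc ==> norm (d' - d) < rc ==> norm (w - c) < rc ==> norm (w' - c) < rc ==> (cub c' d' ^^ m) w = (cub c' d' ^^ m) w' ==> cub c' d' w = cub c' d' w'"
  "!!c' d' w i. norm (c' - c) < rc ==> norm (d' - d) < rc ==> norm (w - c) < rc ==> 1 <= i ==> i < m ==> (cub c' d' ^^ i) w ~= c' & (cub c' d' ^^ i) w ~= d'"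
  by (rule crit_inj[OF m(1) H]) blast
 obtain Rd where Rd: "Rd > 0" "!!c' d'. norm (c' - c) < Rd ==> norm (d' - d) < Rd ==> UL c' d' ==> good ro e0 e1 c' d' ==>
  (cub c' d' ^^ m') d' = 0 ==> crp ro c' d' d' b m' q'"
  by (rule pers_crit[OF mis dd b, where ?e0.0 = e0 and ?e1.0 = e1]) blast
 from inj_chain[OF tnc] obtain rk where rk: "rk > 0" "chain_ok c d k (gam c d t1) rk" by blast
 define e where "e = min rc (min rk (1/4))"
 have e: "e > 0" "e <= rc" "e <= rk" "e <= 1/4" using rc rk by (auto simp: e_def)
 obtain et where et: "et > 0" "!!c' d' th th0. UL c' d' ==> norm (c' - c) < et ==> norm (d' - d) < et ==> \<bar>th - th0\<bar> < et ==>
  dist (gam c' d' th) (gam c d th0) < e"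
  using gam_stability[OF mis e(1)] by metis
 obtain s where s: "s > 0" "!!x. \<bar>x - q\<bar> < s ==> nang ro om x"
  using nang_open[of ro om q] cc unfolding crp_def by metis
 define eps' where "eps' = min eps (min e (min Rd (min et N)))"
 have eps': "eps' > 0" "eps' <= eps" "eps' <= e" "eps' <= Rd" "eps' <= et" "eps' <= N" using eps e Rd et N by (auto simp: eps'_def)
 define de where "de = min eps (min et s)"
 have de: "de > 0" "de <= eps" "de <= et" "de <= s" using eps et s by (auto simp: de_def)
 \<comment> \<open>A bound for the displacements that are divided by 3^M below; 4 pi covers all the
   offsets added to \<open>q'\<close>.\<close>
 define B where "B = \<bar>q' - b\<bar> + 4 * pi"
 have "eventually (%j. B / 3^j < de) sequentially" using de(1) by real_asymp
 moreover have "eventually (%j. j >= (1::nat)) sequentially" by (rule eventually_ge_at_top)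
 moreover note perturb_gam[OF mis N es ro b cc dd eps'(1), folded ka1_def ka2_def]
 ultimately have "eventually (%j. B / 3^j < de & j >= 1 & (\<exists>c' d'. norm (c' - c) < eps' & norm (d' - d) < eps' & mis c' d' & (cub c' d' ^^ m') d' = 0 &
  gam c' d' (pl b j ka1) = (cub c' d' ^^ m) c' & gam c' d' (pl b j ka2) = (cub c' d' ^^ m) c' &
  (cub c' d' ^^ (j + m' + 1)) ((cub c' d' ^^ m) c') = 0 & (\<forall>i < j + m' + 1. (cub c' d' ^^ i) ((cub c' d' ^^ m) c') \<notin> {c', d'}))) sequentially"
  by (intro eventually_conj)
 from eventually_happens'[OF sequentially_bot this] obtain j c' d' where j: "B / 3^j < de" "j >= 1" and cd0: "norm (c' - c) < eps'" "norm (d' - d) < eps'"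
  and mis': "mis c' d'" and d'0: "(cub c' d' ^^ m') d' = 0" and
  gk: "gam c' d' (pl b j ka1) = (cub c' d' ^^ m) c'" "gam c' d' (pl b j ka2) = (cub c' d' ^^ m) c'" and
  c'0: "(cub c' d' ^^ (j + m' + 1)) ((cub c' d' ^^ m) c') = 0" and c'nc: "!!i. i < j + m' + 1 ==> (cub c' d' ^^ i) ((cub c' d' ^^ m) c') \<notin> {c', d'}"
  by (elim exE conjE) blast
 define M where "M = m + j"
 let ?F = "cub c' d'" and ?g = "gam c' d'"
 have UL: "UL c' d'" using mis' by (rule mis_UL)
 have good: "good ro e0 e1 c' d'" using N(2)[rule_format, of c' d'] cd0 eps' by simp
 have cde: "norm (c' - c) < e" "norm (d' - d) < e" using cd0 eps' by simp_all
 have dd': "crp ro c' d' d' b m' q'" using Rd(2)[OF _ _ UL good d'0] cd0 eps' by simp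
 have gf: "gfacts ro e1 c' d' b" "gfacts ro e1 c' d' (pi - b)" using good UL b by (auto simp: good_def)
 have st: "norm (?g th - gam c d th0) < e" if "\<bar>th - th0\<bar> < de" for th th0
  using et(2)[OF UL, of th th0] cd0 eps' de that by (simp add: dist_norm)
 have sm: "\<bar>x / 3^M\<bar> < de" if "\<bar>x\<bar> <= B" for x
 proof -
  have "\<bar>x / 3^M\<bar> = \<bar>x\<bar> / 3^M" by (simp add: abs_divide)
  also have "... <= B / 3^j" using that by (intro frac_le power_increasing) (auto simp: M_def)
  finally show ?thesis using j by simp
 qed
 have h1: "(?F ^^ m) (?g (q + (Q - b) / 3^M)) = ?g (pl b j Q)" for Q
 proof -
  have E: "3^m * (q + (Q - b) / 3^M) = 3^m * q + (Q - b) / 3^j" by (simp add: M_def power_add field_simps)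
  show ?thesis unfolding gam_iter[OF UL]
   by (rule gam_period'[OF UL, of _ _ "l + n"]) (unfold E n pl_def, simp add: b_def l algebra_simps)
 qed
 obtain m0 where m0: "m = Suc m0" using m by (cases m) auto
 have h2: "(?F ^^ m) (?g (th + 2*pi/3)) = (?F ^^ m) (?g th)" for th
  unfolding gam_iter[OF UL] by (rule gam_period'[OF UL, of _ _ "3^m0"]) (simp add: m0 field_simps)
 have h3: "(?F ^^ m) (?g (q + pi/3^m + (Q - b - pi) / 3^M)) = ?g (pl (b + pi) j Q)" for Q
 proof -
  have E: "3^m * (q + pi/3^m + (Q - b - pi) / 3^M) = 3^m * q + pi + (Q - (b + pi)) / 3^j" by (simp add: M_def power_add field_simps)
  show ?thesis unfolding gam_iter[OF UL]
   by (rule gam_period'[OF UL, of _ _ "l + n"]) (unfold E n pl_def, simp add: b_def l algebra_simps)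
 qed
 \<comment> \<open>Pull-backs by \<open>3^M\<close>: near q of the angles \<open>q'\<close> and
   \<open>q' + pi/3^m'\<close> of d' and of \<open>ka1\<close> and \<open>ka2\<close>, and near
   \<open>q + pi/3^m\<close> of the angle \<open>q' + 2*pi/3\<close>.\<close>
 define X1 X2 C1 C2 Y where XCY: "X1 = q + (q' - b) / 3^M" "X2 = q + (q' + pi/3^m' - b) / 3^M"
  "C1 = q + (ka1 - b) / 3^M" "C2 = q + (ka2 - b) / 3^M" "Y = q + pi/3^m + (q' + 2*pi/3 - b - pi) / 3^M"
 have p3: "0 < pi / 3^i & pi / 3^i <= pi" for i :: nat
 proof -
  have "pi / 3^i <= pi / 1" by (intro divide_left_mono) auto
  thus ?thesis by simp
 qed
 have k3: "ka1 = q' + (pi/3^m')/3" "ka2 = q' + 2 * ((pi/3^m')/3)" by (simp_all add: ka1_def ka2_def)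
 have g: "\<bar>q' + x - b\<bar> <= B" if "\<bar>x\<bar> <= 4 * pi" for x unfolding B_def using that by linarith
 define z where "z = pi/3^m'"
 have z: "0 < z" "z <= pi" using p3[of m'] by (simp_all add: z_def)
 have bd: "\<bar>q' - b\<bar> <= B" "\<bar>q' + pi/3^m' - b\<bar> <= B" "\<bar>ka1 - b\<bar> <= B" "\<bar>ka2 - b\<bar> <= B" "\<bar>q' + 2*pi/3 - b - pi\<bar> <= B"
  using g[of 0] g[of z] g[of "z/3"] g[of "2 * (z/3)"] g[of "2*pi/3 - pi"] z unfolding k3 z_def[symmetric]
  by (simp_all add: algebra_simps)
 have near: "\<bar>X1 - q\<bar> < de" "\<bar>X2 - q\<bar> < de" "\<bar>C1 - q\<bar> < de" "\<bar>C2 - q\<bar> < de" "\<bar>Y - (q + pi/3^m)\<bar> < de"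
  using sm[OF bd(1)] sm[OF bd(2)] sm[OF bd(3)] sm[OF bd(4)] sm[OF bd(5)] by (simp_all add: XCY)
 have nc: "norm (?g th - c) < e" "norm (?g (th + 2*pi/3) - c) < e" if "\<bar>th - q\<bar> < de" for th
  using st[of th q] st[of "th + 2*pi/3" "q + 2*pi/3"] that gq by simp_all
 have loc: "w = c'" if "norm (w - c) < e" "(?F ^^ m) w = (?F ^^ m) c'" for w
 proof -
  have "?F w = ?F c'" using rc(2)[of c' d' w c'] that cde e by simp
  thus ?thesis using co_critical_far[of ro e0 e1 d' c' w c] good good_commute[of ro e0 e1 c' d'] that cde e by (simp add: cub_commute[of d' c'])
 qed
 have gC: "?g C1 = c'" "?g C2 = c'" "?g (C1 + 2*pi/3) = c'" "?g (C2 + 2*pi/3) = c'"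
  using near(3,4) by (intro loc nc; simp add: h2; simp add: XCY h1 gk)+
 \<comment> \<open>Near the critical point there are only two preimages of the point with these angles, and the chord of the new critical angles separates them.\<close>
 define y where "y = ?g (pl b j q')"
 have gd: "?g q' = d'" "?g (q' + pi/3^m') = d'" "?g (q' + 2*pi/3) = d'" and na: "nang ro b q'" "nang ro b (q' + pi/3^m')" using dd' by (auto simp: crp_def)
 have yj: "?g (pl b i q') = ?g (pl b i (q' + pi/3^m')) & ?g (pl b i q') = ?g (pl (b + pi) i (q' + 2*pi/3)) & (i >= 1 --> ?g (pl b i q') \<notin> {c', d'})" for i
  using gf(1) na nang_shift[OF na(1)] gd unfolding gfacts_def by metis
 have FX: "(?F ^^ m) (?g X1) = y" "(?F ^^ m) (?g X2) = y" "(?F ^^ m) (?g (X1 + 2*pi/3)) = y" "(?F ^^ m) (?g Y) = y"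
 proof -
  have 1: "?g (pl b j (q' + pi/3^m')) = ?g (pl b j q')" and 2: "?g (pl (b + pi) j (q' + 2*pi/3)) = ?g (pl b j q')"
   using yj[of j] by metis+
  show "(?F ^^ m) (?g X1) = y" "(?F ^^ m) (?g X2) = y" "(?F ^^ m) (?g (X1 + 2*pi/3)) = y" "(?F ^^ m) (?g Y) = y"
   unfolding h2 unfolding XCY h1 h3 y_def 1 2 by (rule refl)+
 qed
 have yc: "y ~= (?F ^^ m) c'"
 proof
  assume "y = (?F ^^ m) c'"
  hence "(?F ^^ m') ((?F ^^ j) (?g (pl b (j + 0) q'))) = (?F ^^ m') ((?F ^^ j) (?g (pl b (j + 0) ka1)))"
   using gk by (simp add: y_def)
  hence "?g (3^m' * ka1) = 0" unfolding gam_pl_iter[OF UL bl] using d'0 gd by (simp add: gam_iter[OF UL])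
  moreover have E: "3^m' * ka1 = 3^m' * q' + pi/3" by (simp add: ka1_def field_simps)
  have "?g (3^m' * ka1) = ?g (pi - b + pi/3)"
   by (rule gam_period'[OF UL, of _ _ "bl + n'"]) (unfold E n, simp add: bl algebra_simps)
  ultimately show False using gf(2) by (simp add: gfacts_def)
 qed
 have nX: "norm (?g X1 - c) < e" "norm (?g X2 - c) < e" "norm (?g (X1 + 2*pi/3) - c) < e" "norm (?g Y - c) < e"
  using nc(1)[OF near(1)] nc(1)[OF near(2)] nc(2)[OF near(1)] st[OF near(5)] unfolding gq by (simp_all only:)
 have cdr: "norm (c' - c) < rc" "norm (d' - d) < rc" using cde e by linarith+
 have FXe: "?F w = ?F (?g X1)" if w: "norm (w - c) < e" "(?F ^^ m) w = y" for w
 proof (rule rc(2)[OF cdr])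
  show "norm (w - c) < rc" "norm (?g X1 - c) < rc" using w(1) nX(1) e by linarith+
  show "(?F ^^ m) w = (?F ^^ m) (?g X1)" unfolding w(2) FX(1) ..
 qed
 have FX1: "?F (?g X2) = ?F (?g X1)" "?F (?g (X1 + 2*pi/3)) = ?F (?g X1)" "?F (?g Y) = ?F (?g X1)"
  by (rule FXe[OF nX(2) FX(2)], rule FXe[OF nX(3) FX(3)], rule FXe[OF nX(4) FX(4)])
 have Xc: "w ~= c'" if "(?F ^^ m) w = y" for w using yc that by auto
 define P where "P = pi / 3^M"
 have P: "P > 0" "P <= pi / 3^m / 3"
 proof -
  show "P > 0" by (simp add: P_def)
  have "pi / 3^M <= pi / 3^(Suc m)" using j by (intro divide_left_mono power_increasing) (auto simp: M_def)
  thus "P <= pi / 3^m / 3" by (simp add: P_def)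
 qed
 define E where "E = P / 3^m'"
 have E: "E > 0" "E <= P / 3"
 proof -
  show "E > 0" using P by (simp add: E_def)
  have "P / 3^m' <= P / 3^1" using P m by (intro divide_left_mono power_increasing) auto
  thus "E <= P / 3" by (simp add: E_def)
 qed
 have m3: "pi / 3^m <= pi / 3"
 proof -
  have "pi / 3^m <= pi / 3^1" using m by (intro divide_left_mono power_increasing) auto
  thus ?thesis by simp
 qed
 have rel: "C1 = X1 + E/3" "X2 = X1 + E" "Y = X1 + pi/3^m - P/3"
  unfolding XCY ka1_def E_def P_def by (simp_all add: field_simps)
 define mz where "mz = pi / 3^m"
 have lin: "P > 0" "P <= mz / 3" "mz <= pi/3" "0 < mz" "E > 0" "E <= P / 3" "C1 = X1 + E/3" "X2 = X1 + E" "Y = X1 + mz - P/3"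
  unfolding mz_def using P m3 E rel p3[of m] by blast+
 \<comment> \<open>A ray inside the sector of the critical chord that lands with \<open>X1\<close>
   would cross the chord; \<open>X1 + 2*pi\<close> represents \<open>X1\<close> in the turn that
   starts at \<open>C1\<close>.\<close>
 have ne: "?g u ~= ?g X1" if "C1 < u" "u < C1 + 2*pi/3" "(?F ^^ m) (?g u) = y" for u
 proof
  assume "?g u = ?g X1"
  moreover have "?g (X1 + 2*pi) = ?g X1" by (rule gam_period'[OF UL, of _ _ 1]) simp
  ultimately have uX: "?g u = ?g (X1 + 2*pi)" by simp
  have "?g u = ?g C1"
  proof (rule unlinked[OF UL _ uX that(1,2)])
   show "?g C1 = ?g (C1 + 2*pi/3)" using gC by simp
   show "C1 + 2*pi/3 < X1 + 2*pi" "X1 + 2*pi < C1 + 2*pi" using lin pi_gt_zero by linarith+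
  qed
  thus False using Xc[OF that(3)] gC by simp
 qed
 have ne3: "?g X2 ~= ?g X1" "?g (X1 + 2*pi/3) ~= ?g X1" "?g Y ~= ?g X1"
 proof -
  have "C1 < X2" "X2 < C1 + 2*pi/3" "C1 < X1 + 2*pi/3" "X1 + 2*pi/3 < C1 + 2*pi/3" "C1 < Y" "Y < C1 + 2*pi/3"
   using lin pi_gt_zero by linarith+
  thus "?g X2 ~= ?g X1" "?g (X1 + 2*pi/3) ~= ?g X1" "?g Y ~= ?g X1" using ne FX by blast+
 qed
 \<comment> \<open>Three distinct points of a fibre have mean (c' + d') / 2. If all were near
   \<open>c\<close>, then d' would be near c', against |c' - d'| > 3/2.\<close>
 have two: "z = z'" if "norm (z - c) < e" "norm (z' - c) < e" "?F z = ?F (?g X1)" "?F z' = ?F (?g X1)" "z ~= ?g X1" "z' ~= ?g X1" for z z'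
 proof (rule ccontr)
  assume "z ~= z'"
  hence sum: "?g X1 + z + z' = 3/2 * (c' + d')" using that by (intro three_roots_sum) auto
  have "3/2 * (c' - d') = 3 * (c' - c) - ((?g X1 - c) + (z - c) + (z' - c))"
   using sum by (simp add: field_simps)
  hence "norm (3/2 * (c' - d')) <= norm (3 * (c' - c)) + norm ((?g X1 - c) + (z - c) + (z' - c))" by (simp only: norm_triangle_ineq4)
  also have "norm ((?g X1 - c) + (z - c) + (z' - c)) <= norm (?g X1 - c) + norm (z - c) + norm (z' - c)"
   by (intro order_trans[OF norm_triangle_ineq] add_right_mono norm_triangle_ineq)
  also have "norm (3 * (c' - c)) = 3 * norm (c' - c)" by (simp only: norm_mult norm_numeral)
  finally have "norm (3/2 * (c' - d')) < 6/4" using that nX(1) cde e by linarith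
  moreover have "norm (3/2 * (c' - d')) = 3/2 * norm (c' - d')" by (simp only: norm_mult norm_divide norm_numeral)
  moreover have "norm (c' - d') > 3/2" using good by (simp add: good_def)
  ultimately show False by simp
 qed
 define v where "v = ?g X2"
 have v: "?g X2 = v" "?g (X1 + 2*pi/3) = v" "?g Y = v"
  using two[OF nX(3) nX(2) FX1(2,1) ne3(2,1)] two[OF nX(4) nX(2) FX1(3,1) ne3(3,1)] by (simp_all add: v_def)
 have vm: "(?F ^^ m) v = y" "norm (v - c) < e" using FX(2) nX(2) v by simp_all
 have vc: "v \<notin> {c', d'}"
 proof -
  have "v ~= d'"
  proof
   assume "v = d'"
   hence "norm (c' - d') <= norm (c' - c) + norm (v - c)" using norm_triangle_ineq4[of "c' - c" "v - c"] by simp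
   thus False using vm(2) cde e good by (simp add: good_def)
  qed
  thus ?thesis using Xc[OF vm(1)] by simp
 qed
 \<comment> \<open>As 3^j is odd, multiplying the multiple om + pi of pi by 3^j changes it by full
   turns only.\<close>
 obtain h :: int where h: "(3::real)^j = 2 * of_int h + 1" by (rule pow3_odd)
 define BB :: int where "BB = h * (l + 1) + l + 3^j * n"
 have qM: "3^M * q = b + 2 * pi * of_int BB"
 proof -
  have "3^M * q = 3^j * (3^m * q)" by (simp add: M_def power_add)
  also have "... = (2 * of_int h + 1) * (om + pi) + 3^j * (2 * pi * of_int n)" unfolding n ring_distribs(1) h[symmetric] by simp
  also have "... = b + 2 * pi * of_int BB" by (simp add: BB_def b_def l algebra_simps)
  finally show ?thesis .
 qed
 define mN where "mN = m + m' + j + 1"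
 have mN: "mN = M + (m' + 1)" by (simp add: mN_def M_def)
 have C2': "C1 + pi/3^mN = C2" unfolding XCY ka1_def ka2_def mN by (simp add: power_add field_simps)
 have ccN: "crp ro c' d' c' om mN C1"
  unfolding crp_def C2'
 proof (intro conjI allI impI)
  show "mN >= 1" by (simp add: mN_def)
  have "(?F ^^ mN) c' = (?F ^^ (j + m' + 1)) ((?F ^^ m) c')"
  proof -
   have "mN = (j + m' + 1) + m" by (simp add: mN_def)
   thus ?thesis by (simp only: funpow_add o_apply)
  qed
  thus "(?F ^^ mN) c' = 0" using c'0 by simp
  show "\<forall>th\<in>{C1, C2, C1 + 2*pi/3, C2 + 2*pi/3}. ?g th = c'" using gC by simp
  show "nang ro om C1" "nang ro om C2" using s(2) near(3,4) de(4) by simp_all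
  show "\<exists>n. 3^mN * C1 = om + pi + 2 * pi * of_int n"
  proof (rule exI)
   have "3^mN * C1 = 3^(m'+1) * (3^M * q + (ka1 - b))" unfolding XCY mN power_add by (simp add: field_simps)
   also have "... = 3^(m'+1) * (2 * pi * of_int BB) + 3 * (3^m' * q') + pi" unfolding qM ka1_def by (simp add: field_simps)
   also have "... = om + pi + 2 * pi * of_int (3^(m'+1) * BB + 3 - 2 * l + 3 * n')" unfolding n by (simp add: b_def l algebra_simps)
   finally show "3^mN * C1 = om + pi + 2 * pi * of_int (3^(m'+1) * BB + 3 - 2 * l + 3 * n')" .
  qed
  fix i assume i: "1 <= i" "i < mN"
  show "(?F ^^ i) c' \<notin> {c', d'}"
  proof (cases "i < m")
   case True
   thus ?thesis using rc(3)[of c' d' c' i] cde e i by simp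
  next
   case False
   then obtain i' where i': "i = i' + m" by (metis add.commute le_Suc_ex not_less)
   hence "(?F ^^ i) c' = (?F ^^ i') ((?F ^^ m) c')" by (simp add: funpow_add)
   thus ?thesis using c'nc[of i'] i i' by (simp add: mN_def)
  qed
 qed
 \<comment> \<open>Displacements divided by 3^k, so that k iterates take the new angles to
   \<open>X2\<close>, \<open>X1 + 2*pi/3\<close> and \<open>Y\<close>, which all land at
   \<open>v\<close>. The k-th iterate is injective near the old branch point, so the new angles land
   together.\<close>
 define s1 s2 s3 where s123: "s1 = t1 + (X2 - q) / 3^k" "s2 = t2 + (X1 - q) / 3^k" "s3 = t3 + (Y - (q + pi/3^m)) / 3^k"
 have k1: "\<bar>x / 3^k\<bar> < de" if "\<bar>x\<bar> < de" for x
 proof -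
  have "\<bar>x / 3^k\<bar> = \<bar>x\<bar> / 3^k" by (simp add: abs_divide)
  also have "... <= \<bar>x\<bar> / 1" by (intro divide_left_mono) auto
  finally show ?thesis using that by simp
 qed
 have sde: "\<bar>s1 - t1\<bar> < de" "\<bar>s2 - t2\<bar> < de" "\<bar>s3 - t3\<bar> < de"
  using k1[OF near(2)] k1[OF near(1)] k1[OF near(5)] by (simp_all add: s123)
 have ks: "3^k * s1 = X2 + 2 * pi * of_int n1" "3^k * s2 = X1 + 2*pi/3 + 2 * pi * of_int n2" "3^k * s3 = Y + 2 * pi * of_int n3"
  unfolding s123 distrib_left n123 by simp_all
 have gs: "(?F ^^ k) (?g s1) = v" "(?F ^^ k) (?g s2) = v" "(?F ^^ k) (?g s3) = v"
  unfolding gam_iter[OF UL] ks gam_period[OF UL] v by simp_all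
 have sn: "norm (?g s1 - gam c d t1) < e" "norm (?g s2 - gam c d t1) < e" "norm (?g s3 - gam c d t1) < e"
  using st[OF sde(1)] st[OF sde(2)] st[OF sde(3)] tt by simp_all
 have seq: "?g s2 = ?g s3" "?g s2 = ?g s1"
  using chain_okD(1)[OF rk(2), of c' d' "?g s2" "?g s3"] chain_okD(1)[OF rk(2), of c' d' "?g s2" "?g s1"] sn gs cde e by simp_all
 define kN where "kN = k + M"
 \<comment> \<open>After M more iterates \<open>s2\<close>, \<open>s3\<close> and \<open>s1\<close>
   become \<open>q'\<close>, \<open>q' + 2*pi/3\<close> and \<open>q' + pi/3^m'\<close>; this is the
   origin of the cyclic order.\<close>
 have "core ro d' c' b m' q' mN C1 kN s2 s3 s1"
  unfolding core_def gam_commute[of d' c'] cub_commute[of d' c'] crp_commute[of ro d' c']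
 proof (intro conjI allI impI)
  show "mis d' c'" using mis' mis_commute by blast
  show "crp ro c' d' c' (pi - b) mN C1" using ccN by (simp add: b_def)
  have M3: "(3::real)^M * (2*pi/3) = 2 * pi * 3^(m0 + j)" by (simp add: M_def m0)
  have M4: "(3::real)^M * (pi/3^m) = 3^j * pi" by (simp add: M_def power_add)
  show "\<exists>n. 3^kN * s2 = q' + 2 * pi * of_int n"
  proof (rule exI)
   have "3^kN * s2 = 3^M * (X1 + 2*pi/3 + 2 * pi * of_int n2)" by (simp add: kN_def power_add flip: ks)
   also have "... = (3^M * q + (q' - b)) + 2 * pi * 3^(m0 + j) + 3^M * (2 * pi * of_int n2)"
    unfolding distrib_left M3 by (simp add: XCY field_simps)
   also have "... = q' + 2 * pi * of_int (BB + 3^(m0 + j) + 3^M * n2)" unfolding qM by (simp add: algebra_simps)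
   finally show "3^kN * s2 = q' + 2 * pi * of_int (BB + 3^(m0 + j) + 3^M * n2)" .
  qed
  show "\<exists>n. 3^kN * s3 = q' + 2*pi/3 + 2 * pi * of_int n"
  proof (rule exI)
   have "3^kN * s3 = 3^M * (Y + 2 * pi * of_int n3)" by (simp add: kN_def power_add flip: ks)
   also have "... = 3^M * q + 3^j * pi + (q' + 2*pi/3 - b - pi) + 3^M * (2 * pi * of_int n3)"
    unfolding XCY distrib_left M4 by simp
   also have "... = q' + 2*pi/3 + 2 * pi * of_int (BB + h + 3^M * n3)" unfolding qM h by (simp add: algebra_simps)
   finally show "3^kN * s3 = q' + 2*pi/3 + 2 * pi * of_int (BB + h + 3^M * n3)" .
  qed
  show "\<exists>n. 3^kN * s1 = q' + pi/3^m' + 2 * pi * of_int n"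
  proof (rule exI)
   have "3^kN * s1 = 3^M * (X2 + 2 * pi * of_int n1)" by (simp add: kN_def power_add flip: ks)
   also have "... = 3^M * q + (q' + pi/3^m' - b) + 3^M * (2 * pi * of_int n1)"
    unfolding XCY distrib_left by simp
   also have "... = q' + pi/3^m' + 2 * pi * of_int (BB + 3^M * n1)" unfolding qM by (simp add: algebra_simps)
   finally show "3^kN * s1 = q' + pi/3^m' + 2 * pi * of_int (BB + 3^M * n1)" .
  qed
  fix i assume i: "i < kN"
  have "(?F ^^ i) (?g s2) \<notin> {c', d'}"
  proof (cases "i < k")
   case True
   thus ?thesis using chain_okD(2)[OF rk(2), of c' d' "?g s2" i] sn cde e by simp
  next
   case False
   then obtain i1 where i1: "i = i1 + k" by (metis add.commute le_Suc_ex not_less)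
   hence F1: "(?F ^^ i) (?g s2) = (?F ^^ i1) v" using gs by (simp add: funpow_add)
   show ?thesis
   proof (cases "i1 < m")
    case True
    thus ?thesis using rc(3)[of c' d' v i1] vm cde e vc F1 by (cases "i1 = 0") auto
   next
    case False
    then obtain i2 where i2: "i1 = i2 + m" by (metis add.commute le_Suc_ex not_less)
    hence F2: "(?F ^^ i) (?g s2) = (?F ^^ i2) y" using F1 vm by (simp add: funpow_add)
    have "i2 < j" using i i1 i2 by (simp add: kN_def M_def)
    then obtain i3 where i3: "j = i2 + Suc i3" by (metis add_Suc_right less_imp_Suc_add)
    have "(?F ^^ i2) y = ?g (pl b (Suc i3) q')" unfolding y_def i3 by (rule gam_pl_iter[OF UL bl])
    moreover have "1 <= Suc i3" by simp
    hence "?g (pl b (Suc i3) q') \<notin> {c', d'}" using yj[of "Suc i3"] by blast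
    ultimately show ?thesis unfolding F2 by simp
   qed
  qed
  thus "(?F ^^ i) (?g s2) \<notin> {d', c'}" by auto
 qed (use b dd' seq in auto)
 moreover have "kN > k" using m by (simp add: kN_def M_def)
 ultimately show ?thesis using cd0 eps' sde de unfolding b_def[symmetric]
  by (intro exI[of _ c'] exI[of _ d'] exI[of _ mN] exI[of _ C1] exI[of _ kN] exI[of _ s1] exI[of _ s2] exI[of _ s3]) simp
qed

section \<open>The limit\<close>

lemma core_facts:
 assumes "core ro c d om m q m' q' k t1 t2 t3"
 shows "mis c d" "gam c d t1 = gam c d t2" "gam c d t1 = gam c d t3" "\<forall>i<k. (cub c d ^^ i) (gam c d t1) \<notin> {c, d}" "(cub c d ^^ k) (gam c d t1) = c"
proof -
 show 1: "mis c d" and "gam c d t1 = gam c d t2" "gam c d t1 = gam c d t3" "\<forall>i<k. (cub c d ^^ i) (gam c d t1) \<notin> {c, d}"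
  using assms unfolding core_def by blast+
 obtain n :: int where n: "3^k * t1 = q + 2 * pi * of_int n" using assms by (auto simp: core_def)
 show "(cub c d ^^ k) (gam c d t1) = c"
  unfolding gam_iter[OF mis_UL[OF 1]] n gam_period[OF mis_UL[OF 1]] using assms by (simp add: core_def crp_def)
qed

text \<open>The roles of the critical points and of the three angles are permuted at every step.\<close>

definition St1 :: "real => complex => complex => nat => real => real => real => bool" where
 "St1 ro c d k t1 t2 t3 \<longleftrightarrow> (\<exists>om m q m' q'. core ro c d om m q m' q' k t1 t2 t3)"

definition St2 :: "real => complex => complex => nat => real => real => real => bool" where
 "St2 ro c d k t1 t2 t3 \<longleftrightarrow> St1 ro c d k t1 t2 t3 \<or> St1 ro d c k t1 t2 t3"

definition St :: "real => complex => complex => nat => real => real => real => bool" where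
 "St ro c d k t1 t2 t3 \<longleftrightarrow> St2 ro c d k t1 t2 t3 \<or> St2 ro c d k t2 t3 t1 \<or> St2 ro c d k t3 t1 t2"

lemma St2_facts:
 assumes "St2 ro c d k t1 t2 t3"
 shows "mis c d" "gam c d t1 = gam c d t2" "gam c d t1 = gam c d t3" "\<forall>i<k. (cub c d ^^ i) (gam c d t1) \<notin> {c, d}" "(cub c d ^^ k) (gam c d t1) \<in> {c, d}"
proof -
 have "mis c d & gam c d t1 = gam c d t2 & gam c d t1 = gam c d t3 & (\<forall>i<k. (cub c d ^^ i) (gam c d t1) \<notin> {c, d}) & (cub c d ^^ k) (gam c d t1) \<in> {c, d}"
  using assms unfolding St2_def St1_def
 proof (elim disjE exE)
  fix om m q m' q' assume "core ro c d om m q m' q' k t1 t2 t3"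
  from core_facts[OF this] show ?thesis by simp
 next
  fix om m q m' q' assume "core ro d c om m q m' q' k t1 t2 t3"
  from core_facts[OF this] show ?thesis unfolding gam_commute[of d c] cub_commute[of d c] mis_commute[of d c] by auto
 qed
 thus "mis c d" "gam c d t1 = gam c d t2" "gam c d t1 = gam c d t3" "\<forall>i<k. (cub c d ^^ i) (gam c d t1) \<notin> {c, d}" "(cub c d ^^ k) (gam c d t1) \<in> {c, d}"
  by blast+
qed

lemma St_facts:
 assumes "St ro c d k t1 t2 t3"
 shows "mis c d" "gam c d t1 = gam c d t2" "gam c d t1 = gam c d t3" "\<forall>i<k. (cub c d ^^ i) (gam c d t1) \<notin> {c, d}" "(cub c d ^^ k) (gam c d t1) \<in> {c, d}"
proof -
 have "mis c d & gam c d t1 = gam c d t2 & gam c d t1 = gam c d t3 & (\<forall>i<k. (cub c d ^^ i) (gam c d t1) \<notin> {c, d}) & (cub c d ^^ k) (gam c d t1) \<in> {c, d}"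
  using assms unfolding St_def
 proof (elim disjE)
  assume "St2 ro c d k t1 t2 t3"
  from St2_facts[OF this] show ?thesis by simp
 next
  assume "St2 ro c d k t2 t3 t1"
  from St2_facts[OF this] show ?thesis by simp
 next
  assume "St2 ro c d k t3 t1 t2"
  from St2_facts[OF this] show ?thesis by simp
 qed
 thus "mis c d" "gam c d t1 = gam c d t2" "gam c d t1 = gam c d t3" "\<forall>i<k. (cub c d ^^ i) (gam c d t1) \<notin> {c, d}" "(cub c d ^^ k) (gam c d t1) \<in> {c, d}"
  by blast+
qed

lemma St2_step:
 assumes "St2 ro c d k t1 t2 t3"
  and N: "N > 0" "\<forall>c' d'. norm (c' - c) < N --> norm (d' - d) < N --> good ro e0 e1 c' d'"
  and es: "0 < e1" "e1 <= e0" "e1 <= e0^3" "ro > 0" "eps > 0"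
 shows "\<exists>c' d' k' s1 s2 s3. norm (c' - c) < eps & norm (d' - d) < eps & k' > k & \<bar>s1 - t1\<bar> < eps & \<bar>s2 - t2\<bar> < eps & \<bar>s3 - t3\<bar> < eps & St2 ro c' d' k' s2 s3 s1"
 using assms(1) unfolding St2_def[of _ c d] St1_def
proof (elim disjE exE)
 fix om m q m' q' assume "core ro c d om m q m' q' k t1 t2 t3"
 from step[OF this N es] obtain c' d' mN qN kN s1 s2 s3 where
  r: "norm (c' - c) < eps" "norm (d' - d) < eps" "kN > k" "\<bar>s1 - t1\<bar> < eps" "\<bar>s2 - t2\<bar> < eps" "\<bar>s3 - t3\<bar> < eps"
  and c: "core ro d' c' (pi - om) m' q' mN qN kN s2 s3 s1" by (elim exE conjE)
 have "St2 ro c' d' kN s2 s3 s1" unfolding St2_def St1_def using c by (intro disjI2) (rule exI)+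
 thus ?thesis using r by (intro exI conjI)
next
 fix om m q m' q' assume *: "core ro d c om m q m' q' k t1 t2 t3"
 have N': "\<forall>d' c'. norm (d' - d) < N --> norm (c' - c) < N --> good ro e0 e1 d' c'"
  using N(2) good_commute by blast
 from step[OF * N(1) N' es] obtain c' d' mN qN kN s1 s2 s3 where
  r: "norm (c' - d) < eps" "norm (d' - c) < eps" "kN > k" "\<bar>s1 - t1\<bar> < eps" "\<bar>s2 - t2\<bar> < eps" "\<bar>s3 - t3\<bar> < eps"
  and c: "core ro d' c' (pi - om) m' q' mN qN kN s2 s3 s1" by (elim exE conjE)
 have "St2 ro d' c' kN s2 s3 s1" unfolding St2_def St1_def using c by (intro disjI1) (rule exI)+
 thus ?thesis using r by (intro exI conjI)
qed

lemma St_step: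
 assumes "St ro c d k t1 t2 t3"
  and N: "N > 0" "\<forall>c' d'. norm (c' - c) < N --> norm (d' - d) < N --> good ro e0 e1 c' d'"
  and es: "0 < e1" "e1 <= e0" "e1 <= e0^3" "ro > 0" "eps > 0"
 shows "\<exists>c' d' k' s1 s2 s3. norm (c' - c) < eps & norm (d' - d) < eps & k' > k & \<bar>s1 - t1\<bar> < eps & \<bar>s2 - t2\<bar> < eps & \<bar>s3 - t3\<bar> < eps & St ro c' d' k' s1 s2 s3"
 using assms(1) unfolding St_def[of _ c d]
proof (elim disjE)
 assume "St2 ro c d k t1 t2 t3"
 from St2_step[OF this N es] show ?thesis unfolding St_def by blast
next
 assume "St2 ro c d k t2 t3 t1"
 from St2_step[OF this N es] show ?thesis unfolding St_def by blast
next
 assume "St2 ro c d k t3 t1 t2"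
 from St2_step[OF this N es] show ?thesis unfolding St_def by blast
qed

text \<open>At the start the branch point is the critical point \<open>w0\<close> itself, hit at
  time 0, with three of its four angles.\<close>

lemma St_init:
 assumes "ro > 0" shows "St ro w0 (- w0) 0 (pi/9) (7*pi/9) (2*pi/9)"
proof -
 have F: "cub w0 (- w0) w0 \<notin> {w0, - w0}"
 proof -
  have h: "1 * y0 < sqrt 3 * y0" using sqrt3_bounds y0_sq(2) by (intro mult_strict_right_mono) auto
  have "sqrt 3 * y0 ~= y0" "sqrt 3 * y0 ~= - y0" using h y0_sq(2) by linarith+
  thus ?thesis unfolding cub_w0_w0 by (simp add: w0_def complex_eq_iff)
 qed
 have F2: "(cub w0 (- w0) ^^ 2) w0 = 0"
  by (simp add: numeral_2_eq_2 cub_w0_w0 cub_w0_imag h0_y0 complex_eq_iff)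
 have nc: "(cub w0 (- w0) ^^ i) w0 \<notin> {w0, - w0} & (cub w0 (- w0) ^^ i) (- w0) \<notin> {w0, - w0}" if "1 <= i" "i < 2" for i
 proof -
  have "i = 1" using that by simp
  thus ?thesis using F by (auto simp: cub_w0_minus minus_equation_iff)
 qed
 have g: "gam w0 (- w0) th = w0" if "th \<in> {pi/9, 2*pi/9, 7*pi/9, 8*pi/9}" for th using g0_crit[OF that] by (simp add: g0_def)
 have g': "gam w0 (- w0) (th + pi) = - w0" if "th \<in> {pi/9, 2*pi/9, 7*pi/9, 8*pi/9}" for th
  using g0_minus[of th] g0_crit[OF that] by (simp add: g0_def)
 have ni: "nang ro om (om + a)" if "a \<in> {pi/9, 2*pi/9}" for a om
  unfolding nang_def using that assms by (intro bexI[of _ a]) simp_all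
 have c1: "crp ro w0 (- w0) w0 0 2 (pi/9)"
  unfolding crp_def
 proof (intro conjI)
  have e: "pi/9 + pi/3^2 = 2*pi/9" "pi/9 + 2*pi/3 = 7*pi/9" "2*pi/9 + 2*pi/3 = 8*pi/9" by simp_all
  have "gam w0 (- w0) (pi/9) = w0" "gam w0 (- w0) (2*pi/9) = w0" "gam w0 (- w0) (7*pi/9) = w0" "gam w0 (- w0) (8*pi/9) = w0"
   by (rule g; simp only: insert_iff simp_thms)+
  thus "\<forall>th\<in>{pi/9, pi/9 + pi/3^2, pi/9 + 2*pi/3, pi/9 + pi/3^2 + 2*pi/3}. gam w0 (- w0) th = w0"
   unfolding e by (simp only: ball_simps simp_thms)
  show "\<exists>n::int. 3^2 * (pi/9) = 0 + pi + 2 * pi * of_int n" by (rule exI[of _ 0]) simp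
  show "nang ro 0 (pi/9)" "nang ro 0 (pi/9 + pi/3^2)" using ni[of "pi/9" 0] ni[of "2*pi/9" 0] by simp_all
 qed (use nc F2 in auto)
 have c2: "crp ro w0 (- w0) (- w0) (pi - 0) 2 (pi/9 + pi)"
  unfolding crp_def
 proof (intro conjI)
  have e: "pi/9 + pi + pi/3^2 = 2*pi/9 + pi" "pi/9 + pi + 2*pi/3 = 7*pi/9 + pi" "2*pi/9 + pi + 2*pi/3 = 8*pi/9 + pi" by simp_all
  have "gam w0 (- w0) (pi/9 + pi) = - w0" "gam w0 (- w0) (2*pi/9 + pi) = - w0" "gam w0 (- w0) (7*pi/9 + pi) = - w0" "gam w0 (- w0) (8*pi/9 + pi) = - w0"
   by (rule g'; simp only: insert_iff simp_thms)+
  thus "\<forall>th\<in>{pi/9 + pi, pi/9 + pi + pi/3^2, pi/9 + pi + 2*pi/3, pi/9 + pi + pi/3^2 + 2*pi/3}. gam w0 (- w0) th = - w0"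
   unfolding e by (simp only: ball_simps simp_thms)
  show "\<exists>n::int. 3^2 * (pi/9 + pi) = pi - 0 + pi + 2 * pi * of_int n" by (rule exI[of _ 4]) simp
  show "nang ro (pi - 0) (pi/9 + pi)" "nang ro (pi - 0) (pi/9 + pi + pi/3^2)" using ni[of "pi/9" pi] ni[of "2*pi/9" pi] by (simp_all add: add.commute)
  show "(cub w0 (- w0) ^^ 2) (- w0) = 0" using F2 by (simp add: numeral_2_eq_2 cub_w0_minus)
 qed (use nc in auto)
 have "core ro w0 (- w0) 0 2 (pi/9) 2 (pi/9 + pi) 0 (pi/9) (7*pi/9) (2*pi/9)"
  unfolding core_def using c1 c2 mis_w0 g by (auto intro!: exI[of _ 0])
 thus ?thesis unfolding St_def St2_def St1_def by (intro disjI1) (rule exI)+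
qed

section \<open>Passage to the limit\<close>

text \<open>Since \<open>eps\<close> shrinks by a factor 4, the later steps add up to at most half
  of \<open>eps n\<close>, which leaves the strict inequality after the limit.\<close>

lemma geometric_limit:
 fixes X :: "nat => 'a::banach"
 assumes X: "!!n. norm (X (Suc n) - X n) < eps n / 4" and e: "!!n. eps (Suc n) <= eps n / 4" "!!n. eps n > 0"
 obtains L where "X \<longlonglongrightarrow> L" "!!n. norm (L - X n) < eps n"
proof -
 have b: "norm (X (n + k) - X n) <= eps n / 2 - eps (n + k) / 2" for n k
 proof (induction k)
  case (Suc k)
  have "norm (X (n + Suc k) - X n) <= norm (X (Suc (n + k)) - X (n + k)) + norm (X (n + k) - X n)"
   using norm_triangle_ineq[of "X (Suc (n + k)) - X (n + k)" "X (n + k) - X n"] by simp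
  thus ?case using Suc X[of "n + k"] e(1)[of "n + k"] e(2)[of "n + k"] by simp
 qed simp
 have en: "eps n <= eps 0 / 4^n" for n
 proof (induction n)
  case (Suc n)
  thus ?case using e(1)[of n] by simp
 qed simp
 have e0: "eps \<longlonglongrightarrow> 0"
 proof (rule tendsto_sandwich[OF _ _ tendsto_const])
  show "eventually (%n. 0 <= eps n) sequentially" using e(2) by (simp add: less_imp_le)
  show "eventually (%n. eps n <= eps 0 / 4^n) sequentially" using en by simp
  show "(%n. eps 0 / 4^n) \<longlonglongrightarrow> 0" by real_asymp
 qed
 have "Cauchy X"
 proof (rule CauchyI)
  fix r :: real assume "r > 0"
  hence "eventually (%n. eps n < r) sequentially" using e0 by (simp add: order_tendsto_iff)
  then obtain N where N: "eps N < r" by (auto simp: eventually_sequentially)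
  have "norm (X m - X N) < r / 2" if "m >= N" for m
   using b[of N "m - N"] that N e(2)[of m] by simp
  note h = this
  have "norm (X m - X n) < r" if "m >= N" "n >= N" for m n
  proof -
   have "norm (X m - X n) <= norm (X m - X N) + norm (X n - X N)"
    using norm_triangle_ineq4[of "X m - X N" "X n - X N"] by simp
   thus ?thesis using h[OF that(1)] h[OF that(2)] by simp
  qed
  thus "\<exists>M. \<forall>m\<ge>M. \<forall>n\<ge>M. norm (X m - X n) < r" by blast
 qed
 then obtain L where L: "X \<longlonglongrightarrow> L" using Cauchy_convergent convergent_def by blast
 have "norm (L - X n) < eps n" for n
 proof -
  have "norm (L - X n) <= eps n / 2"
  proof (rule LIMSEQ_le_const2)
   show "(%k. norm (X (k + n) - X n)) \<longlonglongrightarrow> norm (L - X n)"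
    by (intro tendsto_intros LIMSEQ_ignore_initial_segment L)
   show "\<exists>N. \<forall>k\<ge>N. norm (X (k + n) - X n) <= eps n / 2"
   proof (intro exI allI impI)
    fix k
    show "norm (X (k + n) - X n) <= eps n / 2" using b[of n k] e(2)[of "n + k"] by (simp add: add.commute)
   qed
  qed
  thus ?thesis using e(2)[of n] by simp
 qed
 thus ?thesis using that L by blast
qed

text \<open>By upper semicontinuity, balls in the filled Julia sets of parameters tending to c, d
  would accumulate at a ball in that of the Misiurewicz map, whose interior is empty.\<close>

lemma no_balls_near:
 assumes mis: "mis c d" and de: "de > 0"
 shows "\<exists>r>0. \<forall>c' d' z. norm (c' - c) < r --> norm (d' - d) < r --> ~ ball z de \<subseteq> fk c' d'"
proof (rule ccontr)
 assume contra: "~ ?thesis"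
 have "\<exists>x. norm (fst x - c) < inverse (Suc n) & norm (fst (snd x) - d) < inverse (Suc n) & ball (snd (snd x)) de \<subseteq> fk (fst x) (fst (snd x))" for n
 proof -
  have "inverse (real (Suc n)) > 0" by simp
  then obtain c' d' z where "norm (c' - c) < inverse (Suc n)" "norm (d' - d) < inverse (Suc n)" "ball z de \<subseteq> fk c' d'"
   using contra by blast
  thus ?thesis by (intro exI[of _ "(c', d', z)"]) simp
 qed
 then obtain x where x: "!!n. norm (fst (x n) - c) < inverse (Suc n)" "!!n. norm (fst (snd (x n)) - d) < inverse (Suc n)"
  "!!n. ball (snd (snd (x n))) de \<subseteq> fk (fst (x n)) (fst (snd (x n)))" by metis
 have cl: "(%n. fst (x n)) \<longlonglongrightarrow> c" and dl: "(%n. fst (snd (x n))) \<longlonglongrightarrow> d"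
  using x(1,2) by (auto intro!: LIM_zero_cancel[OF LIMSEQ_norm_0] simp: inverse_eq_divide)
 have "norm (snd (snd (x n))) <= 10" for n
  using x(3)[of n] de by (intro fk_bounded) (auto simp: subset_eq)
 hence "bounded (range (%n. snd (snd (x n))))" by (auto simp: bounded_iff)
 then obtain z r where r: "strict_mono (r::nat => nat)" "((%n. snd (snd (x n))) \<circ> r) \<longlonglongrightarrow> z"
  using bounded_imp_convergent_subsequence by blast
 have "ball z (de/2) \<subseteq> fk c d"
 proof
  fix w assume w: "w \<in> ball z (de/2)"
  have "eventually (%n. dist (snd (snd (x (r n)))) z < de/2) sequentially"
   using r(2) de unfolding tendsto_iff o_def by (metis half_gt_zero)
  then obtain N where N: "!!n. n >= N ==> dist (snd (snd (x (r n)))) z < de/2" unfolding eventually_sequentially by blast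
  have "w \<in> fk (fst (x (r (n + N)))) (fst (snd (x (r (n + N)))))" for n
  proof -
   have "dist (snd (snd (x (r (n + N))))) w < de"
    using N[of "n + N"] w dist_triangle[of "snd (snd (x (r (n + N))))" w z] by simp
   thus ?thesis using x(3)[of "r (n + N)"] by auto
  qed
  thus "w \<in> fk c d"
  proof (rule fk_closed_graph[rotated 3])
   have s: "filterlim (%n. r (n + N)) at_top sequentially"
    using filterlim_compose[OF filterlim_subseq[OF r(1)] filterlim_add_const_nat_at_top[of N]] by (simp add: o_def)
   show "(%n. fst (x (r (n + N)))) \<longlonglongrightarrow> c" by (rule filterlim_compose[OF cl s])
   show "(%n. fst (snd (x (r (n + N))))) \<longlonglongrightarrow> d" by (rule filterlim_compose[OF dl s])
  qed (rule tendsto_const)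
 qed
 hence "z \<in> interior (fk c d)" using de by (meson centre_in_ball half_gt_zero interior_maximal open_ball subsetD)
 thus False using interior_fk_empty[OF mis] by simp
qed

lemma cub_near_all:
 assumes "e > 0"
 shows "\<exists>r>0. \<forall>i\<le>k. \<forall>c d w. norm (c - c0) < r --> norm (d - d0) < r --> norm (w - a) < r --> norm ((cub c d ^^ i) w - (cub c0 d0 ^^ i) a) < e"
proof (induction k)
 case 0
 show ?case using assms by (intro exI[of _ e]) simp
next
 case (Suc k)
 then obtain r where r: "r > 0" "\<forall>i\<le>k. \<forall>c d w. norm (c - c0) < r --> norm (d - d0) < r --> norm (w - a) < r --> norm ((cub c d ^^ i) w - (cub c0 d0 ^^ i) a) < e"
  by blast
 obtain r3 where r3: "r3 > 0" "!!c d w. norm (c - c0) < r3 ==> norm (d - d0) < r3 ==> norm (w - a) < r3 ==> norm ((cub c d ^^ Suc k) w - (cub c0 d0 ^^ Suc k) a) < e"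
  by (rule cub_near[OF assms, where n = "Suc k" and a = a and ?c0.0 = c0 and ?d0.0 = d0]) blast
 show ?case
 proof (intro exI[of _ "min r r3"] conjI allI impI)
  fix i c d w assume *: "i <= Suc k" "norm (c - c0) < min r r3" "norm (d - d0) < min r r3" "norm (w - a) < min r r3"
  show "norm ((cub c d ^^ i) w - (cub c0 d0 ^^ i) a) < e"
  proof (cases "i = Suc k")
   case True
   thus ?thesis using r3(2)[of c d w] * by simp
  next
   case False
   thus ?thesis using r(2) * by simp
  qed
 qed (use r r3 in simp)
qed

lemma distinct_near:
 assumes "!!i l. i < l ==> l <= k ==> (cub c0 d0 ^^ i) a ~= (cub c0 d0 ^^ l) a"
 shows "\<exists>r>0. \<forall>c d w i l. norm (c - c0) < r --> norm (d - d0) < r --> norm (w - a) < r --> i < l --> l <= k --> (cub c d ^^ i) w ~= (cub c d ^^ l) w"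
proof -
 let ?A = "(%(i, l). norm ((cub c0 d0 ^^ i) a - (cub c0 d0 ^^ l) a)) ` {(i, l). i < l & l <= k}"
 have "{(i, l). i < l & l <= k} \<subseteq> {..k} \<times> {..k}" by auto
 hence "finite {(i, l). i < l & l <= k}" by (rule finite_subset) simp
 hence "finite (insert 1 ?A)" by simp
 moreover have "x > 0" if "x \<in> insert 1 ?A" for x using that assms by auto
 ultimately have m: "Min (insert 1 ?A) > 0" by (subst Min_gr_iff) auto
 define e where "e = Min (insert 1 ?A) / 2"
 have e: "e > 0" using m by (simp add: e_def)
 have e2: "2 * e <= norm ((cub c0 d0 ^^ i) a - (cub c0 d0 ^^ l) a)" if "i < l" "l <= k" for i l
  unfolding e_def using \<open>finite (insert 1 ?A)\<close> that by (auto intro!: Min_le)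
 obtain r where r: "r > 0" "\<forall>i\<le>k. \<forall>c d w. norm (c - c0) < r --> norm (d - d0) < r --> norm (w - a) < r --> norm ((cub c d ^^ i) w - (cub c0 d0 ^^ i) a) < e"
  using cub_near_all[OF e, of k c0 d0 a] by blast
 show ?thesis
 proof (intro exI[of _ r] conjI allI impI notI)
  fix c d w i l assume *: "norm (c - c0) < r" "norm (d - d0) < r" "norm (w - a) < r" "i < l" "l <= k" "(cub c d ^^ i) w = (cub c d ^^ l) w"
  have "norm ((cub c d ^^ i) w - (cub c0 d0 ^^ i) a) < e" "norm ((cub c d ^^ l) w - (cub c0 d0 ^^ l) a) < e"
   using r(2)[rule_format, OF _ *(1-3), of i] r(2)[rule_format, OF _ *(1-3), of l] *(4,5) by linarith+
  hence "norm ((cub c0 d0 ^^ i) a - (cub c0 d0 ^^ l) a) < 2 * e"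
   using norm_triangle_ineq4[of "(cub c d ^^ l) w - (cub c0 d0 ^^ l) a" "(cub c d ^^ i) w - (cub c0 d0 ^^ i) a"] *(6) by simp
  thus False using e2[OF *(4,5)] by simp
 qed (fact r(1))
qed

text \<open>A repetition up to time k would make the orbit periodic before it runs through a
  critical point into 0. A periodic point that reaches the fixed point 0 is 0, but the critical
  point is not.\<close>

lemma St_distinct:
 assumes "St ro c d k t1 t2 t3" "i < l" "l <= k"
 shows "(cub c d ^^ i) (gam c d t1) ~= (cub c d ^^ l) (gam c d t1)"
proof
 let ?F = "cub c d" and ?\<xi> = "gam c d t1"
 assume eq: "(?F ^^ i) ?\<xi> = (?F ^^ l) ?\<xi>"
 have mis: "mis c d" using St_facts[OF assms(1)] by simp
 define z where "z = (?F ^^ i) ?\<xi>"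
 define p where "p = l - i"
 have p: "p >= 1" "l = p + i" using assms by (auto simp: p_def)
 have zp: "(?F ^^ p) z = z" using eq unfolding z_def p(2) by (simp add: funpow_add)
 have zpn: "(?F ^^ (p * n)) z = z" for n
  by (induction n) (simp_all add: funpow_add zp add.commute)
 have kz: "(?F ^^ k) ?\<xi> = (?F ^^ (k - i)) z"
  using assms unfolding z_def by (simp flip: funpow_add[THEN fun_cong, simplified o_def])
 have "(?F ^^ k) ?\<xi> \<in> {c, d}" using St_facts[OF assms(1)] by simp
 hence kz': "(?F ^^ (k - i)) z \<in> {c, d}" unfolding kz .
 obtain m1 m2 where m12: "(?F ^^ m1) c = 0" "(?F ^^ m2) d = 0" using mis unfolding mis_def by blast
 define M where "M = m1 + m2"
 have "(?F ^^ M) c = 0" "(?F ^^ M) d = 0" unfolding M_def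
  by (rule funpow_zero_ge[OF m12(1)], simp, rule funpow_zero_ge[OF m12(2)], simp)
 moreover have kz2: "(?F ^^ (k - i)) z = c \<or> (?F ^^ (k - i)) z = d" using kz' by simp
 ultimately have M: "(?F ^^ M) ((?F ^^ (k - i)) z) = 0" by (elim disjE) simp_all
 have "c ~= 0" "d ~= 0" using mis unfolding mis_def by auto
 hence nz: "(?F ^^ k) ?\<xi> ~= 0" unfolding kz using kz2 by (elim disjE) simp_all
 have "(?F ^^ (M + (k - i))) z = 0" using M by (simp add: funpow_add)
 moreover have "M + (k - i) <= p * (M + (k - i))" using p by simp
 ultimately have "(?F ^^ (p * (M + (k - i)))) z = 0" by (rule funpow_zero_ge)
 hence "z = 0" unfolding zpn .
 thus False using nz unfolding kz by (simp add: funpow_cub_0)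
qed

text \<open>A radius within which the achievements of one stage persist with precision
  \<open>de\<close>. All later parameters are chosen so that the limit stays within the radii of all
  stages.\<close>

definition OKr :: "complex => complex => nat => real => real => real => real => real => bool" where
 "OKr c d k t1 t2 t3 de r \<longleftrightarrow> (\<forall>c' d'. norm (c' - c) < r --> norm (d' - d) < r -->
   (\<forall>z. ~ ball z de \<subseteq> fk c' d') & (con c' d' --> (\<exists>s>0. tl c' d' s de)) &
   (UL c' d' --> (\<forall>th. \<bar>th - t1\<bar> < r --> dist (gam c' d' th) (gam c d t1) < de &
     (\<forall>i<k. (cub c' d' ^^ i) (gam c' d' th) \<notin> {c', d'}) & (\<forall>i l. i < l --> l <= k --> (cub c' d' ^^ i) (gam c' d' th) ~= (cub c' d' ^^ l) (gam c' d' th))) &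
     (\<forall>th. \<bar>th - t2\<bar> < r --> dist (gam c' d' th) (gam c d t1) < de) & (\<forall>th. \<bar>th - t3\<bar> < r --> dist (gam c' d' th) (gam c d t1) < de)))"

lemma OKrD:
 assumes "OKr c d k t1 t2 t3 de r" "norm (c' - c) < r" "norm (d' - d) < r"
 shows "~ ball z de \<subseteq> fk c' d'" "con c' d' ==> \<exists>s>0. tl c' d' s de"
  "UL c' d' ==> \<bar>th - t1\<bar> < r ==> dist (gam c' d' th) (gam c d t1) < de"
  "UL c' d' ==> \<bar>th - t2\<bar> < r ==> dist (gam c' d' th) (gam c d t1) < de"
  "UL c' d' ==> \<bar>th - t3\<bar> < r ==> dist (gam c' d' th) (gam c d t1) < de"
  "UL c' d' ==> \<bar>th - t1\<bar> < r ==> i < k ==> (cub c' d' ^^ i) (gam c' d' th) \<notin> {c', d'}"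
  "UL c' d' ==> \<bar>th - t1\<bar> < r ==> i < l ==> l <= k ==> (cub c' d' ^^ i) (gam c' d' th) ~= (cub c' d' ^^ l) (gam c' d' th)"
 using assms(1)[unfolded OKr_def, THEN spec, THEN spec, THEN mp, OF assms(2), THEN mp, OF assms(3)] by simp_all

lemma OKr_mono: "OKr c d k t1 t2 t3 de r ==> r' <= r ==> OKr c d k t1 t2 t3 de r'"
 unfolding OKr_def by (meson less_le_trans)

lemma OKr_exists:
 assumes St: "St ro c d k t1 t2 t3" and de: "de > 0"
 shows "\<exists>r>0. OKr c d k t1 t2 t3 de r"
proof -
 note f = St_facts[OF St]
 note mis = f(1)
 obtain r1 where r1: "r1 > 0" "!!c' d' z. norm (c' - c) < r1 ==> norm (d' - d) < r1 ==> ~ ball z de \<subseteq> fk c' d'"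
  using no_balls_near[OF mis de] by blast
 obtain r2 s where r2: "r2 > 0" "s > 0" "!!c' d'. con c' d' ==> norm (c' - c) < r2 ==> norm (d' - d) < r2 ==> tl c' d' s de"
  by (rule tail_stability[OF mis de]) blast
 have "\<forall>i<k. (cub c d ^^ i) (gam c d t1) ~= c & (cub c d ^^ i) (gam c d t1) ~= d" using f(4) by auto
 from inj_chain[OF this] obtain r3 where r3: "r3 > 0" "chain_ok c d k (gam c d t1) r3" by blast
 obtain r4 where r4: "r4 > 0" "\<forall>c' d' w i l. norm (c' - c) < r4 --> norm (d' - d) < r4 --> norm (w - gam c d t1) < r4 --> i < l --> l <= k --> (cub c' d' ^^ i) w ~= (cub c' d' ^^ l) w"
  using distinct_near[of k c d "gam c d t1", OF St_distinct[OF St]] by blast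
 define e where "e = min de (min r3 r4)"
 have e: "e > 0" "e <= de" "e <= r3" "e <= r4" using de r3 r4 by (auto simp: e_def)
 obtain et where et: "et > 0" "!!c' d' th th0. UL c' d' ==> norm (c' - c) < et ==> norm (d' - d) < et ==> \<bar>th - th0\<bar> < et ==>
  dist (gam c' d' th) (gam c d th0) < e"
  by (rule gam_stability[OF mis e(1)]) blast
 define r where "r = min (min r1 r2) (min (min r3 r4) et)"
 have r: "r > 0" "r <= r1" "r <= r2" "r <= r3" "r <= r4" "r <= et" using r1 r2 r3 r4 et by (auto simp: r_def)
 have "OKr c d k t1 t2 t3 de r"
  unfolding OKr_def
 proof (intro allI impI conjI)
  fix c' d' assume cd: "norm (c' - c) < r" "norm (d' - d) < r"
  show "~ ball z de \<subseteq> fk c' d'" for z using r1(2) cd r by simp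
  show "\<exists>s>0. tl c' d' s de" if "con c' d'" using r2(2) r2(3)[OF that] cd r by (intro exI[of _ s]) simp
  assume UL: "UL c' d'"
  have n: "dist (gam c' d' th) (gam c d t1) < e" if "th0 \<in> {t1, t2, t3}" "\<bar>th - th0\<bar> < r" for th th0
   using et(2)[OF UL, of th th0] cd that r f(2,3) by auto
  show "dist (gam c' d' th) (gam c d t1) < de" if "\<bar>th - t1\<bar> < r" for th using n[of t1 th] that e by simp
  show "dist (gam c' d' th) (gam c d t1) < de" if "\<bar>th - t2\<bar> < r" for th using n[of t2 th] that e by simp
  show "dist (gam c' d' th) (gam c d t1) < de" if "\<bar>th - t3\<bar> < r" for th using n[of t3 th] that e by simp
  fix th assume "\<bar>th - t1\<bar> < r"
  hence n1: "norm (gam c' d' th - gam c d t1) < e" using n[of t1 th] by (simp add: dist_norm)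
  show "(cub c' d' ^^ i) (gam c' d' th) \<notin> {c', d'}" if "i < k" for i
   using chain_okD(2)[OF r3(2), of c' d' "gam c' d' th" i] that n1 cd r e by simp
  show "(cub c' d' ^^ i) (gam c' d' th) ~= (cub c' d' ^^ l) (gam c' d' th)" if "i < l" "l <= k" for i l
   using r4(2)[rule_format, of c' d' "gam c' d' th" i l] that n1 cd r e by simp
 qed
 thus ?thesis using r(1) by blast
qed

lemma limit_param:
 obtains c d t1 t2 t3 where "UL c d" "interior (fk c d) = {}" "t1 < t3" "t3 < t2" "t2 < t1 + 2 * pi"
  "gam c d t1 = gam c d t2" "gam c d t1 = gam c d t3" "!!i. (cub c d ^^ i) (gam c d t1) \<notin> {c, d}"
  "!!i l. i < l ==> (cub c d ^^ i) (gam c d t1) ~= (cub c d ^^ l) (gam c d t1)"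
proof -
 obtain ro e0 e1 where ro: "ro > 0" and es: "0 < e1" "e1 <= e0" "e1 <= e0^3"
  and good: "!!c d. norm (c - w0) < ro ==> norm (d + w0) < ro ==> good ro e0 e1 c d"
  using good_exists by blast
 \<comment> \<open>The clause \<open>n <= k\<close> makes the time of the critical collision tend to
   infinity, and \<open>r < pi/100\<close> at stage 0 keeps the three limit angles distinct and in
   order.\<close>
 define P :: "nat => complex \<times> complex \<times> nat \<times> real \<times> real \<times> real \<times> real => bool" where
  "P n x \<longleftrightarrow> (case x of (c, d, k, t1, t2, t3, r) => St ro c d k t1 t2 t3 & norm (c - w0) < ro & norm (d + w0) < ro & n <= k & r > 0 &
   OKr c d k t1 t2 t3 (1 / Suc n) r & (n = 0 --> t1 = pi/9 & t2 = 7*pi/9 & t3 = 2*pi/9 & r < pi/100))" for n x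
 \<comment> \<open>The radii are at least quartered, as \<open>geometric_limit\<close> requires in
   order to place the limit within the radius of each stage.\<close>
 define Q :: "nat => complex \<times> complex \<times> nat \<times> real \<times> real \<times> real \<times> real => complex \<times> complex \<times> nat \<times> real \<times> real \<times> real \<times> real => bool" where
  "Q n x y \<longleftrightarrow> (case x of (c, d, k, t1, t2, t3, r) => case y of (c', d', k', t1', t2', t3', r') =>
   norm (c' - c) < r/4 & norm (d' - d) < r/4 & \<bar>t1' - t1\<bar> < r/4 & \<bar>t2' - t2\<bar> < r/4 & \<bar>t3' - t3\<bar> < r/4 & r' <= r/4)" for n x y
 have "\<exists>f. \<forall>n. P n (f n) & Q n (f n) (f (Suc n))"
 proof (rule dependent_nat_choice)
  obtain r where r: "r > 0" "OKr w0 (- w0) 0 (pi/9) (7*pi/9) (2*pi/9) (1 / Suc 0) r"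
   using OKr_exists[OF St_init[OF ro], of "1 / Suc 0"] by auto
  have "min r (pi/101) * 100 < pi" using min.cobounded2[of r "pi/101"] pi_gt_zero by linarith
  with r have "P 0 (w0, - w0, 0, pi/9, 7*pi/9, 2*pi/9, min r (pi/101))"
   unfolding P_def using St_init[OF ro] ro OKr_mono[OF r(2), of "min r (pi/101)"] by simp
  thus "\<exists>x. P 0 x" by blast
  fix x n assume Px: "P n x"
  obtain c d k t1 t2 t3 r where x: "x = (c, d, k, t1, t2, t3, r)" by (cases x)
  have St: "St ro c d k t1 t2 t3" and cd: "norm (c - w0) < ro" "norm (d + w0) < ro" "n <= k" "r > 0"
   using Px unfolding P_def x by auto
  define N where "N = min (ro - norm (c - w0)) (ro - norm (d + w0))"
  have N: "N > 0" using cd by (simp add: N_def)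
  have nN: "norm (c' - w0) < ro" "norm (d' + w0) < ro" if "norm (c' - c) < N" "norm (d' - d) < N" for c' d'
   using that norm_triangle_ineq[of "c' - c" "c - w0"] norm_triangle_ineq[of "d' - d" "d + w0"] by (auto simp: N_def)
  have mpos: "min N (r/4) > 0" using N cd by simp
  have NG: "\<forall>c' d'. norm (c' - c) < N --> norm (d' - d) < N --> good ro e0 e1 c' d'" using good nN by blast
  from St_step[OF St N NG es ro mpos] obtain c' d' k' s1 s2 s3 where
   s: "norm (c' - c) < min N (r/4)" "norm (d' - d) < min N (r/4)" "k' > k" "\<bar>s1 - t1\<bar> < min N (r/4)" "\<bar>s2 - t2\<bar> < min N (r/4)" "\<bar>s3 - t3\<bar> < min N (r/4)"
   and St': "St ro c' d' k' s1 s2 s3" by (elim exE conjE)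
  obtain r1 where r1: "r1 > 0" "OKr c' d' k' s1 s2 s3 (1 / Suc (Suc n)) r1"
   using OKr_exists[OF St', of "1 / Suc (Suc n)"] by auto
  have "P (Suc n) (c', d', k', s1, s2, s3, min r1 (r/4))"
   unfolding P_def using St' nN[of c' d'] s cd r1 OKr_mono[OF r1(2), of "min r1 (r/4)"] by simp
  moreover have "Q n x (c', d', k', s1, s2, s3, min r1 (r/4))"
   unfolding Q_def x using s by simp
  ultimately show "\<exists>y. P (Suc n) y & Q n x y" by blast
 qed
 then obtain f where f: "!!n. P n (f n)" "!!n. Q n (f n) (f (Suc n))" by blast
 define C D K T1 T2 T3 E where "C n = fst (f n)" and "D n = fst (snd (f n))" and "K n = fst (snd (snd (f n)))" and
  "T1 n = fst (snd (snd (snd (f n))))" and "T2 n = fst (snd (snd (snd (snd (f n)))))" and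
  "T3 n = fst (snd (snd (snd (snd (snd (f n))))))" and "E n = snd (snd (snd (snd (snd (snd (f n))))))" for n
 have fn: "f n = (C n, D n, K n, T1 n, T2 n, T3 n, E n)" for n
  by (simp add: C_def D_def K_def T1_def T2_def T3_def E_def)
 have St: "St ro (C n) (D n) (K n) (T1 n) (T2 n) (T3 n)" and Kn: "n <= K n" and En: "E n > 0" and
  OK: "OKr (C n) (D n) (K n) (T1 n) (T2 n) (T3 n) (1 / Suc n) (E n)" for n
  using f(1)[of n] unfolding P_def fn by auto
 have init: "T1 0 = pi/9" "T2 0 = 7*pi/9" "T3 0 = 2*pi/9" "E 0 < pi/100" using f(1)[of 0] unfolding P_def fn by auto
 have Qn: "norm (C (Suc n) - C n) < E n / 4" "norm (D (Suc n) - D n) < E n / 4" "norm (T1 (Suc n) - T1 n) < E n / 4"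
  "norm (T2 (Suc n) - T2 n) < E n / 4" "norm (T3 (Suc n) - T3 n) < E n / 4" "E (Suc n) <= E n / 4" for n
  using f(2)[of n] unfolding Q_def fn by auto
 obtain c where c: "C \<longlonglongrightarrow> c" "!!n. norm (c - C n) < E n" by (rule geometric_limit[of C E, OF Qn(1)[folded real_norm_def] Qn(6) En]) blast
 obtain d where d: "D \<longlonglongrightarrow> d" "!!n. norm (d - D n) < E n" by (rule geometric_limit[of D E, OF Qn(2)[folded real_norm_def] Qn(6) En]) blast
 obtain t1 where t1: "!!n. norm (t1 - T1 n) < E n" by (rule geometric_limit[of T1 E, OF Qn(3)[folded real_norm_def] Qn(6) En]) blast
 obtain t2 where t2: "!!n. norm (t2 - T2 n) < E n" by (rule geometric_limit[of T2 E, OF Qn(4)[folded real_norm_def] Qn(6) En]) blast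
 obtain t3 where t3: "!!n. norm (t3 - T3 n) < E n" by (rule geometric_limit[of T3 E, OF Qn(5)[folded real_norm_def] Qn(6) En]) blast
 have con: "con c d" using con_limit[OF c(1) d(1)] mis_con[OF St_facts(1)[OF St]] by blast
 note ok = OKrD[OF OK c(2) d(2)]
 have arch: "\<exists>n. 1 / real (Suc n) < e" if "e > 0" for e :: real
  using reals_Archimedean[OF that] by (simp add: inverse_eq_divide)
 \<comment> \<open>The limit map inherits short tails from the stages: stage n guarantees precision
   1 / (n + 1) on a neighbourhood that contains the limit parameter.\<close>
 have UL: "UL c d"
  unfolding UL_def
 proof (intro conjI allI impI con)
  fix e :: real assume "e > 0"
  then obtain n where n: "1 / real (Suc n) < e" using arch by blast
  obtain s where "s > 0" "tl c d s (1 / real (Suc n))" using ok(2)[OF con] by blast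
  thus "\<exists>s>0. tl c d s e" using n unfolding tl_def by (meson less_imp_le order_trans)
 qed
 have near: "dist (gam c d t1) (gam (C n) (D n) (T1 n)) < 1 / Suc n" "dist (gam c d t2) (gam (C n) (D n) (T1 n)) < 1 / Suc n"
  "dist (gam c d t3) (gam (C n) (D n) (T1 n)) < 1 / Suc n" for n
  using ok(3)[OF UL t1[of n, unfolded real_norm_def]] ok(4)[OF UL t2[of n, unfolded real_norm_def]] ok(5)[OF UL t3[of n, unfolded real_norm_def]] .
 have eq: "gam c d t1 = x" if "!!n. dist x (gam (C n) (D n) (T1 n)) < 1 / Suc n" for x
 proof (rule ccontr)
  assume "gam c d t1 ~= x"
  then obtain n where n: "1 / real (Suc n) < dist (gam c d t1) x / 2" using arch[of "dist (gam c d t1) x / 2"] by auto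
  have "dist (gam c d t1) x < 2 / real (Suc n)"
   using dist_triangle2[of "gam c d t1" x "gam (C n) (D n) (T1 n)"] near(1)[of n] that[of n] by simp
  thus False using n by simp
 qed
 have orb1: "(cub c d ^^ i) (gam c d t1) \<notin> {c, d}" if "i < K n" for i n
  by (rule ok(6)[OF UL t1[of n, unfolded real_norm_def] that])
 have orb2: "(cub c d ^^ i) (gam c d t1) ~= (cub c d ^^ l) (gam c d t1)" if "i < l" "l <= K n" for i l n
  by (rule ok(7)[OF UL t1[of n, unfolded real_norm_def] that])
 show ?thesis
 proof (rule that[of c d t1 t3 t2])
  show "UL c d" by (rule UL)
  show "interior (fk c d) = {}"
  proof (rule ccontr)
   assume "interior (fk c d) ~= {}"
   then obtain z where "z \<in> interior (fk c d)" by blast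
   then obtain e where e: "e > 0" "ball z e \<subseteq> fk c d" by (auto simp: mem_interior)
   obtain n where n: "1 / real (Suc n) < e" using arch[OF e(1)] by blast
   have "~ ball z (1 / Suc n) \<subseteq> fk c d" by (rule ok(1))
   moreover have "ball z (1 / Suc n) \<subseteq> ball z e" using n by (intro subset_ball) simp
   ultimately show False using e by blast
  qed
  have "\<bar>t1 - pi/9\<bar> < pi/100" "\<bar>t2 - 7*pi/9\<bar> < pi/100" "\<bar>t3 - 2*pi/9\<bar> < pi/100"
   using t1[of 0] t2[of 0] t3[of 0] init by auto
  thus "t1 < t3" "t3 < t2" "t2 < t1 + 2 * pi" using pi_gt_zero by linarith+
  show "gam c d t1 = gam c d t2" "gam c d t1 = gam c d t3" using eq near by blast+
  show "(cub c d ^^ i) (gam c d t1) \<notin> {c, d}" for i using orb1[of i "Suc i"] Kn[of "Suc i"] by simp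
  show "(cub c d ^^ i) (gam c d t1) ~= (cub c d ^^ l) (gam c d t1)" if "i < l" for i l using orb2[OF that, of l] Kn[of l] by simp
 qed
qed

section \<open>The limit polynomial and its Julia set\<close>

definition cpoly :: "complex => complex => complex poly" where
 "cpoly c d = [:0, 3 * c * d, - (3/2) * (c + d), 1:]"

lemma poly_cpoly: "poly (cpoly c d) = cub c d"
 by (intro ext) (simp add: cpoly_def cub_def power2_eq_square power3_eq_cube algebra_simps)

lemma degree_cpoly: "degree (cpoly c d) = 3"
 by (simp add: cpoly_def)

lemma pderiv_cpoly: "poly (pderiv (cpoly c d)) z = 0 \<longleftrightarrow> z = c \<or> z = d"
proof -
 have "poly (pderiv (cpoly c d)) z = 3 * (z - c) * (z - d)"
  by (simp add: cpoly_def pderiv_pCons algebra_simps)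
 thus ?thesis by simp
qed

lemma filled_julia_cpoly:
 assumes "par c d" shows "filled_julia (cpoly c d) = fk c d"
proof (intro subset_antisym subsetI)
 fix z assume z: "z \<in> filled_julia (cpoly c d)"
 obtain B where B: "!!n. norm ((cub c d ^^ n) z) <= B"
  using z unfolding filled_julia_def poly_cpoly bounded_iff by blast
 show "z \<in> fk c d"
  by (rule fk_bounded_subseqI[OF assms, of "%n. n" 0 z B]) (use B in \<open>simp_all add: filterlim_ident\<close>)
next
 fix z assume "z \<in> fk c d"
 hence "norm ((cub c d ^^ n) z) <= 10" for n using fk_bounded[OF fk_funpow] by blast
 thus "z \<in> filled_julia (cpoly c d)" unfolding filled_julia_def poly_cpoly bounded_iff by auto
qed

lemma julia_cpoly:
 assumes "con c d" "interior (fk c d) = {}" shows "julia (cpoly c d) = fk c d"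
 using filled_julia_cpoly[OF con_par[OF assms(1)]] closed_fk[of c d] assms(2)
 by (simp add: julia_def frontier_def)

lemma fk_gam_image:
 assumes "UL c d" "interior (fk c d) = {}" shows "fk c d = gam c d ` {0..2*pi}"
proof (intro subset_antisym subsetI)
 fix z assume "z \<in> fk c d"
 hence "z \<in> frontier (fk c d)" using assms(2) closed_fk[of c d] by (simp add: frontier_def)
 then obtain th where "0 <= th" "th <= 2 * pi" "gam c d th = z" by (rule gam_onto_frontier[OF assms(1)])
 thus "z \<in> gam c d ` {0..2*pi}" by auto
qed (use gam_in_fk[OF assms(1)] in auto)

text \<open>The landing map makes the set a quotient of a compact interval, hence locally connected.
  A simple closed curve in it would bound a region on which the maximum principle bounds all
  iterates, against the empty interior.\<close>

lemma dendrite_fk: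
 assumes UL: "UL c d" and int: "interior (fk c d) = {}"
 shows "dendrite (fk c d)"
 unfolding dendrite_def
proof (intro conjI notI)
 have cont: "continuous_on {0..2*pi} (gam c d)" by (rule gam_continuous[OF UL])
 show "connected (fk c d)"
  unfolding fk_gam_image[OF assms] by (intro connected_continuous_image cont connected_Icc)
 show "locally connected (fk c d)"
  unfolding fk_gam_image[OF assms]
 proof (rule locally_connected_quotient_image)
  show "locally connected {0..2*pi}" by (rule convex_imp_locally_connected) simp
  show "openin (top_of_set {0..2*pi}) ({0..2*pi} \<inter> gam c d -` T) \<longleftrightarrow> openin (top_of_set (gam c d ` {0..2*pi})) T"
   if "T \<subseteq> gam c d ` {0..2*pi}" for T
   by (rule Abstract_Topology_2.continuous_imp_quotient_map[OF cont refl compact_Icc that])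
 qed
 assume "\<exists>g. simple_path g & pathfinish g = pathstart g & path_image g \<subseteq> fk c d"
 then obtain g where g: "simple_path g" "pathfinish g = pathstart g" "path_image g \<subseteq> fk c d" by blast
 note J = Jordan_inside_outside[OF g(1,2)]
 let ?I = "inside (path_image g)"
 have fr: "frontier ?I = path_image g" and op: "open ?I" and ne: "?I ~= {}" and bd: "bounded ?I" using J by blast+
 have sub: "?I \<subseteq> fk c d"
 proof
  fix z assume z: "z \<in> ?I"
  have "norm ((cub c d ^^ n) z) <= 10" for n
  proof (rule maximum_modulus_frontier[of "cub c d ^^ n" ?I])
   show "(cub c d ^^ n) holomorphic_on interior ?I" by (rule holomorphic_cub_funpow[OF holomorphic_on_ident])
   show "continuous_on (closure ?I) (cub c d ^^ n)"
    by (rule holomorphic_on_imp_continuous_on[OF holomorphic_cub_funpow[OF holomorphic_on_ident]])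
   show "bounded ?I" by (rule bd)
   show "norm ((cub c d ^^ n) w) <= 10" if "w \<in> frontier ?I" for w
   proof -
    have "w \<in> fk c d" using that fr g(3) by blast
    thus ?thesis by (rule fk_bounded[OF fk_funpow])
   qed
  qed (rule z)
  thus "z \<in> fk c d" by (simp add: fk_def)
 qed
 have "?I \<subseteq> interior (fk c d)" by (rule interior_maximal[OF sub op])
 thus False using int ne by simp
qed

text \<open>Some power 3^k stretches the interval over a full turn, so it contains an angle u for
  which 3^k u and 3^(k+1) a' agree modulo 2 pi. If the rays at u and a' both landed at \<xi>, the
  iterates of \<xi> of orders k and k + 1 would coincide.\<close>

lemma gam_not_constant:
 assumes UL: "UL c d" and ab: "a < b" and np: "\<forall>i l. i < l --> (cub c d ^^ i) \<xi> ~= (cub c d ^^ l) \<xi>"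
 shows "\<exists>u. a < u & u < b & gam c d u ~= \<xi>"
proof (rule ccontr)
 assume "~ ?thesis"
 hence const: "gam c d u = \<xi>" if "a < u" "u < b" for u using that by blast
 define a' where "a' = (2 * a + b) / 3"
 have a': "a < a'" "a' < b" using ab by (auto simp: a'_def)
 have "eventually (%k. 2 * pi / 3^k < b - a') sequentially" using a' by real_asymp
 then obtain k where k: "2 * pi / 3^k < b - a'" by (auto simp: eventually_sequentially)
 obtain n :: int where n: "3^k * a' <= 3^Suc k * a' + 2 * pi * of_int n" "3^Suc k * a' + 2 * pi * of_int n < 3^k * a' + 2 * pi"
  by (rule mod_interval)
 define u where "u = (3^Suc k * a' + 2 * pi * of_int n) / 3^k"
 have ku: "3^k * u = 3^Suc k * a' + 2 * pi * of_int n" by (simp add: u_def)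
 have "a' <= u" using n(1) by (simp add: u_def pos_le_divide_eq mult.commute)
 moreover have "u < a' + 2 * pi / 3^k"
 proof (rule mult_left_less_imp_less)
  show "3^k * u < 3^k * (a' + 2 * pi / 3^k)" unfolding ku using n(2) by (simp add: distrib_left)
 qed simp
 ultimately have "gam c d u = \<xi>" using k a' by (intro const) linarith+
 hence "(cub c d ^^ k) \<xi> = gam c d (3^k * u)" using gam_iter[OF UL, of k u] by simp
 also have "... = gam c d (3^Suc k * a')" unfolding ku by (rule gam_period[OF UL])
 also have "... = (cub c d ^^ Suc k) \<xi>" using gam_iter[OF UL, of "Suc k" a'] const[OF a'] by simp
 finally show False using np[rule_format, of k "Suc k"] by simp
qed

text \<open>Each of the three sectors at \<xi> contains a ray that lands elsewhere, and
  \<open>sector_sep\<close> keeps the components of these landing points apart.\<close>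

lemma three_components:
 assumes UL: "UL c d" and t: "t1 < t2" "t2 < t3" "t3 < t1 + 2 * pi" and g: "gam c d t1 = \<xi>" "gam c d t2 = \<xi>" "gam c d t3 = \<xi>"
  and np: "\<forall>i l. i < l --> (cub c d ^^ i) \<xi> ~= (cub c d ^^ l) \<xi>"
 shows "\<exists>C \<subseteq> components (fk c d - {\<xi>}). card C = 3"
proof -
 obtain u1 where u1: "t1 < u1" "u1 < t2" "gam c d u1 ~= \<xi>" using gam_not_constant[OF UL t(1) np] by blast
 obtain u2 where u2: "t2 < u2" "u2 < t3" "gam c d u2 ~= \<xi>" using gam_not_constant[OF UL t(2) np] by blast
 obtain u3 where u3: "t3 < u3" "u3 < t1 + 2 * pi" "gam c d u3 ~= \<xi>" using gam_not_constant[OF UL t(3) np] by blast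
 let ?S = "fk c d - {\<xi>}" and ?C = "%u. connected_component_set (fk c d - {\<xi>}) (gam c d u)"
 have mem: "gam c d u \<in> ?S" if "gam c d u ~= \<xi>" for u using gam_in_fk[OF UL] that by simp
 have sep: "?C u ~= ?C v" if "a < u" "u < b" "b < v" "v < a + 2 * pi" "a < b" "gam c d a = \<xi>" "gam c d b = \<xi>" "gam c d u ~= \<xi>" "gam c d v ~= \<xi>" for a b u v
 proof
  assume eq: "?C u = ?C v"
  show False
   by (rule sector_sep[OF UL that(6,7,5) _ that(1-4) that(8,9), of "?C u"])
    (use that eq mem connected_component_refl_eq[of ?S] connected_component_subset[of ?S "gam c d u"] in \<open>auto simp: connected_component_refl\<close>)
 qed
 have "?C u1 ~= ?C u2" by (rule sep[of t1 u1 t2 u2]) (use t u1 u2 g in auto)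
 moreover have "?C u1 ~= ?C u3" by (rule sep[of t1 u1 t2 u3]) (use t u1 u3 g in auto)
 moreover have "?C u2 ~= ?C u3" by (rule sep[of t2 u2 t3 u3]) (use t u2 u3 g in auto)
 ultimately have "card {?C u1, ?C u2, ?C u3} = 3" by simp
 moreover have "{?C u1, ?C u2, ?C u3} \<subseteq> components ?S"
  using mem u1 u2 u3 by (auto simp: components_def)
 ultimately show ?thesis by blast
qed

theorem theorem3:
  shows "\<exists>f :: complex poly. degree f = 3 \<and> dendritic f \<and>
    (\<exists>\<xi>. branching_point f \<xi> \<and> \<not> preperiodic f \<xi> \<and> \<not> precritical f \<xi>)"
proof -
 obtain c d t1 t2 t3 where UL: "UL c d" and int: "interior (fk c d) = {}" and t: "t1 < t3" "t3 < t2" "t2 < t1 + 2 * pi" and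
  g: "gam c d t1 = gam c d t2" "gam c d t1 = gam c d t3" and nc: "!!i. (cub c d ^^ i) (gam c d t1) \<notin> {c, d}" and
  np: "!!i l. i < l ==> (cub c d ^^ i) (gam c d t1) ~= (cub c d ^^ l) (gam c d t1)"
  by (rule limit_param) blast
 define \<xi> where "\<xi> = gam c d t1"
 have julia: "julia (cpoly c d) = fk c d" by (rule julia_cpoly[OF UL_con[OF UL] int])
 have "\<exists>C \<subseteq> components (fk c d - {\<xi>}). card C = 3"
  by (rule three_components[OF UL t]) (use g np in \<open>simp_all add: \<xi>_def\<close>)
 moreover have "\<xi> \<in> fk c d" unfolding \<xi>_def by (rule gam_in_fk[OF UL])
 ultimately have "branching_point (cpoly c d) \<xi>" unfolding branching_point_def julia by blast
 moreover have "~ preperiodic (cpoly c d) \<xi>"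
  unfolding preperiodic_def poly_cpoly \<xi>_def
 proof (intro notI, elim exE conjE)
  fix r s :: nat assume "1 <= s" "(cub c d ^^ (r + s)) (gam c d t1) = (cub c d ^^ r) (gam c d t1)"
  thus False using np[of r "r + s"] by simp
 qed
 moreover have "~ precritical (cpoly c d) \<xi>"
  unfolding precritical_def poly_cpoly pderiv_cpoly \<xi>_def using nc by blast
 moreover have "dendritic (cpoly c d)"
  unfolding dendritic_def julia using dendrite_fk[OF UL int] by (simp add: degree_cpoly)
 ultimately show ?thesis using degree_cpoly by blast
qed

end
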